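(* Let $X=\mathbb{P}^1\setminus\{0,1,\infty\}$ and $j:X\to\mathbb{A}^1$ the inclusion. Let $\overline{\mathcal{L}_0}=[t;t]$, $\overline{\mathcal{L}_1}=[t;1-t]$ in $\mathcal{N}^1_{\mathbb{A}^1}(1)$, with restrictions $\mathcal{L}_0,\mathcal{L}_1\in\mathcal{N}^1_X(1)$ to $X$, and set $\mathrm{Li}^{cy}_1=\mathcal{L}_1$, $\overline{\mathrm{Li}^{cy}_1}=\overline{\mathcal{L}_1}$. Then for any integer $n\geq2$ there exists an equidimensional cycle $\mathrm{Li}^{cy}_n\in\mathcal{N}^{eq,1}_X(n)\subset\mathcal{N}^1_X(n)$ over $X$ such that: (1) There is an equidimensional cycle $\overline{\mathrm{Li}^{cy}_n}\in\mathcal{N}^{eq,1}_{\mathbb{A}^1}(n)$ over $\mathbb{A}^1$ with $\mathrm{Li}^{cy}_n=j^*(\overline{\mathrm{Li}^{cy}_n})$ (it has in particular a well defined fiber at $1$). (2) The cycle $\overline{\mathrm{Li}^{cy}_n}$ has empty fiber at $0$. (3) $\mathrm{Li}^{cy}_n$ and $\overline{\mathrm{Li}^{cy}_n}$ satisfy the differential equations $$\partial(\mathrm{Li}^{cy}_n)=\mathcal{L}_0\cdot\mathrm{Li}^{cy}_{n-1}\qquad\text{and}\qquad\partial(\overline{\mathrm{Li}^{cy}_n})=\overline{\mathcal{L}_0}\cdot\overline{\mathrm{Li}^{cy}_{n-1}}.$$ (4) $\mathrm{Li}^{cy}_n$ is explicitly given as a parametrized cycle by $$\Big[t;1-\tfrac{t}{x_{n-1}},x_{n-1},1-\tfrac{x_{n-1}}{x_{n-2}},x_{n-2},\dots,1-\tfrac{x_2}{x_1},x_1,1-x_1\Big]\subset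 X\times\square^{2n-1}.$$
   Context: The base field is $\mathbb{Q}$. Put $\square^1=\mathbb{P}^1\setminus\{1\}$ and $\square^n=(\square^1)^n$ with affine coordinates $u_1,\dots,u_n$. A face $F$ of $\square^n$ is a subvariety given by equations $u_{i_k}=\varepsilon_k$ with $\varepsilon_k\in\{0,\infty\}$. Let $Y$ be a smooth irreducible quasi-projective variety over $\mathbb{Q}$ (here $Y=\mathbb{A}^1$ or $Y=X$). $\mathcal{Z}^p(Y,n)$ is the free abelian group on the closed irreducible subvarieties $Z\subset Y\times\square^n$ of codimension $p$ such that for every face $F$, $Z\cap(Y\times F)$ is empty or of codimension $p$ in $Y\times F$. The group $G_n=(\mathbb{Z}/2\mathbb{Z})^n\rtimes\mathfrak{S}_n$ acts on $\square^n$ (permutation of factors, and $u\mapsto1/u$ on each factor); extend the sign character of $\mathfrak{S}_n$ to $G_n\to\{\pm1\}$ by letting each generator of a $\mathbb{Z}/2\mathbb{Z}$ have sign $-1$, and let $\mathcal{A}lt_n\in\mathbb{Q}[G_n]$ be the corresponding projector. Set $\mathcal{N}^k_Y(p)=\mathcal{A}lt_{2p-k}(\mathcal{Z}^p(Y,2p-k)\otimes\mathbb{Q})$, $\mathcal{N}^\bullet_Y=\bigoplus_{p\ge0}\mathcal{N}^\bullet_Y(p)$ ($k$ is the cohomological degree, $p$ the weight), with differential $\partial=\sum_i(-1)^{i-1}(\partial_i^0-\partial_i^\infty)$ raising $k$ by one, $\partial_i^\varepsilon$ being the pull-back to the face $u_i=\varepsilon$. Exterior product of cycles (concatenating the cube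 factors), pull-back along the diagonal of $Y$ and $\mathcal{A}lt$ give a product making $\mathcal{N}^\bullet_Y$ a graded commutative differential graded algebra. A morphism to $Y$ is equidimensional of relative dimension $r$ if every irreducible component of the source dominates $Y$ and every nonempty fiber has pure dimension $r$ (empty fibers are allowed). $\mathcal{Z}^p_{eq}(Y,n)$ is the free abelian group generated by the irreducible closed $Z\subset Y\times\square^n$ such that for every face $F$, $Z\cap(Y\times F)$ is empty or $Z\cap(Y\times F)\to Y$ is equidimensional of relative dimension $\dim(F)-p$; $\mathcal{N}^{eq,k}_Y(p)=\mathcal{A}lt_{2p-k}(\mathcal{Z}^p_{eq}(Y,2p-k)\otimes\mathbb{Q})\subset\mathcal{N}^k_Y(p)$, whose elements are called equidimensional cycles. The fiber at $x\in Y$ of a generator $Z$ is $Z\cap(\{x\}\times\square^n)$, extended to $\mathcal{A}lt(\sum q_iZ_i)$ linearly. $j^*$ is the restriction of cycles from $\mathbb{A}^1$ to $X$. Notation: $[t;f_1,\dots,f_m]$, where the $f_i$ are rational functions of $t$ and of auxiliary parameters $x_1,x_2,\dots\in\mathbb{P}^1$, denotes the image under $\mathcal{A}lt_m$ of the cycle in $Y\times\square^m$ parametrized by $t\in Y$, $x_i\in\mathbb{P}^1$, with cubical coordinates $u_i=f_i$ (the image being intersected with $Y\times\square^m$). *)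

theory Defs
  imports "HOL-Analysis.Analysis" "HOL-Algebra.Ideal" "HOL-Combinatorics.Permutations"
    "HOL-Library.Poly_Mapping"
begin

section \<open>Affine varieties over the rational numbers\<close>

text \<open>
  A reduced affine variety \<open>V\<close> over \<open>\<rat>\<close> is given by the set \<open>V(\<complex>)\<close> of its complex points
  together with a set of functions that generate its coordinate ring \<open>\<rat>[V]\<close> as a
  \<open>\<rat>\<close>-algebra. Since \<open>\<complex>\<close> is an algebraically closed extension of \<open>\<rat>\<close>, an element of
  \<open>\<rat>[V]\<close> is determined by the function it induces on \<open>V(\<complex>)\<close>, and closed subvarieties over
  \<open>\<rat>\<close> correspond to the subsets of \<open>V(\<complex>)\<close> that are closed in the Zariski topology defined by
  \<open>\<rat>[V]\<close> (not by \<open>\<complex>[V]\<close>).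
\<close>

record 'a variety =
  points :: "'a set"
  gens :: "('a \<Rightarrow> complex) set"

inductive_set coord_ring :: "'a variety \<Rightarrow> ('a \<Rightarrow> complex) set" for V :: "'a variety" where
  const: "(\<lambda>_. of_rat q) \<in> coord_ring V"
| gen: "f \<in> gens V \<Longrightarrow> f \<in> coord_ring V"
| add: "f \<in> coord_ring V \<Longrightarrow> g \<in> coord_ring V \<Longrightarrow> (\<lambda>p. f p + g p) \<in> coord_ring V"
| mult: "f \<in> coord_ring V \<Longrightarrow> g \<in> coord_ring V \<Longrightarrow> (\<lambda>p. f p * g p) \<in> coord_ring V"

definition zariski :: "'a variety \<Rightarrow> 'a topology" where
  "zariski V = topology_generated_by {{p \<in> points V. f p \<noteq> 0} | f. f \<in> coord_ring V}"

definition prod_variety :: "'a variety \<Rightarrow> 'b variety \<Rightarrow> ('a \<times> 'b) variety" (infixr "\<times>\<^sub>V" 80) where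
  "V \<times>\<^sub>V W = \<lparr>points = points V \<times> points W,
     gens = {f \<circ> fst | f. f \<in> gens V} \<union> {g \<circ> snd | g. g \<in> gens W}\<rparr>"

section \<open>Irreducibility, dimension and codimension\<close>

definition irreducible_closed :: "'a topology \<Rightarrow> 'a set \<Rightarrow> bool" where
  "irreducible_closed T Z \<longleftrightarrow> closedin T Z \<and> Z \<noteq> {} \<and>
     (\<forall>C D. closedin T C \<and> closedin T D \<and> Z \<subseteq> C \<union> D \<longrightarrow> Z \<subseteq> C \<or> Z \<subseteq> D)"

definition irr_components :: "'a topology \<Rightarrow> 'a set \<Rightarrow> 'a set set" where
  "irr_components T S = {C. irreducible_closed T C \<and> C \<subseteq> S \<and>
     (\<forall>D. irreducible_closed T D \<and> C \<subseteq> D \<and> D \<subseteq> S \<longrightarrow> D = C)}"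

definition irr_chain :: "'a topology \<Rightarrow> nat \<Rightarrow> (nat \<Rightarrow> 'a set) \<Rightarrow> bool" where
  "irr_chain T n C \<longleftrightarrow> (\<forall>i\<le>n. irreducible_closed T (C i)) \<and> (\<forall>i<n. C i \<subset> C (Suc i))"

definition krull_dim :: "'a topology \<Rightarrow> enat" where
  "krull_dim T = Sup {enat n | n. \<exists>C. irr_chain T n C}"

definition codim :: "'a topology \<Rightarrow> 'a set \<Rightarrow> enat" where
  "codim T Z = Sup {enat n | n. \<exists>C. irr_chain T n C \<and> C 0 = Z}"

definition has_codim :: "'a topology \<Rightarrow> 'a set \<Rightarrow> nat \<Rightarrow> bool" where
  "has_codim T S p \<longleftrightarrow> (\<forall>C \<in> irr_components T S. codim T C = enat p)"

definition has_pure_dim :: "'a topology \<Rightarrow> int \<Rightarrow> bool" where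
  "has_pure_dim T r \<longleftrightarrow> (\<forall>C \<in> irr_components T (topspace T).
     \<exists>d. krull_dim (subtopology T C) = enat d \<and> int d = r)"

section \<open>Cycles and intersection with principal divisors\<close>

text \<open>
  Cycles have rational coefficients: the group \<open>G \<otimes> \<rat>\<close>, for \<open>G\<close> the free abelian group on a
  set \<open>S\<close> of subvarieties, is the set of those \<open>z\<close> with \<open>keys z \<subseteq> S\<close>.
\<close>

type_synonym 'a cycle = "'a set \<Rightarrow>\<^sub>0 rat"

definition scale :: "rat \<Rightarrow> 'a cycle \<Rightarrow> 'a cycle" where
  "scale q z = Poly_Mapping.map ((*) q) z"

definition lin_ext :: "('a set \<Rightarrow> 'b cycle) \<Rightarrow> 'a cycle \<Rightarrow> 'b cycle" where
  "lin_ext f z = (\<Sum>Z \<in> Poly_Mapping.keys z. scale (Poly_Mapping.lookup z Z) (f Z))"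

definition image_cycle :: "('a \<Rightarrow> 'b) \<Rightarrow> 'a cycle \<Rightarrow> 'b cycle" where
  "image_cycle g = lin_ext (\<lambda>Z. Poly_Mapping.single (g ` Z) 1)"

text \<open>
  The local ring \<open>\<O>\<^bsub>Z,W\<^esub>\<close> of the irreducible variety \<open>Z\<close> along the irreducible \<open>W \<subseteq> Z\<close>:
  fractions \<open>a/b\<close> of regular functions with \<open>b\<close> not vanishing identically on \<open>W\<close>, two of
  them being identified if they agree on \<open>Z\<close>.
\<close>

definition fractions :: "'a variety \<Rightarrow> 'a set \<Rightarrow> (('a \<Rightarrow> complex) \<times> ('a \<Rightarrow> complex)) set" where
  "fractions V W = coord_ring V \<times> {b \<in> coord_ring V. \<exists>w\<in>W. b w \<noteq> 0}"

definition frac_class :: "'a variety \<Rightarrow> 'a set \<Rightarrow> 'a set \<Rightarrow> ('a \<Rightarrow> complex) \<Rightarrow> ('a \<Rightarrow> complex)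
    \<Rightarrow> (('a \<Rightarrow> complex) \<times> ('a \<Rightarrow> complex)) set" where
  "frac_class V Z W a b =
     {(a', b') \<in> fractions V W. \<forall>z\<in>Z. a z * b' z = a' z * b z}"

definition local_ring :: "'a variety \<Rightarrow> 'a set \<Rightarrow> 'a set
    \<Rightarrow> (('a \<Rightarrow> complex) \<times> ('a \<Rightarrow> complex)) set ring" where
  "local_ring V Z W = \<lparr>
     carrier = {frac_class V Z W a b | a b. (a, b) \<in> fractions V W},
     monoid.mult = (\<lambda>r s. \<Union>(a, b)\<in>r. \<Union>(c, d)\<in>s.
       frac_class V Z W (\<lambda>p. a p * c p) (\<lambda>p. b p * d p)),
     one = frac_class V Z W (\<lambda>_. 1) (\<lambda>_. 1),
     zero = frac_class V Z W (\<lambda>_. 0) (\<lambda>_. 1),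
     add = (\<lambda>r s. \<Union>(a, b)\<in>r. \<Union>(c, d)\<in>s.
       frac_class V Z W (\<lambda>p. a p * d p + c p * b p) (\<lambda>p. b p * d p))\<rparr>"

text \<open>
  The multiplicity of \<open>W\<close> in the divisor of \<open>f\<close> on \<open>Z\<close>, that is, the length of the module
  \<open>\<O>\<^bsub>Z,W\<^esub> / (f)\<close>; its submodules are the ideals of \<open>\<O>\<^bsub>Z,W\<^esub>\<close> that contain \<open>f\<close>.
\<close>

definition divisor_mult :: "'a variety \<Rightarrow> ('a \<Rightarrow> complex) \<Rightarrow> 'a set \<Rightarrow> 'a set \<Rightarrow> nat" where
  "divisor_mult V f Z W = Sup {k. \<exists>J. (\<forall>i\<le>k. ideal (J i) (local_ring V Z W)) \<and>
     (\<forall>i<k. J i \<subset> J (Suc i)) \<and> frac_class V Z W f (\<lambda>_. 1) \<in> J (0::nat)}"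

text \<open>
  The intersection of a cycle with the effective principal divisor of a regular function \<open>f\<close>
  that vanishes identically on no component of the cycle.
\<close>

definition cut_by :: "'a variety \<Rightarrow> ('a \<Rightarrow> complex) \<Rightarrow> 'a cycle \<Rightarrow> 'a cycle" where
  "cut_by V f = lin_ext (\<lambda>Z. \<Sum>W \<in> irr_components (zariski V) {z \<in> Z. f z = 0}.
     Poly_Mapping.single W (of_nat (divisor_mult V f Z W)))"

section \<open>The base curves and the cubes\<close>

datatype p1 = Fin complex | Infty

fun p1_inverse :: "p1 \<Rightarrow> p1" where
  "p1_inverse (Fin u) = (if u = 0 then Infty else Fin (1 / u))"
| "p1_inverse Infty = Fin 0"

text \<open>The function \<open>1 / (1 - u)\<close>; it is a coordinate on \<open>\<box>\<^sup>1 = \<P>\<^sup>1 - {1} \<cong> \<A>\<^sup>1\<close>.\<close>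

fun cube_coord :: "p1 \<Rightarrow> complex" where
  "cube_coord (Fin u) = 1 / (1 - u)"
| "cube_coord Infty = 0"

definition affine_line :: "complex variety" where
  "affine_line = \<lparr>points = UNIV, gens = {\<lambda>t. t}\<rparr>"

text \<open>\<open>X = \<P>\<^sup>1 - {0, 1, \<infinity>}\<close>, in terms of its affine coordinate \<open>t\<close>.\<close>

definition thrice_punctured_line :: "complex variety" where
  "thrice_punctured_line =
     \<lparr>points = - {0, 1}, gens = {\<lambda>t. t, \<lambda>t. 1 / t, \<lambda>t. 1 / (1 - t)}\<rparr>"

definition cube :: "nat \<Rightarrow> p1 list variety" where
  "cube n = \<lparr>points = {us. length us = n \<and> Fin 1 \<notin> set us},
     gens = {\<lambda>us. cube_coord (us ! i) | i. i < n}\<rparr>"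

text \<open>Coordinates are numbered from \<open>0\<close>; a face is given by a finite partial map
  \<open>i\<^sub>k \<mapsto> \<epsilon>\<^sub>k \<in> {0, \<infinity>}\<close>.\<close>

definition face_eqs :: "nat \<Rightarrow> (nat \<rightharpoonup> p1) set" where
  "face_eqs n = {\<phi>. dom \<phi> \<subseteq> {..<n} \<and> ran \<phi> \<subseteq> {Fin 0, Infty}}"

definition face :: "nat \<Rightarrow> (nat \<rightharpoonup> p1) \<Rightarrow> p1 list set" where
  "face n \<phi> = {us \<in> points (cube n). \<forall>i \<epsilon>. \<phi> i = Some \<epsilon> \<longrightarrow> us ! i = \<epsilon>}"

definition face_dim :: "nat \<Rightarrow> (nat \<rightharpoonup> p1) \<Rightarrow> nat" where
  "face_dim n \<phi> = n - card (dom \<phi>)"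

section \<open>The cycle complex\<close>

definition admissible :: "'b variety \<Rightarrow> nat \<Rightarrow> nat \<Rightarrow> ('b \<times> p1 list) set set" where
  "admissible Y p n = {Z. irreducible_closed (zariski (Y \<times>\<^sub>V cube n)) Z \<and>
     codim (zariski (Y \<times>\<^sub>V cube n)) Z = enat p \<and>
     (\<forall>\<phi> \<in> face_eqs n. let F = points Y \<times> face n \<phi> in
        Z \<inter> F = {} \<or> has_codim (subtopology (zariski (Y \<times>\<^sub>V cube n)) F) (Z \<inter> F) p)}"

definition cube_action :: "nat \<Rightarrow> nat set \<Rightarrow> (nat \<Rightarrow> nat) \<Rightarrow> 'b \<times> p1 list \<Rightarrow> 'b \<times> p1 list" where
  "cube_action n e \<sigma> = (\<lambda>(t, us). (t,
     map (\<lambda>i. if i \<in> e then p1_inverse (us ! \<sigma> i) else us ! \<sigma> i) [0..<n]))"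

definition Alt :: "nat \<Rightarrow> ('b \<times> p1 list) cycle \<Rightarrow> ('b \<times> p1 list) cycle" where
  "Alt n z = scale (1 / (2 ^ n * fact n))
     (\<Sum>e \<in> Pow {..<n}. \<Sum>\<sigma> | \<sigma> permutes {..<n}.
        scale ((- 1) ^ card e * of_int (sign \<sigma>)) (image_cycle (cube_action n e \<sigma>) z))"

text \<open>\<open>\<N>\<^sup>k\<^sub>Y(p)\<close>, which is \<open>0\<close> when the cubical dimension \<open>2p - k\<close> is negative.\<close>

definition cyc_cx :: "'b variety \<Rightarrow> int \<Rightarrow> nat \<Rightarrow> ('b \<times> p1 list) cycle set" where
  "cyc_cx Y k p = (if k \<le> 2 * int p
     then let n = nat (2 * int p - k) in Alt n ` {z. Poly_Mapping.keys z \<subseteq> admissible Y p n} else {0})"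

text \<open>In \<open>\<box>\<^sup>1\<close> the point \<open>u = 0\<close> is the divisor of \<open>u / (u - 1) = 1 - 1 / (1 - u)\<close> and
  \<open>u = \<infinity>\<close> is the divisor of \<open>1 / (1 - u)\<close>. The face \<open>u\<^sub>i = \<epsilon>\<close> is identified with
  \<open>\<box>\<^bsup>n-1\<^esup>\<close> by omitting \<open>u\<^sub>i\<close>.\<close>

definition omit_coord :: "nat \<Rightarrow> 'b \<times> p1 list \<Rightarrow> 'b \<times> p1 list" where
  "omit_coord i = (\<lambda>(t, us). (t, take i us @ drop (Suc i) us))"

definition face_zero :: "'b variety \<Rightarrow> nat \<Rightarrow> nat \<Rightarrow> ('b \<times> p1 list) cycle \<Rightarrow> ('b \<times> p1 list) cycle" where
  "face_zero Y n i z =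
     image_cycle (omit_coord i) (cut_by (Y \<times>\<^sub>V cube n) (\<lambda>(t, us). 1 - cube_coord (us ! i)) z)"

definition face_infty :: "'b variety \<Rightarrow> nat \<Rightarrow> nat \<Rightarrow> ('b \<times> p1 list) cycle \<Rightarrow> ('b \<times> p1 list) cycle" where
  "face_infty Y n i z =
     image_cycle (omit_coord i) (cut_by (Y \<times>\<^sub>V cube n) (\<lambda>(t, us). cube_coord (us ! i)) z)"

text \<open>The sign \<open>(-1)\<^bsup>i-1\<^esup>\<close> becomes \<open>(-1)\<^sup>i\<close> as coordinates are numbered from \<open>0\<close>.\<close>

definition boundary :: "'b variety \<Rightarrow> nat \<Rightarrow> ('b \<times> p1 list) cycle \<Rightarrow> ('b \<times> p1 list) cycle" where
  "boundary Y n z = (\<Sum>i<n. scale ((- 1) ^ i) (face_zero Y n i z - face_infty Y n i z))"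

text \<open>The exterior product \<open>Z \<times> Z'\<close> is reduced, but need not be irreducible over \<open>\<rat>\<close>.\<close>

definition ext_prod :: "'b variety \<Rightarrow> nat \<Rightarrow> nat \<Rightarrow> ('b \<times> p1 list) cycle \<Rightarrow> ('b \<times> p1 list) cycle
    \<Rightarrow> (('b \<times> 'b) \<times> p1 list) cycle" where
  "ext_prod Y m n z z' = lin_ext (\<lambda>Z. lin_ext (\<lambda>Z'.
     \<Sum>W \<in> irr_components (zariski ((Y \<times>\<^sub>V Y) \<times>\<^sub>V cube (m + n)))
        {((t, t'), us @ us') | t us t' us'. (t, us) \<in> Z \<and> (t', us') \<in> Z'}.
     Poly_Mapping.single W 1) z') z"

text \<open>For a curve \<open>Y\<close> in the affine line, the diagonal of \<open>Y \<times> Y\<close> is the divisor of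
  \<open>t - t'\<close>.\<close>

definition diag_pullback :: "complex variety \<Rightarrow> nat \<Rightarrow> ((complex \<times> complex) \<times> p1 list) cycle
    \<Rightarrow> (complex \<times> p1 list) cycle" where
  "diag_pullback Y n z = image_cycle (\<lambda>((t, t'), us). (t, us))
     (cut_by ((Y \<times>\<^sub>V Y) \<times>\<^sub>V cube n) (\<lambda>((t, t'), us). t - t') z)"

definition cyc_prod :: "complex variety \<Rightarrow> nat \<Rightarrow> nat \<Rightarrow> (complex \<times> p1 list) cycle
    \<Rightarrow> (complex \<times> p1 list) cycle \<Rightarrow> (complex \<times> p1 list) cycle" where
  "cyc_prod Y m n z z' = Alt (m + n) (diag_pullback Y (m + n) (ext_prod Y m n z z'))"

definition restrict_cycle :: "'b variety \<Rightarrow> nat \<Rightarrow> ('b \<times> p1 list) cycle \<Rightarrow> ('b \<times> p1 list) cycle" where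
  "restrict_cycle U n = lin_ext (\<lambda>Z. let Z' = Z \<inter> points (U \<times>\<^sub>V cube n) in
     if Z' = {} then 0 else Poly_Mapping.single Z' 1)"

section \<open>Equidimensional cycles and fibers\<close>

definition fiber :: "'b \<Rightarrow> ('b \<times> p1 list) set \<Rightarrow> ('b \<times> p1 list) set" where
  "fiber x S = {z \<in> S. fst z = x}"

text \<open>
  For \<open>x \<in> Y(\<complex>)\<close> lying over the scheme point \<open>y\<close> of \<open>Y\<close>, the residue field of \<open>y\<close> is
  \<open>\<rat>(x) \<subseteq> \<complex>\<close>, and the topology induced on \<open>{x} \<times> \<box>\<^sup>n\<close> by the Zariski topology of
  \<open>Y \<times> \<box>\<^sup>n\<close> over \<open>\<rat>\<close> is the Zariski topology of \<open>\<box>\<^sup>n\<close> over \<open>\<rat>(x)\<close>. Hence \<open>fiber x S\<close>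
  with the induced topology is the fiber of \<open>S\<close> over \<open>y\<close>.
\<close>

definition equidimensional :: "'b variety \<Rightarrow> nat \<Rightarrow> ('b \<times> p1 list) set \<Rightarrow> int \<Rightarrow> bool" where
  "equidimensional Y n S r \<longleftrightarrow>
     (\<forall>C \<in> irr_components (zariski (Y \<times>\<^sub>V cube n)) S. zariski Y closure_of (fst ` C) = points Y) \<and>
     (\<forall>x \<in> points Y. fiber x S \<noteq> {} \<longrightarrow>
        has_pure_dim (subtopology (zariski (Y \<times>\<^sub>V cube n)) (fiber x S)) r)"

definition equi_admissible :: "'b variety \<Rightarrow> nat \<Rightarrow> nat \<Rightarrow> ('b \<times> p1 list) set set" where
  "equi_admissible Y p n = {Z. irreducible_closed (zariski (Y \<times>\<^sub>V cube n)) Z \<and>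
     (\<forall>\<phi> \<in> face_eqs n. let F = points Y \<times> face n \<phi> in
        Z \<inter> F = {} \<or> equidimensional Y n (Z \<inter> F) (int (face_dim n \<phi>) - int p))}"

definition equi_cx :: "'b variety \<Rightarrow> int \<Rightarrow> nat \<Rightarrow> ('b \<times> p1 list) cycle set" where
  "equi_cx Y k p = (if k \<le> 2 * int p
     then let n = nat (2 * int p - k) in Alt n ` {z. Poly_Mapping.keys z \<subseteq> equi_admissible Y p n} else {0})"

text \<open>The fiber at \<open>x\<close> of a cycle is well defined if, for each subvariety occurring in the
  cycle, it meets every face \<open>{x} \<times> F\<close> in the expected dimension.\<close>

definition fiber_well_defined :: "'b variety \<Rightarrow> nat \<Rightarrow> nat \<Rightarrow> 'b \<Rightarrow> ('b \<times> p1 list) cycle \<Rightarrow> bool" where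
  "fiber_well_defined Y p n x z \<longleftrightarrow> (\<forall>Z \<in> Poly_Mapping.keys z. \<forall>\<phi> \<in> face_eqs n.
     let S = fiber x Z \<inter> ({x} \<times> face n \<phi>) in
       S = {} \<or> has_pure_dim (subtopology (zariski (Y \<times>\<^sub>V cube n)) S) (int (face_dim n \<phi>) - int p))"

definition empty_fiber :: "'b \<Rightarrow> ('b \<times> p1 list) cycle \<Rightarrow> bool" where
  "empty_fiber x z \<longleftrightarrow> (\<forall>Z \<in> Poly_Mapping.keys z. fiber x Z = {})"

section \<open>Parametrized cycles\<close>

text \<open>Rational functions are evaluated in \<open>\<P>\<^sup>1\<close>; \<open>None\<close> stands for the indeterminate values
  \<open>0/0\<close> and \<open>\<infinity>/\<infinity>\<close>.\<close>

fun p1_divide :: "p1 \<Rightarrow> p1 \<Rightarrow> p1 option" where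
  "p1_divide (Fin a) (Fin b) =
     (if b \<noteq> 0 then Some (Fin (a / b)) else if a \<noteq> 0 then Some Infty else None)"
| "p1_divide (Fin a) Infty = Some (Fin 0)"
| "p1_divide Infty (Fin b) = Some Infty"
| "p1_divide Infty Infty = None"

fun one_minus :: "p1 \<Rightarrow> p1" where
  "one_minus (Fin a) = Fin (1 - a)"
| "one_minus Infty = Infty"

text \<open>
  \<open>[t; f\<^sub>1, \<dots>, f\<^sub>m]\<close>, where \<open>f t x = [f\<^sub>1, \<dots>, f\<^sub>m]\<close> for \<open>t \<in> Y\<close> and parameters
  \<open>x 1, x 2, \<dots> \<in> \<P>\<^sup>1\<close>. The closure accounts for the points where the \<open>f\<^sub>i\<close> are not all
  defined. The underlying subvariety is taken with multiplicity one, which is its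
  push-forward multiplicity when the parametrization is generically injective.
\<close>

definition param_cycle :: "complex variety \<Rightarrow> nat \<Rightarrow> (complex \<Rightarrow> (nat \<Rightarrow> p1) \<Rightarrow> p1 option list)
    \<Rightarrow> (complex \<times> p1 list) cycle" where
  "param_cycle Y m f = Alt m (Poly_Mapping.single
     (zariski (Y \<times>\<^sub>V cube m) closure_of
        {(t, us) \<in> points (Y \<times>\<^sub>V cube m). \<exists>x. map Some us = f t x}) 1)"

definition L0_bar :: "(complex \<times> p1 list) cycle" where
  "L0_bar = param_cycle affine_line 1 (\<lambda>t x. [Some (Fin t)])"

definition L1_bar :: "(complex \<times> p1 list) cycle" where
  "L1_bar = param_cycle affine_line 1 (\<lambda>t x. [Some (one_minus (Fin t))])"

definition L0 :: "(complex \<times> p1 list) cycle" where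
  "L0 = restrict_cycle thrice_punctured_line 1 L0_bar"

definition L1 :: "(complex \<times> p1 list) cycle" where
  "L1 = restrict_cycle thrice_punctured_line 1 L1_bar"

text \<open>
  \<open>1 - t/x\<^bsub>n-1\<^esub>, x\<^bsub>n-1\<^esub>, 1 - x\<^bsub>n-1\<^esub>/x\<^bsub>n-2\<^esub>, x\<^bsub>n-2\<^esub>, \<dots>, 1 - x\<^sub>2/x\<^sub>1, x\<^sub>1, 1 - x\<^sub>1\<close>
\<close>

definition Li_coords :: "nat \<Rightarrow> complex \<Rightarrow> (nat \<Rightarrow> p1) \<Rightarrow> p1 option list" where
  "Li_coords n t x =
     [map_option one_minus (p1_divide (Fin t) (x (n - 1))), Some (x (n - 1))] @
     concat (map (\<lambda>i. [map_option one_minus (p1_divide (x (i + 1)) (x i)), Some (x i)])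
       (rev [1..<n - 1])) @
     [Some (one_minus (x 1))]"

end

theory Submission
  imports Defs "Jordan_Normal_Form.Determinant"
begin

text \<open>
  In the affine coordinates \<open>c\<^sub>i = 1 / (1 - u\<^sub>i)\<close>, which identify \<open>\<box>\<^sup>n\<close> with affine space, the parametrization
  of \<open>Li\<^sub>n\<close> can be solved for its parameters: \<open>x\<^bsub>n-1-k\<^esub> = t c\<^sub>0 c\<^sub>2 \<dots> c\<^bsub>2k\<^esub>\<close>. The underlying
  subvariety is therefore closed and explicit, given by \<open>n\<close> equations each of which determines one
  coordinate as a rational function of \<open>t, c\<^sub>0, c\<^sub>2, \<dots>, c\<^bsub>2n-4\<^esub>\<close> (\<open>param_cycle_polylog\<close>). So it is the graph
  of a rational map on an open part of an affine space, and so are all its fibers and its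
  intersections with faces. The cycle \<open>Li\<^sub>n\<close> over \<open>X\<close> and its extension to the affine line are the
  alternations of this subvariety for the two base curves.

  Irreducibility of such graphs follows from rational connectedness: a product of two regular
  functions that vanishes on the set vanishes on a rational curve through two given points, where
  one factor has to vanish (\<open>rat_conn_irreducible\<close>). Dimensions and codimensions are computed by chains:
  explicit ones are obtained by fixing coordinates or dropping equations, and a chain cannot be
  longer, since each step makes room for one more algebraically independent coordinate
  (\<open>chain_bound\<close>). This gives admissibility and equidimensionality.
  As \<open>t c\<^sub>0 c\<^sub>2 \<dots> c\<^bsub>2n-2\<^esub> = 1\<close> the fiber at \<open>t = 0\<close> is empty.

  For the boundary, faces commute with alternation (\<open>boundary_Alt\<close>) if every face cuts the subvariety
  in an irreducible set or not at all, with multiplicity one; multiplicity one is certified by a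
  retraction of an open subset onto the face (\<open>uniformizer_by_retraction\<close>). No coordinate is infinite
  on the subvariety, and only \<open>u\<^sub>0, u\<^sub>2, \<dots>, u\<^bsub>2n-4\<^esub>\<close> can be \<open>0\<close>. The face \<open>u\<^bsub>2k\<^esub> = 0\<close> with \<open>k > 0\<close> forces
  \<open>u\<^bsub>2k-1\<^esub> = u\<^bsub>2k+1\<^esub>\<close> and is killed by alternation (\<open>Alt_inner_face\<close>). On the face \<open>u\<^sub>0 = 0\<close>, that is
  \<open>x\<^bsub>n-1\<^esub> = t\<close>, the remaining coordinates are \<open>t\<close> and those of \<open>Li\<^bsub>n-1\<^esub>\<close>, so that this face is the
  exterior product of \<open>[t; t]\<close> and \<open>Li\<^bsub>n-1\<^esub>\<close> restricted to the diagonal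
  (\<open>outer_face_eq_product\<close>). The latter restriction is again of multiplicity one, and the product of
  the alternations is the alternation of the product (\<open>cyc_prod_Alt\<close>).
\<close>

section \<open>Zariski closed sets and rational connectedness\<close>

lemma coord_ring_0: "(\<lambda>_. 0) \<in> coord_ring V"
  using coord_ring.const[of 0 V] by simp

lemma coord_ring_1: "(\<lambda>_. 1) \<in> coord_ring V"
  using coord_ring.const[of 1 V] by simp

lemma coord_ring_uminus:
  assumes "f \<in> coord_ring V" shows "(\<lambda>p. - f p) \<in> coord_ring V"
  using coord_ring.mult[OF coord_ring.const[of "-1"] assms] by simp

lemma coord_ring_diff:
  assumes "f \<in> coord_ring V" "g \<in> coord_ring V" shows "(\<lambda>p. f p - g p) \<in> coord_ring V"
  using coord_ring.add[OF assms(1) coord_ring_uminus[OF assms(2)]] by simp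

lemma coord_ring_sum:
  assumes "\<And>i. i \<in> I \<Longrightarrow> f i \<in> coord_ring V"
  shows "(\<lambda>p. \<Sum>i\<in>I. f i p) \<in> coord_ring V"
  using assms by (induction I rule: infinite_finite_induct)
    (auto intro: coord_ring_0 coord_ring.add)

lemma coord_ring_prod:
  assumes "\<And>i. i \<in> I \<Longrightarrow> f i \<in> coord_ring V"
  shows "(\<lambda>p. \<Prod>i\<in>I. f i p) \<in> coord_ring V"
  using assms by (induction I rule: infinite_finite_induct)
    (auto intro: coord_ring_1 coord_ring.mult)

lemma coord_ring_power:
  assumes "f \<in> coord_ring V" shows "(\<lambda>p. f p ^ k) \<in> coord_ring V"
  using assms by (induction k) (auto intro: coord_ring_1 coord_ring.mult)

lemmas coord_ring_ops = coord_ring_0 coord_ring_1 coord_ring_uminus coord_ring_diff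
  coord_ring_sum coord_ring_prod coord_ring_power coord_ring.const coord_ring.add coord_ring.mult

lemma coord_ring_mono:
  assumes "gens V \<subseteq> coord_ring W" shows "coord_ring V \<subseteq> coord_ring W"
proof
  fix f assume "f \<in> coord_ring V"
  then show "f \<in> coord_ring W"
    by induction (use assms in \<open>auto intro: coord_ring.intros\<close>)
qed

lemma openin_zariski:
  "openin (zariski V) U \<longleftrightarrow>
     U \<subseteq> points V \<and> (\<forall>p\<in>U. \<exists>f\<in>coord_ring V. f p \<noteq> 0 \<and> {q \<in> points V. f q \<noteq> 0} \<subseteq> U)"
    (is "?L \<longleftrightarrow> ?R")
proof
  assume ?L
  then have "generate_topology_on {{p \<in> points V. f p \<noteq> 0} | f. f \<in> coord_ring V} U"
    unfolding zariski_def openin_topology_generated_by_iff .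
  then show ?R
  proof induction
    case (Int A B)
    show ?case
    proof (intro conjI ballI)
      fix p assume p: "p \<in> A \<inter> B"
      obtain f where f: "f \<in> coord_ring V" "f p \<noteq> 0" "{q \<in> points V. f q \<noteq> 0} \<subseteq> A"
        using Int p by blast
      obtain g where g: "g \<in> coord_ring V" "g p \<noteq> 0" "{q \<in> points V. g q \<noteq> 0} \<subseteq> B"
        using Int p by blast
      show "\<exists>f\<in>coord_ring V. f p \<noteq> 0 \<and> {q \<in> points V. f q \<noteq> 0} \<subseteq> A \<inter> B"
        by (rule bexI[OF _ coord_ring.mult[OF f(1) g(1)]]) (use f g in auto)
    qed (use Int in blast)
  next
    case (UN K)
    show ?case
    proof (intro conjI ballI)
      fix p assume "p \<in> \<Union>K"
      then obtain A where A: "A \<in> K" "p \<in> A" by blast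
      then obtain f where "f \<in> coord_ring V" "f p \<noteq> 0" "{q \<in> points V. f q \<noteq> 0} \<subseteq> A"
        using UN by blast
      then show "\<exists>f\<in>coord_ring V. f p \<noteq> 0 \<and> {q \<in> points V. f q \<noteq> 0} \<subseteq> \<Union>K"
        using A by (intro bexI[of _ f]) auto
    qed (use UN in blast)
  next
    case (Basis A)
    then show ?case by auto
  qed simp
next
  assume R: ?R
  have "U = \<Union>{{q \<in> points V. f q \<noteq> 0} | f. f \<in> coord_ring V \<and> {q \<in> points V. f q \<noteq> 0} \<subseteq> U}"
    (is "_ = ?U")
  proof (intro subset_antisym subsetI)
    fix p assume p: "p \<in> U"
    then obtain f where "f \<in> coord_ring V" "f p \<noteq> 0" "{q \<in> points V. f q \<noteq> 0} \<subseteq> U"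
      using R by blast
    moreover have "p \<in> points V" using R p by blast
    ultimately show "p \<in> ?U" by blast
  qed blast
  moreover have "openin (zariski V)
      (\<Union>{{q \<in> points V. f q \<noteq> 0} | f. f \<in> coord_ring V \<and> {q \<in> points V. f q \<noteq> 0} \<subseteq> U})"
    unfolding zariski_def
    by (rule openin_Union) (blast intro: topology_generated_by_Basis)
  ultimately show ?L by simp
qed

lemma topspace_zariski [simp]: "topspace (zariski V) = points V"
proof -
  have "openin (zariski V) (points V)"
    unfolding openin_zariski by (auto intro!: bexI[OF _ coord_ring_1])
  then show ?thesis
    using openin_zariski[of V "topspace (zariski V)"] openin_subset by blast
qed

lemma subtopology_zariski_points: "subtopology (zariski V) (points V) = zariski V"
  using subtopology_topspace[of "zariski V"] by simp

lemma closedin_zariski: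
  "closedin (zariski V) C \<longleftrightarrow>
     C \<subseteq> points V \<and> (\<forall>p\<in>points V - C. \<exists>f\<in>coord_ring V. f p \<noteq> 0 \<and> (\<forall>c\<in>C. f c = 0))"
proof -
  have "{q \<in> points V. f q \<noteq> 0} \<subseteq> points V - C \<longleftrightarrow> (\<forall>c\<in>C. f c = 0)" if "C \<subseteq> points V" for f :: "'a \<Rightarrow> complex"
    using that by auto
  then show ?thesis unfolding closedin_def openin_zariski topspace_zariski by auto
qed

lemma closedin_subtopology_zariski:
  assumes S: "S \<subseteq> points V"
  shows "closedin (subtopology (zariski V) S) C \<longleftrightarrow>
     C \<subseteq> S \<and> (\<forall>p\<in>S - C. \<exists>f\<in>coord_ring V. f p \<noteq> 0 \<and> (\<forall>c\<in>C. f c = 0))" (is "?L \<longleftrightarrow> ?R")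
proof
  assume ?L
  then obtain D where D: "closedin (zariski V) D" "C = D \<inter> S"
    unfolding closedin_subtopology by blast
  show ?R
  proof (intro conjI ballI)
    fix p assume "p \<in> S - C"
    then have "p \<in> points V - D" using D S by blast
    then show "\<exists>f\<in>coord_ring V. f p \<noteq> 0 \<and> (\<forall>c\<in>C. f c = 0)"
      using D unfolding closedin_zariski by blast
  qed (use D in blast)
next
  assume R: ?R
  let ?D = "{q \<in> points V. \<forall>f\<in>coord_ring V. (\<forall>c\<in>C. f c = 0) \<longrightarrow> f q = 0}"
  have "closedin (zariski V) ?D" unfolding closedin_zariski by blast
  moreover have "C = ?D \<inter> S" using R S by blast
  ultimately show ?L unfolding closedin_subtopology by blast
qed

lemma closedin_equations:
  assumes "S \<subseteq> points V" "F \<subseteq> coord_ring V"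
  shows "closedin (subtopology (zariski V) S) {z \<in> S. \<forall>f\<in>F. f z = 0}"
  unfolding closedin_subtopology_zariski[OF assms(1)] using assms(2) by auto

lemma irreducible_prime:
  assumes irr: "irreducible_closed (subtopology (zariski V) S) Z" and S: "S \<subseteq> points V"
    and f: "f \<in> coord_ring V" and g: "g \<in> coord_ring V" and fg: "\<And>z. z \<in> Z \<Longrightarrow> f z * g z = 0"
  shows "(\<forall>z\<in>Z. f z = 0) \<or> (\<forall>z\<in>Z. g z = 0)"
proof -
  let ?T = "subtopology (zariski V) S"
  have ZS: "Z \<subseteq> S"
    using irr unfolding irreducible_closed_def closedin_subtopology_zariski[OF S] by blast
  have cl: "closedin ?T {z \<in> S. \<forall>f\<in>{h}. f z = 0}" if "h \<in> coord_ring V" for h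
    by (rule closedin_equations[OF S]) (use that in blast)
  have "Z \<subseteq> {z \<in> S. \<forall>h\<in>{f}. h z = 0} \<union> {z \<in> S. \<forall>h\<in>{g}. h z = 0}"
    using ZS fg by auto
  then have "Z \<subseteq> {z \<in> S. \<forall>h\<in>{f}. h z = 0} \<or> Z \<subseteq> {z \<in> S. \<forall>h\<in>{g}. h z = 0}"
    using irr cl[OF f] cl[OF g] unfolding irreducible_closed_def by blast
  then show ?thesis by auto
qed

lemma irr_components_irreducible:
  assumes "irreducible_closed T S" shows "irr_components T S = {S}"
  using assms unfolding irr_components_def by blast

lemma irr_components_empty [simp]: "irr_components T {} = {}"
  unfolding irr_components_def irreducible_closed_def by auto

definition rational_on :: "complex set \<Rightarrow> (complex \<Rightarrow> complex) \<Rightarrow> bool" where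
  "rational_on G h \<longleftrightarrow> (\<exists>p q. \<forall>s\<in>G. poly q s \<noteq> 0 \<and> h s = poly p s / poly q s)"

lemma rational_on_const: "rational_on G (\<lambda>_. c)"
  unfolding rational_on_def by (rule exI[of _ "[:c:]"], rule exI[of _ 1]) simp

lemma rational_on_add:
  assumes "rational_on G f" "rational_on G g" shows "rational_on G (\<lambda>s. f s + g s)"
proof -
  obtain p q p' q' where "\<forall>s\<in>G. poly q s \<noteq> 0 \<and> f s = poly p s / poly q s"
    "\<forall>s\<in>G. poly q' s \<noteq> 0 \<and> g s = poly p' s / poly q' s"
    using assms unfolding rational_on_def by blast
  then show ?thesis unfolding rational_on_def
    by (intro exI[of _ "p * q' + p' * q"] exI[of _ "q * q'"]) (auto simp: field_simps)
qed

lemma rational_on_mult: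
  assumes "rational_on G f" "rational_on G g" shows "rational_on G (\<lambda>s. f s * g s)"
proof -
  obtain p q p' q' where "\<forall>s\<in>G. poly q s \<noteq> 0 \<and> f s = poly p s / poly q s"
    "\<forall>s\<in>G. poly q' s \<noteq> 0 \<and> g s = poly p' s / poly q' s"
    using assms unfolding rational_on_def by blast
  then show ?thesis unfolding rational_on_def
    by (intro exI[of _ "p * p'"] exI[of _ "q * q'"]) auto
qed

lemma rational_on_quotient:
  assumes "rational_on G d" "rational_on G e" "\<And>s. s \<in> G \<Longrightarrow> d s \<noteq> 0 \<and> d s * h s = e s"
  shows "rational_on G h"
proof -
  obtain p q p' q' where pq: "\<forall>s\<in>G. poly q s \<noteq> 0 \<and> d s = poly p s / poly q s"
    "\<forall>s\<in>G. poly q' s \<noteq> 0 \<and> e s = poly p' s / poly q' s"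
    using assms unfolding rational_on_def by blast
  show ?thesis unfolding rational_on_def
  proof (intro exI ballI)
    fix s assume s: "s \<in> G"
    have "d s \<noteq> 0" "d s * h s = e s" using assms(3) s by auto
    then have h: "h s = e s / d s" by (simp add: field_simps)
    have nz: "poly q s \<noteq> 0" "poly q' s \<noteq> 0" "poly p s \<noteq> 0"
      using pq s \<open>d s \<noteq> 0\<close> by auto
    show "poly (p * q') s \<noteq> 0 \<and> h s = poly (p' * q) s / poly (p * q') s"
      using nz pq s h by (simp add: field_simps)
  qed
qed

lemma rational_on_subset: "rational_on G h \<Longrightarrow> G' \<subseteq> G \<Longrightarrow> rational_on G' h"
  unfolding rational_on_def by blast

lemma rational_on_coord_ring:
  assumes "f \<in> coord_ring V" "\<And>g. g \<in> gens V \<Longrightarrow> rational_on G (\<lambda>s. g (\<gamma> s))"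
  shows "rational_on G (\<lambda>s. f (\<gamma> s))"
  using assms(1) by induction
    (auto intro: rational_on_const rational_on_add rational_on_mult assms(2))

lemma rational_on_zeros:
  assumes r: "rational_on G h" and "finite (- G)" "s \<in> G" "h s \<noteq> 0"
  shows "finite (- {s \<in> G. h s \<noteq> 0})"
proof -
  obtain p q where pq: "\<forall>s\<in>G. poly q s \<noteq> 0 \<and> h s = poly p s / poly q s"
    using r unfolding rational_on_def by blast
  then have "p \<noteq> 0" using assms by auto
  then have "finite {x. poly p x = 0}" by (rule poly_roots_finite)
  moreover have "- {s \<in> G. h s \<noteq> 0} \<subseteq> - G \<union> {x. poly p x = 0}" using pq by auto
  ultimately show ?thesis using assms(2) finite_subset by blast
qed

text \<open>
  Two points of \<open>S\<close> are joined by a rational curve that stays in \<open>S\<close> outside finitely many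
  parameters. A product of two functions vanishing on \<open>S\<close> then vanishes factor by factor, as it
  does for rational functions of one variable; this is the source of all irreducibility
  statements below.
\<close>

definition rat_conn :: "'a variety \<Rightarrow> 'a set \<Rightarrow> bool" where
  "rat_conn V S \<longleftrightarrow> (\<forall>p\<in>S. \<forall>q\<in>S. \<exists>\<gamma> G. finite (- G) \<and> 0 \<in> G \<and> 1 \<in> G \<and> \<gamma> 0 = p \<and> \<gamma> 1 = q \<and>
     \<gamma> ` G \<subseteq> S \<and> (\<forall>f\<in>gens V. rational_on G (\<lambda>s. f (\<gamma> s))))"

lemma rat_conn_curve:
  assumes "rat_conn V S" "p \<in> S" "q \<in> S"
  obtains \<gamma> G where "finite (- G)" "0 \<in> G" "1 \<in> G" "\<gamma> 0 = p" "\<gamma> 1 = q" "\<gamma> ` G \<subseteq> S"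
    "\<And>f. f \<in> coord_ring V \<Longrightarrow> rational_on G (\<lambda>s. f (\<gamma> s))"
proof -
  obtain \<gamma> G where "finite (- G)" "0 \<in> G" "1 \<in> G" "\<gamma> 0 = p" "\<gamma> 1 = q" "\<gamma> ` G \<subseteq> S"
    "\<forall>f\<in>gens V. rational_on G (\<lambda>s. f (\<gamma> s))"
    using assms unfolding rat_conn_def by meson
  then show ?thesis using rational_on_coord_ring[of _ V G \<gamma>] that[of G \<gamma>] by blast
qed

lemma rat_conn_prime:
  assumes rc: "rat_conn V S" and f: "f \<in> coord_ring V" and g: "g \<in> coord_ring V"
    and fg: "\<And>z. z \<in> S \<Longrightarrow> f z * g z = 0"
  shows "(\<forall>z\<in>S. f z = 0) \<or> (\<forall>z\<in>S. g z = 0)"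
proof (rule ccontr)
  assume "\<not> ?thesis"
  then obtain p q where p: "p \<in> S" "f p \<noteq> 0" and q: "q \<in> S" "g q \<noteq> 0" by blast
  obtain \<gamma> G where G: "finite (- G)" "0 \<in> G" "1 \<in> G" "\<gamma> 0 = p" "\<gamma> 1 = q" "\<gamma> ` G \<subseteq> S"
    "\<And>f. f \<in> coord_ring V \<Longrightarrow> rational_on G (\<lambda>s. f (\<gamma> s))"
    using rat_conn_curve[OF rc p(1) q(1)] by blast
  have "finite (- {s \<in> G. f (\<gamma> s) \<noteq> 0} \<union> - {s \<in> G. g (\<gamma> s) \<noteq> 0})"
    using rational_on_zeros[OF G(7)[OF f] G(1,2)] rational_on_zeros[OF G(7)[OF g] G(1,3)] p q G(4,5)
    by simp
  then obtain s where "s \<notin> - {s \<in> G. f (\<gamma> s) \<noteq> 0} \<union> - {s \<in> G. g (\<gamma> s) \<noteq> 0}"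
    using ex_new_if_finite[OF infinite_UNIV_char_0] by blast
  then have "s \<in> G" "f (\<gamma> s) \<noteq> 0" "g (\<gamma> s) \<noteq> 0" by auto
  then show False using fg[of "\<gamma> s"] G(6) by auto
qed

lemma rat_conn_irreducible:
  assumes rc: "rat_conn V Z" and ne: "Z \<noteq> {}" and S: "S \<subseteq> points V"
    and cl: "closedin (subtopology (zariski V) S) Z"
  shows "irreducible_closed (subtopology (zariski V) S) Z"
  unfolding irreducible_closed_def
proof (intro conjI allI impI cl ne)
  fix C D
  assume A: "closedin (subtopology (zariski V) S) C \<and> closedin (subtopology (zariski V) S) D \<and> Z \<subseteq> C \<union> D"
  have ZS: "Z \<subseteq> S" using cl unfolding closedin_subtopology_zariski[OF S] by blast
  show "Z \<subseteq> C \<or> Z \<subseteq> D"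
  proof (rule ccontr)
    assume "\<not> ?thesis"
    then obtain p q where p: "p \<in> Z" "p \<in> S - C" and q: "q \<in> Z" "q \<in> S - D" using ZS by blast
    obtain f where f: "f \<in> coord_ring V" "f p \<noteq> 0" "\<forall>c\<in>C. f c = 0"
      using A p unfolding closedin_subtopology_zariski[OF S] by blast
    obtain g where g: "g \<in> coord_ring V" "g q \<noteq> 0" "\<forall>c\<in>D. g c = 0"
      using A q unfolding closedin_subtopology_zariski[OF S] by blast
    have "(\<forall>z\<in>Z. f z = 0) \<or> (\<forall>z\<in>Z. g z = 0)"
      by (rule rat_conn_prime[OF rc f(1) g(1)]) (use A f(3) g(3) in auto)
    then show False using p q f g by blast
  qed
qed

text \<open>A curve between two points of the open subset leaves it for finitely many parameters only.\<close>

lemma rat_conn_open: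
  assumes rc: "rat_conn V S" and f: "f \<in> coord_ring V"
  shows "rat_conn V {z \<in> S. f z \<noteq> b}"
  unfolding rat_conn_def
proof (intro ballI)
  fix p q assume p: "p \<in> {z \<in> S. f z \<noteq> b}" and q: "q \<in> {z \<in> S. f z \<noteq> b}"
  obtain \<gamma> G where G: "finite (- G)" "0 \<in> G" "1 \<in> G" "\<gamma> 0 = p" "\<gamma> 1 = q" "\<gamma> ` G \<subseteq> S"
    "\<And>f. f \<in> coord_ring V \<Longrightarrow> rational_on G (\<lambda>s. f (\<gamma> s))"
    using rat_conn_curve[OF rc, of p q] p q by blast
  let ?G = "{s \<in> G. f (\<gamma> s) + - b \<noteq> 0}"
  have "rational_on G (\<lambda>s. f (\<gamma> s) + - b)" by (rule rational_on_add[OF G(7)[OF f] rational_on_const])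
  moreover have "f (\<gamma> 0) + - b \<noteq> 0" using p G(4) by simp
  ultimately have "finite (- ?G)" by (rule rational_on_zeros[OF _ G(1,2)])
  moreover have "\<forall>h\<in>gens V. rational_on ?G (\<lambda>s. h (\<gamma> s))"
    using G(7) rational_on_subset coord_ring.gen by (metis (no_types, lifting) mem_Collect_eq subsetI)
  ultimately show "\<exists>\<gamma> G. finite (- G) \<and> 0 \<in> G \<and> 1 \<in> G \<and> \<gamma> 0 = p \<and> \<gamma> 1 = q \<and>
     \<gamma> ` G \<subseteq> {z \<in> S. f z \<noteq> b} \<and> (\<forall>f\<in>gens V. rational_on G (\<lambda>s. f (\<gamma> s)))"
    using G p q by (intro exI[of _ \<gamma>] exI[of _ ?G]) auto
qed

lemma rat_conn_avoid:
  assumes "finite B" "rat_conn V S" "f \<in> coord_ring V"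
  shows "rat_conn V {z \<in> S. f z \<notin> B}"
  using assms(1)
proof (induction B rule: finite_induct)
  case empty
  then show ?case using assms(2) by simp
next
  case (insert b B)
  have "{z \<in> S. f z \<notin> insert b B} = {z \<in> {z \<in> S. f z \<notin> B}. f z \<noteq> b}" by auto
  then show ?case using rat_conn_open[OF insert.IH assms(3), of b] by simp
qed

lemma rat_conn_image:
  assumes rc: "rat_conn V S"
    and \<phi>: "\<And>f. f \<in> gens W \<Longrightarrow>
      \<exists>d\<in>coord_ring V. \<exists>e\<in>coord_ring V. \<forall>z\<in>S. d z \<noteq> 0 \<and> d z * f (\<phi> z) = e z"
  shows "rat_conn W (\<phi> ` S)"
  unfolding rat_conn_def
proof (intro ballI)
  fix p q assume "p \<in> \<phi> ` S" "q \<in> \<phi> ` S"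
  then obtain p' q' where p': "p' \<in> S" "p = \<phi> p'" and q': "q' \<in> S" "q = \<phi> q'" by blast
  obtain \<gamma> G where G: "finite (- G)" "0 \<in> G" "1 \<in> G" "\<gamma> 0 = p'" "\<gamma> 1 = q'" "\<gamma> ` G \<subseteq> S"
    "\<And>f. f \<in> coord_ring V \<Longrightarrow> rational_on G (\<lambda>s. f (\<gamma> s))"
    using rat_conn_curve[OF rc p'(1) q'(1)] by blast
  have "rational_on G (\<lambda>s. f (\<phi> (\<gamma> s)))" if f: "f \<in> gens W" for f
  proof -
    obtain d e where de: "d \<in> coord_ring V" "e \<in> coord_ring V"
      "\<forall>z\<in>S. d z \<noteq> 0 \<and> d z * f (\<phi> z) = e z" using \<phi>[OF f] by blast
    show ?thesis
      by (rule rational_on_quotient[OF G(7)[OF de(1)] G(7)[OF de(2)]]) (use de G(6) in blast)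
  qed
  then show "\<exists>\<gamma> G. finite (- G) \<and> 0 \<in> G \<and> 1 \<in> G \<and> \<gamma> 0 = p \<and> \<gamma> 1 = q \<and>
     \<gamma> ` G \<subseteq> \<phi> ` S \<and> (\<forall>f\<in>gens W. rational_on G (\<lambda>s. f (\<gamma> s)))"
    using G p' q' by (intro exI[of _ "\<phi> \<circ> \<gamma>"] exI[of _ G]) auto
qed

lemma rat_conn_prod:
  assumes "rat_conn V S" "rat_conn W R"
  shows "rat_conn (V \<times>\<^sub>V W) (S \<times> R)"
  unfolding rat_conn_def
proof (intro ballI)
  fix p q assume p: "p \<in> S \<times> R" and q: "q \<in> S \<times> R"
  obtain \<gamma> G where G: "finite (- G)" "0 \<in> G" "1 \<in> G" "\<gamma> 0 = fst p" "\<gamma> 1 = fst q" "\<gamma> ` G \<subseteq> S"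
    "\<And>f. f \<in> coord_ring V \<Longrightarrow> rational_on G (\<lambda>s. f (\<gamma> s))"
    using rat_conn_curve[OF assms(1), of "fst p" "fst q"] p q by (metis mem_Times_iff)
  obtain \<delta> H where H: "finite (- H)" "0 \<in> H" "1 \<in> H" "\<delta> 0 = snd p" "\<delta> 1 = snd q" "\<delta> ` H \<subseteq> R"
    "\<And>f. f \<in> coord_ring W \<Longrightarrow> rational_on H (\<lambda>s. f (\<delta> s))"
    using rat_conn_curve[OF assms(2), of "snd p" "snd q"] p q by (metis mem_Times_iff)
  have "rational_on (G \<inter> H) (\<lambda>s. f (\<gamma> s, \<delta> s))" if "f \<in> gens (V \<times>\<^sub>V W)" for f
    using that rational_on_subset[OF G(7)[OF coord_ring.gen], of _ "G \<inter> H"]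
      rational_on_subset[OF H(7)[OF coord_ring.gen], of _ "G \<inter> H"]
    unfolding prod_variety_def by auto
  then show "\<exists>\<gamma> G. finite (- G) \<and> 0 \<in> G \<and> 1 \<in> G \<and> \<gamma> 0 = p \<and> \<gamma> 1 = q \<and>
     \<gamma> ` G \<subseteq> S \<times> R \<and> (\<forall>f\<in>gens (V \<times>\<^sub>V W). rational_on G (\<lambda>s. f (\<gamma> s)))"
    using G H by (intro exI[of _ "\<lambda>s. (\<gamma> s, \<delta> s)"] exI[of _ "G \<inter> H"]) (auto simp: Compl_Int)
qed

text \<open>The space of all assignments of complex values to a base coordinate and to coordinates
  \<open>c\<^sub>0, c\<^sub>1, \<dots>\<close>.\<close>

definition coord_space :: "(complex \<times> (nat \<Rightarrow> complex)) variety" where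
  "coord_space = \<lparr>points = UNIV, gens = insert fst (range (\<lambda>i z. snd z i))\<rparr>"

lemma rat_conn_linear:
  assumes "T = UNIV \<or> T = {\<tau>}"
  shows "rat_conn coord_space {z. fst z \<in> T \<and> (\<forall>i\<in>I. snd z i = v i)}"
  unfolding rat_conn_def
proof (intro ballI)
  let ?S = "{z. fst z \<in> T \<and> (\<forall>i\<in>I. snd z i = v i)}"
  fix p q assume p: "p \<in> ?S" and q: "q \<in> ?S"
  let ?\<gamma> = "\<lambda>s. (fst p + s * (fst q - fst p), \<lambda>i. snd p i + s * (snd q i - snd p i))"
  have lin: "rational_on UNIV (\<lambda>s. a + s * b)" for a b
    unfolding rational_on_def by (rule exI[of _ "[:a, b:]"], rule exI[of _ 1]) (simp add: mult.commute)
  have "\<forall>f\<in>gens coord_space. rational_on UNIV (\<lambda>s. f (?\<gamma> s))"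
    unfolding coord_space_def using lin by auto
  then show "\<exists>\<gamma> G. finite (- G) \<and> 0 \<in> G \<and> 1 \<in> G \<and> \<gamma> 0 = p \<and> \<gamma> 1 = q \<and>
     \<gamma> ` G \<subseteq> ?S \<and> (\<forall>f\<in>gens coord_space. rational_on G (\<lambda>s. f (\<gamma> s)))"
    using p q assms by (intro exI[of _ ?\<gamma>] exI[of _ UNIV]) auto
qed

section \<open>Dimension of irreducible closed sets\<close>

definition alg_ring :: "('a \<Rightarrow> complex) set \<Rightarrow> ('a \<Rightarrow> complex) set" where
  "alg_ring G = coord_ring \<lparr>points = UNIV, gens = G\<rparr>"

lemma alg_ring_gen: "g \<in> G \<Longrightarrow> g \<in> alg_ring G"
  unfolding alg_ring_def by (rule coord_ring.gen) simp

lemmas alg_ring_ops = coord_ring_ops[where V = "\<lparr>points = UNIV, gens = G\<rparr>" for G, folded alg_ring_def]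

lemma alg_ring_induct [consumes 1, case_names const gen add mult]:
  assumes "f \<in> alg_ring G" "\<And>q. P (\<lambda>_. of_rat q)" "\<And>g. g \<in> G \<Longrightarrow> P g"
    "\<And>f g. f \<in> alg_ring G \<Longrightarrow> P f \<Longrightarrow> g \<in> alg_ring G \<Longrightarrow> P g \<Longrightarrow> P (\<lambda>p. f p + g p)"
    "\<And>f g. f \<in> alg_ring G \<Longrightarrow> P f \<Longrightarrow> g \<in> alg_ring G \<Longrightarrow> P g \<Longrightarrow> P (\<lambda>p. f p * g p)"
  shows "P f"
  using assms(1)[unfolded alg_ring_def]
proof induction
  case (gen f)
  then show ?case using assms(3) by simp
qed (use assms(2) in blast, fact assms(4)[unfolded alg_ring_def], fact assms(5)[unfolded alg_ring_def])

lemma alg_ring_mono: "G \<subseteq> H \<Longrightarrow> alg_ring G \<subseteq> alg_ring H"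
  using alg_ring_gen[of _ H] unfolding alg_ring_def by (intro coord_ring_mono) auto

lemma alg_ring_subset: "G \<subseteq> coord_ring V \<Longrightarrow> alg_ring G \<subseteq> coord_ring V"
  unfolding alg_ring_def by (rule coord_ring_mono) auto

text \<open>The functions in \<open>R\<close> that vanish on \<open>D\<close> form a prime ideal.\<close>

definition prime_on :: "'a set \<Rightarrow> ('a \<Rightarrow> complex) set \<Rightarrow> bool" where
  "prime_on D R \<longleftrightarrow> D \<noteq> {} \<and> (\<forall>f\<in>R. \<forall>g\<in>R. (\<forall>z\<in>D. f z * g z = 0) \<longrightarrow>
     (\<forall>z\<in>D. f z = 0) \<or> (\<forall>z\<in>D. g z = 0))"

lemma prime_on_mult:
  assumes "prime_on D R" "f \<in> R" "g \<in> R" "\<exists>z\<in>D. f z \<noteq> 0" "\<exists>z\<in>D. g z \<noteq> 0"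
  shows "\<exists>z\<in>D. f z * g z \<noteq> 0"
  using assms unfolding prime_on_def by blast

lemma prime_on_subset: "prime_on D R \<Longrightarrow> R' \<subseteq> R \<Longrightarrow> prime_on D R'"
  unfolding prime_on_def by blast

lemma irreducible_prime_on:
  assumes "irreducible_closed (subtopology (zariski V) S) Z" "S \<subseteq> points V"
  shows "prime_on Z (coord_ring V)"
  unfolding prime_on_def
proof (intro conjI ballI impI)
  show "Z \<noteq> {}" using assms(1) unfolding irreducible_closed_def by blast
  fix f g assume fg: "f \<in> coord_ring V" "g \<in> coord_ring V" "\<forall>z\<in>Z. f z * g z = 0"
  show "(\<forall>z\<in>Z. f z = 0) \<or> (\<forall>z\<in>Z. g z = 0)"
    by (rule irreducible_prime[OF assms fg(1,2)]) (use fg(3) in blast)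
qed

definition algebraic_on :: "'a set \<Rightarrow> ('a \<Rightarrow> complex) set \<Rightarrow> ('a \<Rightarrow> complex) \<Rightarrow> bool" where
  "algebraic_on D R f \<longleftrightarrow> (\<exists>(k::nat) a. (\<forall>i\<le>k. a i \<in> R) \<and> (\<exists>i\<le>k. \<exists>z\<in>D. a i z \<noteq> 0) \<and>
     (\<forall>z\<in>D. (\<Sum>i\<le>k. a i z * f z ^ i) = 0))"

text \<open>More vectors than coordinates are linearly dependent over an integral domain, by Gaussian
  elimination without division.\<close>

lemma linear_dependence:
  assumes "finite J" and pr: "prime_on D (alg_ring G)"
  shows "finite I \<Longrightarrow> card J < card I \<Longrightarrow> (\<And>i j. i \<in> I \<Longrightarrow> j \<in> J \<Longrightarrow> v i j \<in> alg_ring G) \<Longrightarrow>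
    \<exists>c. (\<forall>i\<in>I. c i \<in> alg_ring G) \<and> (\<exists>i\<in>I. \<exists>z\<in>D. c i z \<noteq> 0) \<and>
        (\<forall>j\<in>J. \<forall>z\<in>D. (\<Sum>i\<in>I. c i z * v i j z) = 0)"
  using assms(1)
proof (induction J arbitrary: I v rule: finite_induct)
  case empty
  then obtain i where "i \<in> I" by fastforce
  then show ?case using pr
    by (intro exI[of _ "\<lambda>_ _. 1"]) (auto intro: alg_ring_ops simp: prime_on_def)
next
  case (insert n J)
  show ?case
  proof (cases "\<exists>k\<in>I. \<exists>z\<in>D. v k n z \<noteq> 0")
    case False
    have "card J < card I" using insert by simp
    then obtain c where "\<forall>i\<in>I. c i \<in> alg_ring G" "\<exists>i\<in>I. \<exists>z\<in>D. c i z \<noteq> 0"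
      "\<forall>j\<in>J. \<forall>z\<in>D. (\<Sum>i\<in>I. c i z * v i j z) = 0"
      using insert.IH[of I v] insert.prems by blast
    then show ?thesis using False by (intro exI[of _ c]) auto
  next
    case True
    then obtain k where k: "k \<in> I" "\<exists>z\<in>D. v k n z \<noteq> 0" by blast
    let ?I = "I - {k}"
    let ?w = "\<lambda>i j z. v k n z * v i j z - v i n z * v k j z"
    have "\<exists>c. (\<forall>i\<in>?I. c i \<in> alg_ring G) \<and> (\<exists>i\<in>?I. \<exists>z\<in>D. c i z \<noteq> 0) \<and>
        (\<forall>j\<in>J. \<forall>z\<in>D. (\<Sum>i\<in>?I. c i z * ?w i j z) = 0)"
    proof (rule insert.IH)
      show "card J < card ?I" using insert k by simp
      show "?w i j \<in> alg_ring G" if "i \<in> ?I" "j \<in> J" for i j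
        using insert.prems(3) k that by (intro alg_ring_ops) auto
    qed (use insert in simp)
    then obtain c where c: "\<forall>i\<in>?I. c i \<in> alg_ring G" "\<exists>i\<in>?I. \<exists>z\<in>D. c i z \<noteq> 0"
      "\<forall>j\<in>J. \<forall>z\<in>D. (\<Sum>i\<in>?I. c i z * ?w i j z) = 0" by blast
    define d where "d = (\<lambda>i z. if i = k then - (\<Sum>i\<in>?I. c i z * v i n z) else c i z * v k n z)"
    have dk: "d k = (\<lambda>z. - (\<Sum>i\<in>?I. c i z * v i n z))" by (auto simp: d_def)
    have di: "d i = (\<lambda>z. c i z * v k n z)" if "i \<noteq> k" for i using that by (auto simp: d_def)
    have "d i \<in> alg_ring G" if "i \<in> I" for i
      using c(1) insert.prems(3) k that by (cases "i = k") (auto simp: dk di intro!: alg_ring_ops)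
    moreover have "\<exists>i\<in>I. \<exists>z\<in>D. d i z \<noteq> 0"
    proof -
      obtain i where i: "i \<in> ?I" "\<exists>z\<in>D. c i z \<noteq> 0" using c(2) by blast
      have "\<exists>z\<in>D. c i z * v k n z \<noteq> 0"
        by (rule prime_on_mult[OF pr]) (use c(1) i k insert.prems(3) in auto)
      then show ?thesis using i di by (intro bexI[of _ i]) auto
    qed
    moreover have "(\<Sum>i\<in>I. d i z * v i j z) = 0" if j: "j \<in> insert n J" and z: "z \<in> D" for j z
    proof -
      have "(\<Sum>i\<in>I. d i z * v i j z) = d k z * v k j z + (\<Sum>i\<in>?I. d i z * v i j z)"
        using insert.prems(1) k(1) by (simp add: sum.remove)
      also have "(\<Sum>i\<in>?I. d i z * v i j z) = (\<Sum>i\<in>?I. c i z * v k n z * v i j z)"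
        by (rule sum.cong) (auto simp: di)
      also have "d k z * v k j z + \<dots> = (\<Sum>i\<in>?I. c i z * ?w i j z)"
        by (simp add: dk sum_distrib_left sum_distrib_right sum_subtractf algebra_simps)
      also have "\<dots> = 0"
        using c(3) j z by (cases "j = n") (auto simp: mult.commute)
      finally show ?thesis .
    qed
    ultimately show ?thesis by blast
  qed
qed

definition span_on :: "'a set \<Rightarrow> ('a \<Rightarrow> complex) set \<Rightarrow> 'j set \<Rightarrow> ('j \<Rightarrow> 'a \<Rightarrow> complex) \<Rightarrow> ('a \<Rightarrow> complex) \<Rightarrow> bool"
  where "span_on D R J e h \<longleftrightarrow> (\<exists>c. (\<forall>j\<in>J. c j \<in> R) \<and> (\<forall>z\<in>D. h z = (\<Sum>j\<in>J. c j z * e j z)))"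

lemma span_on_cong: "span_on D R J e h \<Longrightarrow> (\<And>z. z \<in> D \<Longrightarrow> h z = h' z) \<Longrightarrow> span_on D R J e h'"
proof -
  assume "span_on D R J e h" and eq: "\<And>z. z \<in> D \<Longrightarrow> h z = h' z"
  then obtain c where "\<forall>j\<in>J. c j \<in> R" "\<forall>z\<in>D. h z = (\<Sum>j\<in>J. c j z * e j z)"
    unfolding span_on_def by blast
  then show ?thesis unfolding span_on_def using eq by (intro exI[of _ c]) auto
qed

lemma span_on_add:
  assumes "span_on D (alg_ring G) J e f" "span_on D (alg_ring G) J e g"
  shows "span_on D (alg_ring G) J e (\<lambda>z. f z + g z)"
proof -
  obtain c d where "\<forall>j\<in>J. c j \<in> alg_ring G" "\<forall>z\<in>D. f z = (\<Sum>j\<in>J. c j z * e j z)"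
    "\<forall>j\<in>J. d j \<in> alg_ring G" "\<forall>z\<in>D. g z = (\<Sum>j\<in>J. d j z * e j z)"
    using assms unfolding span_on_def by blast
  then show ?thesis unfolding span_on_def
    by (intro exI[of _ "\<lambda>j z. c j z + d j z"]) (auto simp: sum.distrib algebra_simps intro: alg_ring_ops)
qed

lemma span_on_scale:
  assumes "span_on D (alg_ring G) J e f" "a \<in> alg_ring G"
  shows "span_on D (alg_ring G) J e (\<lambda>z. a z * f z)"
proof -
  obtain c where "\<forall>j\<in>J. c j \<in> alg_ring G" "\<forall>z\<in>D. f z = (\<Sum>j\<in>J. c j z * e j z)"
    using assms unfolding span_on_def by blast
  then show ?thesis unfolding span_on_def using assms(2)
    by (intro exI[of _ "\<lambda>j z. a z * c j z"]) (auto simp: sum_distrib_left mult.assoc intro: alg_ring_ops)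
qed

lemma span_on_sum:
  assumes "\<And>i. i \<in> I \<Longrightarrow> span_on D (alg_ring G) J e (f i)"
  shows "span_on D (alg_ring G) J e (\<lambda>z. \<Sum>i\<in>I. f i z)"
proof -
  have "span_on D (alg_ring G) J e (\<lambda>_. 0)"
    unfolding span_on_def by (rule exI[of _ "\<lambda>_ _. 0"]) (auto intro: alg_ring_ops)
  then show ?thesis using assms
    by (induction I rule: infinite_finite_induct) (auto intro: span_on_add)
qed

lemma span_on_basis:
  assumes "finite J" "j \<in> J" shows "span_on D (alg_ring G) J e (e j)"
  unfolding span_on_def
proof (rule exI[of _ "\<lambda>i z. if i = j then 1 else 0"], intro conjI ballI)
  fix i show "(\<lambda>z. if i = j then 1 else 0) \<in> alg_ring G"
    by (cases "i = j") (auto intro: alg_ring_ops)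
next
  fix z
  have "(\<Sum>i\<in>J. (if i = j then 1 else 0) * e i z) = (\<Sum>i\<in>J. if i = j then e i z else 0)"
    by (rule sum.cong) auto
  then show "e j z = (\<Sum>i\<in>J. (if i = j then 1 else 0) * e i z)" using assms by simp
qed

lemma span_on_stable:
  assumes "span_on D (alg_ring G) J e h" "\<And>j. j \<in> J \<Longrightarrow> span_on D (alg_ring G) J e (\<lambda>z. u z * e j z)"
  shows "span_on D (alg_ring G) J e (\<lambda>z. u z * h z)"
proof -
  obtain c where c: "\<forall>j\<in>J. c j \<in> alg_ring G" "\<forall>z\<in>D. h z = (\<Sum>j\<in>J. c j z * e j z)"
    using assms unfolding span_on_def by blast
  have "span_on D (alg_ring G) J e (\<lambda>z. \<Sum>j\<in>J. c j z * (u z * e j z))"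
    by (rule span_on_sum) (use c assms(2) in \<open>auto intro: span_on_scale\<close>)
  then show ?thesis
    by (rule span_on_cong) (use c(2) in \<open>auto simp: sum_distrib_left ac_simps\<close>)
qed

text \<open>A function some multiple of which acts on a finitely generated module containing \<open>1\<close> is
  algebraic: its powers are linearly dependent.\<close>

lemma algebraic_by_module:
  assumes pr: "prime_on D (alg_ring G)" and J: "finite J"
    and d: "d \<in> alg_ring G" "\<exists>z\<in>D. d z \<noteq> 0"
    and one: "span_on D (alg_ring G) J e (\<lambda>_. 1)"
    and act: "\<And>j. j \<in> J \<Longrightarrow> span_on D (alg_ring G) J e (\<lambda>z. d z * f z * e j z)"
  shows "algebraic_on D (alg_ring G) f"
proof -
  have "span_on D (alg_ring G) J e (\<lambda>z. (d z * f z) ^ i)" for i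
    by (induction i) (use one span_on_stable[OF _ act] in auto)
  then have "\<forall>i. \<exists>c. (\<forall>j\<in>J. c j \<in> alg_ring G) \<and> (\<forall>z\<in>D. (d z * f z) ^ i = (\<Sum>j\<in>J. c j z * e j z))"
    unfolding span_on_def by blast
  then obtain v where v: "\<And>i j. j \<in> J \<Longrightarrow> v i j \<in> alg_ring G"
    "\<And>i z. z \<in> D \<Longrightarrow> (d z * f z) ^ i = (\<Sum>j\<in>J. v i j z * e j z)"
    by metis
  obtain c where c: "\<forall>i\<in>{..card J}. c i \<in> alg_ring G" "\<exists>i\<in>{..card J}. \<exists>z\<in>D. c i z \<noteq> 0"
      "\<forall>j\<in>J. \<forall>z\<in>D. (\<Sum>i\<le>card J. c i z * v i j z) = 0"
    using linear_dependence[OF J pr, of "{..card J}" v] v(1) by auto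
  show ?thesis unfolding algebraic_on_def
  proof (rule exI[of _ "card J"], rule exI[of _ "\<lambda>i z. c i z * d z ^ i"], intro conjI)
    show "\<forall>i\<le>card J. (\<lambda>z. c i z * d z ^ i) \<in> alg_ring G"
      using c(1) d(1) by (auto intro!: alg_ring_ops)
    obtain i where i: "i \<le> card J" "\<exists>z\<in>D. c i z \<noteq> 0" using c(2) by auto
    have "\<exists>z\<in>D. c i z * d z ^ i \<noteq> 0"
      by (rule prime_on_mult[OF pr]) (use c(1) i d in \<open>auto intro: alg_ring_ops\<close>)
    then show "\<exists>i\<le>card J. \<exists>z\<in>D. c i z * d z ^ i \<noteq> 0" using i(1) by blast
    show "\<forall>z\<in>D. (\<Sum>i\<le>card J. c i z * d z ^ i * f z ^ i) = 0"
    proof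
      fix z assume z: "z \<in> D"
      have "(\<Sum>i\<le>card J. c i z * d z ^ i * f z ^ i) = (\<Sum>i\<le>card J. c i z * (\<Sum>j\<in>J. v i j z * e j z))"
        using v(2)[OF z] by (intro sum.cong) (auto simp: power_mult_distrib mult.assoc)
      also have "\<dots> = (\<Sum>j\<in>J. (\<Sum>i\<le>card J. c i z * v i j z) * e j z)"
        unfolding sum_distrib_left sum_distrib_right by (subst sum.swap) (simp add: mult.assoc)
      also have "\<dots> = 0" using c(3) z by simp
      finally show "(\<Sum>i\<le>card J. c i z * d z ^ i * f z ^ i) = 0" .
    qed
  qed
qed

lemma algebraic_on_leading:
  assumes "algebraic_on D R f"
  obtains m a where "\<And>i. i \<le> m \<Longrightarrow> a i \<in> R" "0 < m" "\<exists>z\<in>D. a m z \<noteq> 0"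
    "\<And>z. z \<in> D \<Longrightarrow> a m z * f z ^ m = - (\<Sum>i<m. a i z * f z ^ i)"
proof -
  obtain k a where a: "\<forall>i\<le>k. a i \<in> R" "\<exists>i\<le>k. \<exists>z\<in>D. a i z \<noteq> 0"
     "\<forall>z\<in>D. (\<Sum>i\<le>k. a i z * f z ^ i) = 0"
    using assms unfolding algebraic_on_def by blast
  define m where "m = Max {i. i \<le> k \<and> (\<exists>z\<in>D. a i z \<noteq> 0)}"
  have fin: "finite {i. i \<le> k \<and> (\<exists>z\<in>D. a i z \<noteq> 0)}" by simp
  have m: "m \<in> {i. i \<le> k \<and> (\<exists>z\<in>D. a i z \<noteq> 0)}"
    unfolding m_def by (rule Max_in[OF fin]) (use a(2) in blast)
  have above: "a i z = 0" if "i \<le> k" "i > m" "z \<in> D" for i z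
    using Max_ge[OF fin, of i] that unfolding m_def by (metis (mono_tags, lifting) leD mem_Collect_eq)
  have rel: "a m z * f z ^ m + (\<Sum>i<m. a i z * f z ^ i) = 0" if z: "z \<in> D" for z
  proof -
    have "(\<Sum>i\<le>k. a i z * f z ^ i) = (\<Sum>i\<le>m. a i z * f z ^ i)"
      by (rule sum.mono_neutral_right) (use m above z in auto)
    moreover have "(\<Sum>i\<le>k. a i z * f z ^ i) = 0" using a(3) z by blast
    ultimately show ?thesis by (simp add: lessThan_Suc_atMost[symmetric] add.commute)
  qed
  have "m > 0"
    using m rel by (cases m) auto
  then show ?thesis
    using that[of m a] m a(1) rel by (auto simp: add_eq_0_iff2)
qed

lemma algebraic_on_base:
  assumes "g \<in> alg_ring G" "D \<noteq> {}" shows "algebraic_on D (alg_ring G) g"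
  unfolding algebraic_on_def
proof (rule exI[of _ 1], rule exI[of _ "\<lambda>i z. if i = 0 then - g z else 1"], intro conjI)
  show "\<forall>i\<le>1::nat. (\<lambda>z. if i = 0 then - g z else 1) \<in> alg_ring G"
  proof (intro allI impI)
    fix i :: nat assume "i \<le> 1"
    then show "(\<lambda>z. if i = 0 then - g z else 1) \<in> alg_ring G"
      using assms(1) by (cases "i = 0") (auto intro: alg_ring_ops)
  qed
  show "\<exists>i\<le>1::nat. \<exists>z\<in>D. (if i = 0 then - g z else 1) \<noteq> 0"
    using assms(2) by (intro exI[of _ 1]) auto
qed auto

text \<open>The products \<open>f\<^sup>i g\<^sup>j\<close> with exponents below the degrees of the equations of \<open>f\<close> and \<open>g\<close> span a
  module that is stable under the products of \<open>f\<close> and \<open>g\<close> with the leading coefficients.\<close>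

lemma algebraic_on_closed:
  assumes pr: "prime_on D (alg_ring G)"
    and f: "algebraic_on D (alg_ring G) f" and g: "algebraic_on D (alg_ring G) g"
  shows "algebraic_on D (alg_ring G) (\<lambda>z. f z + g z)" "algebraic_on D (alg_ring G) (\<lambda>z. f z * g z)"
proof -
  obtain m a where a: "\<And>i. i \<le> m \<Longrightarrow> a i \<in> alg_ring G" "0 < m" "\<exists>z\<in>D. a m z \<noteq> 0"
    "\<And>z. z \<in> D \<Longrightarrow> a m z * f z ^ m = - (\<Sum>i<m. a i z * f z ^ i)"
    using algebraic_on_leading[OF f] by blast
  obtain n b where b: "\<And>i. i \<le> n \<Longrightarrow> b i \<in> alg_ring G" "0 < n" "\<exists>z\<in>D. b n z \<noteq> 0"
    "\<And>z. z \<in> D \<Longrightarrow> b n z * g z ^ n = - (\<Sum>i<n. b i z * g z ^ i)"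
    using algebraic_on_leading[OF g] by blast
  let ?J = "{..<m} \<times> {..<n}"
  let ?e = "\<lambda>j z. f z ^ fst j * g z ^ snd j"
  let ?span = "span_on D (alg_ring G) ?J ?e"
  have basis: "?span (\<lambda>z. f z ^ i * g z ^ j)" if "i < m" "j < n" for i j
    using span_on_basis[of ?J "(i, j)" D G ?e] that by simp
  have one: "?span (\<lambda>_. 1)" using basis[of 0 0] a(2) b(2) by simp
  have actf: "?span (\<lambda>z. a m z * f z * h z)" if "?span h" for h
  proof (rule span_on_stable[OF that])
    fix j assume j: "j \<in> ?J"
    show "?span (\<lambda>z. a m z * f z * ?e j z)"
    proof (cases "Suc (fst j) < m")
      case True
      then have "?span (\<lambda>z. a m z * (f z ^ Suc (fst j) * g z ^ snd j))"
        by (intro span_on_scale basis) (use a(1) j in auto)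
      then show ?thesis by (rule span_on_cong) simp
    next
      case False
      then have m: "m = Suc (fst j)" using j by auto
      have "?span (\<lambda>z. \<Sum>i<m. - a i z * (f z ^ i * g z ^ snd j))"
        by (rule span_on_sum, rule span_on_scale[OF basis]) (use a(1) j in \<open>auto intro: alg_ring_ops\<close>)
      then show ?thesis
      proof (rule span_on_cong)
        fix z assume z: "z \<in> D"
        have "a m z * f z * ?e j z = (a m z * f z ^ m) * g z ^ snd j" by (simp add: m)
        also have "\<dots> = (\<Sum>i<m. - a i z * (f z ^ i * g z ^ snd j))"
          unfolding a(4)[OF z] by (simp add: sum_distrib_right sum_negf mult.assoc)
        finally show "(\<Sum>i<m. - a i z * (f z ^ i * g z ^ snd j)) = a m z * f z * ?e j z" by simp
      qed
    qed
  qed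
  have actg: "?span (\<lambda>z. b n z * g z * h z)" if "?span h" for h
  proof (rule span_on_stable[OF that])
    fix j assume j: "j \<in> ?J"
    show "?span (\<lambda>z. b n z * g z * ?e j z)"
    proof (cases "Suc (snd j) < n")
      case True
      then have "?span (\<lambda>z. b n z * (f z ^ fst j * g z ^ Suc (snd j)))"
        by (intro span_on_scale basis) (use b(1) j in auto)
      then show ?thesis by (rule span_on_cong) simp
    next
      case False
      then have n: "n = Suc (snd j)" using j by auto
      have "?span (\<lambda>z. \<Sum>i<n. - b i z * (f z ^ fst j * g z ^ i))"
        by (rule span_on_sum, rule span_on_scale[OF basis]) (use b(1) j in \<open>auto intro: alg_ring_ops\<close>)
      then show ?thesis
      proof (rule span_on_cong)
        fix z assume z: "z \<in> D"
        have "b n z * g z * ?e j z = f z ^ fst j * (b n z * g z ^ n)" by (simp add: n)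
        also have "\<dots> = (\<Sum>i<n. - b i z * (f z ^ fst j * g z ^ i))"
          unfolding b(4)[OF z] by (simp add: sum_distrib_left sum_negf ac_simps)
        finally show "(\<Sum>i<n. - b i z * (f z ^ fst j * g z ^ i)) = b n z * g z * ?e j z" by simp
      qed
    qed
  qed
  let ?d = "\<lambda>z. a m z * b n z"
  have d: "?d \<in> alg_ring G" "\<exists>z\<in>D. ?d z \<noteq> 0"
    using a(1)[of m] b(1)[of n] prime_on_mult[OF pr a(1) b(1) a(3) b(3)] by (auto intro: alg_ring_ops)
  show "algebraic_on D (alg_ring G) (\<lambda>z. f z + g z)"
  proof (rule algebraic_by_module[OF pr _ d one])
    fix j assume j: "j \<in> ?J"
    have e: "?span (?e j)" using basis j by auto
    have "?span (\<lambda>z. b n z * (a m z * f z * ?e j z) + a m z * (b n z * g z * ?e j z))"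
      using a(1)[of m] b(1)[of n] by (intro span_on_add span_on_scale actf actg e) auto
    then show "?span (\<lambda>z. ?d z * (f z + g z) * ?e j z)"
      by (rule span_on_cong) (simp add: algebra_simps)
  qed simp
  show "algebraic_on D (alg_ring G) (\<lambda>z. f z * g z)"
  proof (rule algebraic_by_module[OF pr _ d one])
    fix j assume j: "j \<in> ?J"
    have e: "?span (?e j)" using basis j by auto
    have "?span (\<lambda>z. b n z * g z * (a m z * f z * ?e j z))"
      by (intro actf actg e)
    then show "?span (\<lambda>z. ?d z * (f z * g z) * ?e j z)"
      by (rule span_on_cong) (simp add: algebra_simps)
  qed simp
qed

lemma algebraic_on_ring:
  assumes pr: "prime_on D (alg_ring G)"
    and X: "\<And>x. x \<in> X \<Longrightarrow> algebraic_on D (alg_ring G) x" and f: "f \<in> alg_ring (G \<union> X)"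
  shows "algebraic_on D (alg_ring G) f"
proof -
  have D: "D \<noteq> {}" using pr unfolding prime_on_def by blast
  show ?thesis using f
    by (induction rule: alg_ring_induct)
      (use X D algebraic_on_closed[OF pr] in \<open>auto intro: algebraic_on_base alg_ring_ops alg_ring_gen\<close>)
qed

lemma alg_ring_expand:
  assumes "h \<in> alg_ring (insert s G)"
  shows "\<exists>k a. (\<forall>i\<le>k. a i \<in> alg_ring G) \<and> (\<forall>z. h z = (\<Sum>i\<le>(k::nat). a i z * s z ^ i))"
proof -
  have "\<exists>P k. (\<forall>i. (\<lambda>z. poly.coeff (P z) i) \<in> alg_ring G) \<and> (\<forall>z. degree (P z) \<le> k \<and> h z = poly (P z) (s z))"
    using assms
  proof (induction rule: alg_ring_induct)
    case (const q)
    have "(\<lambda>z. poly.coeff [:of_rat q:] i) \<in> alg_ring G" for i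
      by (cases i) (auto intro: alg_ring_ops)
    then show ?case by (intro exI[of _ "\<lambda>_. [:of_rat q:]"] exI[of _ 0]) auto
  next
    case (gen g)
    show ?case
    proof (cases "g = s")
      case True
      have "(\<lambda>z. poly.coeff [:0, 1:] i) \<in> alg_ring G" for i
        by (cases i; cases "i - 1") (auto intro: alg_ring_ops)
      then show ?thesis using True by (intro exI[of _ "\<lambda>_. [:0, 1:]"] exI[of _ 1]) auto
    next
      case False
      have "(\<lambda>z. poly.coeff [:g z:] i) \<in> alg_ring G" for i
        using gen False by (cases i) (auto intro: alg_ring_ops alg_ring_gen)
      then show ?thesis by (intro exI[of _ "\<lambda>z. [:g z:]"] exI[of _ 0]) auto
    qed
  next
    case (add f g)
    then obtain P k Q l where "\<forall>i. (\<lambda>z. poly.coeff (P z) i) \<in> alg_ring G"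
      "\<forall>z. degree (P z) \<le> k \<and> f z = poly (P z) (s z)" "\<forall>i. (\<lambda>z. poly.coeff (Q z) i) \<in> alg_ring G"
      "\<forall>z. degree (Q z) \<le> l \<and> g z = poly (Q z) (s z)" by blast
    then show ?case
      by (intro exI[of _ "\<lambda>z. P z + Q z"] exI[of _ "max k l"])
        (auto intro!: alg_ring_ops degree_add_le intro: max.coboundedI1 max.coboundedI2)
  next
    case (mult f g)
    then obtain P k Q l where "\<forall>i. (\<lambda>z. poly.coeff (P z) i) \<in> alg_ring G"
      "\<forall>z. degree (P z) \<le> k \<and> f z = poly (P z) (s z)" "\<forall>i. (\<lambda>z. poly.coeff (Q z) i) \<in> alg_ring G"
      "\<forall>z. degree (Q z) \<le> l \<and> g z = poly (Q z) (s z)" by blast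
    then show ?case
      by (intro exI[of _ "\<lambda>z. P z * Q z"] exI[of _ "k + l"])
        (auto simp: coeff_mult intro!: alg_ring_ops intro: order.trans[OF degree_mult_le add_mono])
  qed
  then obtain P k where P: "\<And>i. (\<lambda>z. poly.coeff (P z) i) \<in> alg_ring G"
    "\<And>z. degree (P z) \<le> k" "\<And>z. h z = poly (P z) (s z)" by blast
  have "h z = (\<Sum>i\<le>k. poly.coeff (P z) i * s z ^ i)" for z
    unfolding P(3) poly_altdef
    by (rule sum.mono_neutral_left) (use P(2)[of z] in \<open>auto simp: coeff_eq_0\<close>)
  then show ?thesis using P(1) by (intro exI[of _ k] exI[of _ "\<lambda>i z. poly.coeff (P z) i"]) auto
qed

text \<open>Iterated algebraic independence, in the order of the list, of the restrictions to \<open>D\<close>.\<close>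

definition indep_on :: "'a set \<Rightarrow> ('a \<Rightarrow> complex) set \<Rightarrow> ('a \<Rightarrow> complex) list \<Rightarrow> bool" where
  "indep_on D G xs \<longleftrightarrow> (\<forall>i<length xs. \<not> algebraic_on D (alg_ring (G \<union> set (take i xs))) (xs ! i))"

lemma indep_on_Nil [simp]: "indep_on D G []"
  unfolding indep_on_def by simp

lemma indep_on_snoc:
  "indep_on D G (xs @ [x]) \<longleftrightarrow> indep_on D G xs \<and> \<not> algebraic_on D (alg_ring (G \<union> set xs)) x"
  unfolding indep_on_def by (auto simp: less_Suc_eq nth_append)

text \<open>The functions generated by \<open>G\<close> play the role of constants: on \<open>S\<close> each of them vanishes
  everywhere or nowhere.\<close>

definition constants_on :: "('a \<Rightarrow> complex) set \<Rightarrow> 'a set \<Rightarrow> bool" where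
  "constants_on G S \<longleftrightarrow> (\<forall>g\<in>alg_ring G. (\<forall>z\<in>S. g z = 0) \<or> (\<forall>z\<in>S. g z \<noteq> 0))"

lemma constants_onI:
  assumes "\<And>g. g \<in> G \<Longrightarrow> \<exists>c. \<forall>z\<in>S. g z = c"
  shows "constants_on G S"
proof -
  have "\<exists>c. \<forall>z\<in>S. g z = c" if "g \<in> alg_ring G" for g
    using that
  proof (induction rule: alg_ring_induct)
    case (add f g)
    then obtain c d where "\<forall>z\<in>S. f z = c" "\<forall>z\<in>S. g z = d" by blast
    then show ?case by (intro exI[of _ "c + d"]) simp
  next
    case (mult f g)
    then obtain c d where "\<forall>z\<in>S. f z = c" "\<forall>z\<in>S. g z = d" by blast
    then show ?case by (intro exI[of _ "c * d"]) simp
  qed (use assms in blast)+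
  then show ?thesis unfolding constants_on_def by metis
qed

text \<open>The polynomial ring on independent functions injects into the functions on \<open>C\<close>.\<close>

lemma indep_on_vanishing:
  assumes G: "constants_on G S" and C: "C \<subseteq> S" "C \<noteq> {}"
  shows "indep_on C G xs \<Longrightarrow> g \<in> alg_ring (G \<union> set xs) \<Longrightarrow> (\<And>z. z \<in> C \<Longrightarrow> g z = 0) \<Longrightarrow> z \<in> S \<Longrightarrow> g z = 0"
proof (induction xs arbitrary: g z rule: rev_induct)
  case Nil
  then show ?case using G C unfolding constants_on_def by (metis all_not_in_conv list.set(1) subsetD sup_bot.right_neutral)
next
  case (snoc x xs)
  have ind: "indep_on C G xs" "\<not> algebraic_on C (alg_ring (G \<union> set xs)) x"
    using snoc.prems(1) unfolding indep_on_snoc by auto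
  have "g \<in> alg_ring (insert x (G \<union> set xs))" using snoc.prems(2) by simp
  then obtain k a where a: "\<forall>i\<le>k. a i \<in> alg_ring (G \<union> set xs)" "\<forall>z. g z = (\<Sum>i\<le>k. a i z * x z ^ i)"
    using alg_ring_expand by blast
  have "\<forall>z\<in>C. (\<Sum>i\<le>k. a i z * x z ^ i) = 0" using a(2) snoc.prems(3) by simp
  then have "\<forall>i\<le>k. \<forall>z\<in>C. a i z = 0"
    using ind(2) a(1) unfolding algebraic_on_def by blast
  then have "\<forall>i\<le>k. a i z = 0" using snoc.IH[OF ind(1) _ _ snoc.prems(4)] a(1) by blast
  then show ?case using a(2) by simp
qed

lemma indep_on_mono:
  assumes G: "constants_on G S" and C: "C \<subseteq> D" "D \<subseteq> S" "C \<noteq> {}" and ind: "indep_on C G xs"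
  shows "indep_on D G xs"
  unfolding indep_on_def
proof (intro allI impI notI)
  fix i assume i: "i < length xs" and alg: "algebraic_on D (alg_ring (G \<union> set (take i xs))) (xs ! i)"
  obtain k a where a: "\<forall>j\<le>k. a j \<in> alg_ring (G \<union> set (take i xs))" "\<exists>j\<le>k. \<exists>z\<in>D. a j z \<noteq> 0"
     "\<forall>z\<in>D. (\<Sum>j\<le>(k::nat). a j z * (xs ! i) z ^ j) = 0"
    using alg unfolding algebraic_on_def by blast
  have ind': "indep_on C G (take i xs)"
    using ind i unfolding indep_on_def by (auto simp: min_def)
  obtain j z where j: "j \<le> k" "z \<in> D" "a j z \<noteq> 0" using a(2) by blast
  have CS: "C \<subseteq> S" using C by blast
  have "\<exists>z\<in>C. a j z \<noteq> 0"
    using indep_on_vanishing[OF G CS C(3) ind', of "a j" z] a(1) j C(2) by blast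
  then have "\<exists>j\<le>k. \<exists>z\<in>C. a j z \<noteq> 0" using j(1) by blast
  then have "algebraic_on C (alg_ring (G \<union> set (take i xs))) (xs ! i)"
    unfolding algebraic_on_def using a C(1) by blast
  then show False using ind i unfolding indep_on_def by blast
qed

text \<open>If all of \<open>X\<close> were algebraic over \<open>xs\<close> on \<open>D\<close>, then so would be a function that vanishes on \<open>C\<close> but
  not on \<open>D\<close>. The constant term of its relation vanishes on \<open>C\<close>, hence everywhere, as \<open>xs\<close> is
  independent on \<open>C\<close>.\<close>

lemma indep_on_extend:
  assumes S: "S \<subseteq> points V" and G: "constants_on G S" and GX: "G \<union> X \<subseteq> coord_ring V"
    and gen: "\<And>f. f \<in> coord_ring V \<Longrightarrow>
      \<exists>b\<in>coord_ring V. \<exists>g\<in>alg_ring (G \<union> X). \<forall>z\<in>S. b z \<noteq> 0 \<and> g z = b z * f z"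
    and C: "irreducible_closed (subtopology (zariski V) S) C"
    and D: "irreducible_closed (subtopology (zariski V) S) D" and CD: "C \<subset> D"
    and xs: "indep_on C G xs" "set xs \<subseteq> X"
  shows "\<exists>x\<in>X. indep_on D G (xs @ [x])"
proof (rule ccontr)
  assume no: "\<not> ?thesis"
  have sub: "C \<subseteq> S" "D \<subseteq> S" "C \<noteq> {}" "closedin (subtopology (zariski V) S) C"
    using C D unfolding irreducible_closed_def closedin_subtopology_zariski[OF S] by auto
  have prV: "prime_on D (coord_ring V)" by (rule irreducible_prime_on[OF D S])
  let ?R = "alg_ring (G \<union> set xs)"
  have RV: "?R \<subseteq> coord_ring V" by (rule alg_ring_subset) (use GX xs in blast)
  have pr: "prime_on D ?R" using prime_on_subset[OF prV RV] .
  have indD: "indep_on D G xs" using indep_on_mono[OF G _ sub(2,3) xs(1)] CD by blast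
  have X: "algebraic_on D ?R x" if "x \<in> X" for x using no indD that unfolding indep_on_snoc by blast
  obtain p where p: "p \<in> D - C" using CD by blast
  then obtain f where f: "f \<in> coord_ring V" "f p \<noteq> 0" "\<forall>c\<in>C. f c = 0"
    using sub unfolding closedin_subtopology_zariski[OF S] by blast
  obtain b g where bg: "b \<in> coord_ring V" "g \<in> alg_ring (G \<union> X)" "\<forall>z\<in>S. b z \<noteq> 0 \<and> g z = b z * f z"
    using gen[OF f(1)] by blast
  have gp: "g p \<noteq> 0" using bg(3) f(2) p sub(2) by auto
  have gC: "g z = 0" if "z \<in> C" for z using bg(3) f(3) sub(1) that by auto
  have gV: "g \<in> coord_ring V" using alg_ring_subset[OF GX] bg(2) by blast
  have gR: "g \<in> alg_ring ((G \<union> set xs) \<union> X)" using bg(2) alg_ring_mono[of "G \<union> X" "(G \<union> set xs) \<union> X"] by blast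
  have "algebraic_on D ?R g" by (rule algebraic_on_ring[OF pr _ gR]) (rule X)
  then obtain k a where ka: "(\<forall>j\<le>k. a j \<in> ?R) \<and> (\<exists>j\<le>k. \<exists>z\<in>D. a j z \<noteq> 0) \<and>
     (\<forall>z\<in>D. (\<Sum>j\<le>(k::nat). a j z * g z ^ j) = 0)"
    unfolding algebraic_on_def by (elim exE)
  then have a: "\<forall>j\<le>k. a j \<in> ?R" "\<exists>j\<le>k. \<exists>z\<in>D. a j z \<noteq> 0"
     "\<forall>z\<in>D. (\<Sum>j\<le>k. a j z * g z ^ j) = 0"
    by simp_all
  define l where "l = (LEAST j. j \<le> k \<and> (\<exists>z\<in>D. a j z \<noteq> 0))"
  have l: "l \<le> k" "\<exists>z\<in>D. a l z \<noteq> 0"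
    using LeastI_ex[of "\<lambda>j. j \<le> k \<and> (\<exists>z\<in>D. a j z \<noteq> 0)"] a(2) unfolding l_def by auto
  have below: "a j z = 0" if "j < l" "z \<in> D" for j z
    using not_less_Least[of j "\<lambda>j. j \<le> k \<and> (\<exists>z\<in>D. a j z \<noteq> 0)"] that l(1) unfolding l_def by auto
  \<comment> \<open>Divide the relation by the largest possible power of \<open>g\<close>; on \<open>C\<close> only its constant term
    survives.\<close>
  define r where "r = (\<lambda>z. \<Sum>j\<in>{l..k}. a j z * g z ^ (j - l))"
  have "(\<lambda>z. a j z * g z ^ (j - l)) \<in> coord_ring V" if "j \<in> {l..k}" for j
    using a(1) RV gV that by (auto intro!: coord_ring.mult coord_ring_power)
  then have rV: "r \<in> coord_ring V" unfolding r_def by (rule coord_ring_sum)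
  have "g z ^ l * r z = 0" if z: "z \<in> D" for z
  proof -
    have "g z ^ l * r z = (\<Sum>j\<in>{l..k}. a j z * g z ^ j)"
      unfolding r_def sum_distrib_left
      by (rule sum.cong) (auto simp: mult.left_commute power_add[symmetric])
    also have "\<dots> = (\<Sum>j\<le>k. a j z * g z ^ j)"
      by (rule sum.mono_neutral_left) (use below z in auto)
    finally show ?thesis using a(3) z by simp
  qed
  then have r0: "r z = 0" if "z \<in> D" for z
    using prime_on_mult[OF prV coord_ring_power[OF gV] rV, of l] gp p that by auto
  have "a l z = 0" if z: "z \<in> C" for z
  proof -
    have "r z = (\<Sum>j\<in>{l}. a j z * g z ^ (j - l))"
      unfolding r_def by (rule sum.mono_neutral_right) (use l gC[OF z] in auto)
    then show ?thesis using r0[of z] z CD by auto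
  qed
  moreover have "a l \<in> ?R" using a(1) l(1) by blast
  ultimately have al0: "a l z = 0" if "z \<in> S" for z
    using indep_on_vanishing[OF G sub(1,3) xs(1), of "a l" z] that by simp
  obtain z where "z \<in> D" "a l z \<noteq> 0" using l(2) by blast
  then show False using al0[of z] sub(2) by auto
qed

lemma indep_on_distinct:
  assumes "indep_on D G xs" "D \<noteq> {}" shows "distinct xs"
  unfolding distinct_conv_nth
proof (intro allI impI)
  have *: "xs ! i \<noteq> xs ! j" if "i < j" "j < length xs" for i j
  proof
    assume eq: "xs ! i = xs ! j"
    have "xs ! i \<in> set (take j xs)" using that by (auto simp: in_set_conv_nth)
    then have "algebraic_on D (alg_ring (G \<union> set (take j xs))) (xs ! j)"
      unfolding eq using assms(2) by (intro algebraic_on_base alg_ring_gen) auto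
    then show False using assms(1) that unfolding indep_on_def by blast
  qed
  fix i j assume "i < length xs" "j < length xs" "i \<noteq> j"
  then show "xs ! i \<noteq> xs ! j" using *[of i j] *[of j i] by (metis nat_neq_iff)
qed

text \<open>
  Passing to a strictly larger irreducible closed set makes room for one more independent
  function, so chains are at most as long as the number of coordinates allows.
\<close>

lemma chain_bound:
  assumes S: "S \<subseteq> points V" and G: "constants_on G S" and GX: "G \<union> X \<subseteq> coord_ring V" and X: "finite X"
    and gen: "\<And>f. f \<in> coord_ring V \<Longrightarrow>
      \<exists>b\<in>coord_ring V. \<exists>g\<in>alg_ring (G \<union> X). \<forall>z\<in>S. b z \<noteq> 0 \<and> g z = b z * f z"
    and ch: "irr_chain (subtopology (zariski V) S) n C"
    and xs: "indep_on (C 0) G xs" "set xs \<subseteq> X"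
  shows "length xs + n \<le> card X"
proof -
  have "\<exists>ys. indep_on (C m) G ys \<and> set ys \<subseteq> X \<and> length ys = length xs + m" if "m \<le> n" for m
    using that
  proof (induction m)
    case 0
    then show ?case using xs by auto
  next
    case (Suc m)
    then obtain ys where ys: "indep_on (C m) G ys" "set ys \<subseteq> X" "length ys = length xs + m" by auto
    have "irreducible_closed (subtopology (zariski V) S) (C m)"
      "irreducible_closed (subtopology (zariski V) S) (C (Suc m))" "C m \<subset> C (Suc m)"
      using ch Suc.prems unfolding irr_chain_def by auto
    then obtain x where "x \<in> X" "indep_on (C (Suc m)) G (ys @ [x])"
      using indep_on_extend[OF S G GX gen _ _ _ ys(1,2)] by blast
    then show ?case using ys by (intro exI[of _ "ys @ [x]"]) auto
  qed
  then obtain ys where ys: "indep_on (C n) G ys" "set ys \<subseteq> X" "length ys = length xs + n" by blast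
  have "C n \<noteq> {}" using ch unfolding irr_chain_def irreducible_closed_def by blast
  then have "length ys = card (set ys)" using indep_on_distinct[OF ys(1)] distinct_card by metis
  also have "\<dots> \<le> card X" using X ys(2) by (rule card_mono)
  finally show ?thesis using ys(3) by simp
qed

lemma Sup_enat_eq:
  assumes "P N" "\<And>n. P n \<Longrightarrow> n \<le> N"
  shows "Sup {enat n | n. P n} = enat N"
proof (rule antisym)
  show "Sup {enat n | n. P n} \<le> enat N" by (rule Sup_least) (use assms in auto)
  show "enat N \<le> Sup {enat n | n. P n}" by (rule Sup_upper) (use assms in auto)
qed

lemma codim_eqI:
  assumes S: "S \<subseteq> points V" and G: "constants_on G S" and GX: "G \<union> X \<subseteq> coord_ring V" and X: "finite X"
    and gen: "\<And>f. f \<in> coord_ring V \<Longrightarrow>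
      \<exists>b\<in>coord_ring V. \<exists>g\<in>alg_ring (G \<union> X). \<forall>z\<in>S. b z \<noteq> 0 \<and> g z = b z * f z"
    and ch: "irr_chain (subtopology (zariski V) S) n C"
    and xs: "indep_on (C 0) G xs" "set xs \<subseteq> X" and n: "card X \<le> length xs + n"
  shows "codim (subtopology (zariski V) S) (C 0) = enat n"
  unfolding codim_def
proof (rule Sup_enat_eq)
  show "\<exists>C'. irr_chain (subtopology (zariski V) S) n C' \<and> C' 0 = C 0" using ch by blast
  fix m assume "\<exists>C'. irr_chain (subtopology (zariski V) S) m C' \<and> C' 0 = C 0"
  then obtain C' where C': "irr_chain (subtopology (zariski V) S) m C'" "C' 0 = C 0" by blast
  have "length xs + m \<le> card X"
    by (rule chain_bound[OF S G GX X gen C'(1)]) (simp_all add: xs C'(2))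
  then show "m \<le> n" using n by simp
qed

lemma krull_dim_eqI:
  assumes S: "S \<subseteq> points V" and G: "constants_on G S" and GX: "G \<union> X \<subseteq> coord_ring V" and X: "finite X"
    and gen: "\<And>f. f \<in> coord_ring V \<Longrightarrow>
      \<exists>b\<in>coord_ring V. \<exists>g\<in>alg_ring (G \<union> X). \<forall>z\<in>S. b z \<noteq> 0 \<and> g z = b z * f z"
    and ch: "irr_chain (subtopology (zariski V) S) n C" and n: "card X \<le> n"
  shows "krull_dim (subtopology (zariski V) S) = enat n"
  unfolding krull_dim_def
proof (rule Sup_enat_eq)
  show "\<exists>C. irr_chain (subtopology (zariski V) S) n C" using ch by blast
  fix m assume "\<exists>C. irr_chain (subtopology (zariski V) S) m C"
  then obtain C' where C': "irr_chain (subtopology (zariski V) S) m C'" by blast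
  have "m \<le> card X" using chain_bound[OF S G GX X gen C', of "[]"] by simp
  then show "m \<le> n" using n by simp
qed

text \<open>The hypothesis that \<open>X\<close> generates all functions up to denominators needs to be checked on
  generators only.\<close>

lemma generated_up_to_denominators:
  assumes GX: "G \<union> X \<subseteq> coord_ring V"
    and gen: "\<And>f. f \<in> gens V \<Longrightarrow>
      \<exists>b\<in>alg_ring (G \<union> X). \<exists>g\<in>alg_ring (G \<union> X). \<forall>z\<in>S. b z \<noteq> 0 \<and> g z = b z * f z"
    and f: "f \<in> coord_ring V"
  shows "\<exists>b\<in>coord_ring V. \<exists>g\<in>alg_ring (G \<union> X). \<forall>z\<in>S. b z \<noteq> 0 \<and> g z = b z * f z"
proof -
  have "\<exists>b\<in>alg_ring (G \<union> X). \<exists>g\<in>alg_ring (G \<union> X). \<forall>z\<in>S. b z \<noteq> 0 \<and> g z = b z * f z"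
    using f
  proof induction
    case (const q)
    show ?case by (rule bexI[OF _ alg_ring_ops(2)], rule bexI[of _ "\<lambda>_. of_rat q"]) (auto intro: alg_ring_ops)
  next
    case (gen f)
    then show ?case using assms(2) by blast
  next
    case (add f f')
    then obtain b g b' g' where "b \<in> alg_ring (G \<union> X)" "g \<in> alg_ring (G \<union> X)"
      "\<forall>z\<in>S. b z \<noteq> 0 \<and> g z = b z * f z" "b' \<in> alg_ring (G \<union> X)" "g' \<in> alg_ring (G \<union> X)"
      "\<forall>z\<in>S. b' z \<noteq> 0 \<and> g' z = b' z * f' z" by blast
    then show ?case
      by (intro bexI[of _ "\<lambda>z. b z * b' z"] bexI[of _ "\<lambda>z. g z * b' z + g' z * b z"])
        (auto simp: algebra_simps intro: alg_ring_ops)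
  next
    case (mult f f')
    then obtain b g b' g' where "b \<in> alg_ring (G \<union> X)" "g \<in> alg_ring (G \<union> X)"
      "\<forall>z\<in>S. b z \<noteq> 0 \<and> g z = b z * f z" "b' \<in> alg_ring (G \<union> X)" "g' \<in> alg_ring (G \<union> X)"
      "\<forall>z\<in>S. b' z \<noteq> 0 \<and> g' z = b' z * f' z" by blast
    then show ?case
      by (intro bexI[of _ "\<lambda>z. b z * b' z"] bexI[of _ "\<lambda>z. g z * g' z"])
        (auto simp: algebra_simps intro: alg_ring_ops)
  qed
  then show ?thesis using alg_ring_subset[OF GX] by blast
qed

text \<open>A function that takes infinitely many values on \<open>D\<close> while the others are kept fixed is
  transcendental over them.\<close>

lemma not_algebraic_on:
  assumes "\<And>z. z \<in> D \<Longrightarrow> infinite (f ` {z' \<in> D. \<forall>g\<in>G. g z' = g z})"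
  shows "\<not> algebraic_on D (alg_ring G) f"
proof
  assume "algebraic_on D (alg_ring G) f"
  then obtain k a where ka: "(\<forall>i\<le>k. a i \<in> alg_ring G) \<and> (\<exists>i\<le>k. \<exists>z\<in>D. a i z \<noteq> 0) \<and>
     (\<forall>z\<in>D. (\<Sum>i\<le>(k::nat). a i z * f z ^ i) = 0)"
    unfolding algebraic_on_def by (elim exE)
  then obtain i z where iz: "i \<le> k" "z \<in> D" "a i z \<noteq> 0" by (elim conjE exE bexE)
  note a = conjunct1[OF ka] iz conjunct2[OF conjunct2[OF ka]]
  have const: "h z' = h z" if "h \<in> alg_ring G" "\<forall>g\<in>G. g z' = g z" for h z'
    using that(1) by (induction rule: alg_ring_induct) (use that(2) in auto)
  let ?p = "\<Sum>i\<le>k. Polynomial.monom (a i z) i"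
  have "poly.coeff ?p i = a i z" using a(2) by (simp add: coeff_sum)
  then have "poly.coeff ?p i \<noteq> 0" using a(4) by simp
  then have "?p \<noteq> 0" by (rule contrapos_nn) (simp only: coeff_0)
  then have "finite {x. poly ?p x = 0}" by (rule poly_roots_finite)
  moreover have sub: "f ` {z' \<in> D. \<forall>g\<in>G. g z' = g z} \<subseteq> {x. poly ?p x = 0}"
  proof
    fix x assume "x \<in> f ` {z' \<in> D. \<forall>g\<in>G. g z' = g z}"
    then obtain z' where z': "z' \<in> D" "\<forall>g\<in>G. g z' = g z" "x = f z'" by blast
    have "a j z' = a j z" if "j \<le> k" for j using const[of "a j" z'] a(1) z'(2) that by blast
    then have "poly ?p x = (\<Sum>i\<le>k. a i z' * f z' ^ i)"
      unfolding poly_sum poly_monom z'(3) by (intro sum.cong) auto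
    then show "x \<in> {x. poly ?p x = 0}" using a(5) z'(1) by simp
  qed
  ultimately show False using assms[OF a(3)] finite_subset[OF sub] by simp
qed

section \<open>Divisors of multiplicity one\<close>

text \<open>This ensures that the local ring of \<open>Z\<close> along \<open>W\<close> is a ring, and that functions vanishing on \<open>W\<close>
  define a proper ideal of it.\<close>

definition prime_pair :: "'a variety \<Rightarrow> 'a set \<Rightarrow> 'a set \<Rightarrow> bool" where
  "prime_pair V Z W \<longleftrightarrow> prime_on Z (coord_ring V) \<and> prime_on W (coord_ring V) \<and> W \<subseteq> Z"

lemma fractions_iff:
  "(a, b) \<in> fractions V W \<longleftrightarrow> a \<in> coord_ring V \<and> b \<in> coord_ring V \<and> (\<exists>w\<in>W. b w \<noteq> 0)"
  unfolding fractions_def by auto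

lemma fractions_one:
  assumes "prime_pair V Z W" "a \<in> coord_ring V" shows "(a, \<lambda>_. 1) \<in> fractions V W"
  using assms unfolding fractions_iff prime_pair_def prime_on_def by (auto intro: coord_ring_1)

lemma fractions_mult:
  assumes "prime_pair V Z W" "(a, b) \<in> fractions V W" "(c, d) \<in> fractions V W"
  shows "(\<lambda>p. a p * c p, \<lambda>p. b p * d p) \<in> fractions V W"
  using assms prime_on_mult[of W "coord_ring V" b d] unfolding fractions_iff prime_pair_def
  by (auto intro: coord_ring.mult)

lemma fractions_add:
  assumes "prime_pair V Z W" "(a, b) \<in> fractions V W" "(c, d) \<in> fractions V W"
  shows "(\<lambda>p. a p * d p + c p * b p, \<lambda>p. b p * d p) \<in> fractions V W"
  using assms prime_on_mult[of W "coord_ring V" b d] unfolding fractions_iff prime_pair_def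
  by (auto intro: coord_ring.mult coord_ring.add)

lemma mem_frac_class:
  "(a', b') \<in> frac_class V Z W a b \<longleftrightarrow> (a', b') \<in> fractions V W \<and> (\<forall>z\<in>Z. a z * b' z = a' z * b z)"
  unfolding frac_class_def by auto

lemma frac_class_self: "(a, b) \<in> fractions V W \<Longrightarrow> (a, b) \<in> frac_class V Z W a b"
  unfolding mem_frac_class by auto

lemma frac_class_trans:
  assumes pp: "prime_pair V Z W" and F: "(a, b) \<in> fractions V W" "(c, d) \<in> fractions V W" "(a', b') \<in> fractions V W"
    and eq: "\<And>z. z \<in> Z \<Longrightarrow> a z * d z = c z * b z" "\<And>z. z \<in> Z \<Longrightarrow> a z * b' z = a' z * b z"
    and z: "z \<in> Z"
  shows "c z * b' z = a' z * d z"
proof -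
  have pZ: "prime_on Z (coord_ring V)" using pp unfolding prime_pair_def by blast
  let ?h = "\<lambda>z. c z * b' z - a' z * d z"
  have A: "b \<in> coord_ring V" "?h \<in> coord_ring V"
    using F unfolding fractions_iff by (auto intro!: coord_ring_diff coord_ring.mult)
  have "b z * ?h z = 0" if z: "z \<in> Z" for z
  proof -
    have "b z * ?h z = (c z * b z) * b' z - (a' z * b z) * d z" by (simp add: algebra_simps)
    then show ?thesis unfolding eq(1)[OF z, symmetric] eq(2)[OF z, symmetric] by simp
  qed
  moreover have "\<exists>z\<in>Z. b z \<noteq> 0" using F(1) pp unfolding fractions_iff prime_pair_def by blast
  ultimately have "?h z = 0" using prime_on_mult[OF pZ A] z by metis
  then show ?thesis by simp
qed

lemma frac_class_eq:
  assumes pp: "prime_pair V Z W" and F: "(a, b) \<in> fractions V W" "(c, d) \<in> fractions V W"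
  shows "frac_class V Z W a b = frac_class V Z W c d \<longleftrightarrow> (\<forall>z\<in>Z. a z * d z = c z * b z)"
proof
  assume "frac_class V Z W a b = frac_class V Z W c d"
  then have "(c, d) \<in> frac_class V Z W a b" using frac_class_self[OF F(2)] by simp
  then show "\<forall>z\<in>Z. a z * d z = c z * b z" unfolding mem_frac_class by blast
next
  assume eq: "\<forall>z\<in>Z. a z * d z = c z * b z"
  have "x \<in> frac_class V Z W c d" if "x \<in> frac_class V Z W a b" for x
  proof (cases x)
    case (Pair a' b')
    then have x: "(a', b') \<in> fractions V W" "\<And>z. z \<in> Z \<Longrightarrow> a z * b' z = a' z * b z"
      using that[unfolded Pair mem_frac_class] by auto
    have "\<forall>z\<in>Z. c z * b' z = a' z * d z"
      using frac_class_trans[OF pp F x(1) _ x(2)] eq by simp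
    then show ?thesis using x(1) unfolding Pair mem_frac_class by simp
  qed
  moreover have "x \<in> frac_class V Z W a b" if "x \<in> frac_class V Z W c d" for x
  proof (cases x)
    case (Pair a' b')
    then have x: "(a', b') \<in> fractions V W" "\<And>z. z \<in> Z \<Longrightarrow> c z * b' z = a' z * d z"
      using that[unfolded Pair mem_frac_class] by auto
    have "\<forall>z\<in>Z. a z * b' z = a' z * b z"
      using frac_class_trans[OF pp F(2,1) x(1) _ x(2)] eq by simp
    then show ?thesis using x(1) unfolding Pair mem_frac_class by simp
  qed
  ultimately show "frac_class V Z W a b = frac_class V Z W c d" by blast
qed

lemma UN_pairs_const:
  assumes "r \<noteq> {}" "s \<noteq> {}" "\<And>a b c d. (a, b) \<in> r \<Longrightarrow> (c, d) \<in> s \<Longrightarrow> F a b c d = X"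
  shows "(\<Union>(a, b)\<in>r. \<Union>(c, d)\<in>s. F a b c d) = X"
  using assms by fastforce

lemma local_ring_mult:
  assumes pp: "prime_pair V Z W" and F: "(a, b) \<in> fractions V W" "(c, d) \<in> fractions V W"
  shows "frac_class V Z W a b \<otimes>\<^bsub>local_ring V Z W\<^esub> frac_class V Z W c d =
    frac_class V Z W (\<lambda>p. a p * c p) (\<lambda>p. b p * d p)"
  unfolding local_ring_def monoid.simps
proof (rule UN_pairs_const)
  fix a' b' c' d' assume "(a', b') \<in> frac_class V Z W a b" "(c', d') \<in> frac_class V Z W c d"
  then have F': "(a', b') \<in> fractions V W" "(c', d') \<in> fractions V W"
    and eq: "\<And>z. z \<in> Z \<Longrightarrow> a z * b' z = a' z * b z" "\<And>z. z \<in> Z \<Longrightarrow> c z * d' z = c' z * d z"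
    unfolding mem_frac_class by auto
  show "frac_class V Z W (\<lambda>p. a' p * c' p) (\<lambda>p. b' p * d' p) = frac_class V Z W (\<lambda>p. a p * c p) (\<lambda>p. b p * d p)"
    unfolding frac_class_eq[OF pp fractions_mult[OF pp F'] fractions_mult[OF pp F]]
  proof
    fix z assume z: "z \<in> Z"
    have "a' z * c' z * (b z * d z) = (a' z * b z) * (c' z * d z)" by simp
    also have "\<dots> = (a z * b' z) * (c z * d' z)" using eq z by simp
    finally show "a' z * c' z * (b z * d z) = a z * c z * (b' z * d' z)" by simp
  qed
qed (use frac_class_self F in blast)+

lemma local_ring_add:
  assumes pp: "prime_pair V Z W" and F: "(a, b) \<in> fractions V W" "(c, d) \<in> fractions V W"
  shows "frac_class V Z W a b \<oplus>\<^bsub>local_ring V Z W\<^esub> frac_class V Z W c d =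
    frac_class V Z W (\<lambda>p. a p * d p + c p * b p) (\<lambda>p. b p * d p)"
  unfolding local_ring_def ring_record_simps
proof (rule UN_pairs_const)
  fix a' b' c' d' assume "(a', b') \<in> frac_class V Z W a b" "(c', d') \<in> frac_class V Z W c d"
  then have F': "(a', b') \<in> fractions V W" "(c', d') \<in> fractions V W"
    and eq: "\<And>z. z \<in> Z \<Longrightarrow> a z * b' z = a' z * b z" "\<And>z. z \<in> Z \<Longrightarrow> c z * d' z = c' z * d z"
    unfolding mem_frac_class by auto
  show "frac_class V Z W (\<lambda>p. a' p * d' p + c' p * b' p) (\<lambda>p. b' p * d' p) =
      frac_class V Z W (\<lambda>p. a p * d p + c p * b p) (\<lambda>p. b p * d p)"
    unfolding frac_class_eq[OF pp fractions_add[OF pp F'] fractions_add[OF pp F]]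
  proof
    fix z assume z: "z \<in> Z"
    have "(a' z * d' z + c' z * b' z) * (b z * d z) = (a' z * b z) * (d' z * d z) + (c' z * d z) * (b' z * b z)"
      by (simp add: algebra_simps)
    also have "\<dots> = (a z * b' z) * (d' z * d z) + (c z * d' z) * (b' z * b z)" using eq z by simp
    finally show "(a' z * d' z + c' z * b' z) * (b z * d z) = (a z * d z + c z * b z) * (b' z * d' z)"
      by (simp add: algebra_simps)
  qed
qed (use frac_class_self F in blast)+

lemma local_ring_carrier:
  "x \<in> carrier (local_ring V Z W) \<longleftrightarrow> (\<exists>a b. (a, b) \<in> fractions V W \<and> x = frac_class V Z W a b)"
  unfolding local_ring_def by auto

lemma local_ring_carrierI:
  "(a, b) \<in> fractions V W \<Longrightarrow> frac_class V Z W a b \<in> carrier (local_ring V Z W)"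
  unfolding local_ring_carrier by blast

lemma local_ring_carrierE:
  assumes "x \<in> carrier (local_ring V Z W)"
  obtains a b where "(a, b) \<in> fractions V W" "x = frac_class V Z W a b"
  using assms unfolding local_ring_carrier by blast

lemma local_ring_zero: "\<zero>\<^bsub>local_ring V Z W\<^esub> = frac_class V Z W (\<lambda>_. 0) (\<lambda>_. 1)"
  unfolding local_ring_def by simp

lemma local_ring_one: "\<one>\<^bsub>local_ring V Z W\<^esub> = frac_class V Z W (\<lambda>_. 1) (\<lambda>_. 1)"
  unfolding local_ring_def by simp

lemma fractions_uminus: "(a, b) \<in> fractions V W \<Longrightarrow> (\<lambda>p. - a p, b) \<in> fractions V W"
  unfolding fractions_iff by (auto intro: coord_ring_uminus)

lemma local_ring_minus_zero:
  assumes pp: "prime_pair V Z W" and F: "(a, b) \<in> fractions V W"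
  shows "frac_class V Z W (\<lambda>p. - a p) b \<oplus>\<^bsub>local_ring V Z W\<^esub> frac_class V Z W a b = \<zero>\<^bsub>local_ring V Z W\<^esub>"
  unfolding local_ring_add[OF pp fractions_uminus[OF F] F] local_ring_zero
  by (subst frac_class_eq[OF pp fractions_add[OF pp fractions_uminus[OF F] F] fractions_one[OF pp coord_ring_0]]) auto

lemma ring_local_ring:
  assumes pp: "prime_pair V Z W" shows "ring (local_ring V Z W)"
proof (rule ringI)
  let ?R = "local_ring V Z W"
  note f1 = fractions_one[OF pp] and fm = fractions_mult[OF pp] and fa = fractions_add[OF pp]
  note add = local_ring_add[OF pp] and mult = local_ring_mult[OF pp] and eq = frac_class_eq[OF pp]
  show "abelian_group ?R"
  proof (rule abelian_groupI)
    fix x y assume "x \<in> carrier ?R" "y \<in> carrier ?R"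
    then obtain a b c d where x: "(a, b) \<in> fractions V W" "x = frac_class V Z W a b"
      and y: "(c, d) \<in> fractions V W" "y = frac_class V Z W c d" by (elim local_ring_carrierE)
    show "x \<oplus>\<^bsub>?R\<^esub> y \<in> carrier ?R"
      unfolding x(2) y(2) add[OF x(1) y(1)] by (rule local_ring_carrierI[OF fa[OF x(1) y(1)]])
    show "x \<oplus>\<^bsub>?R\<^esub> y = y \<oplus>\<^bsub>?R\<^esub> x"
      unfolding x(2) y(2) add[OF x(1) y(1)] add[OF y(1) x(1)]
      by (subst eq[OF fa[OF x(1) y(1)] fa[OF y(1) x(1)]]) (simp only: distrib_left distrib_right ac_simps mult_zero_left add_0_left mult_1_left mult_1_right ball_triv simp_thms)
    fix z assume "z \<in> carrier ?R"
    then obtain g h where z: "(g, h) \<in> fractions V W" "z = frac_class V Z W g h" by (elim local_ring_carrierE)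
    show "x \<oplus>\<^bsub>?R\<^esub> y \<oplus>\<^bsub>?R\<^esub> z = x \<oplus>\<^bsub>?R\<^esub> (y \<oplus>\<^bsub>?R\<^esub> z)"
      unfolding x(2) y(2) z(2) add[OF x(1) y(1)] add[OF y(1) z(1)]
        add[OF x(1) fa[OF y(1) z(1)]] add[OF fa[OF x(1) y(1)] z(1)]
      by (subst eq[OF fa[OF fa[OF x(1) y(1)] z(1)] fa[OF x(1) fa[OF y(1) z(1)]]]) (simp only: distrib_left distrib_right ac_simps mult_zero_left add_0_left mult_1_left mult_1_right ball_triv simp_thms)
  next
    show "\<zero>\<^bsub>?R\<^esub> \<in> carrier ?R"
      unfolding local_ring_zero by (rule local_ring_carrierI[OF f1[OF coord_ring_0]])
  next
    fix x assume "x \<in> carrier ?R"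
    then obtain a b where x: "(a, b) \<in> fractions V W" "x = frac_class V Z W a b" by (elim local_ring_carrierE)
    show "\<zero>\<^bsub>?R\<^esub> \<oplus>\<^bsub>?R\<^esub> x = x"
      unfolding x(2) local_ring_zero add[OF f1[OF coord_ring_0] x(1)]
      by (subst eq[OF fa[OF f1[OF coord_ring_0] x(1)] x(1)]) (simp only: distrib_left distrib_right ac_simps mult_zero_left add_0_left mult_1_left mult_1_right ball_triv simp_thms)
    show "\<exists>y\<in>carrier ?R. y \<oplus>\<^bsub>?R\<^esub> x = \<zero>\<^bsub>?R\<^esub>"
      unfolding x(2)
      by (rule bexI[rotated], rule local_ring_carrierI[OF fractions_uminus[OF x(1)]],
          rule local_ring_minus_zero[OF pp x(1)])
  qed
  show "monoid ?R"
  proof (rule monoidI)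
    fix x y assume "x \<in> carrier ?R" "y \<in> carrier ?R"
    then obtain a b c d where x: "(a, b) \<in> fractions V W" "x = frac_class V Z W a b"
      and y: "(c, d) \<in> fractions V W" "y = frac_class V Z W c d" by (elim local_ring_carrierE)
    show "x \<otimes>\<^bsub>?R\<^esub> y \<in> carrier ?R"
      unfolding x(2) y(2) mult[OF x(1) y(1)] by (rule local_ring_carrierI[OF fm[OF x(1) y(1)]])
    fix z assume "z \<in> carrier ?R"
    then obtain g h where z: "(g, h) \<in> fractions V W" "z = frac_class V Z W g h" by (elim local_ring_carrierE)
    show "x \<otimes>\<^bsub>?R\<^esub> y \<otimes>\<^bsub>?R\<^esub> z = x \<otimes>\<^bsub>?R\<^esub> (y \<otimes>\<^bsub>?R\<^esub> z)"
      unfolding x(2) y(2) z(2) mult[OF x(1) y(1)] mult[OF y(1) z(1)]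
        mult[OF x(1) fm[OF y(1) z(1)]] mult[OF fm[OF x(1) y(1)] z(1)]
      by (subst eq[OF fm[OF fm[OF x(1) y(1)] z(1)] fm[OF x(1) fm[OF y(1) z(1)]]]) (simp only: distrib_left distrib_right ac_simps mult_zero_left add_0_left mult_1_left mult_1_right ball_triv simp_thms)
  next
    show "\<one>\<^bsub>?R\<^esub> \<in> carrier ?R"
      unfolding local_ring_one by (rule local_ring_carrierI[OF f1[OF coord_ring_1]])
  next
    fix x assume "x \<in> carrier ?R"
    then obtain a b where x: "(a, b) \<in> fractions V W" "x = frac_class V Z W a b" by (elim local_ring_carrierE)
    show "\<one>\<^bsub>?R\<^esub> \<otimes>\<^bsub>?R\<^esub> x = x"
      unfolding x(2) local_ring_one mult[OF f1[OF coord_ring_1] x(1)] by simp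
    show "x \<otimes>\<^bsub>?R\<^esub> \<one>\<^bsub>?R\<^esub> = x"
      unfolding x(2) local_ring_one mult[OF x(1) f1[OF coord_ring_1]] by simp
  qed
  fix x y z assume "x \<in> carrier ?R" "y \<in> carrier ?R" "z \<in> carrier ?R"
  then obtain a b c d g h where x: "(a, b) \<in> fractions V W" "x = frac_class V Z W a b"
    and y: "(c, d) \<in> fractions V W" "y = frac_class V Z W c d"
    and z: "(g, h) \<in> fractions V W" "z = frac_class V Z W g h" by (elim local_ring_carrierE)
  show "(x \<oplus>\<^bsub>?R\<^esub> y) \<otimes>\<^bsub>?R\<^esub> z = x \<otimes>\<^bsub>?R\<^esub> z \<oplus>\<^bsub>?R\<^esub> y \<otimes>\<^bsub>?R\<^esub> z"
    unfolding x(2) y(2) z(2) add[OF x(1) y(1)] mult[OF x(1) z(1)] mult[OF y(1) z(1)]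
      mult[OF fa[OF x(1) y(1)] z(1)] add[OF fm[OF x(1) z(1)] fm[OF y(1) z(1)]]
    by (subst eq[OF fm[OF fa[OF x(1) y(1)] z(1)] fa[OF fm[OF x(1) z(1)] fm[OF y(1) z(1)]]]) (simp only: distrib_left distrib_right ac_simps mult_zero_left add_0_left mult_1_left mult_1_right ball_triv simp_thms)
  show "z \<otimes>\<^bsub>?R\<^esub> (x \<oplus>\<^bsub>?R\<^esub> y) = z \<otimes>\<^bsub>?R\<^esub> x \<oplus>\<^bsub>?R\<^esub> z \<otimes>\<^bsub>?R\<^esub> y"
    unfolding x(2) y(2) z(2) add[OF x(1) y(1)] mult[OF z(1) x(1)] mult[OF z(1) y(1)]
      mult[OF z(1) fa[OF x(1) y(1)]] add[OF fm[OF z(1) x(1)] fm[OF z(1) y(1)]]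
    by (subst eq[OF fm[OF z(1) fa[OF x(1) y(1)]] fa[OF fm[OF z(1) x(1)] fm[OF z(1) y(1)]]]) (simp only: distrib_left distrib_right ac_simps mult_zero_left add_0_left mult_1_left mult_1_right ball_triv simp_thms)
qed

definition max_ideal :: "'a variety \<Rightarrow> 'a set \<Rightarrow> 'a set \<Rightarrow> (('a \<Rightarrow> complex) \<times> ('a \<Rightarrow> complex)) set set" where
  "max_ideal V Z W = {frac_class V Z W a b | a b. (a, b) \<in> fractions V W \<and> (\<forall>w\<in>W. a w = 0)}"

lemma frac_class_max_ideal:
  assumes pp: "prime_pair V Z W" and F: "(a, b) \<in> fractions V W"
  shows "frac_class V Z W a b \<in> max_ideal V Z W \<longleftrightarrow> (\<forall>w\<in>W. a w = 0)"
proof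
  assume "frac_class V Z W a b \<in> max_ideal V Z W"
  then obtain c d where c: "(c, d) \<in> fractions V W" "\<forall>w\<in>W. c w = 0" "frac_class V Z W a b = frac_class V Z W c d"
    unfolding max_ideal_def by blast
  have eq: "a z * d z = c z * b z" if "z \<in> Z" for z using c(3) that unfolding frac_class_eq[OF pp F c(1)] by blast
  have pW: "prime_on W (coord_ring V)" and WZ: "W \<subseteq> Z" using pp unfolding prime_pair_def by auto
  have "a w * d w = 0" if "w \<in> W" for w using eq[of w] c(2) that WZ by auto
  then show "\<forall>w\<in>W. a w = 0"
    using prime_on_mult[OF pW, of a d] F c(1) unfolding fractions_iff by blast
qed (use F in \<open>auto simp: max_ideal_def\<close>)

lemma ideal_max_ideal:
  assumes pp: "prime_pair V Z W" shows "ideal (max_ideal V Z W) (local_ring V Z W)"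
proof -
  let ?R = "local_ring V Z W" and ?m = "max_ideal V Z W"
  interpret R: ring ?R by (rule ring_local_ring[OF pp])
  have mE: "\<exists>a b. (a, b) \<in> fractions V W \<and> (\<forall>w\<in>W. a w = 0) \<and> x = frac_class V Z W a b" if "x \<in> ?m" for x
    using that unfolding max_ideal_def by blast
  have car: "?m \<subseteq> carrier ?R" unfolding max_ideal_def local_ring_carrier[abs_def] local_ring_def by auto
  have "\<zero>\<^bsub>?R\<^esub> \<in> ?m"
    unfolding local_ring_zero frac_class_max_ideal[OF pp fractions_one[OF pp coord_ring_0]] by simp
  moreover have "\<ominus>\<^bsub>?R\<^esub> x \<in> ?m" if xm: "x \<in> ?m" for x
  proof -
    obtain a b where x: "(a, b) \<in> fractions V W" "\<forall>w\<in>W. a w = 0" "x = frac_class V Z W a b"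
      using mE[OF xm] by blast
    have m: "frac_class V Z W (\<lambda>p. - a p) b \<in> ?m"
      using frac_class_max_ideal[OF pp fractions_uminus[OF x(1)]] x(2) by simp
    have "\<ominus>\<^bsub>?R\<^esub> x = frac_class V Z W (\<lambda>p. - a p) b"
      by (rule R.minus_equality) (use local_ring_minus_zero[OF pp x(1)] x(3) xm car m in auto)
    then show ?thesis using m by simp
  qed
  moreover have "x \<oplus>\<^bsub>?R\<^esub> y \<in> ?m" if xy: "x \<in> ?m" "y \<in> ?m" for x y
  proof -
    obtain a b where x: "(a, b) \<in> fractions V W" "\<forall>w\<in>W. a w = 0" "x = frac_class V Z W a b"
      using mE[OF xy(1)] by blast
    obtain c d where y: "(c, d) \<in> fractions V W" "\<forall>w\<in>W. c w = 0" "y = frac_class V Z W c d"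
      using mE[OF xy(2)] by blast
    show ?thesis unfolding x(3) y(3) local_ring_add[OF pp x(1) y(1)]
        frac_class_max_ideal[OF pp fractions_add[OF pp x(1) y(1)]] using x(2) y(2) by simp
  qed
  ultimately have "subgroup ?m (add_monoid ?R)"
    using car by (intro R.add.subgroupI) auto
  moreover have "x \<otimes>\<^bsub>?R\<^esub> y \<in> ?m" "y \<otimes>\<^bsub>?R\<^esub> x \<in> ?m" if xy: "x \<in> ?m" "y \<in> carrier ?R" for x y
  proof -
    obtain a b where x: "(a, b) \<in> fractions V W" "\<forall>w\<in>W. a w = 0" "x = frac_class V Z W a b"
      using mE[OF xy(1)] by blast
    obtain c d where y: "(c, d) \<in> fractions V W" "y = frac_class V Z W c d"
      using xy(2) by (elim local_ring_carrierE)
    show "x \<otimes>\<^bsub>?R\<^esub> y \<in> ?m" unfolding x(3) y(2) local_ring_mult[OF pp x(1) y(1)]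
        frac_class_max_ideal[OF pp fractions_mult[OF pp x(1) y(1)]] using x(2) by simp
    show "y \<otimes>\<^bsub>?R\<^esub> x \<in> ?m" unfolding x(3) y(2) local_ring_mult[OF pp y(1) x(1)]
        frac_class_max_ideal[OF pp fractions_mult[OF pp y(1) x(1)]] using x(2) by simp
  qed
  ultimately show ?thesis by (intro idealI R.ring_axioms) auto
qed

text \<open>\<open>f\<close> generates the maximal ideal of the local ring of \<open>Z\<close> along \<open>W\<close>.\<close>

definition uniformizer :: "'a variety \<Rightarrow> ('a \<Rightarrow> complex) \<Rightarrow> 'a set \<Rightarrow> 'a set \<Rightarrow> bool" where
  "uniformizer V f Z W \<longleftrightarrow> (\<forall>h\<in>coord_ring V. (\<forall>w\<in>W. h w = 0) \<longrightarrow>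
     (\<exists>d\<in>coord_ring V. \<exists>a\<in>coord_ring V. (\<exists>w\<in>W. d w \<noteq> 0) \<and> (\<forall>z\<in>Z. d z * h z = a z * f z)))"

text \<open>An element outside the maximal ideal is a unit, and \<open>f\<close> generates the maximal ideal.\<close>

lemma ideals_above_uniformizer:
  assumes pp: "prime_pair V Z W" and f: "f \<in> coord_ring V" and u: "uniformizer V f Z W"
    and J: "ideal J (local_ring V Z W)" "frac_class V Z W f (\<lambda>_. 1) \<in> J"
  shows "J = max_ideal V Z W \<or> J = carrier (local_ring V Z W)"
proof (cases "J \<subseteq> max_ideal V Z W")
  case True
  interpret ideal J "local_ring V Z W" by (rule J(1))
  have "max_ideal V Z W \<subseteq> J"
  proof
    fix x assume "x \<in> max_ideal V Z W"
    then obtain a b where x: "(a, b) \<in> fractions V W" "\<forall>w\<in>W. a w = 0" "x = frac_class V Z W a b"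
      unfolding max_ideal_def by blast
    have ab: "a \<in> coord_ring V" "b \<in> coord_ring V" "\<exists>w\<in>W. b w \<noteq> 0" using x(1) unfolding fractions_iff by auto
    obtain d h where d: "d \<in> coord_ring V" "h \<in> coord_ring V" "\<exists>w\<in>W. d w \<noteq> 0" "\<forall>z\<in>Z. d z * a z = h z * f z"
      using u ab(1) x(2) unfolding uniformizer_def by blast
    have F1: "(f, \<lambda>_. 1) \<in> fractions V W" by (rule fractions_one[OF pp f])
    have "prime_on W (coord_ring V)" using pp unfolding prime_pair_def by blast
    then have F2: "(h, \<lambda>p. d p * b p) \<in> fractions V W"
      using prime_on_mult[of W "coord_ring V" d b] d ab unfolding fractions_iff by (auto intro: coord_ring.mult)
    have "x = frac_class V Z W f (\<lambda>_. 1) \<otimes>\<^bsub>local_ring V Z W\<^esub> frac_class V Z W h (\<lambda>p. d p * b p)"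
      unfolding x(3) local_ring_mult[OF pp F1 F2] frac_class_eq[OF pp x(1) fractions_mult[OF pp F1 F2]]
    proof
      fix z assume "z \<in> Z"
      then have "d z * a z = h z * f z" using d(4) by blast
      then show "a z * (1 * (d z * b z)) = f z * h z * b z" by (simp add: ac_simps)
    qed
    then show "x \<in> J" using I_r_closed[OF J(2) local_ring_carrierI[OF F2]] by simp
  qed
  then show ?thesis using True by blast
next
  case False
  interpret ideal J "local_ring V Z W" by (rule J(1))
  obtain x where x: "x \<in> J" "x \<notin> max_ideal V Z W" using False by blast
  then obtain a b where ab: "(a, b) \<in> fractions V W" "x = frac_class V Z W a b"
    using a_subset by (meson local_ring_carrierE subsetD)
  then have "\<exists>w\<in>W. a w \<noteq> 0" using x(2) frac_class_max_ideal[OF pp ab(1)] by blast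
  then have ba: "(b, a) \<in> fractions V W" using ab(1) unfolding fractions_iff by blast
  have "x \<otimes>\<^bsub>local_ring V Z W\<^esub> frac_class V Z W b a = \<one>\<^bsub>local_ring V Z W\<^esub>"
    unfolding ab(2) local_ring_mult[OF pp ab(1) ba] local_ring_one
    by (subst frac_class_eq[OF pp fractions_mult[OF pp ab(1) ba] fractions_one[OF pp coord_ring_1]]) auto
  then have "\<one>\<^bsub>local_ring V Z W\<^esub> \<in> J" using I_r_closed[OF x(1) local_ring_carrierI[OF ba]] by simp
  then show ?thesis using one_imp_carrier by blast
qed

lemma divisor_mult_uniformizer:
  assumes pp: "prime_pair V Z W" and f: "f \<in> coord_ring V" and fW: "\<And>w. w \<in> W \<Longrightarrow> f w = 0"
    and u: "uniformizer V f Z W"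
  shows "divisor_mult V f Z W = 1"
proof -
  let ?R = "local_ring V Z W" and ?m = "max_ideal V Z W" and ?f = "frac_class V Z W f (\<lambda>_. 1)"
  let ?S = "{k. \<exists>J. (\<forall>i\<le>k. ideal (J i) ?R) \<and> (\<forall>i<k. J i \<subset> J (Suc i)) \<and> ?f \<in> J (0::nat)}"
  interpret R: ring ?R by (rule ring_local_ring[OF pp])
  have m: "ideal ?m ?R" by (rule ideal_max_ideal[OF pp])
  have fm: "?f \<in> ?m" using frac_class_max_ideal[OF pp fractions_one[OF pp f]] fW by blast
  have "\<one>\<^bsub>?R\<^esub> \<notin> ?m"
    unfolding local_ring_one frac_class_max_ideal[OF pp fractions_one[OF pp coord_ring_1]]
    using pp unfolding prime_pair_def prime_on_def by auto
  then have proper: "?m \<subset> carrier ?R"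
    using additive_subgroup.a_subset[OF ideal.axioms(1)[OF m]] R.one_closed by blast
  have "1 \<in> ?S"
  proof (intro CollectI exI[of _ "\<lambda>i::nat. if i = 0 then ?m else carrier ?R"] conjI allI impI)
    fix i :: nat show "ideal (if i = 0 then ?m else carrier ?R) ?R"
      using m R.oneideal by simp
  qed (use proper fm in auto)
  moreover have "k \<le> 1" if k: "k \<in> ?S" for k
  proof (rule ccontr)
    assume "\<not> k \<le> 1"
    obtain J where J: "\<forall>i\<le>k. ideal (J i) ?R" "\<forall>i<k. J i \<subset> J (Suc i)" "?f \<in> J (0::nat)" using k by blast
    have s: "J 0 \<subset> J 1" "J 1 \<subset> J 2" using J(2) \<open>\<not> k \<le> 1\<close> by (auto simp: numeral_2_eq_2)
    have i: "ideal (J 0) ?R" "ideal (J 1) ?R" "ideal (J 2) ?R" using J(1) \<open>\<not> k \<le> 1\<close> by auto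
    have "J 0 = ?m \<or> J 0 = carrier ?R" "J 1 = ?m \<or> J 1 = carrier ?R" "J 2 = ?m \<or> J 2 = carrier ?R"
      using ideals_above_uniformizer[OF pp f u] i J(3) s by blast+
    then show False using s proper by auto
  qed
  ultimately have "Sup ?S = 1" by (rule cSup_eq_maximum)
  then show ?thesis unfolding divisor_mult_def .
qed

lemma lookup_scale [simp]: "Poly_Mapping.lookup (scale q z) W = q * Poly_Mapping.lookup z W"
  unfolding scale_def by (simp add: Poly_Mapping.map.rep_eq when_def)

lemma scale_0_left [simp]: "scale 0 z = 0"
  by (rule poly_mapping_eqI) simp

lemma scale_1 [simp]: "scale 1 z = z"
  by (rule poly_mapping_eqI) simp

lemma scale_0_right [simp]: "scale q 0 = 0"
  by (rule poly_mapping_eqI) simp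

lemma scale_scale [simp]: "scale q (scale r z) = scale (q * r) z"
  by (rule poly_mapping_eqI) (simp add: mult.assoc)

lemma scale_add: "scale q (y + z) = scale q y + scale q z"
  by (rule poly_mapping_eqI) (simp add: lookup_add distrib_left)

lemma scale_add_left: "scale (q + r) z = scale q z + scale r z"
  by (rule poly_mapping_eqI) (simp add: lookup_add distrib_right)

lemma scale_diff: "scale q (y - z) = scale q y - scale q z"
  by (rule poly_mapping_eqI) (simp add: lookup_minus right_diff_distrib)

lemma scale_sum: "scale q (\<Sum>i\<in>I. z i) = (\<Sum>i\<in>I. scale q (z i))"
  by (induction I rule: infinite_finite_induct) (auto simp: scale_add)

lemma lookup_lin_ext:
  assumes "finite A" "Poly_Mapping.keys z \<subseteq> A"
  shows "Poly_Mapping.lookup (lin_ext f z) W =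
    (\<Sum>Z\<in>A. Poly_Mapping.lookup z Z * Poly_Mapping.lookup (f Z) W)"
proof -
  have "Poly_Mapping.lookup (lin_ext f z) W =
      (\<Sum>Z\<in>Poly_Mapping.keys z. Poly_Mapping.lookup z Z * Poly_Mapping.lookup (f Z) W)"
    unfolding lin_ext_def by (simp add: lookup_sum)
  also have "\<dots> = (\<Sum>Z\<in>A. Poly_Mapping.lookup z Z * Poly_Mapping.lookup (f Z) W)"
    by (rule sum.mono_neutral_left[OF assms]) (simp add: in_keys_iff)
  finally show ?thesis .
qed

lemma lin_ext_0 [simp]: "lin_ext f 0 = 0"
  unfolding lin_ext_def by simp

lemma lin_ext_add: "lin_ext f (y + z) = lin_ext f y + lin_ext f z"
proof (rule poly_mapping_eqI)
  fix W
  let ?A = "Poly_Mapping.keys y \<union> Poly_Mapping.keys z"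
  have "Poly_Mapping.keys (y + z) \<subseteq> ?A" by (rule keys_add)
  then show "Poly_Mapping.lookup (lin_ext f (y + z)) W = Poly_Mapping.lookup (lin_ext f y + lin_ext f z) W"
    by (simp add: lookup_add lookup_lin_ext[of ?A] sum.distrib distrib_right)
qed

lemma lin_ext_scale: "lin_ext f (scale q z) = scale q (lin_ext f z)"
proof (rule poly_mapping_eqI)
  fix W
  have "Poly_Mapping.keys (scale q z) \<subseteq> Poly_Mapping.keys z" by (auto simp: in_keys_iff)
  then show "Poly_Mapping.lookup (lin_ext f (scale q z)) W = Poly_Mapping.lookup (scale q (lin_ext f z)) W"
    by (simp add: lookup_lin_ext[of "Poly_Mapping.keys z"] sum_distrib_left mult.assoc)
qed

lemma lin_ext_sum: "lin_ext f (\<Sum>i\<in>I. z i) = (\<Sum>i\<in>I. lin_ext f (z i))"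
  by (induction I rule: infinite_finite_induct) (auto simp: lin_ext_add)

lemma lin_ext_single: "lin_ext f (Poly_Mapping.single Z 1) = f Z"
  unfolding lin_ext_def by simp

lemma image_cycle_single: "image_cycle g (Poly_Mapping.single Z 1) = Poly_Mapping.single (g ` Z) 1"
  unfolding image_cycle_def lin_ext_single ..

lemma lin_ext_diff: "lin_ext f (y - z) = lin_ext f y - lin_ext f z"
  using lin_ext_add[of f "y - z" z] by (simp add: algebra_simps)

lemmas image_cycle_linear = lin_ext_0 [of "\<lambda>Z. Poly_Mapping.single (g ` Z) 1" for g, folded image_cycle_def]
  lin_ext_add [of "\<lambda>Z. Poly_Mapping.single (g ` Z) 1" for g, folded image_cycle_def]
  lin_ext_diff [of "\<lambda>Z. Poly_Mapping.single (g ` Z) 1" for g, folded image_cycle_def]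
  lin_ext_scale [of "\<lambda>Z. Poly_Mapping.single (g ` Z) 1" for g, folded image_cycle_def]
  lin_ext_sum [of "\<lambda>Z. Poly_Mapping.single (g ` Z) 1" for g, folded image_cycle_def]

text \<open>A subvariety that does not meet a face contributes the zero cycle.\<close>

definition set_cycle :: "'a set \<Rightarrow> 'a cycle" where
  "set_cycle W = (if W = {} then 0 else Poly_Mapping.single W 1)"

lemma image_cycle_set_cycle: "image_cycle g (set_cycle W) = set_cycle (g ` W)"
  unfolding set_cycle_def by (simp add: image_cycle_single image_cycle_linear)

text \<open>The divisor of \<open>f\<close> on \<open>Z\<close> is \<open>W\<close> with multiplicity one, and zero if \<open>W\<close> is empty.\<close>

definition simple_cut :: "'a variety \<Rightarrow> ('a \<Rightarrow> complex) \<Rightarrow> 'a set \<Rightarrow> 'a set \<Rightarrow> bool" where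
  "simple_cut V f Z W \<longleftrightarrow> W = {z \<in> Z. f z = 0} \<and>
     (W = {} \<or> irreducible_closed (zariski V) W \<and> uniformizer V f Z W)"

lemma prime_pairI:
  assumes "irreducible_closed (zariski V) Z" "irreducible_closed (zariski V) W" "W \<subseteq> Z"
  shows "prime_pair V Z W"
  using irreducible_prime_on[of V "points V" Z] irreducible_prime_on[of V "points V" W] assms
  unfolding prime_pair_def subtopology_zariski_points by blast

lemma cut_by_simple:
  assumes Z: "irreducible_closed (zariski V) Z" and f: "f \<in> coord_ring V" and cut: "simple_cut V f Z W"
  shows "cut_by V f (Poly_Mapping.single Z 1) = set_cycle W"
proof (cases "W = {}")
  case True
  then show ?thesis
    using cut unfolding cut_by_def lin_ext_single simple_cut_def set_cycle_def by (metis irr_components_empty sum.empty)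
next
  case False
  then have W: "W = {z \<in> Z. f z = 0}" "irreducible_closed (zariski V) W" "uniformizer V f Z W"
    using cut unfolding simple_cut_def by auto
  have "W \<subseteq> Z" using W(1) by blast
  have "divisor_mult V f Z W = 1"
    by (rule divisor_mult_uniformizer[OF prime_pairI[OF Z W(2) \<open>W \<subseteq> Z\<close>] f _ W(3)]) (use W(1) in blast)
  then show ?thesis
    using False unfolding cut_by_def lin_ext_single W(1)[symmetric] irr_components_irreducible[OF W(2)] set_cycle_def
    by simp
qed

section \<open>Transport along isomorphisms\<close>

lemma irreducible_closed_homeomorphic:
  assumes h: "homeomorphic_maps T T' f g" and C: "irreducible_closed T C"
  shows "irreducible_closed T' (f ` C)"
proof -
  have h': "homeomorphic_maps T' T g f" using h homeomorphic_maps_sym by blast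
  have cl: "closedin T C" and ne: "C \<noteq> {}" using C unfolding irreducible_closed_def by auto
  have CT: "C \<subseteq> topspace T" using cl closedin_subset by blast
  have gf: "g (f x) = x" if "x \<in> topspace T" for x using h that unfolding homeomorphic_maps_def by blast
  have fg: "f (g y) = y" if "y \<in> topspace T'" for y using h that unfolding homeomorphic_maps_def by blast
  show ?thesis unfolding irreducible_closed_def
  proof (intro conjI allI impI)
    show "closedin T' (f ` C)"
      using homeomorphic_map_closedness[OF homeomorphic_maps_imp_map[OF h] CT] cl by blast
    show "f ` C \<noteq> {}" using ne by blast
    fix D E assume DE: "closedin T' D \<and> closedin T' E \<and> f ` C \<subseteq> D \<union> E"
    have cl': "closedin T (g ` D)" "closedin T (g ` E)"
      using homeomorphic_map_closedness[OF homeomorphic_maps_imp_map[OF h']] DE closedin_subset by blast+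
    have "C \<subseteq> g ` D \<union> g ` E"
    proof
      fix x assume x: "x \<in> C"
      then have "f x \<in> D \<or> f x \<in> E" using DE by blast
      moreover have "x = g (f x)" using gf x CT by auto
      ultimately show "x \<in> g ` D \<union> g ` E" by (metis UnCI imageI)
    qed
    then have "C \<subseteq> g ` D \<or> C \<subseteq> g ` E" using C cl' unfolding irreducible_closed_def by blast
    moreover have "D \<subseteq> topspace T'" "E \<subseteq> topspace T'" using DE closedin_subset by blast+
    ultimately show "f ` C \<subseteq> D \<or> f ` C \<subseteq> E" using fg by (auto simp: subset_iff image_iff)
  qed
qed

lemma irr_chain_homeomorphic:
  assumes h: "homeomorphic_maps T T' f g" and C: "irr_chain T n C"
  shows "irr_chain T' n (\<lambda>i. f ` C i)"
  unfolding irr_chain_def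
proof (intro conjI allI impI)
  have gf: "g (f x) = x" if "x \<in> topspace T" for x using h that unfolding homeomorphic_maps_def by blast
  have irr: "irreducible_closed T (C i)" if "i \<le> n" for i
    using C that unfolding irr_chain_def by simp
  have CT: "C i \<subseteq> topspace T" if "i \<le> n" for i
    using irr[OF that] closedin_subset[of T "C i"] unfolding irreducible_closed_def by simp
  show "irreducible_closed T' (f ` C i)" if "i \<le> n" for i
    by (rule irreducible_closed_homeomorphic[OF h irr[OF that]])
  fix i assume i: "i < n"
  have inj: "inj_on f (topspace T)" using gf by (rule inj_on_inverseI)
  have sub: "C i \<subset> C (Suc i)" using C i unfolding irr_chain_def by simp
  have "C i \<subseteq> topspace T" "C (Suc i) \<subseteq> topspace T" using CT[of i] CT[of "Suc i"] i by auto
  then have "f ` C i \<noteq> f ` C (Suc i)"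
    using inj_on_image_eq_iff[OF inj, of "C i" "C (Suc i)"] sub by simp
  moreover have "f ` C i \<subseteq> f ` C (Suc i)" by (rule image_mono) (use sub in blast)
  ultimately show "f ` C i \<subset> f ` C (Suc i)" by simp
qed

lemma krull_dim_homeomorphic_le:
  assumes h: "homeomorphic_maps T T' f g"
  shows "krull_dim T \<le> krull_dim T'"
  unfolding krull_dim_def
proof (rule Sup_subset_mono, rule subsetI)
  fix x assume "x \<in> {enat n | n. \<exists>C. irr_chain T n C}"
  then obtain n C where x: "x = enat n" "irr_chain T n C" by blast
  have "irr_chain T' n (\<lambda>i. f ` C i)" by (rule irr_chain_homeomorphic[OF h x(2)])
  then show "x \<in> {enat n | n. \<exists>C. irr_chain T' n C}" using x(1) by blast
qed

lemma krull_dim_homeomorphic: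
  assumes h: "homeomorphic_maps T T' f g"
  shows "krull_dim T = krull_dim T'"
  using krull_dim_homeomorphic_le[OF h] krull_dim_homeomorphic_le[of T' T g f] h homeomorphic_maps_sym
  by (metis antisym)

lemma has_pure_dim_homeomorphic:
  assumes h: "homeomorphic_maps T T' f g" and r: "has_pure_dim T r"
  shows "has_pure_dim T' r"
  unfolding has_pure_dim_def
proof
  have h': "homeomorphic_maps T' T g f" using h homeomorphic_maps_sym by blast
  have gf: "g (f x) = x" if "x \<in> topspace T" for x using h that unfolding homeomorphic_maps_def by blast
  have fg: "f (g y) = y" if "y \<in> topspace T'" for y using h that unfolding homeomorphic_maps_def by blast
  have sub: "C \<subseteq> topspace S" if "irreducible_closed S C" for S :: "'c topology" and C
    using that closedin_subset unfolding irreducible_closed_def by blast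
  fix C' assume C': "C' \<in> irr_components T' (topspace T')"
  then have irr': "irreducible_closed T' C'" unfolding irr_components_def by blast
  have irr: "irreducible_closed T (g ` C')" by (rule irreducible_closed_homeomorphic[OF h' irr'])
  have C'T: "C' \<subseteq> topspace T'" using closedin_subset irr' unfolding irreducible_closed_def by blast
  have gCT: "g ` C' \<subseteq> topspace T" using closedin_subset irr unfolding irreducible_closed_def by blast
  have fgC: "f ` g ` C' = C'" using C'T fg by (force simp: image_iff subset_iff)
  have "g ` C' \<in> irr_components T (topspace T)"
    unfolding irr_components_def
  proof (intro CollectI conjI allI impI irr gCT)
    fix D assume D: "irreducible_closed T D \<and> g ` C' \<subseteq> D \<and> D \<subseteq> topspace T"
    have "irreducible_closed T' (f ` D)" using irreducible_closed_homeomorphic[OF h] D by blast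
    moreover have "C' \<subseteq> f ` D" using D fgC by blast
    moreover have "f ` D \<subseteq> topspace T'"
      using closedin_subset \<open>irreducible_closed T' (f ` D)\<close> unfolding irreducible_closed_def by blast
    ultimately have "f ` D = C'" using C' unfolding irr_components_def by blast
    then have "g ` f ` D = g ` C'" by simp
    moreover have "g ` f ` D = D" using D gf by (force simp: image_iff subset_iff)
    ultimately show "D = g ` C'" by simp
  qed
  then obtain d where d: "krull_dim (subtopology T (g ` C')) = enat d" "int d = r"
    using r unfolding has_pure_dim_def by blast
  have "homeomorphic_maps (subtopology T (g ` C')) (subtopology T' C') f g"
  proof (rule homeomorphic_maps_subtopologies[OF h])
    have "topspace T \<inter> g ` C' = g ` C'" "topspace T' \<inter> C' = C'" using gCT C'T by blast+
    then show "f ` (topspace T \<inter> g ` C') = topspace T' \<inter> C'" using fgC by simp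
  qed
  then show "\<exists>d. krull_dim (subtopology T' C') = enat d \<and> int d = r"
    using krull_dim_homeomorphic d by metis
qed

definition variety_iso :: "'a variety \<Rightarrow> 'b variety \<Rightarrow> ('a \<Rightarrow> 'b) \<Rightarrow> ('b \<Rightarrow> 'a) \<Rightarrow> bool" where
  "variety_iso V W \<Phi> \<Psi> \<longleftrightarrow>
     (\<forall>p\<in>points V. \<Phi> p \<in> points W \<and> \<Psi> (\<Phi> p) = p) \<and> (\<forall>q\<in>points W. \<Psi> q \<in> points V \<and> \<Phi> (\<Psi> q) = q) \<and>
     (\<forall>f\<in>coord_ring W. \<exists>f'\<in>coord_ring V. \<forall>p\<in>points V. f' p = f (\<Phi> p)) \<and>
     (\<forall>f\<in>coord_ring V. \<exists>f'\<in>coord_ring W. \<forall>q\<in>points W. f' q = f (\<Psi> q))"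

lemma pullback_coord_ring:
  assumes gen: "\<And>f. f \<in> gens W \<Longrightarrow> \<exists>f'\<in>coord_ring V. \<forall>p\<in>points V. f' p = f (\<Phi> p)"
    and f: "f \<in> coord_ring W"
  shows "\<exists>f'\<in>coord_ring V. \<forall>p\<in>points V. f' p = f (\<Phi> p)"
  using f
proof induction
  case (const q)
  show ?case by (rule bexI[OF _ coord_ring.const[of q]]) simp
next
  case (gen f)
  then show ?case using assms(1) by blast
next
  case (add f g)
  then obtain f' g' where "f' \<in> coord_ring V" "\<forall>p\<in>points V. f' p = f (\<Phi> p)"
    "g' \<in> coord_ring V" "\<forall>p\<in>points V. g' p = g (\<Phi> p)" by blast
  then show ?case by (intro bexI[of _ "\<lambda>p. f' p + g' p"]) (auto intro: coord_ring.add)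
next
  case (mult f g)
  then obtain f' g' where "f' \<in> coord_ring V" "\<forall>p\<in>points V. f' p = f (\<Phi> p)"
    "g' \<in> coord_ring V" "\<forall>p\<in>points V. g' p = g (\<Phi> p)" by blast
  then show ?case by (intro bexI[of _ "\<lambda>p. f' p * g' p"]) (auto intro: coord_ring.mult)
qed

lemma continuous_map_zariski:
  assumes pts: "\<And>p. p \<in> points V \<Longrightarrow> \<Phi> p \<in> points W"
    and pull: "\<And>f. f \<in> coord_ring W \<Longrightarrow> \<exists>f'\<in>coord_ring V. \<forall>p\<in>points V. f' p = f (\<Phi> p)"
  shows "continuous_map (zariski V) (zariski W) \<Phi>"
  unfolding continuous_map_def
proof (intro conjI allI impI)
  show "\<Phi> \<in> topspace (zariski V) \<rightarrow> topspace (zariski W)" using pts by auto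
  fix U assume U: "openin (zariski W) U"
  show "openin (zariski V) {x \<in> topspace (zariski V). \<Phi> x \<in> U}"
    unfolding openin_zariski
  proof (intro conjI ballI)
    fix p assume p: "p \<in> {x \<in> topspace (zariski V). \<Phi> x \<in> U}"
    then obtain f where f: "f \<in> coord_ring W" "f (\<Phi> p) \<noteq> 0" "{q \<in> points W. f q \<noteq> 0} \<subseteq> U"
      using U unfolding openin_zariski by blast
    obtain f' where f': "f' \<in> coord_ring V" "\<forall>p\<in>points V. f' p = f (\<Phi> p)" using pull[OF f(1)] by blast
    show "\<exists>f\<in>coord_ring V. f p \<noteq> 0 \<and> {q \<in> points V. f q \<noteq> 0} \<subseteq> {x \<in> topspace (zariski V). \<Phi> x \<in> U}"
      by (rule bexI[OF _ f'(1)]) (use p f f'(2) pts in auto)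
  qed auto
qed

lemma variety_iso_homeomorphic:
  assumes "variety_iso V W \<Phi> \<Psi>" shows "homeomorphic_maps (zariski V) (zariski W) \<Phi> \<Psi>"
  using assms unfolding homeomorphic_maps_def variety_iso_def topspace_zariski
  by (intro conjI continuous_map_zariski) blast+

lemma simple_cut_transport:
  assumes iso: "variety_iso V V' \<Phi> \<Psi>" and Z: "Z \<subseteq> points V" and cut: "simple_cut V f Z W"
    and f': "\<And>p. p \<in> points V \<Longrightarrow> f' (\<Phi> p) = f p"
  shows "simple_cut V' f' (\<Phi> ` Z) (\<Phi> ` W)"
  unfolding simple_cut_def
proof (intro conjI)
  have W: "W = {z \<in> Z. f z = 0}" using cut unfolding simple_cut_def by blast
  show eq: "\<Phi> ` W = {z \<in> \<Phi> ` Z. f' z = 0}" using W f' Z by auto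
  show "\<Phi> ` W = {} \<or> irreducible_closed (zariski V') (\<Phi> ` W) \<and> uniformizer V' f' (\<Phi> ` Z) (\<Phi> ` W)"
  proof (cases "W = {}")
    case False
    then have irr: "irreducible_closed (zariski V) W" and u: "uniformizer V f Z W"
      using cut unfolding simple_cut_def by auto
    have WV: "W \<subseteq> points V" using W Z by blast
    have \<Psi>\<Phi>: "\<Psi> (\<Phi> p) = p" and pt: "\<Phi> p \<in> points V'" if "p \<in> points V" for p
      using iso that unfolding variety_iso_def by blast+
    have "uniformizer V' f' (\<Phi> ` Z) (\<Phi> ` W)"
      unfolding uniformizer_def
    proof (intro ballI impI)
      fix h assume h: "h \<in> coord_ring V'" "\<forall>w\<in>\<Phi> ` W. h w = 0"
      obtain h0 where h0: "h0 \<in> coord_ring V" "\<forall>p\<in>points V. h0 p = h (\<Phi> p)"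
        using iso h(1) unfolding variety_iso_def by blast
      have "\<forall>w\<in>W. h0 w = 0" using h(2) h0(2) WV by auto
      then obtain d a w where d: "d \<in> coord_ring V" "a \<in> coord_ring V" "w \<in> W" "d w \<noteq> 0" "\<forall>z\<in>Z. d z * h0 z = a z * f z"
        using u h0(1) unfolding uniformizer_def by blast
      obtain d' where d': "d' \<in> coord_ring V'" "\<forall>q\<in>points V'. d' q = d (\<Psi> q)"
        using iso d(1) unfolding variety_iso_def by blast
      obtain a' where a': "a' \<in> coord_ring V'" "\<forall>q\<in>points V'. a' q = a (\<Psi> q)"
        using iso d(2) unfolding variety_iso_def by blast
      show "\<exists>d\<in>coord_ring V'. \<exists>a\<in>coord_ring V'. (\<exists>w\<in>\<Phi> ` W. d w \<noteq> 0) \<and> (\<forall>z\<in>\<Phi> ` Z. d z * h z = a z * f' z)"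
      proof (rule bexI[OF _ d'(1)], rule bexI[OF _ a'(1)], intro conjI ballI)
        have wV: "w \<in> points V" using d(3) WV by blast
        have "d' (\<Phi> w) = d w" using d'(2) pt[OF wV] \<Psi>\<Phi>[OF wV] by simp
        then show "\<exists>w\<in>\<Phi> ` W. d' w \<noteq> 0" using d(3,4) by force
        fix q assume "q \<in> \<Phi> ` Z"
        then obtain z where z: "z \<in> Z" "q = \<Phi> z" by blast
        then have zV: "z \<in> points V" using Z by blast
        have "d' q = d z" "a' q = a z" "h q = h0 z" "f' q = f z"
          using d'(2) a'(2) h0(2) f'[OF zV] pt[OF zV] \<Psi>\<Phi>[OF zV] z(2) zV by auto
        then show "d' q * h q = a' q * f' q" using d(5) z(1) by simp
      qed
    qed
    then show ?thesis using irreducible_closed_homeomorphic[OF variety_iso_homeomorphic[OF iso] irr] by blast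
  qed simp
qed

section \<open>The action on the cube and alternating cycles\<close>

lemma points_prod [simp]: "points (V \<times>\<^sub>V W) = points V \<times> points W"
  unfolding prod_variety_def by simp

lemma points_cube: "us \<in> points (cube n) \<longleftrightarrow> length us = n \<and> Fin 1 \<notin> set us"
  unfolding cube_def by simp

lemma coord_ring_fst: "f \<in> coord_ring V \<Longrightarrow> (\<lambda>z. f (fst z)) \<in> coord_ring (V \<times>\<^sub>V W)"
proof (induction rule: coord_ring.induct)
  case (gen f)
  then show ?case by (intro coord_ring.gen) (auto simp: prod_variety_def comp_def)
qed (auto intro: coord_ring.intros)

lemma coord_ring_snd: "f \<in> coord_ring W \<Longrightarrow> (\<lambda>z. f (snd z)) \<in> coord_ring (V \<times>\<^sub>V W)"
proof (induction rule: coord_ring.induct)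
  case (gen f)
  then show ?case by (intro coord_ring.gen) (auto simp: prod_variety_def comp_def)
qed (auto intro: coord_ring.intros)

text \<open>These coordinates identify \<open>\<box>\<^sup>n\<close> with affine space; \<open>u\<^sub>i = 0\<close> becomes \<open>c\<^sub>i = 1\<close> and \<open>u\<^sub>i = \<infinity>\<close> becomes
  \<open>c\<^sub>i = 0\<close>.\<close>

definition cc :: "nat \<Rightarrow> 'b \<times> p1 list \<Rightarrow> complex" where
  "cc i z = cube_coord (snd z ! i)"

lemma cc_coord_ring: "i < n \<Longrightarrow> cc i \<in> coord_ring (B \<times>\<^sub>V cube n)"
proof -
  assume "i < n"
  then have "(\<lambda>us. cube_coord (us ! i)) \<in> coord_ring (cube n)"
    by (intro coord_ring.gen) (auto simp: cube_def)
  from coord_ring_snd[OF this] show ?thesis unfolding cc_def[abs_def] .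
qed

lemma gens_prod_cube:
  "f \<in> gens (B \<times>\<^sub>V cube n) \<longleftrightarrow> (\<exists>g\<in>gens B. f = (\<lambda>z. g (fst z))) \<or> (\<exists>i<n. f = cc i)"
  unfolding prod_variety_def cube_def cc_def[abs_def] by (auto simp: comp_def)

lemma p1_inverse_involutive [simp]: "p1_inverse (p1_inverse u) = u"
  by (cases u) auto

lemma p1_inverse_eq_1 [simp]: "p1_inverse u = Fin 1 \<longleftrightarrow> u = Fin 1"
  by (cases u) (auto simp: field_simps)

lemma cube_coord_inverse: "u \<noteq> Fin 1 \<Longrightarrow> cube_coord (p1_inverse u) = 1 - cube_coord u"
  by (cases u) (auto simp: field_simps)

lemma length_cube_action [simp]: "length (snd (cube_action n e \<sigma> z)) = n"
  unfolding cube_action_def by (cases z) simp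

lemma fst_cube_action [simp]: "fst (cube_action n e \<sigma> z) = fst z"
  unfolding cube_action_def by (cases z) simp

lemma nth_cube_action:
  "i < n \<Longrightarrow> snd (cube_action n e \<sigma> z) ! i = (if i \<in> e then p1_inverse (snd z ! \<sigma> i) else snd z ! \<sigma> i)"
  unfolding cube_action_def by (cases z) simp

lemma prod_list_eqI:
  assumes "fst z = fst w" "length (snd z) = length (snd w)" "\<And>i. i < length (snd z) \<Longrightarrow> snd z ! i = snd w ! i"
  shows "z = w"
  using assms by (auto simp: prod_eq_iff intro: nth_equalityI)

lemma cube_action_comp:
  assumes "\<sigma> permutes {..<n}"
  shows "cube_action n e \<sigma> (cube_action n e' \<sigma>' z) =
    cube_action n ((e - {i. \<sigma> i \<in> e'}) \<union> ({i. i < n \<and> \<sigma> i \<in> e'} - e)) (\<sigma>' \<circ> \<sigma>) z"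
proof (rule prod_list_eqI)
  fix i assume "i < length (snd (cube_action n e \<sigma> (cube_action n e' \<sigma>' z)))"
  then have i: "i < n" "\<sigma> i < n" using permutes_in_image[OF assms, of i] by auto
  then show "snd (cube_action n e \<sigma> (cube_action n e' \<sigma>' z)) ! i =
    snd (cube_action n ((e - {i. \<sigma> i \<in> e'}) \<union> ({i. i < n \<and> \<sigma> i \<in> e'} - e)) (\<sigma>' \<circ> \<sigma>) z) ! i"
    by (simp add: nth_cube_action)
qed auto

lemma cube_action_id:
  assumes "z \<in> points (B \<times>\<^sub>V cube n)" shows "cube_action n {} id z = z"
  by (rule prod_list_eqI) (use assms in \<open>auto simp: nth_cube_action points_cube mem_Times_iff\<close>)

lemma nth_cube_points:
  assumes "z \<in> points (B \<times>\<^sub>V cube n)" "i < n" shows "snd z ! i \<noteq> Fin 1"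
proof -
  have "length (snd z) = n" "Fin 1 \<notin> set (snd z)" using assms(1) by (auto simp: points_cube mem_Times_iff)
  then show ?thesis using nth_mem[of i "snd z"] assms(2) by metis
qed

lemma cube_action_points:
  assumes "\<sigma> permutes {..<n}" "z \<in> points (B \<times>\<^sub>V cube n)"
  shows "cube_action n e \<sigma> z \<in> points (B \<times>\<^sub>V cube n)"
proof -
  have "snd z ! \<sigma> i \<noteq> Fin 1" if "i < n" for i
  proof -
    have "\<sigma> i < n" using permutes_in_image[OF assms(1), of i] that by auto
    then show ?thesis by (rule nth_cube_points[OF assms(2)])
  qed
  then have "Fin 1 \<notin> set (snd (cube_action n e \<sigma> z))"
    by (auto simp: in_set_conv_nth nth_cube_action split: if_splits)
  then show ?thesis using assms(2) by (auto simp: points_cube mem_Times_iff)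
qed

lemma cc_cube_action:
  assumes "\<sigma> permutes {..<n}" "z \<in> points (B \<times>\<^sub>V cube n)" "i < n"
  shows "cc i (cube_action n e \<sigma> z) = (if i \<in> e then 1 - cc (\<sigma> i) z else cc (\<sigma> i) z)"
proof -
  have "\<sigma> i < n" using permutes_in_image[OF assms(1), of i] assms(3) by auto
  then have "snd z ! \<sigma> i \<noteq> Fin 1" by (rule nth_cube_points[OF assms(2)])
  then show ?thesis using assms(3) by (simp add: cc_def nth_cube_action cube_coord_inverse)
qed

lemma cube_action_inverse:
  assumes "\<sigma> permutes {..<n}" "e \<subseteq> {..<n}" "z \<in> points (B \<times>\<^sub>V cube n)"
  shows "cube_action n {i. i < n \<and> inv_into UNIV \<sigma> i \<in> e} (inv_into UNIV \<sigma>) (cube_action n e \<sigma> z) = z"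
    "cube_action n e \<sigma> (cube_action n {i. i < n \<and> inv_into UNIV \<sigma> i \<in> e} (inv_into UNIV \<sigma>) z) = z"
proof -
  have bij: "bij \<sigma>" using assms(1) permutes_bij by blast
  have inv: "inv_into UNIV \<sigma> permutes {..<n}" using assms(1) by (rule permutes_inv)
  have \<sigma>n: "\<sigma> i < n" if "i < n" for i using permutes_in_image[OF assms(1), of i] that by auto
  have 1: "({i. i < n \<and> inv_into UNIV \<sigma> i \<in> e} - {i. inv_into UNIV \<sigma> i \<in> e}) \<union> ({i. i < n \<and> inv_into UNIV \<sigma> i \<in> e} - {i. i < n \<and> inv_into UNIV \<sigma> i \<in> e}) = {}"
    by auto
  have c1: "\<sigma> \<circ> inv_into UNIV \<sigma> = id" and c2: "inv_into UNIV \<sigma> \<circ> \<sigma> = id"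
    using bij by (auto simp: bij_def surj_iff inj_iff)
  have 2: "(e - {i. \<sigma> i \<in> {i. i < n \<and> inv_into UNIV \<sigma> i \<in> e}}) \<union> ({i. i < n \<and> \<sigma> i \<in> {i. i < n \<and> inv_into UNIV \<sigma> i \<in> e}} - e) = {}"
    using assms(2) \<sigma>n bij by (auto simp: bij_def)
  show "cube_action n {i. i < n \<and> inv_into UNIV \<sigma> i \<in> e} (inv_into UNIV \<sigma>) (cube_action n e \<sigma> z) = z"
    unfolding cube_action_comp[OF inv] 1 c1 by (rule cube_action_id[OF assms(3)])
  show "cube_action n e \<sigma> (cube_action n {i. i < n \<and> inv_into UNIV \<sigma> i \<in> e} (inv_into UNIV \<sigma>) z) = z"
    unfolding cube_action_comp[OF assms(1)] 2 c2 by (rule cube_action_id[OF assms(3)])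
qed

lemma cube_action_pullback:
  assumes "\<sigma> permutes {..<n}" "f \<in> coord_ring (B \<times>\<^sub>V cube n)"
  shows "\<exists>f'\<in>coord_ring (B \<times>\<^sub>V cube n). \<forall>p\<in>points (B \<times>\<^sub>V cube n). f' p = f (cube_action n e \<sigma> p)"
proof (rule pullback_coord_ring[OF _ assms(2)])
  fix f assume "f \<in> gens (B \<times>\<^sub>V cube n)"
  then consider g where "g \<in> gens B" "f = (\<lambda>z. g (fst z))" | i where "i < n" "f = cc i"
    unfolding gens_prod_cube by blast
  then show "\<exists>f'\<in>coord_ring (B \<times>\<^sub>V cube n). \<forall>p\<in>points (B \<times>\<^sub>V cube n). f' p = f (cube_action n e \<sigma> p)"
  proof cases
    case 1
    then have "f \<in> coord_ring (B \<times>\<^sub>V cube n)"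
      using coord_ring_fst[OF coord_ring.gen[OF 1(1)]] by simp
    then show ?thesis by (rule bexI[rotated]) (use 1(2) in simp)
  next
    case (2 i)
    have "\<sigma> i < n" using permutes_in_image[OF assms(1), of i] 2(1) by auto
    then have "cc (\<sigma> i) \<in> coord_ring (B \<times>\<^sub>V cube n)" by (rule cc_coord_ring)
    then have "(\<lambda>z. if i \<in> e then 1 - cc (\<sigma> i) z else cc (\<sigma> i) z) \<in> coord_ring (B \<times>\<^sub>V cube n)"
      by (cases "i \<in> e") (auto intro: coord_ring_diff coord_ring_1)
    then show ?thesis
      by (rule bexI[rotated]) (use cc_cube_action[OF assms(1) _ 2(1), of _ B e] 2(2) in simp)
  qed
qed

lemma variety_iso_cube_action:
  assumes \<sigma>: "\<sigma> permutes {..<n}" and e: "e \<subseteq> {..<n}"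
  shows "variety_iso (B \<times>\<^sub>V cube n) (B \<times>\<^sub>V cube n) (cube_action n e \<sigma>)
    (cube_action n {i. i < n \<and> inv_into UNIV \<sigma> i \<in> e} (inv_into UNIV \<sigma>))"
  unfolding variety_iso_def
proof (intro conjI ballI)
  have inv: "inv_into UNIV \<sigma> permutes {..<n}" using \<sigma> by (rule permutes_inv)
  show "cube_action n e \<sigma> p \<in> points (B \<times>\<^sub>V cube n)" if "p \<in> points (B \<times>\<^sub>V cube n)" for p
    by (rule cube_action_points[OF \<sigma> that])
  show "cube_action n {i. i < n \<and> inv_into UNIV \<sigma> i \<in> e} (inv_into UNIV \<sigma>) p \<in> points (B \<times>\<^sub>V cube n)"
    if "p \<in> points (B \<times>\<^sub>V cube n)" for p
    by (rule cube_action_points[OF inv that])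
qed (use cube_action_inverse[OF \<sigma> e] cube_action_pullback[OF \<sigma>] cube_action_pullback[OF permutes_inv[OF \<sigma>]] in \<open>blast+\<close>)

definition sgn_action :: "nat set \<Rightarrow> (nat \<Rightarrow> nat) \<Rightarrow> rat" where
  "sgn_action e \<sigma> = (- 1) ^ card e * of_int (sign \<sigma>)"

definition alt_sum :: "nat \<Rightarrow> ('b \<times> p1 list) cycle \<Rightarrow> ('b \<times> p1 list) cycle" where
  "alt_sum n z = (\<Sum>\<sigma> | \<sigma> permutes {..<n}. \<Sum>e \<in> Pow {..<n}.
     scale (sgn_action e \<sigma>) (image_cycle (cube_action n e \<sigma>) z))"

lemma Alt_eq_alt_sum: "Alt n z = scale (1 / (2 ^ n * fact n)) (alt_sum n z)"
  unfolding Alt_def alt_sum_def sgn_action_def by (subst sum.swap) (rule refl)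

lemma alt_sum_linear:
  "alt_sum n 0 = 0" "alt_sum n (y + z) = alt_sum n y + alt_sum n z"
  "alt_sum n (y - z) = alt_sum n y - alt_sum n z" "alt_sum n (scale q z) = scale q (alt_sum n z)"
  unfolding alt_sum_def
  by (simp_all add: image_cycle_linear scale_add scale_diff sum.distrib sum_subtractf scale_sum mult.commute)

lemma Alt_linear:
  "Alt n 0 = 0" "Alt n (y + z) = Alt n y + Alt n z"
  "Alt n (y - z) = Alt n y - Alt n z" "Alt n (scale q z) = scale q (Alt n z)"
  unfolding Alt_eq_alt_sum by (simp_all add: alt_sum_linear scale_add scale_diff mult.commute)

lemma Alt_sum: "Alt n (\<Sum>i\<in>I. z i) = (\<Sum>i\<in>I. Alt n (z i))"
  by (induction I rule: infinite_finite_induct) (auto simp: Alt_linear)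

lemma image_cycle_comp: "image_cycle g (image_cycle h z) = image_cycle (\<lambda>x. g (h x)) z"
  unfolding image_cycle_def lin_ext_def[of "\<lambda>Z. Poly_Mapping.single (h ` Z) 1" z] lin_ext_sum lin_ext_scale
    lin_ext_single lin_ext_def[of "\<lambda>Z. Poly_Mapping.single ((\<lambda>x. g (h x)) ` Z) 1" z]
  by (simp add: image_image)

lemma minus_one_power_symdiff:
  assumes "finite A" "finite B"
  shows "(- 1 :: rat) ^ card ((A - B) \<union> (B - A)) = (- 1) ^ card A * (- 1) ^ card B"
proof -
  have A: "card A = card (A - B) + card (A \<inter> B)" and B: "card B = card (B - A) + card (A \<inter> B)"
    using card_Int_Diff[OF assms(1), of B] card_Int_Diff[OF assms(2), of A] by (simp_all add: Int_commute)
  have "card ((A - B) \<union> (B - A)) = card (A - B) + card (B - A)"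
    by (rule card_Un_disjoint) (use assms in auto)
  then show ?thesis unfolding A B by (simp add: power_add)
qed

lemma sum_Pow_symdiff:
  assumes "s \<subseteq> N"
  shows "(\<Sum>e\<in>Pow N. f ((e - s) \<union> (s - e))) = (\<Sum>e\<in>Pow N. f e)"
proof -
  have "(\<lambda>e. (e - s) \<union> (s - e)) ` Pow N = Pow N"
  proof
    show "Pow N \<subseteq> (\<lambda>e. (e - s) \<union> (s - e)) ` Pow N"
    proof
      fix e assume "e \<in> Pow N"
      then have "e = (((e - s) \<union> (s - e)) - s) \<union> (s - ((e - s) \<union> (s - e)))"
        and "(e - s) \<union> (s - e) \<in> Pow N" using assms by blast+
      then show "e \<in> (\<lambda>e. (e - s) \<union> (s - e)) ` Pow N" by (rule image_eqI)
    qed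
  qed (use assms in blast)
  moreover have "inj_on (\<lambda>e. (e - s) \<union> (s - e)) (Pow N)" unfolding inj_on_def by blast
  ultimately show ?thesis using sum.reindex[of "\<lambda>e. (e - s) \<union> (s - e)" "Pow N" f] by (simp add: comp_def)
qed

lemma card_permutes_vimage:
  assumes \<sigma>: "\<sigma> permutes {..<n}" and b: "b \<subseteq> {..<n}"
  shows "card {i. i < n \<and> \<sigma> i \<in> b} = card b"
proof (rule bij_betw_same_card[of \<sigma>])
  have "\<sigma> ` {i. i < n \<and> \<sigma> i \<in> b} = b"
  proof
    show "b \<subseteq> \<sigma> ` {i. i < n \<and> \<sigma> i \<in> b}"
    proof
      fix j assume j: "j \<in> b"
      then have "j \<in> \<sigma> ` {..<n}" using b permutes_image[OF \<sigma>] by blast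
      then show "j \<in> \<sigma> ` {i. i < n \<and> \<sigma> i \<in> b}" using j by auto
    qed
  qed auto
  then show "bij_betw \<sigma> {i. i < n \<and> \<sigma> i \<in> b} b"
    unfolding bij_betw_def using permutes_inj_on[OF \<sigma>] by simp
qed

lemma sgn_action_comp:
  assumes \<sigma>: "\<sigma> permutes {..<n}" and \<tau>: "\<tau> permutes {..<n}" and e: "e \<subseteq> {..<n}" and b: "b \<subseteq> {..<n}"
  shows "sgn_action b \<tau> * sgn_action ((e - {i. i < n \<and> \<sigma> i \<in> b}) \<union> ({i. i < n \<and> \<sigma> i \<in> b} - e)) (\<tau> \<circ> \<sigma>) =
    sgn_action e \<sigma>" (is "_ * sgn_action ?d _ = _")
proof -
  have perm: "permutation \<rho>" if "\<rho> permutes {..<n}" for \<rho>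
    by (rule permutes_imp_permutation[OF finite_lessThan that])
  have "finite e" by (rule finite_subset[OF e finite_lessThan])
  then have 1: "(- 1 :: rat) ^ card ?d = (- 1) ^ card e * (- 1) ^ card b"
    using minus_one_power_symdiff[of e "{i. i < n \<and> \<sigma> i \<in> b}"] card_permutes_vimage[OF \<sigma> b] by simp
  have 2: "sign (\<tau> \<circ> \<sigma>) = sign \<tau> * sign \<sigma>" by (rule sign_compose[OF perm[OF \<tau>] perm[OF \<sigma>]])
  have 3: "((- 1 :: rat) ^ card b * (- 1) ^ card b) = 1" by (simp add: power_mult_distrib[symmetric])
  have 4: "(of_int (sign \<tau>) * of_int (sign \<tau>) :: rat) = 1"
    by (cases "evenperm \<tau>") (simp_all add: sign_def)
  have "sgn_action b \<tau> * sgn_action ?d (\<tau> \<circ> \<sigma>) =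
      (- 1) ^ card e * of_int (sign \<sigma>) * ((- 1) ^ card b * (- 1) ^ card b) * (of_int (sign \<tau>) * of_int (sign \<tau>))"
    unfolding sgn_action_def 1 2 of_int_mult by (simp only: ac_simps)
  then show ?thesis unfolding 3 4 sgn_action_def by simp
qed

text \<open>Alternation turns the action of a group element into its sign, since the sum over the group
  may be reindexed by right multiplication.\<close>

lemma Alt_image_action:
  assumes \<tau>: "\<tau> permutes {..<n}" and b: "b \<subseteq> {..<n}"
  shows "Alt n (image_cycle (cube_action n b \<tau>) z) = scale (sgn_action b \<tau>) (Alt n z)"
proof -
  define F where "F = (\<lambda>e \<sigma>. scale (sgn_action e \<sigma>) (image_cycle (cube_action n e \<sigma>) z))"
  \<comment> \<open>Composing with \<open>(b, \<tau>)\<close> changes the set of inverted coordinates by the symmetric difference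
    with \<open>s \<sigma>\<close>.\<close>
  define s where "s = (\<lambda>\<sigma>. {i. i < n \<and> \<sigma> i \<in> b})"
  have summand: "scale (sgn_action e \<sigma>) (image_cycle (cube_action n e \<sigma>) (image_cycle (cube_action n b \<tau>) z)) =
      scale (sgn_action b \<tau>) (F ((e - s \<sigma>) \<union> (s \<sigma> - e)) (\<tau> \<circ> \<sigma>))"
    if \<sigma>: "\<sigma> permutes {..<n}" and e: "e \<subseteq> {..<n}" for e \<sigma>
  proof -
    have eq: "e - {i. \<sigma> i \<in> b} = e - s \<sigma>" using e unfolding s_def by auto
    show ?thesis
      unfolding F_def scale_scale image_cycle_comp cube_action_comp[OF \<sigma>] eq
        s_def sgn_action_comp[OF \<sigma> \<tau> e b] ..
  qed
  have alt: "alt_sum n z = (\<Sum>\<sigma> | \<sigma> permutes {..<n}. \<Sum>e\<in>Pow {..<n}. F e \<sigma>)"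
    unfolding alt_sum_def F_def ..
  have inner: "(\<Sum>e\<in>Pow {..<n}. F ((e - s \<sigma>) \<union> (s \<sigma> - e)) \<rho>) = (\<Sum>e\<in>Pow {..<n}. F e \<rho>)" for \<sigma> \<rho>
  proof -
    have "s \<sigma> \<subseteq> {..<n}" unfolding s_def by blast
    then show ?thesis by (rule sum_Pow_symdiff[of "s \<sigma>" "{..<n}" "\<lambda>e. F e \<rho>"])
  qed
  have "alt_sum n (image_cycle (cube_action n b \<tau>) z) =
      (\<Sum>\<sigma> | \<sigma> permutes {..<n}. \<Sum>e\<in>Pow {..<n}. scale (sgn_action b \<tau>) (F ((e - s \<sigma>) \<union> (s \<sigma> - e)) (\<tau> \<circ> \<sigma>)))"
    unfolding alt_sum_def
  proof (rule sum.cong[OF refl], rule sum.cong[OF refl])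
    fix \<sigma> e assume "\<sigma> \<in> {\<sigma>. \<sigma> permutes {..<n}}" "e \<in> Pow {..<n}"
    then have "\<sigma> permutes {..<n}" "e \<subseteq> {..<n}" by simp_all
    then show "scale (sgn_action e \<sigma>) (image_cycle (cube_action n e \<sigma>) (image_cycle (cube_action n b \<tau>) z)) =
      scale (sgn_action b \<tau>) (F ((e - s \<sigma>) \<union> (s \<sigma> - e)) (\<tau> \<circ> \<sigma>))" by (rule summand)
  qed
  also have "\<dots> = scale (sgn_action b \<tau>) (\<Sum>\<sigma> | \<sigma> permutes {..<n}. \<Sum>e\<in>Pow {..<n}. F e (\<tau> \<circ> \<sigma>))"
    unfolding scale_sum[symmetric] inner ..
  also have "(\<Sum>\<sigma> | \<sigma> permutes {..<n}. \<Sum>e\<in>Pow {..<n}. F e (\<tau> \<circ> \<sigma>)) = alt_sum n z"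
    unfolding alt
    by (rule setum_permutations_compose_left[OF \<tau>, of "\<lambda>\<sigma>. \<Sum>e\<in>Pow {..<n}. F e \<sigma>", symmetric])
  finally have "alt_sum n (image_cycle (cube_action n b \<tau>) z) = scale (sgn_action b \<tau>) (alt_sum n z)" .
  then show ?thesis unfolding Alt_eq_alt_sum by (simp only: scale_scale mult.commute)
qed

lemma Alt_eq_0_if_transposition:
  assumes ab: "a < n" "b < n" "a \<noteq> b"
    and inv: "image_cycle (cube_action n {} (Transposition.transpose a b)) z = z"
  shows "Alt n z = 0"
proof -
  have t: "Transposition.transpose a b permutes {..<n}" by (rule permutes_swap_id) (use ab in auto)
  have sgn: "sgn_action {} (Transposition.transpose a b) = - 1"
    using ab(3) by (simp add: sgn_action_def sign_swap_id)
  have "Alt n z = scale (- 1) (Alt n z)"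
    using Alt_image_action[OF t empty_subsetI, of z] unfolding inv sgn .
  then have "Poly_Mapping.lookup (Alt n z) W = Poly_Mapping.lookup (scale (- 1) (Alt n z)) W" for W
    by (rule arg_cong[where f = "\<lambda>y. Poly_Mapping.lookup y W"])
  then have eq: "Poly_Mapping.lookup (Alt n z) W = - Poly_Mapping.lookup (Alt n z) W" for W
    unfolding lookup_scale by simp
  show ?thesis
  proof (rule poly_mapping_eqI)
    fix W show "Poly_Mapping.lookup (Alt n z) W = Poly_Mapping.lookup 0 W"
      using eq[of W] by simp
  qed
qed

section \<open>Boundaries of alternating cycles\<close>

lemma face_zero_linear:
  "face_zero Y n i (scale q z) = scale q (face_zero Y n i z)"
  "face_zero Y n i (\<Sum>x\<in>A. w x) = (\<Sum>x\<in>A. face_zero Y n i (w x))"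
  unfolding face_zero_def cut_by_def by (simp_all only: lin_ext_scale lin_ext_sum image_cycle_linear)

lemma face_infty_linear:
  "face_infty Y n i (scale q z) = scale q (face_infty Y n i z)"
  "face_infty Y n i (\<Sum>x\<in>A. w x) = (\<Sum>x\<in>A. face_infty Y n i (w x))"
  unfolding face_infty_def cut_by_def by (simp_all only: lin_ext_scale lin_ext_sum image_cycle_linear)

lemma nth_omit:
  assumes "i < length us" "l < length us - 1"
  shows "(take i us @ drop (Suc i) us) ! l = us ! insert_index i l"
  using assms by (auto simp: nth_append insert_index_def min_def)

lemma snd_omit_coord: "snd (omit_coord i z) = take i (snd z) @ drop (Suc i) (snd z)"
  unfolding omit_coord_def by (cases z) simp

lemma fst_omit_coord [simp]: "fst (omit_coord i z) = fst z"
  unfolding omit_coord_def by (cases z) simp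

lemma permutation_insert_index:
  "permutation_insert i j \<sigma> (insert_index i l) = insert_index j (\<sigma> l)"
  unfolding permutation_insert_def insert_dom_def insert_ran_def insert_index_def by auto

lemma insert_index_neq [simp]: "insert_index i l \<noteq> i"
  unfolding insert_index_def by auto

lemma inj_insert_index: "inj (insert_index i)"
  unfolding insert_index_def inj_def by auto

lemma insert_index_less: "l < n \<Longrightarrow> i < Suc n \<Longrightarrow> insert_index i l < Suc n"
  unfolding insert_index_def by auto

lemma lessThan_Suc_insert_index:
  assumes "i < Suc n" shows "{..<Suc n} = insert i (insert_index i ` {..<n})"
proof
  show "{..<Suc n} \<subseteq> insert i (insert_index i ` {..<n})"
  proof
    fix k assume k: "k \<in> {..<Suc n}"
    show "k \<in> insert i (insert_index i ` {..<n})"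
    proof (cases "k = i")
      case False
      then have "k = insert_index i (delete_index i k)" using insert_delete_index[OF False] by simp
      moreover have "delete_index i k < n" using k assms False unfolding delete_index_def by auto
      ultimately show ?thesis by blast
    qed simp
  qed
qed (use assms insert_index_less in auto)

lemma omit_coord_cube_action:
  assumes \<sigma>: "\<sigma> permutes {..<n}" and ij: "i < Suc n" "j < Suc n" and len: "length (snd z) = Suc n"
    and e: "\<And>l. l < n \<Longrightarrow> insert_index i l \<in> e' \<longleftrightarrow> l \<in> e"
  shows "omit_coord i (cube_action (Suc n) e' (permutation_insert i j \<sigma>) z) = cube_action n e \<sigma> (omit_coord j z)"
proof (rule prod_list_eqI)
  show "length (snd (omit_coord i (cube_action (Suc n) e' (permutation_insert i j \<sigma>) z))) =
      length (snd (cube_action n e \<sigma> (omit_coord j z)))"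
    using ij by (simp add: snd_omit_coord)
  fix l assume "l < length (snd (omit_coord i (cube_action (Suc n) e' (permutation_insert i j \<sigma>) z)))"
  then have l: "l < n" using ij by (simp add: snd_omit_coord)
  have \<sigma>l: "\<sigma> l < n" using permutes_in_image[OF \<sigma>, of l] l by auto
  have "snd (omit_coord i (cube_action (Suc n) e' (permutation_insert i j \<sigma>) z)) ! l =
      snd (cube_action (Suc n) e' (permutation_insert i j \<sigma>) z) ! insert_index i l"
    unfolding snd_omit_coord by (rule nth_omit) (use ij l in auto)
  also have "\<dots> = (if l \<in> e then p1_inverse (snd z ! insert_index j (\<sigma> l)) else snd z ! insert_index j (\<sigma> l))"
    using e[OF l] by (simp add: permutation_insert_index nth_cube_action[OF insert_index_less[OF l ij(1)]])
  also have "snd z ! insert_index j (\<sigma> l) = snd (omit_coord j z) ! \<sigma> l"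
    unfolding snd_omit_coord by (rule nth_omit[symmetric]) (use ij \<sigma>l len in auto)
  finally show "snd (omit_coord i (cube_action (Suc n) e' (permutation_insert i j \<sigma>) z)) ! l =
      snd (cube_action n e \<sigma> (omit_coord j z)) ! l"
    by (simp add: nth_cube_action[OF l])
qed simp

text \<open>The contribution of the \<open>j\<close>-th coordinate to the boundary of a subvariety that meets the faces
  \<open>u\<^sub>j = 0\<close> and \<open>u\<^sub>j = \<infinity>\<close> in \<open>D0 j\<close> and \<open>D1 j\<close>.\<close>

definition face_diff :: "(nat \<Rightarrow> ('b \<times> p1 list) set) \<Rightarrow> (nat \<Rightarrow> ('b \<times> p1 list) set) \<Rightarrow> nat \<Rightarrow> ('b \<times> p1 list) cycle" where
  "face_diff D0 D1 j = set_cycle (omit_coord j ` D0 j) - set_cycle (omit_coord j ` D1 j)"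

definition simple_faces :: "'b variety \<Rightarrow> nat \<Rightarrow> ('b \<times> p1 list) set \<Rightarrow> (nat \<Rightarrow> ('b \<times> p1 list) set) \<Rightarrow>
    (nat \<Rightarrow> ('b \<times> p1 list) set) \<Rightarrow> bool" where
  "simple_faces Y n Z D0 D1 \<longleftrightarrow> irreducible_closed (zariski (Y \<times>\<^sub>V cube n)) Z \<and>
     (\<forall>j<n. simple_cut (Y \<times>\<^sub>V cube n) (\<lambda>z. 1 - cc j z) Z (D0 j) \<and> simple_cut (Y \<times>\<^sub>V cube n) (cc j) Z (D1 j))"

lemma irreducible_closed_points: "irreducible_closed (zariski V) Z \<Longrightarrow> Z \<subseteq> points V"
  unfolding irreducible_closed_def closedin_zariski by blast

lemma face_fun_cc:
  "(\<lambda>(t, us). 1 - cube_coord (us ! i)) = (\<lambda>z. 1 - cc i z)" "(\<lambda>(t, us). cube_coord (us ! i)) = cc i"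
  by (auto simp: cc_def)

text \<open>The new coordinate \<open>u\<^sub>i\<close> is \<open>u\<^sub>j\<close> or its inverse; in the second case the two faces are exchanged,
  which gives the sign.\<close>

lemma face_of_translate:
  assumes fac: "simple_faces Y (Suc n) Z D0 D1"
    and \<sigma>: "\<sigma> permutes {..<n}" and ij: "i < Suc n" "j < Suc n" and e': "e' \<subseteq> {..<Suc n}"
    and e: "\<And>l. l < n \<Longrightarrow> insert_index i l \<in> e' \<longleftrightarrow> l \<in> e"
  defines "g \<equiv> cube_action (Suc n) e' (permutation_insert i j \<sigma>)"
  shows "face_zero Y (Suc n) i (Poly_Mapping.single (g ` Z) 1) - face_infty Y (Suc n) i (Poly_Mapping.single (g ` Z) 1) =
    scale (if i \<in> e' then - 1 else 1) (image_cycle (cube_action n e \<sigma>) (face_diff D0 D1 j))"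
proof -
  let ?V = "Y \<times>\<^sub>V cube (Suc n)"
  let ?\<rho> = "permutation_insert i j \<sigma>"
  have \<rho>: "?\<rho> permutes {..<Suc n}"
    using permutation_insert_permutes[of \<sigma> n i j] \<sigma> ij by (simp add: lessThan_atLeast0)
  have irr: "irreducible_closed (zariski ?V) Z" using fac unfolding simple_faces_def by blast
  have ZV: "Z \<subseteq> points ?V" by (rule irreducible_closed_points[OF irr])
  have iso: "variety_iso ?V ?V g (cube_action (Suc n) {i. i < Suc n \<and> inv_into UNIV ?\<rho> i \<in> e'} (inv_into UNIV ?\<rho>))"
    unfolding g_def by (rule variety_iso_cube_action[OF \<rho> e'])
  have irrg: "irreducible_closed (zariski ?V) (g ` Z)"
    by (rule irreducible_closed_homeomorphic[OF variety_iso_homeomorphic[OF iso] irr])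
  have A: "cc i \<in> coord_ring ?V" "(\<lambda>z. 1 - cc i z) \<in> coord_ring ?V"
    by (auto intro: coord_ring_diff coord_ring_1 cc_coord_ring[OF ij(1)])
  have cuts: "simple_cut ?V (\<lambda>z. 1 - cc j z) Z (D0 j)" "simple_cut ?V (cc j) Z (D1 j)"
    using fac ij(2) unfolding simple_faces_def by blast+
  have DZ: "D0 j \<subseteq> Z" "D1 j \<subseteq> Z" using cuts unfolding simple_cut_def by blast+
  have cc: "cc i (g p) = (if i \<in> e' then 1 - cc j p else cc j p)" if "p \<in> points ?V" for p
    unfolding g_def using cc_cube_action[OF \<rho> that ij(1)] by simp
  have omit: "omit_coord i ` g ` D = cube_action n e \<sigma> ` omit_coord j ` D" if "D \<subseteq> Z" for D
    unfolding image_image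
  proof (rule image_cong[OF refl])
    fix z assume "z \<in> D"
    then have "z \<in> points ?V" using that ZV by blast
    then have "length (snd z) = Suc n" by (simp add: mem_Times_iff points_cube)
    then show "omit_coord i (g z) = cube_action n e \<sigma> (omit_coord j z)"
      unfolding g_def using omit_coord_cube_action[OF \<sigma> ij _ e] by blast
  qed
  show ?thesis
  proof (cases "i \<in> e'")
    case True
    have c0: "simple_cut ?V (\<lambda>z. 1 - cc i z) (g ` Z) (g ` D1 j)"
      by (rule simple_cut_transport[OF iso ZV cuts(2)]) (use cc True in simp)
    have c1: "simple_cut ?V (cc i) (g ` Z) (g ` D0 j)"
      by (rule simple_cut_transport[OF iso ZV cuts(1)]) (use cc True in simp)
    show ?thesis
      unfolding face_zero_def face_infty_def face_fun_cc cut_by_simple[OF irrg A(2) c0]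
        cut_by_simple[OF irrg A(1) c1] image_cycle_set_cycle omit[OF DZ(1)] omit[OF DZ(2)] face_diff_def
        image_cycle_linear scale_diff
      using True by (simp add: poly_mapping_eq_iff fun_eq_iff lookup_minus)
  next
    case False
    have c0: "simple_cut ?V (\<lambda>z. 1 - cc i z) (g ` Z) (g ` D0 j)"
      by (rule simple_cut_transport[OF iso ZV cuts(1)]) (use cc False in simp)
    have c1: "simple_cut ?V (cc i) (g ` Z) (g ` D1 j)"
      by (rule simple_cut_transport[OF iso ZV cuts(2)]) (use cc False in simp)
    show ?thesis
      unfolding face_zero_def face_infty_def face_fun_cc cut_by_simple[OF irrg A(2) c0]
        cut_by_simple[OF irrg A(1) c1] image_cycle_set_cycle omit[OF DZ(1)] omit[OF DZ(2)] face_diff_def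
        image_cycle_linear scale_diff
      using False by simp
  qed
qed

lemma sum_Pow_Suc:
  assumes i: "i < Suc n"
  shows "(\<Sum>e\<in>Pow {..<Suc n}. f e) =
    (\<Sum>e\<in>Pow {..<n}. f (insert_index i ` e) + f (insert i (insert_index i ` e)))"
proof -
  let ?I = "insert_index i"
  have Pow: "Pow {..<Suc n} = (\<lambda>e. ?I ` e) ` Pow {..<n} \<union> (\<lambda>e. insert i (?I ` e)) ` Pow {..<n}"
    unfolding lessThan_Suc_insert_index[OF i] Pow_insert image_Pow_surj[OF refl, symmetric] image_image ..
  have ni: "i \<notin> ?I ` e" for e by (metis imageE insert_index_neq)
  have disj: "(\<lambda>e. ?I ` e) ` Pow {..<n} \<inter> (\<lambda>e. insert i (?I ` e)) ` Pow {..<n} = {}"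
    using ni by blast
  have inj1: "inj_on (\<lambda>e. ?I ` e) (Pow {..<n})"
    by (rule inj_onI) (simp add: inj_image_eq_iff[OF inj_insert_index])
  have inj2: "inj_on (\<lambda>e. insert i (?I ` e)) (Pow {..<n})"
    by (rule inj_onI) (metis insert_ident ni inj_image_eq_iff[OF inj_insert_index])
  show ?thesis
    unfolding Pow using disj by (subst sum.union_disjoint) (auto simp: sum.reindex[OF inj1] sum.reindex[OF inj2] sum.distrib)
qed

lemma sum_permutes_Suc:
  assumes i: "i < Suc n"
  shows "(\<Sum>\<sigma> | \<sigma> permutes {..<Suc n}. f \<sigma>) =
    (\<Sum>j<Suc n. \<Sum>\<sigma> | \<sigma> permutes {..<n}. f (permutation_insert i j \<sigma>))"
proof -
  let ?P = "{\<sigma>. \<sigma> permutes {..<Suc n}}"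
  have fin: "finite ?P" by (rule finite_permutations) simp
  have "(\<Sum>\<sigma>\<in>?P. f \<sigma>) = (\<Sum>j<Suc n. \<Sum>\<sigma>\<in>{\<sigma>\<in>?P. \<sigma> i = j}. f \<sigma>)"
  proof (rule sum.group[OF fin, symmetric])
    show "(\<lambda>\<sigma>. \<sigma> i) ` ?P \<subseteq> {..<Suc n}" using permutes_in_image i by fastforce
  qed simp
  also have "\<dots> = (\<Sum>j<Suc n. \<Sum>\<sigma> | \<sigma> permutes {..<n}. f (permutation_insert i j \<sigma>))"
  proof (rule sum.cong[OF refl])
    fix j assume "j \<in> {..<Suc n}"
    then have j: "j < Suc n" by simp
    have eq: "{\<sigma>\<in>?P. \<sigma> i = j} = permutation_insert i j ` {\<sigma>. \<sigma> permutes {..<n}}"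
      using permutation_fix[OF i j] by (simp add: lessThan_atLeast0)
    show "(\<Sum>\<sigma>\<in>{\<sigma>\<in>?P. \<sigma> i = j}. f \<sigma>) = (\<Sum>\<sigma> | \<sigma> permutes {..<n}. f (permutation_insert i j \<sigma>))"
      unfolding eq
      by (subst sum.reindex) (use permutation_insert_inj_on[OF i j] in \<open>simp_all add: lessThan_atLeast0\<close>)
  qed
  finally show ?thesis .
qed

text \<open>
  Taking faces commutes with alternation. The \<open>i\<close>-th face of a translate of \<open>Z\<close> by a group element
  that moves the \<open>j\<close>-th coordinate to the \<open>i\<close>-th one is a translate of the \<open>j\<close>-th face of \<open>Z\<close>, by the
  group element with this coordinate deleted; the signs differ by \<open>(-1)\<^bsup>i+j\<^esup>\<close> and by the
  inversion of the coordinate, which exchanges the two faces. For given \<open>j\<close> each group element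
  of the smaller cube arises \<open>2 (n + 1)\<close> times.
\<close>

lemma boundary_Alt:
  assumes fac: "simple_faces Y (Suc n) Z D0 D1"
  shows "boundary Y (Suc n) (Alt (Suc n) (Poly_Mapping.single Z 1)) =
    Alt n (\<Sum>j<Suc n. scale ((- 1) ^ j) (face_diff D0 D1 j))"
proof -
  define \<Delta> where "\<Delta> = (\<lambda>i z. face_zero Y (Suc n) i z - face_infty Y (Suc n) i z)"
  have \<Delta>_linear: "\<Delta> i (scale q z) = scale q (\<Delta> i z)" "\<Delta> i (\<Sum>x\<in>A. w x) = (\<Sum>x\<in>A. \<Delta> i (w x))"
    for i q z and A :: "'x set" and w
    unfolding \<Delta>_def by (simp_all only: face_zero_linear face_infty_linear scale_diff sum_subtractf)
  define c where "c = (\<lambda>e \<sigma>. scale (sgn_action e \<sigma>) (Poly_Mapping.single (cube_action (Suc n) e \<sigma> ` Z) 1))"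
  have alt: "alt_sum (Suc n) (Poly_Mapping.single Z 1) = (\<Sum>\<sigma> | \<sigma> permutes {..<Suc n}. \<Sum>e\<in>Pow {..<Suc n}. c e \<sigma>)"
    unfolding alt_sum_def c_def image_cycle_single ..
  have term1: "\<Delta> i (c (insert_index i ` e) (permutation_insert i j \<sigma>)) + \<Delta> i (c (insert i (insert_index i ` e)) (permutation_insert i j \<sigma>))
      = scale (2 * (- 1) ^ (i + j)) (scale (sgn_action e \<sigma>) (image_cycle (cube_action n e \<sigma>) (face_diff D0 D1 j)))"
    if i: "i < Suc n" and j: "j < Suc n" and \<sigma>: "\<sigma> permutes {..<n}" and e: "e \<subseteq> {..<n}" for i j \<sigma> e
  proof -
    let ?\<rho> = "permutation_insert i j \<sigma>" and ?H = "image_cycle (cube_action n e \<sigma>) (face_diff D0 D1 j)"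
    have ni: "i \<notin> insert_index i ` e" by (metis imageE insert_index_neq)
    have fin: "finite e" by (rule finite_subset[OF e finite_lessThan])
    have card1: "card (insert_index i ` e) = card e"
      by (rule card_image) (rule inj_on_subset[OF inj_insert_index subset_UNIV])
    have card2: "card (insert i (insert_index i ` e)) = Suc (card e)"
      using ni fin card1 by simp
    have sign: "(of_int (sign ?\<rho>) :: rat) = (- 1) ^ (i + j) * of_int (sign \<sigma>)"
      using signof_permutation_insert[of \<sigma> n i j] \<sigma> i j by (simp add: lessThan_atLeast0)
    have sub: "insert_index i ` e \<subseteq> {..<Suc n}" "insert i (insert_index i ` e) \<subseteq> {..<Suc n}"
      unfolding lessThan_Suc_insert_index[OF i] using e by blast+
    have mem: "insert_index i l \<in> insert_index i ` e \<longleftrightarrow> l \<in> e" for l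
      by (rule inj_image_mem_iff[OF inj_insert_index])
    have d1: "\<Delta> i (Poly_Mapping.single (cube_action (Suc n) (insert_index i ` e) ?\<rho> ` Z) 1) = ?H"
      unfolding \<Delta>_def using face_of_translate[OF fac \<sigma> i j sub(1), of e] mem ni by simp
    have d2: "\<Delta> i (Poly_Mapping.single (cube_action (Suc n) (insert i (insert_index i ` e)) ?\<rho> ` Z) 1) = scale (- 1) ?H"
      unfolding \<Delta>_def using face_of_translate[OF fac \<sigma> i j sub(2), of e] mem by simp
    have s1: "sgn_action (insert_index i ` e) ?\<rho> = (- 1) ^ (i + j) * sgn_action e \<sigma>"
      and s2: "sgn_action (insert i (insert_index i ` e)) ?\<rho> = - ((- 1) ^ (i + j) * sgn_action e \<sigma>)"
      unfolding sgn_action_def card1 card2 sign by simp_all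
    show ?thesis
      unfolding c_def \<Delta>_linear d1 d2 s1 s2 scale_scale scale_add_left[symmetric] by (simp add: ac_simps)
  qed
  have per_face: "\<Delta> i (alt_sum (Suc n) (Poly_Mapping.single Z 1)) =
      (\<Sum>j<Suc n. scale (2 * (- 1) ^ (i + j)) (alt_sum n (face_diff D0 D1 j)))" if i: "i < Suc n" for i
  proof -
    have "\<Delta> i (alt_sum (Suc n) (Poly_Mapping.single Z 1)) =
        (\<Sum>\<sigma> | \<sigma> permutes {..<Suc n}. \<Sum>e\<in>Pow {..<Suc n}. \<Delta> i (c e \<sigma>))"
      unfolding alt \<Delta>_linear ..
    also have "\<dots> = (\<Sum>j<Suc n. \<Sum>\<sigma> | \<sigma> permutes {..<n}. \<Sum>e\<in>Pow {..<n}.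
        \<Delta> i (c (insert_index i ` e) (permutation_insert i j \<sigma>)) +
        \<Delta> i (c (insert i (insert_index i ` e)) (permutation_insert i j \<sigma>)))"
      unfolding sum_permutes_Suc[OF i] sum_Pow_Suc[OF i] ..
    also have "\<dots> = (\<Sum>j<Suc n. \<Sum>\<sigma> | \<sigma> permutes {..<n}. \<Sum>e\<in>Pow {..<n}.
        scale (2 * (- 1) ^ (i + j)) (scale (sgn_action e \<sigma>) (image_cycle (cube_action n e \<sigma>) (face_diff D0 D1 j))))"
    proof (rule sum.cong[OF refl], rule sum.cong[OF refl], rule sum.cong[OF refl])
      fix j \<sigma> e assume "j \<in> {..<Suc n}" "\<sigma> \<in> {\<sigma>. \<sigma> permutes {..<n}}" "e \<in> Pow {..<n}"
      then show "\<Delta> i (c (insert_index i ` e) (permutation_insert i j \<sigma>)) +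
          \<Delta> i (c (insert i (insert_index i ` e)) (permutation_insert i j \<sigma>)) =
        scale (2 * (- 1) ^ (i + j)) (scale (sgn_action e \<sigma>) (image_cycle (cube_action n e \<sigma>) (face_diff D0 D1 j)))"
        by (intro term1[OF i]) simp_all
    qed
    also have "\<dots> = (\<Sum>j<Suc n. scale (2 * (- 1) ^ (i + j)) (alt_sum n (face_diff D0 D1 j)))"
      unfolding alt_sum_def scale_sum ..
    finally show ?thesis .
  qed
  have "boundary Y (Suc n) (Alt (Suc n) (Poly_Mapping.single Z 1)) =
      (\<Sum>i<Suc n. scale ((- 1) ^ i) (scale (1 / (2 ^ Suc n * fact (Suc n))) (\<Delta> i (alt_sum (Suc n) (Poly_Mapping.single Z 1)))))"
    unfolding boundary_def \<Delta>_def[symmetric] Alt_eq_alt_sum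
    by (rule sum.cong[OF refl]) (simp only: \<Delta>_linear[unfolded \<Delta>_def] \<Delta>_def)
  also have "\<dots> = (\<Sum>i<Suc n. \<Sum>j<Suc n. scale (1 / (2 ^ Suc n * fact (Suc n)) * 2 * (- 1) ^ j) (alt_sum n (face_diff D0 D1 j)))"
  proof (rule sum.cong[OF refl])
    fix i assume "i \<in> {..<Suc n}"
    then have i: "i < Suc n" by simp
    have s: "(- 1) ^ i * (1 / (2 ^ Suc n * fact (Suc n)) * (2 * (- 1) ^ (i + j))) =
        (1 / (2 ^ Suc n * fact (Suc n)) * 2 * (- 1) ^ j :: rat)" for j
      by (simp add: power_add power_mult_distrib[symmetric] mult.assoc[symmetric])
    show "scale ((- 1) ^ i) (scale (1 / (2 ^ Suc n * fact (Suc n))) (\<Delta> i (alt_sum (Suc n) (Poly_Mapping.single Z 1)))) =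
        (\<Sum>j<Suc n. scale (1 / (2 ^ Suc n * fact (Suc n)) * 2 * (- 1) ^ j) (alt_sum n (face_diff D0 D1 j)))"
      unfolding per_face[OF i] scale_sum scale_scale s ..
  qed
  also have "\<dots> = scale (of_nat (Suc n)) (\<Sum>j<Suc n. scale (1 / (2 ^ Suc n * fact (Suc n)) * 2 * (- 1) ^ j) (alt_sum n (face_diff D0 D1 j)))"
    by (rule poly_mapping_eqI) (simp only: sum_constant lookup_scale card_lessThan lookup_sum of_nat_mult sum_distrib_left)
  also have "\<dots> = Alt n (\<Sum>j<Suc n. scale ((- 1) ^ j) (face_diff D0 D1 j))"
  proof -
    have s: "of_nat (Suc n) * (1 / (2 ^ Suc n * fact (Suc n)) * 2 * (- 1) ^ j) = (- 1) ^ j * (1 / (2 ^ n * fact n) :: rat)" for j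
      by (simp add: field_simps del: of_nat_Suc)
    show ?thesis unfolding Alt_sum Alt_linear unfolding Alt_eq_alt_sum scale_sum scale_scale s ..
  qed
  finally show ?thesis .
qed

section \<open>Products of alternating cycles\<close>

definition join_points :: "'b \<times> p1 list \<Rightarrow> 'b \<times> p1 list \<Rightarrow> ('b \<times> 'b) \<times> p1 list" where
  "join_points z w = ((fst z, fst w), snd z @ snd w)"

definition join_set :: "('b \<times> p1 list) set \<Rightarrow> ('b \<times> p1 list) set \<Rightarrow> (('b \<times> 'b) \<times> p1 list) set" where
  "join_set G Z = {join_points z w | z w. z \<in> G \<and> w \<in> Z}"

lemma join_set_eq: "{((t, t'), us @ us') | t us t' us'. (t, us) \<in> G \<and> (t', us') \<in> Z} = join_set G Z"
  unfolding join_set_def join_points_def by fastforce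

lemma permutation_insert_0_0:
  "permutation_insert 0 0 \<sigma> 0 = 0" "permutation_insert 0 0 \<sigma> (Suc l) = Suc (\<sigma> l)"
  using permutation_insert_index[of 0 0 \<sigma> l] by simp_all

lemma join_points_cube_action:
  assumes \<tau>: "\<tau> permutes {..<m}" and z: "length (snd z) = 1" and w: "length (snd w) = m" and d: "d \<subseteq> {..<1}"
  shows "join_points (cube_action 1 d id z) (cube_action m e \<tau> w) =
    cube_action (Suc m) (d \<union> Suc ` e) (permutation_insert 0 0 \<tau>) (join_points z w)"
proof (rule prod_list_eqI)
  show "length (snd (join_points (cube_action 1 d id z) (cube_action m e \<tau> w))) =
    length (snd (cube_action (Suc m) (d \<union> Suc ` e) (permutation_insert 0 0 \<tau>) (join_points z w)))"
    by (simp add: join_points_def)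
  fix i assume "i < length (snd (join_points (cube_action 1 d id z) (cube_action m e \<tau> w)))"
  then have i: "i < Suc m" by (simp add: join_points_def)
  show "snd (join_points (cube_action 1 d id z) (cube_action m e \<tau> w)) ! i =
    snd (cube_action (Suc m) (d \<union> Suc ` e) (permutation_insert 0 0 \<tau>) (join_points z w)) ! i"
  proof (cases i)
    case 0
    then show ?thesis using z by (simp add: nth_cube_action join_points_def nth_append permutation_insert_0_0 image_iff)
  next
    case (Suc l)
    have "\<tau> l < m" using permutes_in_image[OF \<tau>, of l] i Suc by auto
    moreover have "Suc l \<notin> d" using d by auto
    ultimately show ?thesis using z i Suc
      by (simp add: nth_cube_action join_points_def nth_append permutation_insert_0_0 image_iff)
  qed
qed (simp add: join_points_def)

lemma join_set_cube_action:
  assumes \<tau>: "\<tau> permutes {..<m}" and d: "d \<subseteq> {..<1}"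
    and G: "\<And>z. z \<in> G \<Longrightarrow> length (snd z) = 1" and Z: "\<And>w. w \<in> Z \<Longrightarrow> length (snd w) = m"
  shows "join_set (cube_action 1 d id ` G) (cube_action m e \<tau> ` Z) =
    cube_action (Suc m) (d \<union> Suc ` e) (permutation_insert 0 0 \<tau>) ` join_set G Z"
proof -
  have "join_points (cube_action 1 d id z) (cube_action m e \<tau> w) =
    cube_action (Suc m) (d \<union> Suc ` e) (permutation_insert 0 0 \<tau>) (join_points z w)" if "z \<in> G" "w \<in> Z" for z w
    by (rule join_points_cube_action[OF \<tau> G[OF that(1)] Z[OF that(2)] d])
  note eq = this
  show ?thesis
  proof (intro subset_antisym subsetI)
    fix x assume "x \<in> join_set (cube_action 1 d id ` G) (cube_action m e \<tau> ` Z)"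
    then obtain z w where zw: "z \<in> G" "w \<in> Z" "x = join_points (cube_action 1 d id z) (cube_action m e \<tau> w)"
      unfolding join_set_def by blast
    have "join_points z w \<in> join_set G Z" using zw unfolding join_set_def by blast
    then show "x \<in> cube_action (Suc m) (d \<union> Suc ` e) (permutation_insert 0 0 \<tau>) ` join_set G Z"
      unfolding zw(3) eq[OF zw(1,2)] by (rule imageI)
  next
    fix x assume "x \<in> cube_action (Suc m) (d \<union> Suc ` e) (permutation_insert 0 0 \<tau>) ` join_set G Z"
    then obtain z w where zw: "z \<in> G" "w \<in> Z"
      "x = cube_action (Suc m) (d \<union> Suc ` e) (permutation_insert 0 0 \<tau>) (join_points z w)"
      unfolding join_set_def by blast
    show "x \<in> join_set (cube_action 1 d id ` G) (cube_action m e \<tau> ` Z)"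
      unfolding zw(3) eq[OF zw(1,2), symmetric] join_set_def using zw(1,2) by blast
  qed
qed

lemma sum_scale_const: "(\<Sum>x\<in>A. z) = scale (of_nat (card A)) z"
  by (rule poly_mapping_eqI) (simp add: lookup_sum)

lemma sgn_action_square: "sgn_action e \<sigma> * sgn_action e \<sigma> = 1"
proof -
  have "((- 1 :: rat) ^ card e * (- 1) ^ card e) = 1" by (simp add: power_mult_distrib[symmetric])
  moreover have "(of_int (sign \<sigma>) * of_int (sign \<sigma>) :: rat) = 1"
    by (cases "evenperm \<sigma>") (simp_all add: sign_def)
  moreover have "sgn_action e \<sigma> * sgn_action e \<sigma> =
      ((- 1) ^ card e * (- 1) ^ card e) * (of_int (sign \<sigma>) * of_int (sign \<sigma>))"
    unfolding sgn_action_def by (simp only: ac_simps)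
  ultimately show ?thesis by simp
qed

text \<open>Alternation averages over the group, so that a map which turns the action into signs may be
  evaluated on the subvariety itself.\<close>

lemma Alt_lin_ext:
  assumes "\<And>e \<sigma>. \<sigma> permutes {..<n} \<Longrightarrow> e \<subseteq> {..<n} \<Longrightarrow> f (cube_action n e \<sigma> ` Z) = scale (sgn_action e \<sigma>) A"
  shows "lin_ext f (Alt n (Poly_Mapping.single Z 1)) = A"
proof -
  have "lin_ext f (alt_sum n (Poly_Mapping.single Z 1)) =
      (\<Sum>\<sigma> | \<sigma> permutes {..<n}. \<Sum>e\<in>Pow {..<n}. scale (sgn_action e \<sigma>) (f (cube_action n e \<sigma> ` Z)))"
    unfolding alt_sum_def image_cycle_single lin_ext_sum lin_ext_scale lin_ext_single ..
  also have "\<dots> = (\<Sum>\<sigma> | \<sigma> permutes {..<n}. \<Sum>e\<in>Pow {..<n}. A)"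
  proof (rule sum.cong[OF refl], rule sum.cong[OF refl])
    fix \<sigma> e assume "\<sigma> \<in> {\<sigma>. \<sigma> permutes {..<n}}" "e \<in> Pow {..<n}"
    then have "f (cube_action n e \<sigma> ` Z) = scale (sgn_action e \<sigma>) A" by (intro assms) simp_all
    then show "scale (sgn_action e \<sigma>) (f (cube_action n e \<sigma> ` Z)) = A"
      by (simp add: sgn_action_square)
  qed
  also have "\<dots> = scale (of_nat (fact n) * of_nat (2 ^ n)) A"
    unfolding sum_scale_const scale_scale using card_permutations[OF refl finite_lessThan, of n]
    by (simp add: card_Pow)
  finally show ?thesis
    unfolding Alt_eq_alt_sum lin_ext_scale by simp
qed

text \<open>The projection that identifies the diagonal with the base.\<close>

definition forget_snd :: "('b \<times> 'b) \<times> p1 list \<Rightarrow> 'b \<times> p1 list" where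
  "forget_snd z = (fst (fst z), snd z)"

lemma forget_snd_cube_action: "forget_snd (cube_action n e \<sigma> z) = cube_action n e \<sigma> (forget_snd z)"
  unfolding forget_snd_def cube_action_def by (cases z) auto

lemma diag_funs:
  "(\<lambda>((t, t'), us). (t, us)) = forget_snd" "(\<lambda>((t, t'), us). t - t') = (\<lambda>z. fst (fst z) - snd (fst z))"
  by (auto simp: forget_snd_def)

definition diag_fun :: "(complex \<times> complex) \<times> p1 list \<Rightarrow> complex" where
  "diag_fun z = fst (fst z) - snd (fst z)"

text \<open>
  The product of two alternated subvarieties is the alternation of the diagonal pull-back of their
  exterior product: a pair of group elements acts on the exterior product as an element of the
  larger group, with the product of their signs.
\<close>

lemma cyc_prod_Alt:
  assumes G: "G \<subseteq> points (Y \<times>\<^sub>V cube 1)" and Z: "Z \<subseteq> points (Y \<times>\<^sub>V cube m)"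
    and irr: "irreducible_closed (zariski ((Y \<times>\<^sub>V Y) \<times>\<^sub>V cube (Suc m))) (join_set G Z)"
    and diag: "diag_fun \<in> coord_ring ((Y \<times>\<^sub>V Y) \<times>\<^sub>V cube (Suc m))"
    and cut: "simple_cut ((Y \<times>\<^sub>V Y) \<times>\<^sub>V cube (Suc m)) diag_fun (join_set G Z) W"
  shows "cyc_prod Y 1 m (Alt 1 (Poly_Mapping.single G 1)) (Alt m (Poly_Mapping.single Z 1)) =
    Alt (Suc m) (set_cycle (forget_snd ` W))"
proof -
  let ?V = "(Y \<times>\<^sub>V Y) \<times>\<^sub>V cube (Suc m)"
  define E where "E = (\<lambda>G' Z'. \<Sum>W\<in>irr_components (zariski ?V) (join_set G' Z'). Poly_Mapping.single W (1::rat))"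
  define T where "T = (\<lambda>z. Alt (Suc m) (diag_pullback Y (Suc m) z))"
  let ?A = "Alt (Suc m) (set_cycle (forget_snd ` W))"
  have T_scale: "T (scale q z) = scale q (T z)" for q z
    unfolding T_def diag_pullback_def cut_by_def lin_ext_scale image_cycle_linear Alt_linear ..
  have T_sum: "T (\<Sum>i\<in>I. z i) = (\<Sum>i\<in>I. T (z i))" for I :: "'x set" and z
    unfolding T_def diag_pullback_def cut_by_def lin_ext_sum image_cycle_linear Alt_sum ..
  have T_lin: "T (lin_ext f z) = lin_ext (\<lambda>Z. T (f Z)) z" for f :: "'x set \<Rightarrow> _" and z
    unfolding lin_ext_def T_sum T_scale ..
  have lenG: "length (snd z) = 1" if "z \<in> G" for z using G that by (auto simp: points_cube)
  have lenZ: "length (snd z) = m" if "z \<in> Z" for z using Z that by (auto simp: points_cube)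
  have pair: "T (E (cube_action 1 d id ` G) (cube_action m e \<tau> ` Z)) = scale (sgn_action d id) (scale (sgn_action e \<tau>) ?A)"
    if d: "d \<subseteq> {..<1}" and e: "e \<subseteq> {..<m}" and \<tau>: "\<tau> permutes {..<m}" for d e \<tau>
  proof -
    let ?\<rho> = "permutation_insert 0 0 \<tau>" and ?b = "d \<union> Suc ` e"
    define g :: "(complex \<times> complex) \<times> p1 list \<Rightarrow> (complex \<times> complex) \<times> p1 list"
      where "g = cube_action (Suc m) ?b ?\<rho>"
    have \<rho>: "?\<rho> permutes {..<Suc m}"
      using permutation_insert_permutes[of \<tau> m 0 0] \<tau> by (simp add: lessThan_atLeast0)
    have b: "?b \<subseteq> {..<Suc m}" using d e by auto
    have iso: "variety_iso ?V ?V g (cube_action (Suc m) {i. i < Suc m \<and> inv_into UNIV ?\<rho> i \<in> ?b} (inv_into UNIV ?\<rho>))"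
      unfolding g_def by (rule variety_iso_cube_action[OF \<rho> b])
    have join: "join_set (cube_action 1 d id ` G) (cube_action m e \<tau> ` Z) = g ` join_set G Z"
      unfolding g_def by (rule join_set_cube_action[OF \<tau> d lenG lenZ])
    have irrg: "irreducible_closed (zariski ?V) (g ` join_set G Z)"
      by (rule irreducible_closed_homeomorphic[OF variety_iso_homeomorphic[OF iso] irr])
    have E: "E (cube_action 1 d id ` G) (cube_action m e \<tau> ` Z) = Poly_Mapping.single (g ` join_set G Z) 1"
      unfolding E_def join irr_components_irreducible[OF irrg] by simp
    have cutg: "simple_cut ?V diag_fun (g ` join_set G Z) (g ` W)"
      by (rule simple_cut_transport[OF iso irreducible_closed_points[OF irr] cut])
        (simp add: g_def diag_fun_def)
    have "diag_pullback Y (Suc m) (Poly_Mapping.single (g ` join_set G Z) 1) = set_cycle (forget_snd ` g ` W)"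
      unfolding diag_pullback_def diag_funs diag_fun_def[abs_def, symmetric] cut_by_simple[OF irrg diag cutg]
        image_cycle_set_cycle ..
    also have "forget_snd ` g ` W = cube_action (Suc m) ?b ?\<rho> ` forget_snd ` W"
      unfolding image_image g_def forget_snd_cube_action ..
    finally have T1: "T (E (cube_action 1 d id ` G) (cube_action m e \<tau> ` Z)) = scale (sgn_action ?b ?\<rho>) ?A"
      unfolding T_def E image_cycle_set_cycle[symmetric] by (simp only: Alt_image_action[OF \<rho> b])
    have "card ?b = card d + card e"
    proof -
      have "finite d" "finite e" using d e finite_subset by blast+
      moreover have "d \<inter> Suc ` e = {}" using d by auto
      ultimately show ?thesis by (simp add: card_Un_disjoint card_image)
    qed
    moreover have "(of_int (sign ?\<rho>) :: rat) = of_int (sign \<tau>)"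
      using signof_permutation_insert[of \<tau> m 0 0, where 'a = rat] \<tau> by (simp add: lessThan_atLeast0)
    ultimately have "sgn_action ?b ?\<rho> = sgn_action d id * sgn_action e \<tau>"
      unfolding sgn_action_def by (simp add: power_add sign_id)
    then show ?thesis unfolding T1 by simp
  qed
  have inner: "lin_ext (\<lambda>Z'. T (E (cube_action 1 d \<sigma> ` G) Z')) (Alt m (Poly_Mapping.single Z 1)) = scale (sgn_action d \<sigma>) ?A"
    if d: "d \<subseteq> {..<1}" and \<sigma>: "\<sigma> permutes {..<1}" for d \<sigma>
  proof -
    have id: "\<sigma> = id"
      using \<sigma> permutes_sing[of \<sigma> 0] by (simp add: lessThan_Suc)
    show ?thesis unfolding id
      by (rule Alt_lin_ext) (use pair[OF d] in \<open>simp add: mult.commute\<close>)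
  qed
  have "cyc_prod Y 1 m (Alt 1 (Poly_Mapping.single G 1)) (Alt m (Poly_Mapping.single Z 1)) =
      T (lin_ext (\<lambda>G'. lin_ext (E G') (Alt m (Poly_Mapping.single Z 1))) (Alt 1 (Poly_Mapping.single G 1)))"
    unfolding cyc_prod_def ext_prod_def join_set_eq T_def E_def plus_1_eq_Suc ..
  also have "\<dots> = ?A"
    unfolding T_lin by (rule Alt_lin_ext) (rule inner)
  finally show ?thesis .
qed

text \<open>\<open>d h = a f\<close> on \<open>Z\<close> can be verified with the help of a retraction \<open>\<rho>\<close> of an open subset of \<open>Z\<close>
  onto \<open>W\<close>: modulo \<open>f\<close>, and up to denominators, each function agrees with its pull-back by \<open>\<rho>\<close>.\<close>

lemma uniformizer_by_retraction:
  assumes f: "f \<in> coord_ring V" and W: "W \<noteq> {}" "W \<subseteq> Z"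
    and b: "b \<in> coord_ring V" "\<And>w. w \<in> W \<Longrightarrow> b w \<noteq> 0"
    and ret: "\<And>z. z \<in> Z \<Longrightarrow> b z \<noteq> 0 \<Longrightarrow> \<rho> z \<in> W"
    and gen: "\<And>h. h \<in> gens V \<Longrightarrow> \<exists>d\<in>coord_ring V. \<exists>a\<in>coord_ring V. (\<forall>w\<in>W. d w \<noteq> 0) \<and>
      (\<forall>z\<in>Z. b z \<noteq> 0 \<longrightarrow> d z * (h z - h (\<rho> z)) = a z * f z)"
  shows "uniformizer V f Z W"
  unfolding uniformizer_def
proof (intro ballI impI)
  have all: "\<exists>d\<in>coord_ring V. \<exists>a\<in>coord_ring V. (\<forall>w\<in>W. d w \<noteq> 0) \<and>
      (\<forall>z\<in>Z. b z \<noteq> 0 \<longrightarrow> d z * (h z - h (\<rho> z)) = a z * f z)" if "h \<in> coord_ring V" for h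
    using that
  proof induction
    case (const q)
    show ?case by (rule bexI[OF _ coord_ring_1], rule bexI[OF _ coord_ring_0]) simp
  next
    case (gen h)
    then show ?case by (rule assms(7))
  next
    case (add g h)
    then obtain d a where d: "d \<in> coord_ring V" "a \<in> coord_ring V" "\<forall>w\<in>W. d w \<noteq> 0"
      "\<forall>z\<in>Z. b z \<noteq> 0 \<longrightarrow> d z * (g z - g (\<rho> z)) = a z * f z" by blast
    obtain d' a' where d': "d' \<in> coord_ring V" "a' \<in> coord_ring V" "\<forall>w\<in>W. d' w \<noteq> 0"
      "\<forall>z\<in>Z. b z \<noteq> 0 \<longrightarrow> d' z * (h z - h (\<rho> z)) = a' z * f z" using add by blast
    show ?case
    proof (rule bexI[of _ "\<lambda>z. d z * d' z"], rule bexI[of _ "\<lambda>z. d' z * a z + d z * a' z"], intro conjI ballI impI)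
      fix z assume z: "z \<in> Z" "b z \<noteq> 0"
      have "d z * d' z * (g z + h z - (g (\<rho> z) + h (\<rho> z))) =
          d' z * (d z * (g z - g (\<rho> z))) + d z * (d' z * (h z - h (\<rho> z)))" by (simp add: algebra_simps)
      also have "\<dots> = d' z * (a z * f z) + d z * (a' z * f z)" using d(4) d'(4) z by simp
      finally show "d z * d' z * (g z + h z - (g (\<rho> z) + h (\<rho> z))) = (d' z * a z + d z * a' z) * f z"
        by (simp add: algebra_simps)
    qed (use d d' in \<open>auto intro: coord_ring.intros\<close>)
  next
    case (mult g h)
    then obtain d a where d: "d \<in> coord_ring V" "a \<in> coord_ring V" "\<forall>w\<in>W. d w \<noteq> 0"
      "\<forall>z\<in>Z. b z \<noteq> 0 \<longrightarrow> d z * (g z - g (\<rho> z)) = a z * f z" by blast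
    obtain d' a' where d': "d' \<in> coord_ring V" "a' \<in> coord_ring V" "\<forall>w\<in>W. d' w \<noteq> 0"
      "\<forall>z\<in>Z. b z \<noteq> 0 \<longrightarrow> d' z * (h z - h (\<rho> z)) = a' z * f z" using mult by blast
    have A: "g \<in> coord_ring V" "h \<in> coord_ring V" using mult by auto
    show ?case
    proof (rule bexI[of _ "\<lambda>z. d z * d' z"],
        rule bexI[of _ "\<lambda>z. d' z * a z * h z + (d z * g z - a z * f z) * a' z"], intro conjI ballI impI)
      fix z assume z: "z \<in> Z" "b z \<noteq> 0"
      have "d z * d' z * (g z * h z - g (\<rho> z) * h (\<rho> z)) =
          d' z * (d z * (g z - g (\<rho> z))) * h z +
          (d z * g z - d z * (g z - g (\<rho> z))) * (d' z * (h z - h (\<rho> z)))" by (simp add: algebra_simps)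
      also have "\<dots> = d' z * (a z * f z) * h z + (d z * g z - a z * f z) * (a' z * f z)"
        using d(4) d'(4) z by simp
      finally show "d z * d' z * (g z * h z - g (\<rho> z) * h (\<rho> z)) =
          (d' z * a z * h z + (d z * g z - a z * f z) * a' z) * f z"
        by (simp add: algebra_simps)
    next
      show "(\<lambda>z. d' z * a z * h z + (d z * g z - a z * f z) * a' z) \<in> coord_ring V"
        by (intro coord_ring.add coord_ring.mult coord_ring_diff d d' f A)
    qed (use d d' in \<open>auto intro: coord_ring.mult\<close>)
  qed
  fix h assume h: "h \<in> coord_ring V" "\<forall>w\<in>W. h w = 0"
  obtain d a where d: "d \<in> coord_ring V" "a \<in> coord_ring V" "\<forall>w\<in>W. d w \<noteq> 0"
      "\<forall>z\<in>Z. b z \<noteq> 0 \<longrightarrow> d z * (h z - h (\<rho> z)) = a z * f z" using all[OF h(1)] by blast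
  show "\<exists>d\<in>coord_ring V. \<exists>a\<in>coord_ring V. (\<exists>w\<in>W. d w \<noteq> 0) \<and> (\<forall>z\<in>Z. d z * h z = a z * f z)"
  proof (rule bexI[of _ "\<lambda>z. b z * d z"], rule bexI[of _ "\<lambda>z. b z * a z"], intro conjI ballI)
    show "\<exists>w\<in>W. b w * d w \<noteq> 0" using W(1) b(2) d(3) by auto
    fix z assume z: "z \<in> Z"
    show "b z * d z * h z = b z * a z * f z"
    proof (cases "b z = 0")
      case False
      then have "h (\<rho> z) = 0" using ret[OF z] h(2) by blast
      moreover have "d z * (h z - h (\<rho> z)) = a z * f z" using d(4) z False by blast
      ultimately show ?thesis by simp
    qed simp
  qed (use b d in \<open>auto intro: coord_ring.mult\<close>)
qed

section \<open>Base curves and coordinates of the cube\<close>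

text \<open>The properties shared by the affine line and the thrice punctured line: a cofinite set of
  points, the coordinate \<open>t\<close>, and regular functions that are fractions of polynomials in \<open>t\<close>.\<close>

definition base_curve :: "complex variety \<Rightarrow> bool" where
  "base_curve Y \<longleftrightarrow> finite (- points Y) \<and> (\<lambda>t. t) \<in> gens Y \<and>
     (\<forall>f\<in>gens Y. \<exists>d\<in>alg_ring {\<lambda>t. t}. \<exists>e\<in>alg_ring {\<lambda>t. t}. \<forall>t\<in>points Y. d t \<noteq> 0 \<and> d t * f t = e t)"

lemma base_curve_affine_line: "base_curve affine_line"
proof -
  let ?A = "alg_ring {\<lambda>t::complex. t}"
  have A: "(\<lambda>t. 1) \<in> ?A" "(\<lambda>t. t) \<in> ?A" by (rule alg_ring_ops(2), rule alg_ring_gen) simp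
  have "\<exists>d\<in>?A. \<exists>e\<in>?A. \<forall>t\<in>UNIV. d t \<noteq> 0 \<and> d t * t = e t"
    by (intro bexI[OF _ A(1)] bexI[OF _ A(2)]) simp
  then show ?thesis unfolding base_curve_def affine_line_def by simp
qed

lemma base_curve_thrice_punctured_line: "base_curve thrice_punctured_line"
proof -
  let ?A = "alg_ring {\<lambda>t::complex. t}"
  have A: "(\<lambda>t. 1) \<in> ?A" "(\<lambda>t. t) \<in> ?A" by (rule alg_ring_ops(2), rule alg_ring_gen) simp
  have A3: "(\<lambda>t. 1 - t) \<in> ?A" using alg_ring_ops(4)[OF A] by simp
  have "\<exists>d\<in>?A. \<exists>e\<in>?A. \<forall>t\<in>- {0, 1}. d t \<noteq> 0 \<and> d t * f t = e t"
    if f: "f \<in> {\<lambda>t. t, \<lambda>t. 1 / t, \<lambda>t. 1 / (1 - t)}" for f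
  proof -
    consider "f = (\<lambda>t. t)" | "f = (\<lambda>t. 1 / t)" | "f = (\<lambda>t. 1 / (1 - t))" using f by blast
    then show ?thesis
    proof cases
      case 1
      then show ?thesis by (intro bexI[OF _ A(1)] bexI[OF _ A(2)]) auto
    next
      case 2
      then show ?thesis by (intro bexI[OF _ A(2)] bexI[OF _ A(1)]) auto
    next
      case 3
      then show ?thesis by (intro bexI[OF _ A3] bexI[OF _ A(1)]) auto
    qed
  qed
  then show ?thesis unfolding base_curve_def thrice_punctured_line_def by simp
qed

lemma alg_ring_compose:
  assumes "d \<in> alg_ring {\<lambda>t. t}" "f \<in> coord_ring V"
  shows "(\<lambda>z. d (f z)) \<in> coord_ring V"
  using assms(1) by (induction rule: alg_ring_induct) (auto intro: coord_ring.intros assms(2))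

lemma alg_ring_compose_alg:
  assumes "d \<in> alg_ring {\<lambda>t. t}" "f \<in> alg_ring G"
  shows "(\<lambda>z. d (f z)) \<in> alg_ring G"
  using alg_ring_compose[OF assms(1), of f "\<lparr>points = UNIV, gens = G\<rparr>"] assms(2) unfolding alg_ring_def by simp

lemma base_curve_frac:
  assumes "base_curve Y" "f \<in> gens Y"
  shows "\<exists>d\<in>alg_ring {\<lambda>t. t}. \<exists>e\<in>alg_ring {\<lambda>t. t}. \<forall>t\<in>points Y. d t \<noteq> 0 \<and> d t * f t = e t"
  using assms unfolding base_curve_def by simp

lemma base_curve_coordinate: "base_curve Y \<Longrightarrow> (\<lambda>t. t) \<in> coord_ring Y"
  unfolding base_curve_def by (intro coord_ring.gen) simp

lemma base_coord_ring: "base_curve Y \<Longrightarrow> (\<lambda>z. fst z) \<in> coord_ring (Y \<times>\<^sub>V W)"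
  by (drule base_curve_coordinate, drule coord_ring_fst) simp

lemma base_curve_infinite:
  assumes "base_curve Y" "finite B" shows "infinite (points Y - B)"
proof
  assume "finite (points Y - B)"
  then have "finite ((points Y - B) \<union> (- points Y \<union> B))" using assms unfolding base_curve_def by auto
  moreover have "(points Y - B) \<union> (- points Y \<union> B) = UNIV" by auto
  ultimately show False using infinite_UNIV_char_0 by metis
qed

text \<open>A regular function on the curve is a quotient of polynomials in \<open>t\<close> and has finitely many zeros
  unless it vanishes.\<close>

lemma base_curve_dense:
  assumes Y: "base_curve Y" and S: "S \<subseteq> points Y" "infinite S"
  shows "zariski Y closure_of S = points Y"
proof -
  have "points Y \<subseteq> C" if C: "closedin (zariski Y) C" "S \<subseteq> C" for C
  proof (rule ccontr)
    assume "\<not> points Y \<subseteq> C"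
    then obtain p f where p: "p \<in> points Y" "p \<notin> C" and f: "f \<in> coord_ring Y" "f p \<noteq> 0" "\<forall>c\<in>C. f c = 0"
      using C(1) unfolding closedin_zariski by blast
    have "rational_on (points Y) (\<lambda>t. f t)"
    proof (rule rational_on_coord_ring[OF f(1)])
      fix g assume g: "g \<in> gens Y"
      have poly: "rational_on (points Y) h" if "h \<in> alg_ring {\<lambda>t. t}" for h
        using that
      proof (induction rule: alg_ring_induct)
        case (gen g)
        then show ?case unfolding rational_on_def by (intro exI[of _ "[:0, 1:]"] exI[of _ 1]) simp
      qed (auto intro: rational_on_const rational_on_add rational_on_mult)
      obtain d e where "d \<in> alg_ring {\<lambda>t. t}" "e \<in> alg_ring {\<lambda>t. t}"
        "\<forall>t\<in>points Y. d t \<noteq> 0 \<and> d t * g t = e t"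
        using base_curve_frac[OF Y g] by (elim bexE)
      then show "rational_on (points Y) g"
        by (intro rational_on_quotient[OF poly poly, of d e g]) simp_all
    qed
    then have "finite (- {t \<in> points Y. f t \<noteq> 0})"
      by (rule rational_on_zeros) (use Y p f in \<open>auto simp: base_curve_def\<close>)
    moreover have "S \<subseteq> - {t \<in> points Y. f t \<noteq> 0}" using C(2) f(3) by auto
    ultimately show False using S(2) finite_subset by blast
  qed
  then have "points Y \<subseteq> zariski Y closure_of S"
    using closedin_closure_of[of "zariski Y" S] closure_of_subset[of S "zariski Y"] S(1) by simp
  moreover have "zariski Y closure_of S \<subseteq> points Y"
    using closure_of_subset_topspace[of "zariski Y" S] by simp
  ultimately show ?thesis by (rule subset_antisym[rotated])
qed

text \<open>The inverse of \<open>cube_coord\<close>.\<close>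

definition cube_pt :: "complex \<Rightarrow> p1" where
  "cube_pt c = (if c = 0 then Infty else Fin (1 - 1 / c))"

lemma cube_coord_pt [simp]: "cube_coord (cube_pt c) = c"
  unfolding cube_pt_def by simp

lemma cube_pt_neq_1 [simp]: "cube_pt c \<noteq> Fin 1"
  unfolding cube_pt_def by simp

lemma cube_pt_coord: "u \<noteq> Fin 1 \<Longrightarrow> cube_pt (cube_coord u) = u"
  by (cases u) (auto simp: cube_pt_def)

lemma cube_coord_inj: "u \<noteq> Fin 1 \<Longrightarrow> v \<noteq> Fin 1 \<Longrightarrow> cube_coord u = cube_coord v \<longleftrightarrow> u = v"
  by (metis cube_pt_coord)

lemma cube_coord_0: "u \<noteq> Fin 1 \<Longrightarrow> cube_coord u = 1 \<longleftrightarrow> u = Fin 0"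
  using cube_coord_inj[of u "Fin 0"] by simp

lemma cube_coord_Infty: "u \<noteq> Fin 1 \<Longrightarrow> cube_coord u = 0 \<longleftrightarrow> u = Infty"
  using cube_coord_inj[of u Infty] by simp

text \<open>The point over \<open>t\<close> with affine coordinates \<open>c\<^sub>0, \<dots>, c\<^bsub>N-1\<^esub>\<close>.\<close>

definition point_with :: "nat \<Rightarrow> 'b \<Rightarrow> (nat \<Rightarrow> complex) \<Rightarrow> 'b \<times> p1 list" where
  "point_with N t c = (t, map (\<lambda>i. cube_pt (c i)) [0..<N])"

lemma fst_point_with [simp]: "fst (point_with N t c) = t" and length_point_with [simp]: "length (snd (point_with N t c)) = N"
  unfolding point_with_def by auto

lemma cc_point_with [simp]: "i < N \<Longrightarrow> cc i (point_with N t c) = c i"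
  unfolding point_with_def cc_def by simp

lemma point_with_points: "point_with N t c \<in> points (B \<times>\<^sub>V cube N) \<longleftrightarrow> t \<in> points B"
proof -
  have "Fin 1 \<notin> set (map (\<lambda>i. cube_pt (c i)) [0..<N])" by (auto simp: cube_pt_neq_1[symmetric] simp del: cube_pt_neq_1)
  then show ?thesis unfolding point_with_def by (simp add: points_cube)
qed

lemma point_with_cc:
  assumes "z \<in> points (B \<times>\<^sub>V cube N)" shows "point_with N (fst z) (\<lambda>i. cc i z) = z"
proof (rule prod_list_eqI)
  fix i assume "i < length (snd (point_with N (fst z) (\<lambda>i. cc i z)))"
  then show "snd (point_with N (fst z) (\<lambda>i. cc i z)) ! i = snd z ! i"
    using nth_cube_points[OF assms, of i] by (simp add: point_with_def cc_def cube_pt_coord)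
qed (use assms in \<open>auto simp: points_cube mem_Times_iff\<close>)

lemma cube_points_eqI:
  assumes "z \<in> points (B \<times>\<^sub>V cube N)" "w \<in> points (B \<times>\<^sub>V cube N)" "fst z = fst w"
    "\<And>i. i < N \<Longrightarrow> cc i z = cc i w"
  shows "z = w"
proof -
  have "point_with N (fst z) (\<lambda>i. cc i z) = point_with N (fst w) (\<lambda>i. cc i w)"
    unfolding point_with_def using assms(3,4) by simp
  then show ?thesis using point_with_cc[OF assms(1)] point_with_cc[OF assms(2)] by simp
qed

lemma coord_space_gens: "fst \<in> coord_ring coord_space" "(\<lambda>z. snd z i) \<in> coord_ring coord_space"
  by (auto intro!: coord_ring.gen simp: coord_space_def)

text \<open>A subset of \<open>Y \<times> \<box>\<^sup>N\<close> whose coordinates are rational functions of affine coordinates.\<close>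

lemma rat_conn_point_with_image:
  assumes Y: "base_curve Y" and rc: "rat_conn coord_space S" and S: "\<And>z. z \<in> S \<Longrightarrow> fst z \<in> points Y"
    and c: "\<And>i. i < N \<Longrightarrow> \<exists>d\<in>coord_ring coord_space. \<exists>e\<in>coord_ring coord_space.
      \<forall>z\<in>S. d z \<noteq> 0 \<and> d z * c z i = e z"
  shows "rat_conn (Y \<times>\<^sub>V cube N) ((\<lambda>z. point_with N (fst z) (c z)) ` S)"
proof (rule rat_conn_image[OF rc])
  fix f assume "f \<in> gens (Y \<times>\<^sub>V cube N)"
  then consider g where "g \<in> gens Y" "f = (\<lambda>z. g (fst z))" | i where "i < N" "f = cc i"
    unfolding gens_prod_cube by blast
  then show "\<exists>d\<in>coord_ring coord_space. \<exists>e\<in>coord_ring coord_space.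
      \<forall>z\<in>S. d z \<noteq> 0 \<and> d z * f (point_with N (fst z) (c z)) = e z"
  proof cases
    case (1 g)
    obtain d e where de: "d \<in> alg_ring {\<lambda>t. t}" "e \<in> alg_ring {\<lambda>t. t}"
      "\<forall>t\<in>points Y. d t \<noteq> 0 \<and> d t * g t = e t"
      using base_curve_frac[OF Y 1(1)] by (elim bexE)
    show ?thesis
      by (rule bexI[OF _ alg_ring_compose[OF de(1) coord_space_gens(1)]],
          rule bexI[OF _ alg_ring_compose[OF de(2) coord_space_gens(1)]])
        (use de(3) S 1(2) in simp)
  next
    case (2 i)
    then show ?thesis using c[OF 2(1)] by simp
  qed
qed

section \<open>The polylogarithmic subvarieties\<close>

text \<open>The parameter \<open>x\<^bsub>n-1-k\<^esub>\<close> of the cycle of weight \<open>n\<close>, as a function of the point.\<close>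

definition pp :: "nat \<Rightarrow> complex \<Rightarrow> (nat \<Rightarrow> complex) \<Rightarrow> complex" where
  "pp k t c = t * (\<Prod>j\<le>k. c (2 * j))"

text \<open>The equation \<open>t c\<^sub>0 c\<^sub>2 \<dots> c\<^bsub>2n-2\<^esub> = 1\<close> says that \<open>u\<^bsub>2n-2\<^esub> = 1 - x\<^sub>1\<close> if \<open>n \<ge> 2\<close>, and
  \<open>c\<^bsub>2k+1\<^esub> (1 - x\<^bsub>n-1-k\<^esub>) = 1\<close> says that \<open>u\<^bsub>2k+1\<^esub> = x\<^bsub>n-1-k\<^esub>\<close>. The subvariety of weight \<open>n\<close> is the
  case \<open>m = n - 1\<close>; smaller \<open>m\<close> give larger subvarieties, which serve to compute codimensions.\<close>

definition partial_polylog :: "complex variety \<Rightarrow> nat \<Rightarrow> nat \<Rightarrow> (complex \<times> p1 list) set" where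
  "partial_polylog Y n m = {z \<in> points (Y \<times>\<^sub>V cube (2 * n - 1)). pp (n - 1) (fst z) (\<lambda>i. cc i z) = 1 \<and>
     (\<forall>k<m. cc (2 * k + 1) z * (1 - pp k (fst z) (\<lambda>i. cc i z)) = 1)}"

text \<open>The equations determine the coordinate \<open>c\<^bsub>2n-2\<^esub>\<close> and the first \<open>m\<close> odd ones; the other entries of
  \<open>c\<close> are kept.\<close>

definition graph_coords :: "nat \<Rightarrow> nat \<Rightarrow> complex \<Rightarrow> (nat \<Rightarrow> complex) \<Rightarrow> nat \<Rightarrow> complex" where
  "graph_coords n m t c i = (if i = 2 * n - 2 then 1 / (t * (\<Prod>j<n-1. c (2 * j)))
     else if odd i \<and> i < 2 * m then 1 / (1 - pp (i div 2) t c) else c i)"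

definition graph_point :: "nat \<Rightarrow> nat \<Rightarrow> complex \<Rightarrow> (nat \<Rightarrow> complex) \<Rightarrow> complex \<times> p1 list" where
  "graph_point n m t c = point_with (2 * n - 1) t (graph_coords n m t c)"

text \<open>The domain of the rational map whose graph is the subvariety: the denominators do not vanish.\<close>

definition in_domain :: "nat \<Rightarrow> nat \<Rightarrow> complex \<Rightarrow> (nat \<Rightarrow> complex) \<Rightarrow> bool" where
  "in_domain n m t c \<longleftrightarrow> t * (\<Prod>j<n-1. c (2 * j)) \<noteq> 0 \<and> (\<forall>k<m. pp k t c \<noteq> 1)"

lemma pp_cong: "(\<And>j. j \<le> k \<Longrightarrow> c (2 * j) = c' (2 * j)) \<Longrightarrow> pp k t c = pp k t c'"
  unfolding pp_def by (intro arg_cong[of _ _ "(*) t"] prod.cong) auto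

lemma pp_last: "n \<ge> 1 \<Longrightarrow> pp (n - 1) t c = t * (\<Prod>j<n-1. c (2 * j)) * c (2 * n - 2)"
proof -
  assume "n \<ge> 1"
  then obtain k where n: "n = Suc k" by (cases n) auto
  show ?thesis unfolding n pp_def by (simp add: lessThan_Suc_atMost[symmetric])
qed

lemma pp_graph_coords: "k < n - 1 \<Longrightarrow> pp k t (graph_coords n m t c) = pp k t c"
  by (rule pp_cong) (auto simp: graph_coords_def)

lemma fst_graph_point [simp]: "fst (graph_point n m t c) = t"
  unfolding graph_point_def by simp

lemma cc_graph_point: "i < 2 * n - 1 \<Longrightarrow> cc i (graph_point n m t c) = graph_coords n m t c i"
  unfolding graph_point_def by simp

lemma graph_point_partial_polylog:
  assumes t: "t \<in> points Y" and n: "n \<ge> 1" and m: "m \<le> n - 1" and g: "in_domain n m t c"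
  shows "graph_point n m t c \<in> partial_polylog Y n m"
  unfolding partial_polylog_def
proof (intro CollectI conjI allI impI)
  show "graph_point n m t c \<in> points (Y \<times>\<^sub>V cube (2 * n - 1))"
    unfolding graph_point_def using t by (simp only: point_with_points)
  have pp: "pp k (fst (graph_point n m t c)) (\<lambda>i. cc i (graph_point n m t c)) = pp k t (graph_coords n m t c)" if "k \<le> n - 1" for k
    unfolding fst_graph_point by (rule pp_cong) (use that n in \<open>auto simp: cc_graph_point\<close>)
  have prod: "(\<Prod>j<n-1. graph_coords n m t c (2 * j)) = (\<Prod>j<n-1. c (2 * j))"
    by (rule prod.cong) (auto simp: graph_coords_def)
  have "pp (n - 1) t (graph_coords n m t c) = t * (\<Prod>j<n-1. c (2 * j)) * graph_coords n m t c (2 * n - 2)"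
    unfolding pp_last[OF n] prod ..
  also have "\<dots> = 1" using g unfolding in_domain_def graph_coords_def by simp
  finally show "pp (n - 1) (fst (graph_point n m t c)) (\<lambda>i. cc i (graph_point n m t c)) = 1"
    unfolding pp[OF order_refl] .
  fix k assume k: "k < m"
  then have k': "k < n - 1" using m by simp
  have "cc (2 * k + 1) (graph_point n m t c) = 1 / (1 - pp k t c)"
    using k k' by (simp add: cc_graph_point graph_coords_def) presburger
  moreover have "pp k t c \<noteq> 1" using g k unfolding in_domain_def by blast
  ultimately show "cc (2 * k + 1) (graph_point n m t c) * (1 - pp k (fst (graph_point n m t c)) (\<lambda>i. cc i (graph_point n m t c))) = 1"
    using pp[of k] k' by (simp add: pp_graph_coords)
qed

lemma partial_polylog_points: "z \<in> partial_polylog Y n m \<Longrightarrow> z \<in> points (Y \<times>\<^sub>V cube (2 * n - 1))"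
  unfolding partial_polylog_def by blast

lemma partial_polylog_in_domain:
  assumes z: "z \<in> partial_polylog Y n m" and n: "n \<ge> 1"
  shows "in_domain n m (fst z) (\<lambda>i. cc i z)"
proof -
  have "pp (n - 1) (fst z) (\<lambda>i. cc i z) = 1" using z unfolding partial_polylog_def by blast
  then have "fst z * (\<Prod>j<n-1. cc (2 * j) z) \<noteq> 0" unfolding pp_last[OF n] by (metis mult_zero_left zero_neq_one)
  moreover have "pp k (fst z) (\<lambda>i. cc i z) \<noteq> 1" if "k < m" for k
  proof -
    have "cc (2 * k + 1) z * (1 - pp k (fst z) (\<lambda>i. cc i z)) = 1" using z that unfolding partial_polylog_def by blast
    then show ?thesis by auto
  qed
  ultimately show ?thesis unfolding in_domain_def by blast
qed

lemma partial_polylog_graph_coords: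
  assumes z: "z \<in> partial_polylog Y n m" and n: "n \<ge> 1" and i: "i < 2 * n - 1"
  shows "graph_coords n m (fst z) (\<lambda>i. cc i z) i = cc i z"
proof -
  have g: "in_domain n m (fst z) (\<lambda>i. cc i z)" by (rule partial_polylog_in_domain[OF z n])
  consider "i = 2 * n - 2" | "i \<noteq> 2 * n - 2" "odd i" "i < 2 * m" | "i \<noteq> 2 * n - 2" "\<not> (odd i \<and> i < 2 * m)" by blast
  then show ?thesis
  proof cases
    case 1
    have "fst z * (\<Prod>j<n-1. cc (2 * j) z) * cc (2 * n - 2) z = 1"
      using z unfolding partial_polylog_def pp_last[OF n] by blast
    then have "cc (2 * n - 2) z = 1 / (fst z * (\<Prod>j<n-1. cc (2 * j) z))"
      using g unfolding in_domain_def by (simp add: eq_divide_eq mult.commute)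
    then show ?thesis unfolding graph_coords_def 1 by simp
  next
    case 2
    then obtain k where k: "i = 2 * k + 1" "k < m" by (metis oddE Suc_1 Suc_eq_plus1 add_lessD1 nat_mult_less_cancel_disj)
    have "cc i z * (1 - pp k (fst z) (\<lambda>i. cc i z)) = 1" using z k unfolding partial_polylog_def by blast
    moreover have "pp k (fst z) (\<lambda>i. cc i z) \<noteq> 1" using g k(2) unfolding in_domain_def by blast
    ultimately have "cc i z = 1 / (1 - pp k (fst z) (\<lambda>i. cc i z))" by (simp add: eq_divide_eq)
    moreover have "i div 2 = k" using k(1) by simp
    ultimately show ?thesis unfolding graph_coords_def using 2 by simp
  next
    case 3
    then show ?thesis unfolding graph_coords_def by auto
  qed
qed

lemma graph_point_cc:
  assumes z: "z \<in> partial_polylog Y n m" and n: "n \<ge> 1"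
  shows "graph_point n m (fst z) (\<lambda>i. cc i z) = z"
proof -
  have "graph_point n m (fst z) (\<lambda>i. cc i z) = point_with (2 * n - 1) (fst z) (\<lambda>i. cc i z)"
    unfolding graph_point_def point_with_def using partial_polylog_graph_coords[OF z n] by simp
  then show ?thesis using point_with_cc[OF partial_polylog_points[OF z]] by simp
qed

definition free_index :: "nat \<Rightarrow> nat \<Rightarrow> nat \<Rightarrow> bool" where
  "free_index n m i \<longleftrightarrow> i < 2 * n - 2 \<and> \<not> (odd i \<and> i < 2 * m)"

lemma graph_coords_free: "free_index n m i \<Longrightarrow> graph_coords n m t c i = c i"
  unfolding free_index_def graph_coords_def by auto

text \<open>Fibers are the case \<open>T = {x}\<close>, and intersections with faces the case \<open>v = 1\<close>. Other values \<open>v\<close> and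
  index sets occur in chains.\<close>

definition slice :: "complex variety \<Rightarrow> nat \<Rightarrow> nat \<Rightarrow> complex set \<Rightarrow> nat set \<Rightarrow> (nat \<Rightarrow> complex) \<Rightarrow> (complex \<times> p1 list) set" where
  "slice Y n m T I v = {z \<in> partial_polylog Y n m. fst z \<in> T \<and> (\<forall>i\<in>I. cc i z = v i)}"

lemma slice_eq_image:
  assumes n: "n \<ge> 1" and m: "m \<le> n - 1" and I: "\<forall>i\<in>I. free_index n m i"
  shows "slice Y n m T I v = (\<lambda>z. point_with (2 * n - 1) (fst z) (graph_coords n m (fst z) (snd z))) `
    {z. fst z \<in> T \<and> (\<forall>i\<in>I. snd z i = v i) \<and> fst z \<in> points Y \<and> in_domain n m (fst z) (snd z)}"
proof (intro subset_antisym subsetI)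
  fix z assume z: "z \<in> slice Y n m T I v"
  then have zP: "z \<in> partial_polylog Y n m" unfolding slice_def by blast
  have "z = point_with (2 * n - 1) (fst z) (graph_coords n m (fst z) (\<lambda>i. cc i z))"
    using graph_point_cc[OF zP n] unfolding graph_point_def by simp
  moreover have "fst z \<in> points Y" using partial_polylog_points[OF zP] by (simp add: mem_Times_iff)
  moreover have "in_domain n m (fst z) (\<lambda>i. cc i z)" by (rule partial_polylog_in_domain[OF zP n])
  ultimately show "z \<in> (\<lambda>z. point_with (2 * n - 1) (fst z) (graph_coords n m (fst z) (snd z))) `
    {z. fst z \<in> T \<and> (\<forall>i\<in>I. snd z i = v i) \<and> fst z \<in> points Y \<and> in_domain n m (fst z) (snd z)}"
    using z unfolding slice_def by (intro image_eqI[of _ _ "(fst z, \<lambda>i. cc i z)"]) auto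
next
  fix z assume "z \<in> (\<lambda>z. point_with (2 * n - 1) (fst z) (graph_coords n m (fst z) (snd z))) `
    {z. fst z \<in> T \<and> (\<forall>i\<in>I. snd z i = v i) \<and> fst z \<in> points Y \<and> in_domain n m (fst z) (snd z)}"
  then obtain t c where tc: "z = graph_point n m t c" "t \<in> T" "\<forall>i\<in>I. c i = v i" "t \<in> points Y" "in_domain n m t c"
    unfolding graph_point_def by auto
  have "z \<in> partial_polylog Y n m" unfolding tc(1) by (rule graph_point_partial_polylog[OF tc(4) n m tc(5)])
  moreover have "cc i z = v i" if i: "i \<in> I" for i
  proof -
    have "i < 2 * n - 1" using I i unfolding free_index_def by fastforce
    moreover have "graph_coords n m t c i = c i" by (rule graph_coords_free) (use I i in blast)
    ultimately show ?thesis unfolding tc(1) using tc(3) i by (simp add: cc_graph_point)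
  qed
  ultimately show "z \<in> slice Y n m T I v" unfolding slice_def using tc(1,2) by simp
qed

lemma pp_coord_space: "(\<lambda>z. pp k (fst z) (snd z)) \<in> coord_ring coord_space"
  unfolding pp_def by (intro coord_ring.mult coord_ring_prod coord_space_gens)

lemma rat_conn_slice:
  assumes Y: "base_curve Y" and n: "n \<ge> 1" and m: "m \<le> n - 1" and I: "\<forall>i\<in>I. free_index n m i"
    and T: "T = UNIV \<or> T = {\<tau>}"
  shows "rat_conn (Y \<times>\<^sub>V cube (2 * n - 1)) (slice Y n m T I v)"
  unfolding slice_eq_image[OF n m I]
proof (rule rat_conn_point_with_image[OF Y])
  let ?L = "{z. fst z \<in> T \<and> (\<forall>i\<in>I. snd z i = v i)}"
  let ?S = "{z. fst z \<in> T \<and> (\<forall>i\<in>I. snd z i = v i) \<and> fst z \<in> points Y \<and> in_domain n m (fst z) (snd z)}"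
  let ?q = "\<lambda>z :: complex \<times> (nat \<Rightarrow> complex). fst z * (\<Prod>j<n-1. snd z (2 * j)) * (\<Prod>k<m. 1 - pp k (fst z) (snd z))"
  have q: "?q \<in> coord_ring coord_space"
    by (intro coord_ring.mult coord_ring_prod coord_ring_diff coord_ring_1 coord_space_gens pp_coord_space)
  have "rat_conn coord_space {z \<in> {z \<in> ?L. ?q z \<noteq> 0}. fst z \<notin> - points Y}"
    by (rule rat_conn_avoid[OF _ rat_conn_open[OF rat_conn_linear[OF T] q] coord_space_gens(1)])
      (use Y in \<open>simp add: base_curve_def\<close>)
  moreover have "{z \<in> {z \<in> ?L. ?q z \<noteq> 0}. fst z \<notin> - points Y} = ?S"
    unfolding in_domain_def by auto
  ultimately show "rat_conn coord_space ?S" by simp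
  show "fst z \<in> points Y" if "z \<in> ?S" for z using that by blast
  fix i assume "i < 2 * n - 1"
  consider "i = 2 * n - 2" | "i \<noteq> 2 * n - 2" "odd i \<and> i < 2 * m" | "i \<noteq> 2 * n - 2" "\<not> (odd i \<and> i < 2 * m)" by blast
  then show "\<exists>d\<in>coord_ring coord_space. \<exists>e\<in>coord_ring coord_space.
      \<forall>z\<in>?S. d z \<noteq> 0 \<and> d z * graph_coords n m (fst z) (snd z) i = e z"
  proof cases
    case 1
    have "(\<lambda>z. fst z * (\<Prod>j<n-1. snd z (2 * j))) \<in> coord_ring coord_space"
      by (intro coord_ring.mult coord_ring_prod coord_space_gens)
    then show ?thesis
      by (rule bexI[rotated], intro bexI[OF _ coord_ring_1]) (auto simp: in_domain_def graph_coords_def 1)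
  next
    case 2
    have d: "(\<lambda>z. 1 - pp (i div 2) (fst z) (snd z)) \<in> coord_ring coord_space"
      by (intro coord_ring_diff coord_ring_1 pp_coord_space)
    have "i div 2 < m" using 2 by auto
    then have "pp (i div 2) (fst z) (snd z) \<noteq> 1" if "z \<in> ?S" for z using that unfolding in_domain_def by blast
    then show ?thesis
      by (intro bexI[OF _ d] bexI[OF _ coord_ring_1]) (use 2 in \<open>auto simp: graph_coords_def\<close>)
  next
    case 3
    then have "graph_coords n m t c i = c i" for t c unfolding graph_coords_def by auto
    then show ?thesis
      by (intro bexI[OF _ coord_ring_1] bexI[OF _ coord_space_gens(2)[of i]]) simp
  qed
qed

section \<open>Dimensions of the polylogarithmic subvarieties and their faces\<close>

text \<open>The derivative of the \<open>l\<close>-th partial product with respect to \<open>c\<^bsub>2k\<^esub>\<close>, for \<open>k \<le> l\<close>.\<close>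

definition pp_without :: "nat \<Rightarrow> nat \<Rightarrow> complex \<Rightarrow> (nat \<Rightarrow> complex) \<Rightarrow> complex" where
  "pp_without k l t c = t * (\<Prod>j\<in>{..l} - {k}. c (2 * j))"

lemma pp_update: "pp l t (c(2 * k := v)) = (if k \<le> l then v * pp_without k l t c else pp l t c)"
proof (cases "k \<le> l")
  case True
  have "(\<Prod>j\<le>l. (c(2 * k := v)) (2 * j)) = v * (\<Prod>j\<in>{..l} - {k}. (c(2 * k := v)) (2 * j))"
    using prod.remove[of "{..l}" k "\<lambda>j. (c(2 * k := v)) (2 * j)"] True by simp
  also have "(\<Prod>j\<in>{..l} - {k}. (c(2 * k := v)) (2 * j)) = (\<Prod>j\<in>{..l} - {k}. c (2 * j))"
    by (rule prod.cong) auto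
  finally show ?thesis using True unfolding pp_def pp_without_def by simp
next
  case False
  then show ?thesis using pp_cong[of l "c(2 * k := v)" c t] by auto
qed

text \<open>A free even coordinate may be changed to any value outside the roots of finitely many linear
  equations, with the other free coordinates kept.\<close>

lemma slice_modify:
  assumes n: "n \<ge> 1" and m: "m \<le> n - 1" and I: "\<forall>i\<in>I. free_index n m i" and k: "k < n - 1" "2 * k \<notin> I"
    and z: "z \<in> slice Y n m T I v"
  shows "\<exists>B. finite B \<and> (\<forall>w. w \<notin> B \<longrightarrow> (\<exists>z'\<in>slice Y n m T I v. cc (2 * k) z' = w \<and> fst z' = fst z \<and>
    (\<forall>i. free_index n m i \<and> i \<noteq> 2 * k \<longrightarrow> cc i z' = cc i z)))"
proof -
  define c where "c = (\<lambda>i. cc i z)"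
  have zP: "z \<in> partial_polylog Y n m" using z unfolding slice_def by blast
  have g: "in_domain n m (fst z) c" unfolding c_def by (rule partial_polylog_in_domain[OF zP n])
  let ?B = "insert 0 (\<Union>l<m. {w. w * pp_without k l (fst z) c = 1})"
  have "finite {w. w * a = (1::complex)}" for a
  proof (cases "a = 0")
    case False
    then have "{w. w * a = 1} = {1 / a}" by (auto simp: field_simps)
    then show ?thesis by simp
  qed simp
  then have fin: "finite ?B" by simp
  have "\<exists>z'\<in>slice Y n m T I v. cc (2 * k) z' = w \<and> fst z' = fst z \<and>
    (\<forall>i. free_index n m i \<and> i \<noteq> 2 * k \<longrightarrow> cc i z' = cc i z)" if w: "w \<notin> ?B" for w
  proof
    let ?c = "c(2 * k := w)"
    let ?z = "graph_point n m (fst z) ?c"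
    have "(\<Prod>j<n-1. ?c (2 * j)) \<noteq> 0"
      using g w unfolding in_domain_def by (auto simp: prod_zero_iff)
    moreover have "fst z \<noteq> 0" using g unfolding in_domain_def by auto
    moreover have "pp l (fst z) ?c \<noteq> 1" if "l < m" for l
      unfolding pp_update using g w that unfolding in_domain_def by auto
    ultimately have in_domain: "in_domain n m (fst z) ?c" unfolding in_domain_def by simp
    have t: "fst z \<in> points Y" using partial_polylog_points[OF zP] by (simp add: mem_Times_iff)
    have P: "?z \<in> partial_polylog Y n m" by (rule graph_point_partial_polylog[OF t n m in_domain])
    have fr: "cc i ?z = ?c i" if "free_index n m i" for i
    proof -
      have "i < 2 * n - 1" using that unfolding free_index_def by linarith
      then show ?thesis using graph_coords_free[OF that] by (simp add: cc_graph_point)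
    qed
    have k2: "free_index n m (2 * k)" using k(1) unfolding free_index_def by auto
    have same: "cc i ?z = cc i z" if "free_index n m i" "i \<noteq> 2 * k" for i
      using fr[OF that(1)] that(2) unfolding c_def by simp
    show "cc (2 * k) ?z = w \<and> fst ?z = fst z \<and> (\<forall>i. free_index n m i \<and> i \<noteq> 2 * k \<longrightarrow> cc i ?z = cc i z)"
      using fr[OF k2] same by simp
    have "cc i ?z = v i" if i: "i \<in> I" for i
    proof -
      have "i \<noteq> 2 * k" using i k(2) by blast
      then have "cc i ?z = cc i z" using same I i by blast
      then show ?thesis using z i unfolding slice_def by simp
    qed
    then show "?z \<in> slice Y n m T I v" unfolding slice_def using P z unfolding slice_def by simp
  qed
  then show ?thesis using fin by blast
qed

lemma pp_const: "pp k t (\<lambda>_. 1) = t"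
  unfolding pp_def by simp

text \<open>All parameters \<open>x\<^sub>i\<close> equal \<open>t\<close> if the even coordinates are \<open>1\<close>.\<close>

lemma slice_ones:
  assumes n: "n \<ge> 1" and m: "m \<le> n - 1" and I: "\<forall>i\<in>I. free_index n m i" and t: "t \<in> points Y - {0, 1}"
    and c: "\<And>j. j < n - 1 \<Longrightarrow> c (2 * j) = 1" "\<And>i. i \<in> I \<Longrightarrow> c i = 1"
  shows "graph_point n m t c \<in> slice Y n m UNIV I (\<lambda>_. 1)"
proof -
  have "pp k t c = t" if "k < n - 1" for k
    using pp_cong[of k c "\<lambda>_. 1" t] c(1) that by (simp add: pp_const)
  then have "in_domain n m t c" using t m c(1) unfolding in_domain_def by auto
  then have P: "graph_point n m t c \<in> partial_polylog Y n m" using graph_point_partial_polylog[OF _ n m] t by blast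
  have "cc i (graph_point n m t c) = 1" if i: "i \<in> I" for i
  proof -
    have fi: "free_index n m i" using I i by blast
    then have "i < 2 * n - 1" unfolding free_index_def by linarith
    then show ?thesis using graph_coords_free[OF fi] c(2)[OF i] by (simp add: cc_graph_point)
  qed
  then show ?thesis unfolding slice_def using P by simp
qed

lemma slice_ones_infinite:
  assumes Y: "base_curve Y" and n: "n \<ge> 1" and m: "m \<le> n - 1" and I: "\<forall>i\<in>I. free_index n m i"
  shows "infinite (fst ` slice Y n m UNIV I (\<lambda>_. 1))"
proof -
  have "points Y - {0, 1} \<subseteq> fst ` slice Y n m UNIV I (\<lambda>_. 1)"
  proof
    fix t assume "t \<in> points Y - {0, 1}"
    then have "graph_point n m t (\<lambda>_. 1) \<in> slice Y n m UNIV I (\<lambda>_. 1)" by (rule slice_ones[OF n m I]) simp_all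
    then show "t \<in> fst ` slice Y n m UNIV I (\<lambda>_. 1)" by (rule rev_image_eqI) simp
  qed
  then show ?thesis using base_curve_infinite[OF Y, of "{0, 1}"] finite_subset by blast
qed

lemma pp_coord_ring:
  assumes "base_curve Y" "2 * k < N"
  shows "(\<lambda>z. pp k (fst z) (\<lambda>i. cc i z)) \<in> coord_ring (Y \<times>\<^sub>V cube N)"
  unfolding pp_def
  by (intro coord_ring.mult coord_ring_prod base_coord_ring[OF assms(1)] cc_coord_ring) (use assms(2) in auto)

lemma closedin_slice:
  assumes Y: "base_curve Y" and n: "n \<ge> 1" and m: "m \<le> n - 1" and S: "S \<subseteq> points (Y \<times>\<^sub>V cube (2 * n - 1))"
    and sub: "slice Y n m T I v \<subseteq> S" and T: "\<And>z. z \<in> S \<Longrightarrow> fst z \<in> T"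
    and I: "\<forall>i\<in>I. i < 2 * n - 1" and v: "\<forall>i\<in>I. v i \<in> range of_rat"
  shows "closedin (subtopology (zariski (Y \<times>\<^sub>V cube (2 * n - 1))) S) (slice Y n m T I v)"
proof -
  let ?V = "Y \<times>\<^sub>V cube (2 * n - 1)"
  let ?F = "{\<lambda>z. pp (n - 1) (fst z) (\<lambda>i. cc i z) - 1} \<union>
    (\<lambda>k z. cc (2 * k + 1) z * (1 - pp k (fst z) (\<lambda>i. cc i z)) - 1) ` {..<m} \<union> (\<lambda>i z. cc i z - v i) ` I"
  have "?F \<subseteq> coord_ring ?V"
  proof (intro Un_least subsetI)
    fix f :: "complex \<times> p1 list \<Rightarrow> complex" assume "f \<in> (\<lambda>i z. cc i z - v i) ` I"
    then obtain i where i: "i \<in> I" "f = (\<lambda>z. cc i z - v i)" by blast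
    then obtain q where "v i = of_rat q" using v by blast
    then show "f \<in> coord_ring ?V"
      unfolding i(2) using I i(1) by (auto intro!: coord_ring_diff cc_coord_ring coord_ring.const)
  next
    fix f :: "complex \<times> p1 list \<Rightarrow> complex" assume "f \<in> {\<lambda>z. pp (n - 1) (fst z) (\<lambda>i. cc i z) - 1}"
    then show "f \<in> coord_ring ?V"
      using n by (auto intro!: coord_ring_diff coord_ring_1 pp_coord_ring[OF Y])
  next
    fix f :: "complex \<times> p1 list \<Rightarrow> complex"
    assume "f \<in> (\<lambda>k z. cc (2 * k + 1) z * (1 - pp k (fst z) (\<lambda>i. cc i z)) - 1) ` {..<m}"
    then show "f \<in> coord_ring ?V"
      using n m by (auto intro!: coord_ring_diff coord_ring.mult coord_ring_1 pp_coord_ring[OF Y] cc_coord_ring)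
  qed
  then have "closedin (subtopology (zariski ?V) S) {z \<in> S. \<forall>f\<in>?F. f z = 0}" by (rule closedin_equations[OF S])
  moreover have "slice Y n m T I v = {z \<in> S. \<forall>f\<in>?F. f z = 0}"
  proof (intro subset_antisym subsetI)
    fix z assume z: "z \<in> slice Y n m T I v"
    then show "z \<in> {z \<in> S. \<forall>f\<in>?F. f z = 0}" using sub unfolding slice_def partial_polylog_def by auto
  next
    fix z assume z: "z \<in> {z \<in> S. \<forall>f\<in>?F. f z = 0}"
    then have "z \<in> points ?V" "fst z \<in> T" using S T by auto
    then show "z \<in> slice Y n m T I v" using z unfolding slice_def partial_polylog_def by (auto simp: ball_Un)
  qed
  ultimately show ?thesis by simp
qed

lemma irreducible_slice:
  assumes Y: "base_curve Y" and n: "n \<ge> 1" and m: "m \<le> n - 1" and S: "S \<subseteq> points (Y \<times>\<^sub>V cube (2 * n - 1))"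
    and sub: "slice Y n m T I v \<subseteq> S" and T: "\<And>z. z \<in> S \<Longrightarrow> fst z \<in> T" "T = UNIV \<or> T = {\<tau>}"
    and I: "\<forall>i\<in>I. free_index n m i" and v: "\<forall>i\<in>I. v i \<in> range of_rat" and ne: "slice Y n m T I v \<noteq> {}"
  shows "irreducible_closed (subtopology (zariski (Y \<times>\<^sub>V cube (2 * n - 1))) S) (slice Y n m T I v)"
proof (rule rat_conn_irreducible[OF rat_conn_slice[OF Y n m I T(2)] ne S])
  have small: "\<forall>i\<in>I. i < 2 * n - 1" using I unfolding free_index_def by fastforce
  show "closedin (subtopology (zariski (Y \<times>\<^sub>V cube (2 * n - 1))) S) (slice Y n m T I v)"
    by (rule closedin_slice[OF Y n m S sub T(1) small v])
qed

text \<open>The face of \<open>Y \<times> \<box>\<^sup>N\<close> on which \<open>u\<^sub>i = 0\<close> for \<open>i \<in> I\<close>.\<close>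

definition zero_face :: "complex variety \<Rightarrow> nat \<Rightarrow> nat set \<Rightarrow> (complex \<times> p1 list) set" where
  "zero_face Y N I = {z \<in> points (Y \<times>\<^sub>V cube N). \<forall>i\<in>I. cc i z = 1}"

lemma irreducible_zero_face:
  assumes Y: "base_curve Y" and I: "I \<subseteq> {..<N}"
  shows "irreducible_closed (subtopology (zariski (Y \<times>\<^sub>V cube N)) (zero_face Y N I)) (zero_face Y N I)"
proof -
  let ?L = "{z. fst z \<in> (UNIV :: complex set) \<and> (\<forall>i\<in>I. snd z i = (1 :: complex))}"
  let ?S = "{z \<in> ?L. fst z \<notin> - points Y}"
  have fin: "finite (- points Y)" using Y unfolding base_curve_def by blast
  have sub: "zero_face Y N I \<subseteq> points (Y \<times>\<^sub>V cube N)" unfolding zero_face_def by blast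
  have rc: "rat_conn coord_space ?S"
    by (rule rat_conn_avoid[OF fin rat_conn_linear coord_space_gens(1)]) simp
  have img: "rat_conn (Y \<times>\<^sub>V cube N) ((\<lambda>z. point_with N (fst z) (\<lambda>i. if i \<in> I then 1 else snd z i)) ` ?S)"
  proof (rule rat_conn_point_with_image[OF Y rc])
    fix i :: nat
    show "\<exists>d\<in>coord_ring coord_space. \<exists>e\<in>coord_ring coord_space.
      \<forall>z\<in>?S. d z \<noteq> 0 \<and> d z * (if i \<in> I then 1 else snd z i) = e z"
    proof (cases "i \<in> I")
      case True
      then show ?thesis by (intro bexI[OF _ coord_ring_1]) simp
    next
      case False
      then show ?thesis by (intro bexI[OF _ coord_ring_1] bexI[OF _ coord_space_gens(2)[of i]]) simp
    qed
  qed simp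
  have eq: "(\<lambda>z. point_with N (fst z) (\<lambda>i. if i \<in> I then 1 else snd z i)) ` ?S = {z \<in> points (Y \<times>\<^sub>V cube N). \<forall>i\<in>I. i < N \<longrightarrow> cc i z = 1}"
  proof (intro subset_antisym subsetI)
    fix z assume z: "z \<in> {z \<in> points (Y \<times>\<^sub>V cube N). \<forall>i\<in>I. i < N \<longrightarrow> cc i z = 1}"
    then have zp: "z \<in> points (Y \<times>\<^sub>V cube N)" by blast
    have zm: "z = point_with N (fst z) (\<lambda>i. if i \<in> I then 1 else cc i z)"
    proof (rule cube_points_eqI[OF zp])
      show "point_with N (fst z) (\<lambda>i. if i \<in> I then 1 else cc i z) \<in> points (Y \<times>\<^sub>V cube N)"
        unfolding point_with_points using zp by (simp add: mem_Times_iff)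
    qed (use z in simp_all)
    show "z \<in> (\<lambda>z. point_with N (fst z) (\<lambda>i. if i \<in> I then 1 else snd z i)) ` ?S"
      by (rule image_eqI[of _ _ "(fst z, \<lambda>i. if i \<in> I then 1 else cc i z)"])
        (use zp zm in \<open>auto simp: mem_Times_iff cong: if_cong\<close>)
  qed (auto simp: point_with_points simp del: points_prod)
  then have eq: "(\<lambda>z. point_with N (fst z) (\<lambda>i. if i \<in> I then 1 else snd z i)) ` ?S = zero_face Y N I"
    using I unfolding zero_face_def by auto
  obtain t where "t \<in> points Y" using base_curve_infinite[OF Y finite.emptyI] by (metis Diff_empty finite.emptyI equals0I)
  then have "point_with N t (\<lambda>_. 1) \<in> zero_face Y N I"
    unfolding zero_face_def using I by (auto simp: point_with_points simp del: points_prod)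
  then have ne: "zero_face Y N I \<noteq> {}" by blast
  have "closedin (subtopology (zariski (Y \<times>\<^sub>V cube N)) (zero_face Y N I))
      (topspace (subtopology (zariski (Y \<times>\<^sub>V cube N)) (zero_face Y N I)))"
    by (rule closedin_topspace)
  moreover have "topspace (subtopology (zariski (Y \<times>\<^sub>V cube N)) (zero_face Y N I)) = zero_face Y N I"
    using sub by auto
  ultimately have cl: "closedin (subtopology (zariski (Y \<times>\<^sub>V cube N)) (zero_face Y N I)) (zero_face Y N I)" by simp
  show ?thesis by (rule rat_conn_irreducible[OF img[unfolded eq] ne sub cl])
qed

text \<open>Together with \<open>t\<close> the \<open>c\<^sub>i\<close> with these indices parametrize the subvariety of weight \<open>n\<close>. For \<open>n \<ge> 2\<close> the
  corresponding \<open>u\<^sub>i\<close> are the only ones that can vanish on it.\<close>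

definition evens :: "nat \<Rightarrow> nat set" where
  "evens n = (\<lambda>k. 2 * k) ` {..<n - 1}"

lemma evens_free: "i \<in> evens n \<Longrightarrow> free_index n m i"
  unfolding evens_def free_index_def by auto

lemma card_evens: "card (evens n) = n - 1" and finite_evens: "finite (evens n)"
  unfolding evens_def by (simp_all add: card_image inj_on_def)

lemma irr_chain_snoc:
  assumes "irr_chain T n C" "irreducible_closed T D" "C n \<subset> D"
  shows "irr_chain T (Suc n) (C(Suc n := D))"
  using assms unfolding irr_chain_def by (auto simp: le_Suc_eq less_Suc_eq)

lemma slice_modify_even:
  assumes n: "n \<ge> 1" and m: "m \<le> n - 1" and I: "I \<subseteq> evens n" and j: "j \<in> evens n" "j \<notin> I"
    and z: "z \<in> slice Y n m T I v"
  shows "\<exists>B. finite B \<and> (\<forall>w. w \<notin> B \<longrightarrow> (\<exists>z'\<in>slice Y n m T I v. cc j z' = w \<and> fst z' = fst z \<and>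
    (\<forall>i\<in>evens n - {j}. cc i z' = cc i z)))"
proof -
  obtain k where k: "j = 2 * k" "k < n - 1" using j(1) unfolding evens_def by blast
  have I': "\<forall>i\<in>I. free_index n m i" using I evens_free by blast
  obtain B where B: "finite B" "\<forall>w. w \<notin> B \<longrightarrow> (\<exists>z'\<in>slice Y n m T I v. cc (2 * k) z' = w \<and> fst z' = fst z \<and>
    (\<forall>i. free_index n m i \<and> i \<noteq> 2 * k \<longrightarrow> cc i z' = cc i z))"
    using slice_modify[OF n m I' k(2) _ z] j(2) k(1) by blast
  show ?thesis
  proof (intro exI[of _ B] conjI allI impI B(1))
    fix w assume "w \<notin> B"
    then obtain z' where z': "z' \<in> slice Y n m T I v" "cc (2 * k) z' = w" "fst z' = fst z"
      "\<forall>i. free_index n m i \<and> i \<noteq> 2 * k \<longrightarrow> cc i z' = cc i z" using B(2) by blast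
    show "\<exists>z'\<in>slice Y n m T I v. cc j z' = w \<and> fst z' = fst z \<and> (\<forall>i\<in>evens n - {j}. cc i z' = cc i z)"
      by (rule bexI[OF _ z'(1)]) (use z' k(1) evens_free[of _ n m] in auto)
  qed
qed

lemma rational_outside_finite:
  assumes "finite (B :: complex set)" shows "\<exists>q. of_rat q \<notin> B"
proof -
  have "infinite (range (of_rat :: rat \<Rightarrow> complex))"
    using finite_imageD[of "of_rat :: rat \<Rightarrow> complex" UNIV] infinite_UNIV_char_0[where 'a = rat]
    by (auto simp: inj_on_def)
  then have "\<not> range (of_rat :: rat \<Rightarrow> complex) \<subseteq> B" using assms finite_subset by blast
  then show ?thesis by blast
qed

text \<open>The coordinates are fixed one after the other, at rational values so that the resulting sets
  are closed over \<open>\<rat>\<close>.\<close>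

lemma slice_chain:
  assumes Y: "base_curve Y" and n: "n \<ge> 1" and S: "S \<subseteq> points (Y \<times>\<^sub>V cube (2 * n - 1))"
    and T: "\<And>z. z \<in> S \<Longrightarrow> fst z \<in> T" "T = UNIV \<or> T = {\<tau>}"
  shows "finite J \<Longrightarrow> J \<subseteq> evens n - I \<Longrightarrow> I \<subseteq> evens n \<Longrightarrow> \<forall>i\<in>I. v i \<in> range of_rat \<Longrightarrow>
    slice Y n (n - 1) T I v \<subseteq> S \<Longrightarrow> slice Y n (n - 1) T I v \<noteq> {} \<Longrightarrow>
    \<exists>C. irr_chain (subtopology (zariski (Y \<times>\<^sub>V cube (2 * n - 1))) S) (card J) C \<and>
      C (card J) = slice Y n (n - 1) T I v"
proof (induction J arbitrary: I v rule: finite_induct)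
  case empty
  have free: "\<forall>i\<in>I. free_index n (n - 1) i" using empty.prems(2) evens_free by blast
  have "irreducible_closed (subtopology (zariski (Y \<times>\<^sub>V cube (2 * n - 1))) S) (slice Y n (n - 1) T I v)"
    by (rule irreducible_slice[OF Y n order_refl S empty.prems(4) T free empty.prems(3,5)])
  then show ?case
    by (intro exI[of _ "\<lambda>_. slice Y n (n - 1) T I v"]) (simp add: irr_chain_def)
next
  case (insert j J)
  let ?D = "slice Y n (n - 1) T I v"
  have j: "j \<in> evens n" "j \<notin> I" using insert.prems(1) by auto
  obtain z where z: "z \<in> ?D" using insert.prems(5) by blast
  obtain B where B: "finite B" "\<forall>w. w \<notin> B \<longrightarrow> (\<exists>z'\<in>?D. cc j z' = w \<and> fst z' = fst z \<and> (\<forall>i\<in>evens n - {j}. cc i z' = cc i z))"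
    using slice_modify_even[OF n order_refl insert.prems(2) j z] by blast
  \<comment> \<open>The value \<open>q\<close> is the one at which the coordinate is fixed, and a second value \<open>r\<close> shows that this
    gives a smaller set.\<close>
  obtain q where q: "of_rat q \<notin> B" using rational_outside_finite[OF B(1)] by blast
  obtain r where r: "of_rat r \<notin> insert (of_rat q) B" using rational_outside_finite[of "insert (of_rat q) B"] B(1) by blast
  obtain zq where zq: "zq \<in> ?D" "cc j zq = of_rat q" using B(2) q by blast
  obtain zr where zr: "zr \<in> ?D" "cc j zr = of_rat r" using B(2) r by blast
  let ?v = "v(j := of_rat q)" and ?I = "insert j I"
  let ?E = "slice Y n (n - 1) T ?I ?v"
  have ED: "?E \<subseteq> ?D" using j(2) unfolding slice_def by auto
  have "zq \<in> ?E" using zq j(2) unfolding slice_def by auto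
  moreover have "\<exists>C. irr_chain (subtopology (zariski (Y \<times>\<^sub>V cube (2 * n - 1))) S) (card J) C \<and> C (card J) = ?E"
  proof (rule insert.IH)
    show "J \<subseteq> evens n - ?I" using insert.prems(1) insert.hyps(2) by blast
    show "?I \<subseteq> evens n" using insert.prems(2) j(1) by blast
    show "\<forall>i\<in>?I. ?v i \<in> range of_rat" using insert.prems(3) by simp
    show "?E \<subseteq> S" using ED insert.prems(4) by blast
    show "?E \<noteq> {}" using \<open>zq \<in> ?E\<close> by blast
  qed
  then obtain C where C: "irr_chain (subtopology (zariski (Y \<times>\<^sub>V cube (2 * n - 1))) S) (card J) C" "C (card J) = ?E"
    by (elim exE conjE)
  have "zr \<notin> ?E" using zr(2) r unfolding slice_def by auto
  then have "C (card J) \<subset> ?D" using ED zr(1) C(2) by blast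
  moreover have "irreducible_closed (subtopology (zariski (Y \<times>\<^sub>V cube (2 * n - 1))) S) ?D"
  proof -
    have free: "\<forall>i\<in>I. free_index n (n - 1) i" using insert.prems(2) evens_free by blast
    show ?thesis
      by (rule irreducible_slice[OF Y n order_refl S insert.prems(4) T free insert.prems(3,5)])
  qed
  ultimately have "irr_chain (subtopology (zariski (Y \<times>\<^sub>V cube (2 * n - 1))) S) (Suc (card J)) (C(Suc (card J) := ?D))"
    using irr_chain_snoc[OF C(1)] by blast
  moreover have card: "card (insert j J) = Suc (card J)" using insert.hyps by simp
  ultimately show ?case
    unfolding card by (intro exI[of _ "C(Suc (card J) := ?D)"] conjI) (assumption, rule fun_upd_same)
qed

lemma base_gen_alg:
  assumes Y: "base_curve Y" and g: "g \<in> gens Y" and S: "S \<subseteq> points (Y \<times>\<^sub>V W)" and G: "(\<lambda>z. fst z) \<in> alg_ring G"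
  shows "\<exists>b\<in>alg_ring G. \<exists>h\<in>alg_ring G. \<forall>z\<in>S. b z \<noteq> 0 \<and> h z = b z * g (fst z)"
proof -
  obtain d e where de: "d \<in> alg_ring {\<lambda>t. t}" "e \<in> alg_ring {\<lambda>t. t}" "\<forall>t\<in>points Y. d t \<noteq> 0 \<and> d t * g t = e t"
    using base_curve_frac[OF Y g] by (elim bexE)
  show ?thesis
    by (rule bexI[OF _ alg_ring_compose_alg[OF de(1) G]], rule bexI[OF _ alg_ring_compose_alg[OF de(2) G]])
      (use de(3) S in \<open>auto simp: mem_Times_iff subset_iff\<close>)
qed

text \<open>On a fiber the coordinates \<open>c\<^bsub>2k\<^esub>\<close> that are not fixed generate all functions, up to denominators
  and over the field generated by the value of \<open>t\<close>.\<close>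

lemma krull_dim_slice:
  assumes Y: "base_curve Y" and n: "n \<ge> 1" and I: "I \<subseteq> evens n" and ne: "slice Y n (n - 1) {\<tau>} I (\<lambda>_. 1) \<noteq> {}"
  shows "krull_dim (subtopology (zariski (Y \<times>\<^sub>V cube (2 * n - 1))) (slice Y n (n - 1) {\<tau>} I (\<lambda>_. 1))) = enat (n - 1 - card I)"
proof -
  let ?V = "Y \<times>\<^sub>V cube (2 * n - 1)" and ?S = "slice Y n (n - 1) {\<tau>} I (\<lambda>_. 1)"
  let ?J = "evens n - I"
  let ?G = "{\<lambda>z :: complex \<times> p1 list. fst z}" and ?X = "cc ` ?J"
  have finJ: "finite ?J" using finite_evens by blast
  have cardJ: "card ?J = n - 1 - card I"
    using card_Diff_subset[OF finite_subset[OF I finite_evens] I] card_evens[of n] by simp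
  have S: "?S \<subseteq> points ?V" unfolding slice_def using partial_polylog_points by blast
  have small: "i < 2 * n - 1" if "i \<in> evens n" for i using that unfolding evens_def by auto
  have GX: "?G \<union> ?X \<subseteq> coord_ring ?V"
    using base_coord_ring[OF Y] cc_coord_ring small by blast
  have G: "constants_on ?G ?S"
    by (rule constants_onI) (auto simp: slice_def)
  let ?R = "alg_ring (?G \<union> ?X)"
  have fstR: "(\<lambda>z. fst z) \<in> ?R" by (rule alg_ring_gen) simp
  \<comment> \<open>As the coordinates in \<open>I\<close> are \<open>1\<close>, the partial products involve the remaining ones only.\<close>
  define P where "P = (\<lambda>k (z :: complex \<times> p1 list). fst z * (\<Prod>j\<in>{j. j \<le> k \<and> 2 * j \<in> ?J}. cc (2 * j) z))"
  have PR: "P k \<in> ?R" for k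
    unfolding P_def by (intro alg_ring_ops(10) alg_ring_ops(6) fstR alg_ring_gen) auto
  have Peq: "P k z = pp k (fst z) (\<lambda>i. cc i z)" if z: "z \<in> ?S" and k: "k < n - 1" for k z
  proof -
    have "(\<Prod>j\<in>{j. j \<le> k \<and> 2 * j \<in> ?J}. cc (2 * j) z) = (\<Prod>j\<le>k. cc (2 * j) z)"
    proof (rule prod.mono_neutral_left)
      show "\<forall>j\<in>{..k} - {j. j \<le> k \<and> 2 * j \<in> ?J}. cc (2 * j) z = 1"
      proof
        fix j assume j: "j \<in> {..k} - {j. j \<le> k \<and> 2 * j \<in> ?J}"
        then have "2 * j \<in> evens n" using k unfolding evens_def by auto
        then have "2 * j \<in> I" using j by auto
        then show "cc (2 * j) z = 1" using z unfolding slice_def by auto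
      qed
    qed auto
    then show ?thesis unfolding P_def pp_def by simp
  qed
  have gens: "\<exists>b\<in>?R. \<exists>g\<in>?R. \<forall>z\<in>?S. b z \<noteq> 0 \<and> g z = b z * f z" if f: "f \<in> gens ?V" for f
  proof -
    have one: "(\<lambda>_. 1) \<in> ?R" by (rule alg_ring_ops)
    from f consider g where "g \<in> gens Y" "f = (\<lambda>z. g (fst z))" | i where "i < 2 * n - 1" "f = cc i"
      unfolding gens_prod_cube by blast
    then show ?thesis
    proof cases
      case (1 g)
      then show ?thesis using base_gen_alg[OF Y 1(1) S fstR] by simp
    next
      case (2 i)
      consider "i = 2 * n - 2" | "i \<in> I" | "i \<in> ?J" | k where "i = 2 * k + 1" "k < n - 1"
      proof -
        have "i \<in> evens n \<or> i = 2 * n - 2 \<or> (\<exists>k<n-1. i = 2 * k + 1)"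
        proof (cases "even i")
          case True
          then obtain k where "i = 2 * k" by blast
          then show ?thesis using 2(1) unfolding evens_def by (cases "k = n - 1") auto
        next
          case False
          then obtain k where "i = 2 * k + 1" by (metis oddE)
          then show ?thesis using 2(1) by auto
        qed
        then show ?thesis using that by blast
      qed
      then show ?thesis
      proof cases
        case 1
        show ?thesis
        proof (cases "n = 1")
          case True
          have "fst z * cc i z = 1" if "z \<in> ?S" for z
            using that True 1 unfolding slice_def partial_polylog_def pp_def by auto
          then have "\<forall>z\<in>?S. fst z \<noteq> 0 \<and> 1 = fst z * cc i z" by (metis mult_zero_left zero_neq_one)
          then show ?thesis unfolding 2(2) by (intro bexI[OF _ fstR] bexI[OF _ one])
        next
          case False
          then have n2: "n - 2 < n - 1" "n - 1 = Suc (n - 2)" using n by auto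
          have "P (n - 2) z * cc i z = 1" if z: "z \<in> ?S" for z
          proof -
            have "pp (n - 1) (fst z) (\<lambda>i. cc i z) = 1" using z unfolding slice_def partial_polylog_def by blast
            then have "fst z * (\<Prod>j<n-1. cc (2 * j) z) * cc (2 * n - 2) z = 1" unfolding pp_last[OF n] .
            moreover have "pp (n - 2) (fst z) (\<lambda>i. cc i z) = fst z * (\<Prod>j<n-1. cc (2 * j) z)"
              unfolding pp_def n2(2) lessThan_Suc_atMost ..
            ultimately show ?thesis using Peq[OF z n2(1)] 1 by simp
          qed
          then show ?thesis unfolding 2(2) by (intro bexI[OF _ PR[of "n - 2"]] bexI[OF _ one]) force
        qed
      next
        case 2
        then show ?thesis unfolding \<open>f = cc i\<close> by (intro bexI[OF _ one]) (auto simp: slice_def)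
      next
        case 3
        then have "cc i \<in> ?R" by (intro alg_ring_gen) auto
        then show ?thesis unfolding 2(2) by (intro bexI[OF _ one] bexI[of _ "cc i"]) simp_all
      next
        case (4 k)
        have "(1 - P k z) * cc i z = 1" if z: "z \<in> ?S" for z
        proof -
          have "cc (2 * k + 1) z * (1 - pp k (fst z) (\<lambda>i. cc i z)) = 1"
            using z 4(2) unfolding slice_def partial_polylog_def by blast
          then show ?thesis unfolding Peq[OF z 4(2)] 4(1) by (simp add: mult.commute)
        qed
        moreover have "(\<lambda>z. 1 - P k z) \<in> ?R" by (rule alg_ring_ops(4)[OF one PR])
        ultimately show ?thesis unfolding 2(2) by (intro bexI[OF _ \<open>(\<lambda>z. 1 - P k z) \<in> ?R\<close>] bexI[OF _ one]) force
      qed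
    qed
  qed
  have chain: "\<exists>C. irr_chain (subtopology (zariski ?V) ?S) (card ?J) C \<and> C (card ?J) = ?S"
    by (rule slice_chain[OF Y n S _ _ finJ]) (use I ne in \<open>auto simp: slice_def intro: range_eqI[of _ _ 1]\<close>)
  then obtain C where C: "irr_chain (subtopology (zariski ?V) ?S) (card ?J) C" by (elim exE conjE)
  have "card ?X \<le> card ?J" using finJ by (rule card_image_le)
  then have "krull_dim (subtopology (zariski ?V) ?S) = enat (card ?J)"
    using finJ by (intro krull_dim_eqI[OF S G GX _ generated_up_to_denominators[OF GX gens] C]) simp_all
  then show ?thesis unfolding cardJ .
qed

text \<open>Dropping the equations one after the other gives a chain of length \<open>n\<close> up to the whole face. It is
  a longest one, since \<open>t\<close> and the free even coordinates are independent on the subvariety.\<close>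

lemma codim_slice:
  assumes Y: "base_curve Y" and n: "n \<ge> 1" and I: "I \<subseteq> evens n"
  shows "codim (subtopology (zariski (Y \<times>\<^sub>V cube (2 * n - 1))) (zero_face Y (2 * n - 1) I))
    (slice Y n (n - 1) UNIV I (\<lambda>_. 1)) = enat n"
proof -
  let ?N = "2 * n - 1"
  let ?V = "Y \<times>\<^sub>V cube ?N" and ?S = "zero_face Y (2 * n - 1) I"
  let ?X = "insert (\<lambda>z. fst z) (cc ` ({..<?N} - I))"
  let ?Z = "\<lambda>m. slice Y n m UNIV I (\<lambda>_. 1)"
  have S: "?S \<subseteq> points ?V" unfolding zero_face_def by blast
  have small: "i < ?N" if "i \<in> evens n" for i using that unfolding evens_def by auto
  have free: "\<forall>i\<in>I. free_index n m i" for m using I evens_free by blast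
  have sub: "?Z m \<subseteq> ?S" for m unfolding slice_def zero_face_def using partial_polylog_points by blast
  have ne: "?Z m \<noteq> {}" if "m \<le> n - 1" for m
    using slice_ones_infinite[OF Y n that free] by auto
  have irr: "irreducible_closed (subtopology (zariski ?V) ?S) (?Z m)" if "m \<le> n - 1" for m
    by (rule irreducible_slice[OF Y n that S sub _ _ free _ ne[OF that]]) (auto intro: range_eqI[of _ _ 1])
  have irrS: "irreducible_closed (subtopology (zariski ?V) ?S) ?S"
    by (rule irreducible_zero_face[OF Y]) (use I small in auto)
  obtain t where t: "t \<in> points Y - {0, 1}"
    using base_curve_infinite[OF Y, of "{0, 1}"] by (metis all_not_in_conv finite.emptyI finite.insertI)
  have mono: "?Z (Suc m) \<subset> ?Z m" if m: "Suc m \<le> n - 1" for m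
  proof -
    \<comment> \<open>The equation that is dropped excludes \<open>c\<^bsub>2m+1\<^esub> = 0\<close>.\<close>
    let ?c = "(\<lambda>_. 1)(2 * m + 1 := 0 :: complex)"
    have mI: "2 * m + 1 \<notin> I"
    proof
      assume "2 * m + 1 \<in> I"
      then obtain k where "2 * m + 1 = 2 * k" using I unfolding evens_def by blast
      then show False by presburger
    qed
    have "graph_point n m t ?c \<in> ?Z m"
    proof (rule slice_ones[OF n _ free t])
      show "m \<le> n - 1" using m by simp
      show "?c (2 * j) = 1" for j by simp presburger
      show "?c i = 1" if "i \<in> I" for i using that mI by auto
    qed
    moreover have "cc (2 * m + 1) (graph_point n m t ?c) = 0"
    proof -
      have "free_index n m (2 * m + 1)" using m unfolding free_index_def by auto
      then have "graph_coords n m t ?c (2 * m + 1) = ?c (2 * m + 1)" by (rule graph_coords_free)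
      moreover have "2 * m + 1 < 2 * n - 1" using m by simp
      ultimately show ?thesis by (simp add: cc_graph_point)
    qed
    then have "graph_point n m t ?c \<notin> ?Z (Suc m)" unfolding slice_def partial_polylog_def by auto
    moreover have "?Z (Suc m) \<subseteq> ?Z m" unfolding slice_def partial_polylog_def by auto
    ultimately show ?thesis by blast
  qed
  have top: "?Z 0 \<subset> ?S"
  proof -
    \<comment> \<open>The first equation excludes \<open>c\<^bsub>2n-2\<^esub> = 0\<close>.\<close>
    let ?z = "point_with ?N t (\<lambda>i. if i = 2 * n - 2 then 0 else 1)"
    have "cc i ?z = 1" if "i \<in> I" for i
    proof -
      have "i \<in> evens n" using that I by blast
      then have "i < ?N" "i \<noteq> 2 * n - 2" unfolding evens_def by auto
      then show ?thesis by simp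
    qed
    then have "?z \<in> ?S" unfolding zero_face_def using t by (auto simp: point_with_points simp del: points_prod)
    moreover have "pp (n - 1) (fst ?z) (\<lambda>i. cc i ?z) = 0"
      unfolding pp_last[OF n] using n by simp
    then have "?z \<notin> ?Z 0" unfolding slice_def partial_polylog_def by auto
    ultimately show ?thesis using sub[of 0] by blast
  qed
  let ?C = "\<lambda>j. if j \<le> n - 1 then ?Z (n - 1 - j) else ?S"
  have ch: "irr_chain (subtopology (zariski ?V) ?S) n ?C"
    unfolding irr_chain_def
  proof (intro conjI allI impI)
    show "irreducible_closed (subtopology (zariski ?V) ?S) (?C j)" for j
      using irr[of "n - 1 - j"] irrS by simp
    fix j assume j: "j < n"
    show "?C j \<subset> ?C (Suc j)"
    proof (cases "Suc j \<le> n - 1")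
      case True
      then have "n - 1 - j = Suc (n - 1 - Suc j)" by simp
      then show ?thesis using mono[of "n - 1 - Suc j"] True by simp
    next
      case False
      then have "j = n - 1" using j by simp
      then show ?thesis using top n by simp
    qed
  qed
  have indep: "indep_on (?Z (n - 1)) {} ((\<lambda>z. fst z) # map cc js)"
    if "distinct js" "set js \<subseteq> evens n - I" for js
    using that
  proof (induction js rule: rev_induct)
    case Nil
    have "\<not> algebraic_on (?Z (n - 1)) (alg_ring {}) (\<lambda>z. fst z)"
      by (rule not_algebraic_on) (use slice_ones_infinite[OF Y n order_refl free] in simp)
    then show ?case using indep_on_snoc[of "?Z (n - 1)" "{}" "[]" "\<lambda>z. fst z"] by simp
  next
    case (snoc j js)
    have j: "j \<in> evens n" "j \<notin> I" "j \<notin> set js" "set js \<subseteq> evens n" using snoc.prems by auto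
    have "\<not> algebraic_on (?Z (n - 1)) (alg_ring ({} \<union> set ((\<lambda>z. fst z) # map cc js))) (cc j)"
    proof (rule not_algebraic_on)
      fix z assume z: "z \<in> ?Z (n - 1)"
      obtain B where B: "finite B" "\<forall>w. w \<notin> B \<longrightarrow> (\<exists>z'\<in>?Z (n - 1). cc j z' = w \<and> fst z' = fst z \<and>
        (\<forall>i\<in>evens n - {j}. cc i z' = cc i z))"
        using slice_modify_even[OF n order_refl I j(1,2) z] by blast
      have "- B \<subseteq> cc j ` {z' \<in> ?Z (n - 1). \<forall>g\<in>{} \<union> set ((\<lambda>z. fst z) # map cc js). g z' = g z}"
      proof
        fix w assume "w \<in> - B"
        then obtain z' where z': "z' \<in> ?Z (n - 1)" "cc j z' = w" "fst z' = fst z" "\<forall>i\<in>evens n - {j}. cc i z' = cc i z"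
          using B(2) by blast
        have "\<forall>g\<in>{} \<union> set ((\<lambda>z. fst z) # map cc js). g z' = g z" using z'(3,4) j(3,4) by auto
        then show "w \<in> cc j ` {z' \<in> ?Z (n - 1). \<forall>g\<in>{} \<union> set ((\<lambda>z. fst z) # map cc js). g z' = g z}"
          using z'(1,2) by (intro image_eqI[of _ _ z']) simp_all
      qed
      moreover have "infinite (- B)" using B(1) infinite_UNIV_char_0[where 'a = complex] by simp
      ultimately show "infinite (cc j ` {z' \<in> ?Z (n - 1). \<forall>g\<in>{} \<union> set ((\<lambda>z. fst z) # map cc js). g z' = g z})"
        using finite_subset by blast
    qed
    then have "indep_on (?Z (n - 1)) {} (((\<lambda>z. fst z) # map cc js) @ [cc j])"
      unfolding indep_on_snoc using snoc by auto
    then show ?case by simp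
  qed
  obtain js where js: "set js = evens n - I" "distinct js"
    using finite_distinct_list[of "evens n - I"] finite_evens by blast
  have GX: "{} \<union> ?X \<subseteq> coord_ring ?V" using base_coord_ring[OF Y] cc_coord_ring by blast
  have gens: "\<exists>b\<in>alg_ring ({} \<union> ?X). \<exists>g\<in>alg_ring ({} \<union> ?X). \<forall>z\<in>?S. b z \<noteq> 0 \<and> g z = b z * f z"
    if f: "f \<in> gens ?V" for f
  proof -
    have one: "(\<lambda>_. 1) \<in> alg_ring ({} \<union> ?X)" by (rule alg_ring_ops)
    have fstR: "(\<lambda>z. fst z) \<in> alg_ring ({} \<union> ?X)" by (rule alg_ring_gen) simp
    from f consider g where "g \<in> gens Y" "f = (\<lambda>z. g (fst z))" | i where "i < ?N" "f = cc i"
      unfolding gens_prod_cube by blast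
    then show ?thesis
    proof cases
      case (1 g)
      then show ?thesis using base_gen_alg[OF Y 1(1) S fstR] by simp
    next
      case (2 i)
      show ?thesis
      proof (cases "i \<in> I")
        case True
        then show ?thesis unfolding 2(2) by (intro bexI[OF _ one]) (auto simp: zero_face_def)
      next
        case False
        then have "cc i \<in> alg_ring ({} \<union> ?X)" using 2(1) by (intro alg_ring_gen) auto
        then show ?thesis unfolding 2(2) by (intro bexI[OF _ one] bexI[of _ "cc i"]) simp_all
      qed
    qed
  qed
  have lenjs: "length js = n - 1 - card I"
    using distinct_card[OF js(2)] js(1) card_Diff_subset[OF finite_subset[OF I finite_evens] I] card_evens[of n] by simp
  have cI: "card I \<le> n - 1" using card_mono[OF finite_evens I] card_evens[of n] by simp
  have "I \<subseteq> {..<?N}" using I small by auto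
  then have "card ({..<?N} - I) = ?N - card I"
    using card_Diff_subset[OF finite_subset[OF I finite_evens]] by simp
  then have "card (cc ` ({..<?N} - I) :: (complex \<times> p1 list \<Rightarrow> complex) set) \<le> ?N - card I"
    using card_image_le[of "{..<?N} - I" cc] by simp
  then have cX: "card ?X \<le> Suc (?N - card I)" using card_insert_le_m1 by (simp add: card_insert_if)
  have "codim (subtopology (zariski ?V) ?S) (?C 0) = enat n"
  proof (rule codim_eqI[OF S _ GX _ generated_up_to_denominators[OF GX gens] ch])
    show "constants_on {} ?S" by (rule constants_onI) simp
    show "finite ?X" by simp
    show "indep_on (?C 0) {} ((\<lambda>z. fst z) # map cc js)" using indep[OF js(2)] js(1) by simp
    show "set ((\<lambda>z. fst z) # map cc js) \<subseteq> ?X" using js(1) small by auto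
    show "card ?X \<le> length ((\<lambda>z. fst z) # map cc js) + n" using cX lenjs cI n by simp
  qed
  then show ?thesis by simp
qed

section \<open>Admissibility and equidimensionality\<close>

definition polylog :: "complex variety \<Rightarrow> nat \<Rightarrow> (complex \<times> p1 list) set" where
  "polylog Y n = partial_polylog Y n (n - 1)"

lemma slice_polylog: "slice Y n (n - 1) T I (\<lambda>_. 1) = {z \<in> polylog Y n. fst z \<in> T \<and> (\<forall>i\<in>I. cc i z = 1)}"
  unfolding slice_def polylog_def ..

lemma polylog_points: "z \<in> polylog Y n \<Longrightarrow> z \<in> points (Y \<times>\<^sub>V cube (2 * n - 1))"
  unfolding polylog_def by (rule partial_polylog_points)

lemma polylog_fst_nonzero: "z \<in> polylog Y n \<Longrightarrow> fst z \<noteq> 0"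
  unfolding polylog_def partial_polylog_def pp_def by auto

lemma polylog_even_nonzero:
  assumes "z \<in> polylog Y n" "k < n" shows "cc (2 * k) z \<noteq> 0"
proof
  assume 0: "cc (2 * k) z = 0"
  have "(\<Prod>j\<le>n - 1. cc (2 * j) z) = 0" by (rule prod_zero) (use 0 assms(2) in auto)
  moreover have "fst z * (\<Prod>j\<le>n - 1. cc (2 * j) z) = 1"
    using assms(1) unfolding polylog_def partial_polylog_def pp_def by blast
  ultimately show False by (simp only: mult_zero_right zero_neq_one)
qed

lemma polylog_equation:
  assumes "z \<in> polylog Y n" "k < n - 1"
  shows "cc (2 * k + 1) z * (1 - pp k (fst z) (\<lambda>i. cc i z)) = 1"
  using assms unfolding polylog_def partial_polylog_def by blast

lemma polylog_pp_nonzero: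
  assumes "z \<in> polylog Y n" "k < n - 1"
  shows "pp k (fst z) (\<lambda>i. cc i z) \<noteq> 0" "pp k (fst z) (\<lambda>i. cc i z) \<noteq> 1"
proof -
  show "pp k (fst z) (\<lambda>i. cc i z) \<noteq> 1" using polylog_equation[OF assms] by auto
  have "(\<Prod>j\<le>k. cc (2 * j) z) \<noteq> 0" using polylog_even_nonzero[OF assms(1)] assms(2) by simp
  then show "pp k (fst z) (\<lambda>i. cc i z) \<noteq> 0" unfolding pp_def using polylog_fst_nonzero[OF assms(1)] by simp
qed

lemma pp_Suc: "pp (Suc k) t c = pp k t c * c (2 * Suc k)"
  unfolding pp_def by simp

lemma polylog_last:
  assumes "z \<in> polylog Y n" "n \<ge> 2"
  shows "pp (n - 2) (fst z) (\<lambda>i. cc i z) * cc (2 * n - 2) z = 1"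
proof -
  have n: "n - 1 = Suc (n - 2)" "2 * Suc (n - 2) = 2 * n - 2" using assms(2) by auto
  have "pp (n - 1) (fst z) (\<lambda>i. cc i z) = 1" using assms(1) unfolding polylog_def partial_polylog_def by blast
  then show ?thesis unfolding n(1) pp_Suc n(2) .
qed

text \<open>The parameters \<open>x\<^sub>i\<close> avoid \<open>0\<close>, \<open>1\<close> and \<open>\<infinity>\<close> on the subvariety, which leaves the faces \<open>u\<^bsub>2k\<^esub> = 0\<close> with
  \<open>k < n - 1\<close>.\<close>

lemma polylog_coordinates:
  assumes z: "z \<in> polylog Y n" and n: "n \<ge> 2" and i: "i < 2 * n - 1"
  shows "cc i z \<noteq> 0" "cc i z = 1 \<Longrightarrow> i \<in> evens n"
proof -
  have *: "cc i z \<noteq> 0 \<and> (cc i z = 1 \<longrightarrow> i \<in> evens n)"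
  proof (cases "even i")
    case True
    then obtain k where k: "i = 2 * k" by blast
    have "k < n" using i k by simp
    then have "cc i z \<noteq> 0" unfolding k by (rule polylog_even_nonzero[OF z])
    moreover have "i \<in> evens n" if c: "cc i z = 1"
    proof (cases "k = n - 1")
      case True
      then have i2: "i = 2 * n - 2" using k by simp
      have "pp (n - 2) (fst z) (\<lambda>i. cc i z) = 1" using polylog_last[OF z n] c unfolding i2 by simp
      then show ?thesis using polylog_pp_nonzero(2)[OF z, of "n - 2"] n by simp
    next
      case False
      then show ?thesis using \<open>k < n\<close> k unfolding evens_def by auto
    qed
    ultimately show ?thesis by blast
  next
    case False
    then obtain k where k: "i = 2 * k + 1" by (metis oddE)
    then have k': "k < n - 1" using i by simp
    have eq: "cc i z * (1 - pp k (fst z) (\<lambda>i. cc i z)) = 1" using polylog_equation[OF z k'] unfolding k .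
    then have "cc i z \<noteq> 0" by auto
    moreover have "cc i z \<noteq> 1" using eq polylog_pp_nonzero(1)[OF z k'] by auto
    ultimately show ?thesis by blast
  qed
  then show "cc i z \<noteq> 0" "cc i z = 1 \<Longrightarrow> i \<in> evens n" by blast+
qed

lemma mem_face:
  assumes "us \<in> points (cube N)"
  shows "us \<in> face N \<phi> \<longleftrightarrow> (\<forall>i\<in>dom \<phi>. Some (us ! i) = \<phi> i)"
proof
  assume "us \<in> face N \<phi>"
  then show "\<forall>i\<in>dom \<phi>. Some (us ! i) = \<phi> i" unfolding face_def by auto
next
  assume *: "\<forall>i\<in>dom \<phi>. Some (us ! i) = \<phi> i"
  have "us ! i = \<epsilon>" if "\<phi> i = Some \<epsilon>" for i \<epsilon> using bspec[OF * domI[of \<phi> i \<epsilon>]] that by simp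
  then show "us \<in> face N \<phi>" unfolding face_def using assms by blast
qed

lemma face_condition:
  assumes "z \<in> points (Y \<times>\<^sub>V cube N)" "\<phi> \<in> face_eqs N"
  shows "z \<in> points Y \<times> face N \<phi> \<longleftrightarrow> (\<forall>i\<in>dom \<phi>. cc i z = (if \<phi> i = Some Infty then 0 else 1))"
proof -
  have "snd z \<in> face N \<phi> \<longleftrightarrow> (\<forall>i\<in>dom \<phi>. Some (snd z ! i) = \<phi> i)"
    by (rule mem_face) (use assms(1) in \<open>simp add: mem_Times_iff\<close>)
  also have "\<dots> \<longleftrightarrow> (\<forall>i\<in>dom \<phi>. cc i z = (if \<phi> i = Some Infty then 0 else 1))"
  proof (rule ball_cong[OF refl])
    fix i assume i: "i \<in> dom \<phi>"
    then have u: "snd z ! i \<noteq> Fin 1" using assms(2) nth_cube_points[OF assms(1)] unfolding face_eqs_def by blast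
    obtain \<epsilon> where \<epsilon>: "\<phi> i = Some \<epsilon>" using i by blast
    then have "\<epsilon> = Fin 0 \<or> \<epsilon> = Infty" using assms(2) unfolding face_eqs_def ran_def by blast
    then show "Some (snd z ! i) = \<phi> i \<longleftrightarrow> cc i z = (if \<phi> i = Some Infty then 0 else 1)"
      unfolding cc_def \<epsilon> using cube_coord_0[OF u] cube_coord_Infty[OF u] by auto
  qed
  finally show ?thesis using assms(1) by (simp add: mem_Times_iff)
qed

lemma points_face_subset: "points Y \<times> face N \<phi> \<subseteq> points (Y \<times>\<^sub>V cube N)"
  unfolding face_def by auto

lemma polylog_face:
  assumes n: "n \<ge> 2" and \<phi>: "\<phi> \<in> face_eqs (2 * n - 1)" and ne: "polylog Y n \<inter> (points Y \<times> face (2 * n - 1) \<phi>) \<noteq> {}"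
  shows "dom \<phi> \<subseteq> evens n" "points Y \<times> face (2 * n - 1) \<phi> = zero_face Y (2 * n - 1) (dom \<phi>)"
proof -
  obtain z where z: "z \<in> polylog Y n" "z \<in> points Y \<times> face (2 * n - 1) \<phi>" using ne by blast
  have zero: "\<phi> i \<noteq> Some Infty \<and> i \<in> evens n" if i: "i \<in> dom \<phi>" for i
  proof -
    have iN: "i < 2 * n - 1" using \<phi> i unfolding face_eqs_def by blast
    have c: "cc i z = (if \<phi> i = Some Infty then 0 else 1)"
      using z(2) i face_condition[OF polylog_points[OF z(1)] \<phi>] by blast
    then have "\<phi> i \<noteq> Some Infty" using polylog_coordinates(1)[OF z(1) n iN] by auto
    then show ?thesis using c polylog_coordinates(2)[OF z(1) n iN] by simp
  qed
  then show "dom \<phi> \<subseteq> evens n" by blast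
  show "points Y \<times> face (2 * n - 1) \<phi> = zero_face Y (2 * n - 1) (dom \<phi>)"
  proof (intro subset_antisym subsetI)
    fix w assume w: "w \<in> points Y \<times> face (2 * n - 1) \<phi>"
    then have wp: "w \<in> points (Y \<times>\<^sub>V cube (2 * n - 1))" using points_face_subset by blast
    then show "w \<in> zero_face Y (2 * n - 1) (dom \<phi>)"
      using w face_condition[OF wp \<phi>] zero unfolding zero_face_def by simp
  next
    fix w assume w: "w \<in> zero_face Y (2 * n - 1) (dom \<phi>)"
    then have wp: "w \<in> points (Y \<times>\<^sub>V cube (2 * n - 1))" unfolding zero_face_def by blast
    then show "w \<in> points Y \<times> face (2 * n - 1) \<phi>"
      using w face_condition[OF wp \<phi>] zero unfolding zero_face_def by simp
  qed
qed

lemma zero_face_empty: "zero_face Y N {} = points (Y \<times>\<^sub>V cube N)"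
  unfolding zero_face_def by simp

lemma polylog_zero_face: "polylog Y n \<inter> zero_face Y (2 * n - 1) I = slice Y n (n - 1) UNIV I (\<lambda>_. 1)"
  unfolding slice_polylog zero_face_def using polylog_points by blast

lemma irreducible_polylog_face:
  assumes Y: "base_curve Y" and n: "n \<ge> 1" and I: "I \<subseteq> evens n"
    and S: "S \<subseteq> points (Y \<times>\<^sub>V cube (2 * n - 1))" "slice Y n (n - 1) UNIV I (\<lambda>_. 1) \<subseteq> S"
  shows "irreducible_closed (subtopology (zariski (Y \<times>\<^sub>V cube (2 * n - 1))) S) (slice Y n (n - 1) UNIV I (\<lambda>_. 1))"
proof -
  have free: "\<forall>i\<in>I. free_index n (n - 1) i" using I evens_free by blast
  have ne: "slice Y n (n - 1) UNIV I (\<lambda>_. 1) \<noteq> {}" using slice_ones_infinite[OF Y n order_refl free] by auto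
  show ?thesis
    by (rule irreducible_slice[OF Y n order_refl S _ _ free _ ne]) (auto intro: range_eqI[of _ _ 1])
qed

lemma slice_points: "slice Y n m T I v \<subseteq> points (Y \<times>\<^sub>V cube (2 * n - 1))"
  unfolding slice_def using partial_polylog_points by blast

lemma irreducible_polylog:
  assumes Y: "base_curve Y" and n: "n \<ge> 1"
  shows "irreducible_closed (zariski (Y \<times>\<^sub>V cube (2 * n - 1))) (polylog Y n)"
  using irreducible_polylog_face[OF Y n empty_subsetI subset_refl slice_points]
  unfolding subtopology_zariski_points slice_polylog by simp

lemma polylog_admissible:
  assumes Y: "base_curve Y" and n: "n \<ge> 2"
  shows "polylog Y n \<in> admissible Y n (2 * n - 1)"
  unfolding admissible_def Let_def
proof (intro CollectI conjI ballI)
  let ?V = "Y \<times>\<^sub>V cube (2 * n - 1)"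
  have n1: "n \<ge> 1" using n by simp
  show "irreducible_closed (zariski ?V) (polylog Y n)" by (rule irreducible_polylog[OF Y n1])
  show "codim (zariski ?V) (polylog Y n) = enat n"
    using codim_slice[OF Y n1 empty_subsetI] unfolding zero_face_empty subtopology_zariski_points slice_polylog by simp
  fix \<phi> assume \<phi>: "\<phi> \<in> face_eqs (2 * n - 1)"
  let ?F = "points Y \<times> face (2 * n - 1) \<phi>"
  show "polylog Y n \<inter> ?F = {} \<or> has_codim (subtopology (zariski ?V) ?F) (polylog Y n \<inter> ?F) n"
  proof (cases "polylog Y n \<inter> ?F = {}")
    case False
    note dom = polylog_face[OF n \<phi> False]
    have sub: "slice Y n (n - 1) UNIV (dom \<phi>) (\<lambda>_. 1) \<subseteq> zero_face Y (2 * n - 1) (dom \<phi>)"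
      using polylog_zero_face by blast
    have "irreducible_closed (subtopology (zariski ?V) ?F) (polylog Y n \<inter> ?F)"
      unfolding dom(2) polylog_zero_face
      by (rule irreducible_polylog_face[OF Y n1 dom(1) _ sub]) (use points_face_subset dom(2) in blast)
    moreover have "codim (subtopology (zariski ?V) ?F) (polylog Y n \<inter> ?F) = enat n"
      unfolding dom(2) polylog_zero_face by (rule codim_slice[OF Y n1 dom(1)])
    ultimately show ?thesis unfolding has_codim_def by (simp add: irr_components_irreducible)
  qed simp
qed

lemma pure_dim_irreducible:
  assumes S: "S \<subseteq> topspace T" and irr: "irreducible_closed (subtopology T S) S"
    and d: "krull_dim (subtopology T S) = enat d" "int d = r"
  shows "has_pure_dim (subtopology T S) r"
proof -
  have "topspace (subtopology T S) = S" using S by auto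
  moreover have "subtopology (subtopology T S) S = subtopology T S" by (simp add: subtopology_subtopology)
  ultimately show ?thesis unfolding has_pure_dim_def using irr_components_irreducible[OF irr] d by simp
qed

lemma pure_dim_fiber:
  assumes Y: "base_curve Y" and n: "n \<ge> 1" and I: "I \<subseteq> evens n" and ne: "slice Y n (n - 1) {x} I (\<lambda>_. 1) \<noteq> {}"
  shows "has_pure_dim (subtopology (zariski (Y \<times>\<^sub>V cube (2 * n - 1))) (slice Y n (n - 1) {x} I (\<lambda>_. 1)))
    (int (2 * n - 1 - card I) - int n)"
proof (rule pure_dim_irreducible)
  show "slice Y n (n - 1) {x} I (\<lambda>_. 1) \<subseteq> topspace (zariski (Y \<times>\<^sub>V cube (2 * n - 1)))"
    unfolding topspace_zariski by (rule slice_points)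
  have free: "\<forall>i\<in>I. free_index n (n - 1) i" using I evens_free by blast
  show "irreducible_closed (subtopology (zariski (Y \<times>\<^sub>V cube (2 * n - 1))) (slice Y n (n - 1) {x} I (\<lambda>_. 1)))
      (slice Y n (n - 1) {x} I (\<lambda>_. 1))"
    by (rule irreducible_slice[OF Y n order_refl slice_points subset_refl _ _ free _ ne])
      (auto simp: slice_def intro: range_eqI[of _ _ 1])
  show "krull_dim (subtopology (zariski (Y \<times>\<^sub>V cube (2 * n - 1))) (slice Y n (n - 1) {x} I (\<lambda>_. 1))) = enat (n - 1 - card I)"
    by (rule krull_dim_slice[OF Y n I ne])
  have "card I \<le> n - 1" using card_mono[OF finite_evens I] card_evens[of n] by simp
  then show "int (n - 1 - card I) = int (2 * n - 1 - card I) - int n" using n by simp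
qed

lemma polylog_fiber_face:
  assumes Y: "base_curve Y" and n: "n \<ge> 2" and \<phi>: "\<phi> \<in> face_eqs (2 * n - 1)" and x: "x \<in> points Y"
  defines "S \<equiv> fiber x (polylog Y n) \<inter> ({x} \<times> face (2 * n - 1) \<phi>)"
  shows "S = {} \<or> has_pure_dim (subtopology (zariski (Y \<times>\<^sub>V cube (2 * n - 1))) S) (int (face_dim (2 * n - 1) \<phi>) - int n)"
proof (cases "S = {}")
  case False
  have eq: "S = fiber x (polylog Y n \<inter> (points Y \<times> face (2 * n - 1) \<phi>))"
    unfolding S_def fiber_def using x by auto
  then have ne: "polylog Y n \<inter> (points Y \<times> face (2 * n - 1) \<phi>) \<noteq> {}" using False unfolding fiber_def by blast
  note dom = polylog_face[OF n \<phi> ne]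
  have "S = slice Y n (n - 1) {x} (dom \<phi>) (\<lambda>_. 1)"
    unfolding eq dom(2) polylog_zero_face slice_polylog fiber_def by auto
  then show ?thesis
    using pure_dim_fiber[OF Y _ dom(1), of x] n False unfolding face_dim_def by simp
qed simp

lemma polylog_equi_admissible:
  assumes Y: "base_curve Y" and n: "n \<ge> 2"
  shows "polylog Y n \<in> equi_admissible Y n (2 * n - 1)"
  unfolding equi_admissible_def Let_def
proof (intro CollectI conjI ballI)
  let ?V = "Y \<times>\<^sub>V cube (2 * n - 1)"
  have n1: "n \<ge> 1" using n by simp
  show "irreducible_closed (zariski ?V) (polylog Y n)" by (rule irreducible_polylog[OF Y n1])
  fix \<phi> assume \<phi>: "\<phi> \<in> face_eqs (2 * n - 1)"
  let ?F = "points Y \<times> face (2 * n - 1) \<phi>"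
  show "polylog Y n \<inter> ?F = {} \<or> equidimensional Y (2 * n - 1) (polylog Y n \<inter> ?F) (int (face_dim (2 * n - 1) \<phi>) - int n)"
  proof (cases "polylog Y n \<inter> ?F = {}")
    case False
    note dom = polylog_face[OF n \<phi> False]
    have eq: "polylog Y n \<inter> ?F = slice Y n (n - 1) UNIV (dom \<phi>) (\<lambda>_. 1)" unfolding dom(2) polylog_zero_face ..
    have irr: "irreducible_closed (zariski ?V) (polylog Y n \<inter> ?F)"
      using irreducible_polylog_face[OF Y n1 dom(1) subset_refl slice_points] unfolding subtopology_zariski_points eq .
    have free: "\<forall>i\<in>dom \<phi>. free_index n (n - 1) i" using dom(1) evens_free by blast
    have "zariski Y closure_of (fst ` (polylog Y n \<inter> ?F)) = points Y"
    proof (rule base_curve_dense[OF Y])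
      show "fst ` (polylog Y n \<inter> ?F) \<subseteq> points Y" by auto
      show "infinite (fst ` (polylog Y n \<inter> ?F))" unfolding eq by (rule slice_ones_infinite[OF Y n1 order_refl free])
    qed
    moreover have "fiber x (polylog Y n \<inter> ?F) \<noteq> {} \<longrightarrow>
        has_pure_dim (subtopology (zariski ?V) (fiber x (polylog Y n \<inter> ?F))) (int (face_dim (2 * n - 1) \<phi>) - int n)"
      if x: "x \<in> points Y" for x
    proof -
      have "fiber x (polylog Y n) \<inter> ({x} \<times> face (2 * n - 1) \<phi>) = fiber x (polylog Y n \<inter> ?F)"
        unfolding fiber_def using x by auto
      then show ?thesis using polylog_fiber_face[OF Y n \<phi> x] by (simp only: disj_not1) blast
    qed
    ultimately show ?thesis
      unfolding equidimensional_def irr_components_irreducible[OF irr] by blast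
  qed simp
qed

text \<open>Terms may cancel, but no other subvarieties occur.\<close>

lemma keys_Alt_single:
  assumes "W \<in> Poly_Mapping.keys (Alt n (Poly_Mapping.single Z 1))"
  shows "\<exists>e \<sigma>. e \<subseteq> {..<n} \<and> \<sigma> permutes {..<n} \<and> W = cube_action n e \<sigma> ` Z"
proof (rule ccontr)
  assume no: "\<not> ?thesis"
  have "Poly_Mapping.lookup (alt_sum n (Poly_Mapping.single Z 1)) W = 0"
    unfolding alt_sum_def image_cycle_single lookup_sum lookup_scale
    by (intro sum.neutral ballI) (use no in \<open>auto simp: lookup_single when_def\<close>)
  then show False using assms unfolding Alt_eq_alt_sum by (simp add: in_keys_iff)
qed

lemma empty_fiber_Alt_polylog: "empty_fiber 0 (Alt N (Poly_Mapping.single (polylog Y n) 1))"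
  unfolding empty_fiber_def
proof
  fix W assume "W \<in> Poly_Mapping.keys (Alt N (Poly_Mapping.single (polylog Y n) 1))"
  then obtain e \<sigma> where W: "W = cube_action N e \<sigma> ` polylog Y n" using keys_Alt_single by blast
  have "fst w \<noteq> 0" if "w \<in> W" for w
  proof -
    from that obtain z where z: "z \<in> polylog Y n" "w = cube_action N e \<sigma> z" unfolding W by blast
    show ?thesis unfolding z(2) fst_cube_action by (rule polylog_fst_nonzero[OF z(1)])
  qed
  then show "fiber 0 W = {}" unfolding fiber_def by blast
qed

text \<open>The equation \<open>u\<^sub>i = \<epsilon>\<close> for the image of a point under a group element is an equation for its
  coordinate with index \<open>\<sigma> i\<close>, with \<open>\<epsilon>\<close> inverted if \<open>i \<in> e\<close>.\<close>

definition face_pullback :: "nat set \<Rightarrow> (nat \<Rightarrow> nat) \<Rightarrow> (nat \<rightharpoonup> p1) \<Rightarrow> (nat \<rightharpoonup> p1)" where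
  "face_pullback e \<sigma> \<phi> = (\<lambda>j. map_option (if inv_into UNIV \<sigma> j \<in> e then p1_inverse else id) (\<phi> (inv_into UNIV \<sigma> j)))"

lemma face_pullback:
  assumes \<sigma>: "\<sigma> permutes {..<N}" and \<phi>: "\<phi> \<in> face_eqs N"
  shows "face_pullback e \<sigma> \<phi> \<in> face_eqs N" "face_dim N (face_pullback e \<sigma> \<phi>) = face_dim N \<phi>"
    "z \<in> points (B \<times>\<^sub>V cube N) \<Longrightarrow> snd (cube_action N e \<sigma> z) \<in> face N \<phi> \<longleftrightarrow> snd z \<in> face N (face_pullback e \<sigma> \<phi>)"
proof -
  have bij: "bij \<sigma>" using \<sigma> permutes_bij by blast
  have inv1: "inv_into UNIV \<sigma> (\<sigma> i) = i" for i using bij by (simp add: bij_is_inj)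
  have inv2: "\<sigma> (inv_into UNIV \<sigma> j) = j" for j using bij by (simp add: bij_is_surj surj_f_inv_f)
  have dom: "dom (face_pullback e \<sigma> \<phi>) = \<sigma> ` dom \<phi>"
  proof (intro subset_antisym subsetI)
    fix j assume "j \<in> dom (face_pullback e \<sigma> \<phi>)"
    then have "inv_into UNIV \<sigma> j \<in> dom \<phi>" unfolding face_pullback_def by auto
    then show "j \<in> \<sigma> ` dom \<phi>" using inv2[of j] by force
  qed (auto simp: face_pullback_def inv1)
  have \<sigma>N: "\<sigma> i < N \<longleftrightarrow> i < N" for i using permutes_in_image[OF \<sigma>, of i] by simp
  show "face_pullback e \<sigma> \<phi> \<in> face_eqs N"
    unfolding face_eqs_def
  proof (intro CollectI conjI)
    show "dom (face_pullback e \<sigma> \<phi>) \<subseteq> {..<N}" unfolding dom using \<phi> \<sigma>N unfolding face_eqs_def by auto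
    show "ran (face_pullback e \<sigma> \<phi>) \<subseteq> {Fin 0, Infty}"
    proof
      fix \<epsilon> assume "\<epsilon> \<in> ran (face_pullback e \<sigma> \<phi>)"
      then obtain j \<delta> where d: "\<phi> (inv_into UNIV \<sigma> j) = Some \<delta>" "\<epsilon> = (if inv_into UNIV \<sigma> j \<in> e then p1_inverse \<delta> else \<delta>)"
        unfolding ran_def face_pullback_def by auto
      then have "\<delta> \<in> {Fin 0, Infty}" using \<phi> unfolding face_eqs_def ran_def by blast
      then show "\<epsilon> \<in> {Fin 0, Infty}" using d(2) by auto
    qed
  qed
  have "card (\<sigma> ` dom \<phi>) = card (dom \<phi>)"
    using bij by (intro card_image) (auto intro: inj_on_subset[OF bij_is_inj])
  then show "face_dim N (face_pullback e \<sigma> \<phi>) = face_dim N \<phi>" unfolding face_dim_def dom by simp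
  assume z: "z \<in> points (B \<times>\<^sub>V cube N)"
  have pts: "snd (cube_action N e \<sigma> z) \<in> points (cube N)" "snd z \<in> points (cube N)"
    using cube_action_points[OF \<sigma> z, of e] z by (simp_all add: mem_Times_iff)
  have "snd (cube_action N e \<sigma> z) \<in> face N \<phi> \<longleftrightarrow> (\<forall>i\<in>dom \<phi>. Some (snd (cube_action N e \<sigma> z) ! i) = \<phi> i)"
    by (rule mem_face[OF pts(1)])
  also have "\<dots> \<longleftrightarrow> (\<forall>i\<in>dom \<phi>. Some (snd z ! \<sigma> i) = face_pullback e \<sigma> \<phi> (\<sigma> i))"
  proof (rule ball_cong[OF refl])
    fix i assume i: "i \<in> dom \<phi>"
    then have iN: "i < N" using \<phi> unfolding face_eqs_def by blast
    obtain \<epsilon> where "\<phi> i = Some \<epsilon>" using i by blast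
    then show "Some (snd (cube_action N e \<sigma> z) ! i) = \<phi> i \<longleftrightarrow> Some (snd z ! \<sigma> i) = face_pullback e \<sigma> \<phi> (\<sigma> i)"
      unfolding face_pullback_def inv1 nth_cube_action[OF iN]
      by (auto simp: p1_inverse_involutive)
  qed
  also have "\<dots> \<longleftrightarrow> (\<forall>j\<in>dom (face_pullback e \<sigma> \<phi>). Some (snd z ! j) = face_pullback e \<sigma> \<phi> j)"
    unfolding dom by simp
  also have "\<dots> \<longleftrightarrow> snd z \<in> face N (face_pullback e \<sigma> \<phi>)"
    by (rule mem_face[OF pts(2), symmetric])
  finally show "snd (cube_action N e \<sigma> z) \<in> face N \<phi> \<longleftrightarrow> snd z \<in> face N (face_pullback e \<sigma> \<phi>)" .
qed

text \<open>The group acts by homeomorphisms over the base, so that it suffices to consider the subvariety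
  itself and the face pulled back.\<close>

lemma translate_fiber_face:
  assumes Y: "base_curve Y" and n: "n \<ge> 2" and x: "x \<in> points Y" and \<phi>: "\<phi> \<in> face_eqs (2 * n - 1)"
    and e: "e \<subseteq> {..<2 * n - 1}" and \<sigma>: "\<sigma> permutes {..<2 * n - 1}"
  defines "S \<equiv> fiber x (cube_action (2 * n - 1) e \<sigma> ` polylog Y n) \<inter> ({x} \<times> face (2 * n - 1) \<phi>)"
  shows "S = {} \<or> has_pure_dim (subtopology (zariski (Y \<times>\<^sub>V cube (2 * n - 1))) S)
    (int (face_dim (2 * n - 1) \<phi>) - int n)"
proof (cases "S = {}")
  case False
  let ?N = "2 * n - 1" let ?V = "Y \<times>\<^sub>V cube (2 * n - 1)"
  define g :: "complex \<times> p1 list \<Rightarrow> complex \<times> p1 list" where "g = cube_action ?N e \<sigma>"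
  define S0 where "S0 = fiber x (polylog Y n) \<inter> ({x} \<times> face ?N (face_pullback e \<sigma> \<phi>))"
  have S0V: "S0 \<subseteq> points ?V" unfolding S0_def fiber_def using polylog_points by blast
  have mem: "snd (g z) \<in> face ?N \<phi> \<longleftrightarrow> snd z \<in> face ?N (face_pullback e \<sigma> \<phi>)" if "z \<in> polylog Y n" for z
    unfolding g_def by (rule face_pullback(3)[OF \<sigma> \<phi> polylog_points[OF that]])
  have fst_g: "fst (g z) = fst z" for z unfolding g_def by simp
  have img: "g ` S0 = S"
  proof (intro subset_antisym subsetI)
    fix w assume "w \<in> g ` S0"
    then obtain z where z: "z \<in> S0" "w = g z" by blast
    then have "z \<in> polylog Y n" "fst z = x" "snd z \<in> face ?N (face_pullback e \<sigma> \<phi>)"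
      unfolding S0_def fiber_def by (simp_all add: mem_Times_iff)
    then show "w \<in> S" unfolding S_def fiber_def z(2) g_def[symmetric] using mem[of z] fst_g[of z] by (simp add: mem_Times_iff)
  next
    fix w assume w: "w \<in> S"
    then obtain z where z: "z \<in> polylog Y n" "w = g z" unfolding S_def fiber_def g_def by blast
    have "fst w = x" "snd w \<in> face ?N \<phi>" using w unfolding S_def fiber_def by (simp_all add: mem_Times_iff)
    then have "z \<in> S0" unfolding S0_def fiber_def using z(1) mem[OF z(1)] fst_g[of z] z(2) by (simp add: mem_Times_iff)
    then show "w \<in> g ` S0" using z(2) by blast
  qed
  have "S0 \<noteq> {}" using img False by blast
  then have pure: "has_pure_dim (subtopology (zariski ?V) S0) (int (face_dim ?N \<phi>) - int n)"
    using polylog_fiber_face[OF Y n face_pullback(1)[OF \<sigma> \<phi>] x, of e]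
    unfolding S0_def[symmetric] face_pullback(2)[OF \<sigma> \<phi>] by blast
  have hm: "homeomorphic_maps (zariski ?V) (zariski ?V) g (cube_action ?N {i. i < ?N \<and> inv_into UNIV \<sigma> i \<in> e} (inv_into UNIV \<sigma>))"
    unfolding g_def by (rule variety_iso_homeomorphic[OF variety_iso_cube_action[OF \<sigma> e]])
  have "g z \<in> points ?V" if "z \<in> S0" for z
    unfolding g_def by (rule cube_action_points[OF \<sigma>]) (use S0V that in blast)
  then have SV: "S \<subseteq> points ?V" unfolding img[symmetric] by blast
  have "g ` (topspace (zariski ?V) \<inter> S0) = topspace (zariski ?V) \<inter> S"
    unfolding topspace_zariski Int_absorb1[OF S0V] Int_absorb1[OF SV] by (rule img)
  then have "has_pure_dim (subtopology (zariski ?V) S) (int (face_dim ?N \<phi>) - int n)"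
    by (rule has_pure_dim_homeomorphic[OF homeomorphic_maps_subtopologies[OF hm] pure])
  then show ?thesis by (rule disjI2)
qed simp

lemma fiber_well_defined_Alt_polylog:
  assumes Y: "base_curve Y" and n: "n \<ge> 2" and x: "x \<in> points Y"
  shows "fiber_well_defined Y n (2 * n - 1) x (Alt (2 * n - 1) (Poly_Mapping.single (polylog Y n) 1))"
  unfolding fiber_well_defined_def Let_def
proof (intro ballI)
  fix W \<phi> assume W: "W \<in> Poly_Mapping.keys (Alt (2 * n - 1) (Poly_Mapping.single (polylog Y n) (1 :: rat)))"
    and \<phi>: "\<phi> \<in> face_eqs (2 * n - 1)"
  show "fiber x W \<inter> ({x} \<times> face (2 * n - 1) \<phi>) = {} \<or>
    has_pure_dim (subtopology (zariski (Y \<times>\<^sub>V cube (2 * n - 1))) (fiber x W \<inter> ({x} \<times> face (2 * n - 1) \<phi>)))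
      (int (face_dim (2 * n - 1) \<phi>) - int n)"
    using keys_Alt_single[OF W] translate_fiber_face[OF Y n x \<phi>] by (elim exE conjE) simp
qed

section \<open>The curves of weight one\<close>

text \<open>The curve \<open>u = 1 - l(t)\<close>: \<open>[t; t]\<close> for \<open>l = 1 - t\<close>, and \<open>[t; 1 - t]\<close> for \<open>l = t\<close>.\<close>

definition curve :: "complex variety \<Rightarrow> (complex \<Rightarrow> complex) \<Rightarrow> (complex \<times> p1 list) set" where
  "curve Y l = {z \<in> points (Y \<times>\<^sub>V cube 1). cc 0 z * l (fst z) = 1}"

definition degree_one :: "(complex \<Rightarrow> complex) \<Rightarrow> bool" where
  "degree_one l \<longleftrightarrow> l = (\<lambda>t. t) \<or> l = (\<lambda>t. 1 - t)"

lemma degree_one_ring: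
  assumes "degree_one l" "f \<in> coord_ring V" shows "(\<lambda>z. l (f z)) \<in> coord_ring V"
  using assms unfolding degree_one_def by (auto intro: coord_ring_diff[OF coord_ring_1])

lemma degree_one_roots:
  assumes "degree_one l" shows "finite {t. l t = 0}" "\<exists>a. \<forall>t. l t = 1 \<longleftrightarrow> t = a"
proof -
  show "finite {t. l t = 0}" using assms unfolding degree_one_def by auto
  show "\<exists>a. \<forall>t. l t = 1 \<longleftrightarrow> t = a"
    using assms unfolding degree_one_def by (auto intro: exI[of _ 1] exI[of _ 0])
qed

lemma point_with_curve: "t \<in> points Y \<Longrightarrow> l t \<noteq> 0 \<Longrightarrow> point_with 1 t (\<lambda>_. 1 / l t) \<in> curve Y l"
  unfolding curve_def by (simp add: point_with_points del: points_prod)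

lemma rat_conn_curve_set:
  assumes Y: "base_curve Y" and l: "degree_one l"
  shows "rat_conn (Y \<times>\<^sub>V cube 1) (curve Y l)"
proof -
  let ?S = "{z \<in> {z \<in> {z. fst z \<in> (UNIV :: complex set) \<and> (\<forall>i\<in>({} :: nat set). snd z i = (0 :: complex))}. l (fst z) \<noteq> 0}. fst z \<notin> - points Y}"
  have fin: "finite (- points Y)" using Y unfolding base_curve_def by blast
  have lr: "(\<lambda>z. l (fst z)) \<in> coord_ring coord_space" by (rule degree_one_ring[OF l coord_space_gens(1)])
  have rc: "rat_conn coord_space ?S"
    by (rule rat_conn_avoid[OF fin rat_conn_open[OF rat_conn_linear lr] coord_space_gens(1)]) simp
  have "rat_conn (Y \<times>\<^sub>V cube 1) ((\<lambda>z. point_with 1 (fst z) (\<lambda>_. 1 / l (fst z))) ` ?S)"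
  proof (rule rat_conn_point_with_image[OF Y rc])
    show "\<exists>d\<in>coord_ring coord_space. \<exists>e\<in>coord_ring coord_space. \<forall>z\<in>?S. d z \<noteq> 0 \<and> d z * (1 / l (fst z)) = e z"
      by (intro bexI[OF _ lr] bexI[OF _ coord_ring_1]) simp
  qed simp
  moreover have "(\<lambda>z. point_with 1 (fst z) (\<lambda>_. 1 / l (fst z))) ` ?S = curve Y l"
  proof (intro subset_antisym subsetI)
    fix z assume z: "z \<in> curve Y l"
    then have zp: "z \<in> points (Y \<times>\<^sub>V cube 1)" and eq: "cc 0 z * l (fst z) = 1" unfolding curve_def by auto
    then have l0: "l (fst z) \<noteq> 0" by auto
    have t: "fst z \<in> points Y" using zp by (simp add: mem_Times_iff)
    have "z = point_with 1 (fst z) (\<lambda>_. 1 / l (fst z))"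
    proof (rule cube_points_eqI[OF zp])
      show "point_with 1 (fst z) (\<lambda>_. 1 / l (fst z)) \<in> points (Y \<times>\<^sub>V cube 1)" unfolding point_with_points by (rule t)
      show "cc i z = cc i (point_with 1 (fst z) (\<lambda>_. 1 / l (fst z)))" if "i < 1" for i
        using that eq l0 by (simp add: eq_divide_eq)
    qed simp
    then show "z \<in> (\<lambda>z. point_with 1 (fst z) (\<lambda>_. 1 / l (fst z))) ` ?S"
      using t l0 by (intro image_eqI[of _ _ "(fst z, \<lambda>_. 0)"]) auto
  next
    fix z assume "z \<in> (\<lambda>z. point_with 1 (fst z) (\<lambda>_. 1 / l (fst z))) ` ?S"
    then obtain t where "z = point_with 1 t (\<lambda>_. 1 / l t)" "l t \<noteq> 0" "t \<in> points Y" by auto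
    then show "z \<in> curve Y l" using point_with_curve[of t Y l] by simp
  qed
  ultimately show ?thesis by simp
qed

lemma closedin_curve:
  assumes Y: "base_curve Y" and l: "degree_one l"
  shows "closedin (zariski (Y \<times>\<^sub>V cube 1)) (curve Y l)"
proof -
  have "{\<lambda>z. cc 0 z * l (fst z) - 1} \<subseteq> coord_ring (Y \<times>\<^sub>V cube 1)"
    using degree_one_ring[OF l base_coord_ring[OF Y]]
    by (auto intro!: coord_ring_diff coord_ring.mult coord_ring_1 cc_coord_ring)
  from closedin_equations[OF subset_refl this] show ?thesis
    unfolding subtopology_zariski_points curve_def by simp
qed

lemma curve_infinite:
  assumes Y: "base_curve Y" and l: "degree_one l" shows "infinite (fst ` curve Y l)"
proof -
  have "points Y - {t. l t = 0} \<subseteq> fst ` curve Y l"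
  proof
    fix t assume "t \<in> points Y - {t. l t = 0}"
    then have "point_with 1 t (\<lambda>_. 1 / l t) \<in> curve Y l" by (intro point_with_curve) auto
    then show "t \<in> fst ` curve Y l" by (rule rev_image_eqI) simp
  qed
  then show ?thesis using base_curve_infinite[OF Y degree_one_roots(1)[OF l]] finite_subset by blast
qed

lemma irreducible_curve:
  assumes Y: "base_curve Y" and l: "degree_one l"
  shows "irreducible_closed (zariski (Y \<times>\<^sub>V cube 1)) (curve Y l)"
  using rat_conn_irreducible[OF rat_conn_curve_set[OF Y l] _ subset_refl] closedin_curve[OF Y l] curve_infinite[OF Y l]
  unfolding subtopology_zariski_points by fastforce

lemma generated_cube_1:
  assumes Y: "base_curve Y" and S: "S \<subseteq> points (Y \<times>\<^sub>V cube 1)"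
    and X: "(\<lambda>z. fst z) \<in> X" "cc 0 \<in> X \<or> (\<forall>z\<in>S. cc 0 z = 1)" and f: "f \<in> gens (Y \<times>\<^sub>V cube 1)"
  shows "\<exists>b\<in>alg_ring ({} \<union> X). \<exists>g\<in>alg_ring ({} \<union> X). \<forall>z\<in>S. b z \<noteq> 0 \<and> g z = b z * f z"
proof -
  have one: "(\<lambda>_. 1) \<in> alg_ring ({} \<union> X)" by (rule alg_ring_ops)
  have fstR: "(\<lambda>z. fst z) \<in> alg_ring ({} \<union> X)" by (rule alg_ring_gen) (use X in simp)
  from f consider g where "g \<in> gens Y" "f = (\<lambda>z. g (fst z))" | "f = cc 0"
    unfolding gens_prod_cube by fastforce
  then show ?thesis
  proof cases
    case (1 g)
    then show ?thesis using base_gen_alg[OF Y 1(1) S fstR] by simp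
  next
    case 2
    from X(2) show ?thesis
    proof
      assume "cc 0 \<in> X"
      then have "cc 0 \<in> alg_ring ({} \<union> X)" by (intro alg_ring_gen) simp
      then show ?thesis unfolding 2 by (intro bexI[OF _ one] bexI[of _ "cc 0"]) simp_all
    next
      assume "\<forall>z\<in>S. cc 0 z = 1"
      then show ?thesis unfolding 2 by (intro bexI[OF _ one]) simp
    qed
  qed
qed

lemma irr_chain_two:
  assumes "irreducible_closed T C" "irreducible_closed T D" "C \<subset> D"
  shows "irr_chain T 1 (\<lambda>i. if i = 0 then C else D)"
  using assms unfolding irr_chain_def by auto

lemma codim_curve:
  assumes Y: "base_curve Y" and l: "degree_one l"
  shows "codim (zariski (Y \<times>\<^sub>V cube 1)) (curve Y l) = enat 1"
proof -
  let ?V = "Y \<times>\<^sub>V cube 1" and ?X = "{\<lambda>z. fst z, cc 0} :: (complex \<times> p1 list \<Rightarrow> complex) set"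
  let ?T = "subtopology (zariski ?V) (points ?V)"
  have irrV: "irreducible_closed ?T (points ?V)"
    using irreducible_zero_face[OF Y empty_subsetI] unfolding zero_face_empty .
  have irr: "irreducible_closed ?T (curve Y l)"
    unfolding subtopology_zariski_points by (rule irreducible_curve[OF Y l])
  obtain t where t: "t \<in> points Y" using base_curve_infinite[OF Y finite.emptyI] by (metis Diff_empty finite.emptyI equals0I)
  have "point_with 1 t (\<lambda>_. 0) \<in> points ?V" "point_with 1 t (\<lambda>_. 0) \<notin> curve Y l"
    using t unfolding curve_def by (simp_all add: point_with_points del: points_prod)
  then have lt: "curve Y l \<subset> points ?V" unfolding curve_def by blast
  have GX: "{} \<union> ?X \<subseteq> coord_ring ?V" by (simp add: base_coord_ring[OF Y, simplified] cc_coord_ring)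
  have gens: "\<exists>b\<in>alg_ring ({} \<union> ?X). \<exists>g\<in>alg_ring ({} \<union> ?X). \<forall>z\<in>points ?V. b z \<noteq> 0 \<and> g z = b z * f z"
    if "f \<in> gens ?V" for f
    by (rule generated_cube_1[OF Y subset_refl _ _ that]) simp_all
  have na: "\<not> algebraic_on (curve Y l) (alg_ring {}) (\<lambda>z. fst z)"
    by (rule not_algebraic_on) (use curve_infinite[OF Y l] in simp)
  have "codim ?T (if (0::nat) = 0 then curve Y l else points ?V) = enat 1"
  proof (rule codim_eqI[OF subset_refl _ GX _ generated_up_to_denominators[OF GX gens] irr_chain_two[OF irr irrV lt]])
    show "constants_on {} (points ?V)" by (rule constants_onI) simp
    show "indep_on (if (0::nat) = 0 then curve Y l else points ?V) {} [\<lambda>z. fst z]"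
      using indep_on_snoc[of "curve Y l" "{}" "[]" "\<lambda>z. fst z"] na by simp
    show "card ?X \<le> length [\<lambda>z :: complex \<times> p1 list. fst z] + 1" by (simp add: card_insert_if)
  qed simp_all
  then show ?thesis unfolding subtopology_zariski_points by simp
qed

lemma curve_zero_face:
  assumes Y: "base_curve Y" and l: "degree_one l"
  shows "curve Y l \<inter> zero_face Y 1 {0} = {} \<or>
    has_codim (subtopology (zariski (Y \<times>\<^sub>V cube 1)) (zero_face Y 1 {0})) (curve Y l \<inter> zero_face Y 1 {0}) 1"
proof (cases "curve Y l \<inter> zero_face Y 1 {0} = {}")
  case False
  let ?V = "Y \<times>\<^sub>V cube 1" and ?X = "{\<lambda>z. fst z} :: (complex \<times> p1 list \<Rightarrow> complex) set" and ?F = "zero_face Y 1 {0}"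
  let ?T = "subtopology (zariski ?V) ?F" and ?P = "curve Y l \<inter> ?F"
  obtain a where a: "\<And>t. l t = 1 \<longleftrightarrow> t = a" using degree_one_roots(2)[OF l] by blast
  have FV: "?F \<subseteq> points ?V" unfolding zero_face_def by blast
  have Peq: "?P = {z \<in> ?F. \<forall>f\<in>{\<lambda>z. l (fst z) - 1}. f z = 0}"
    unfolding curve_def zero_face_def by auto
  have "{\<lambda>z. l (fst z) - 1} \<subseteq> coord_ring ?V"
    using degree_one_ring[OF l base_coord_ring[OF Y]] by (auto intro!: coord_ring_diff coord_ring_1)
  then have cl: "closedin ?T ?P" unfolding Peq by (rule closedin_equations[OF FV])
  obtain p where p: "p \<in> ?P" using False by blast
  have single: "?P = {p}"
  proof -
    have "z = p" if z: "z \<in> ?P" for z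
    proof (rule cube_points_eqI)
      show "z \<in> points ?V" "p \<in> points ?V" using z p FV by blast+
      show "fst z = fst p" using z p a unfolding Peq by auto
      show "cc i z = cc i p" if "i < 1" for i using z p that unfolding zero_face_def by auto
    qed
    then show ?thesis using p by blast
  qed
  have irr: "irreducible_closed ?T ?P"
    using cl unfolding irreducible_closed_def single by blast
  have irrF: "irreducible_closed ?T ?F" by (rule irreducible_zero_face[OF Y]) simp
  obtain t where t: "t \<in> points Y - {a}"
    using base_curve_infinite[OF Y, of "{a}"] by (metis all_not_in_conv finite.emptyI finite.insertI)
  have "point_with 1 t (\<lambda>_. 1) \<in> ?F" using t unfolding zero_face_def by (simp add: point_with_points del: points_prod)
  moreover have "point_with 1 t (\<lambda>_. 1) \<notin> ?P" unfolding Peq using t a by auto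
  ultimately have lt: "?P \<subset> ?F" by blast
  have GX: "{} \<union> ?X \<subseteq> coord_ring ?V" using base_coord_ring[OF Y] by simp
  have gens: "\<exists>b\<in>alg_ring ({} \<union> ?X). \<exists>g\<in>alg_ring ({} \<union> ?X). \<forall>z\<in>?F. b z \<noteq> 0 \<and> g z = b z * f z"
    if "f \<in> gens ?V" for f
    by (rule generated_cube_1[OF Y FV _ _ that]) (simp_all add: zero_face_def)
  have "codim ?T (if (0::nat) = 0 then ?P else ?F) = enat 1"
  proof (rule codim_eqI[OF FV _ GX _ generated_up_to_denominators[OF GX gens] irr_chain_two[OF irr irrF lt]])
    show "constants_on {} ?F" by (rule constants_onI) simp
    show "card ?X \<le> length ([] :: (complex \<times> p1 list \<Rightarrow> complex) list) + 1" by simp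
  qed simp_all
  then have "codim ?T ?P = enat 1" by simp
  then have "has_codim ?T ?P 1" unfolding has_codim_def irr_components_irreducible[OF irr] by simp
  then show ?thesis by (rule disjI2)
qed simp

lemma curve_admissible:
  assumes Y: "base_curve Y" and l: "degree_one l"
  shows "curve Y l \<in> admissible Y 1 1"
  unfolding admissible_def Let_def
proof (intro CollectI conjI ballI)
  let ?V = "Y \<times>\<^sub>V cube 1"
  have irr: "irreducible_closed (zariski ?V) (curve Y l)" by (rule irreducible_curve[OF Y l])
  have cod: "codim (zariski ?V) (curve Y l) = enat 1" by (rule codim_curve[OF Y l])
  show "irreducible_closed (zariski ?V) (curve Y l)" by (rule irr)
  show "codim (zariski ?V) (curve Y l) = enat 1" by (rule cod)
  fix \<phi> assume \<phi>: "\<phi> \<in> face_eqs 1"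
  let ?F = "points Y \<times> face 1 \<phi>"
  have cond: "z \<in> ?F \<longleftrightarrow> (\<forall>i\<in>dom \<phi>. cc i z = (if \<phi> i = Some Infty then 0 else 1))" if "z \<in> points ?V" for z
    by (rule face_condition[OF that \<phi>])
  have dom: "dom \<phi> = {} \<or> dom \<phi> = {0}" using \<phi> unfolding face_eqs_def by fastforce
  then consider "dom \<phi> = {}" | "dom \<phi> = {0}" "\<phi> 0 = Some Infty" | "dom \<phi> = {0}" "\<phi> 0 \<noteq> Some Infty" by blast
  then show "curve Y l \<inter> ?F = {} \<or> has_codim (subtopology (zariski ?V) ?F) (curve Y l \<inter> ?F) 1"
  proof cases
    case 1
    then have F: "?F = points ?V" using cond points_face_subset[of Y 1 \<phi>] by auto
    have "curve Y l \<inter> ?F = curve Y l" unfolding F curve_def by blast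
    then show ?thesis
      unfolding F subtopology_zariski_points has_codim_def using irr_components_irreducible[OF irr] cod by simp
  next
    case 2
    have "z \<notin> ?F" if z: "z \<in> curve Y l" for z
    proof -
      have "z \<in> points ?V" "cc 0 z \<noteq> 0" using z unfolding curve_def by auto
      then show ?thesis using cond[of z] 2 by simp
    qed
    then show ?thesis by blast
  next
    case 3
    have F: "?F = zero_face Y 1 {0}"
    proof (intro subset_antisym subsetI)
      fix z assume z: "z \<in> ?F"
      then have "z \<in> points ?V" using points_face_subset by blast
      then show "z \<in> zero_face Y 1 {0}" using z cond[of z] 3 unfolding zero_face_def by simp
    next
      fix z assume z: "z \<in> zero_face Y 1 {0}"
      then have "z \<in> points ?V" unfolding zero_face_def by blast
      then show "z \<in> ?F" using z cond[of z] 3 unfolding zero_face_def by simp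
    qed
    show ?thesis unfolding F by (rule curve_zero_face[OF Y l])
  qed
qed

section \<open>Boundaries of the polylogarithmic cycles\<close>

text \<open>Setting \<open>c\<^bsub>2k\<^esub>\<close> to \<open>1\<close> and recomputing the dependent coordinates retracts an open subset to the face,
  and changes every coordinate by a multiple of \<open>1 - c\<^bsub>2k\<^esub>\<close>, up to denominators.\<close>

lemma polylog_zero_faces_uniformizer:
  assumes Y: "base_curve Y" and n: "n \<ge> 2" and k: "k < n - 1"
  shows "uniformizer (Y \<times>\<^sub>V cube (2 * n - 1)) (\<lambda>z. 1 - cc (2 * k) z) (polylog Y n) {z \<in> polylog Y n. cc (2 * k) z = 1}"
proof -
  let ?V = "Y \<times>\<^sub>V cube (2 * n - 1)" and ?W = "{z \<in> polylog Y n. cc (2 * k) z = 1}"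
  have n1: "n \<ge> 1" and kN: "2 * k < 2 * n - 1" using n k by auto
  have kE: "2 * k \<in> evens n" using k unfolding evens_def by blast
  \<comment> \<open>\<open>Q l\<close> is the value of the \<open>l\<close>-th partial product after the retraction, and \<open>b\<close> the product of the
    denominators.\<close>
  define c where "c = (\<lambda>(z :: complex \<times> p1 list) i. cc i z)"
  define Q where "Q = (\<lambda>l z. pp_without k l (fst z) (c z))"
  define \<rho> where "\<rho> = (\<lambda>z. graph_point n (n - 1) (fst z) ((c z)(2 * k := 1)))"
  define b where "b = (\<lambda>z. \<Prod>l\<in>{k..<n-1}. 1 - Q l z)"
  have QV: "Q l \<in> coord_ring ?V" if "l < n - 1" for l
    unfolding Q_def pp_without_def c_def
    by (intro coord_ring.mult coord_ring_prod base_coord_ring[OF Y] cc_coord_ring) (use that in auto)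
  have bV: "b \<in> coord_ring ?V"
    unfolding b_def by (intro coord_ring_prod coord_ring_diff coord_ring_1 QV) auto
  have ppQ: "pp l (fst z) (c z) = cc (2 * k) z * Q l z" if "k \<le> l" for l z
  proof -
    have "c z = (c z)(2 * k := cc (2 * k) z)" by (auto simp: c_def)
    then have "pp l (fst z) (c z) = pp l (fst z) ((c z)(2 * k := cc (2 * k) z))" by (rule arg_cong)
    then show ?thesis unfolding pp_update Q_def using that by simp
  qed
  have Qne: "1 - Q l z \<noteq> 0" if "b z \<noteq> 0" "k \<le> l" "l < n - 1" for l z
    using that unfolding b_def by (simp add: prod_zero_iff)
  have in_domain: "in_domain n (n - 1) (fst z) ((c z)(2 * k := 1))" if z: "z \<in> polylog Y n" and bz: "b z \<noteq> 0" for z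
    unfolding in_domain_def
  proof (intro conjI allI impI)
    have "(\<Prod>j<n-1. ((c z)(2 * k := 1)) (2 * j)) \<noteq> 0"
      using polylog_even_nonzero[OF z] by (auto simp: prod_zero_iff c_def)
    then show "fst z * (\<Prod>j<n-1. ((c z)(2 * k := 1)) (2 * j)) \<noteq> 0" using polylog_fst_nonzero[OF z] by simp
    fix l assume l: "l < n - 1"
    show "pp l (fst z) ((c z)(2 * k := 1)) \<noteq> 1"
    proof (cases "k \<le> l")
      case True
      then show ?thesis using Qne[OF bz True l] unfolding pp_update Q_def by simp
    next
      case False
      then show ?thesis using polylog_pp_nonzero(2)[OF z l] unfolding pp_update c_def by simp
    qed
  qed
  have cc\<rho>: "cc i (\<rho> z) = graph_coords n (n - 1) (fst z) ((c z)(2 * k := 1)) i" if "i < 2 * n - 1" for i z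
    unfolding \<rho>_def by (rule cc_graph_point[OF that])
  have odd_last: "Suc (2 * l) \<noteq> 2 * n - 2" for l by presburger
  have free_k: "free_index n (n - 1) (2 * k)" by (rule evens_free[OF kE])
  show ?thesis
  proof (rule uniformizer_by_retraction[where b = b and \<rho> = \<rho>])
    show "(\<lambda>z. 1 - cc (2 * k) z) \<in> coord_ring ?V"
      by (intro coord_ring_diff coord_ring_1 cc_coord_ring kN)
    have "infinite (fst ` slice Y n (n - 1) UNIV {2 * k} (\<lambda>_. 1))"
      by (rule slice_ones_infinite[OF Y n1 order_refl]) (use free_k in simp)
    moreover have "slice Y n (n - 1) UNIV {2 * k} (\<lambda>_. 1) = ?W" unfolding slice_polylog by auto
    ultimately show "?W \<noteq> {}" by (metis finite.emptyI image_empty)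
    show "?W \<subseteq> polylog Y n" by blast
    show "b \<in> coord_ring ?V" by (rule bV)
    show "b w \<noteq> 0" if w: "w \<in> ?W" for w
    proof -
      have "1 - Q l w \<noteq> 0" if "l \<in> {k..<n-1}" for l
        using ppQ[of l w] polylog_pp_nonzero(2)[of w Y n l] w that by (auto simp: c_def)
      then show ?thesis unfolding b_def by (simp add: prod_zero_iff)
    qed
    show "\<rho> z \<in> ?W" if z: "z \<in> polylog Y n" and bz: "b z \<noteq> 0" for z
    proof -
      have "fst z \<in> points Y" using polylog_points[OF z] by (simp add: mem_Times_iff)
      then have "\<rho> z \<in> polylog Y n" unfolding \<rho>_def polylog_def by (rule graph_point_partial_polylog[OF _ n1 order_refl in_domain[OF z bz]])
      moreover have "cc (2 * k) (\<rho> z) = 1" unfolding cc\<rho>[OF kN] graph_coords_free[OF free_k] by simp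
      ultimately show ?thesis by blast
    qed
    fix h assume "h \<in> gens ?V"
    then consider g where "g \<in> gens Y" "h = (\<lambda>z. g (fst z))" | i where "i < 2 * n - 1" "h = cc i"
      unfolding gens_prod_cube by blast
    then show "\<exists>d\<in>coord_ring ?V. \<exists>a\<in>coord_ring ?V. (\<forall>w\<in>?W. d w \<noteq> 0) \<and>
      (\<forall>z\<in>polylog Y n. b z \<noteq> 0 \<longrightarrow> d z * (h z - h (\<rho> z)) = a z * (1 - cc (2 * k) z))"
    proof cases
      case (1 g)
      have "h z - h (\<rho> z) = 0" for z unfolding 1(2) \<rho>_def by simp
      then show ?thesis by (intro bexI[OF _ coord_ring_1] bexI[OF _ coord_ring_0]) simp
    next
      case (2 i)
      have Vi: "cc i \<in> coord_ring ?V" by (rule cc_coord_ring[OF 2(1)])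
      have same: ?thesis if "\<And>z. z \<in> polylog Y n \<Longrightarrow> b z \<noteq> 0 \<Longrightarrow> cc i (\<rho> z) = cc i z"
        using that unfolding 2(2) by (intro bexI[OF _ coord_ring_1] bexI[OF _ coord_ring_0]) simp
      consider "i = 2 * k" | "i \<in> evens n" "i \<noteq> 2 * k" | "i = 2 * n - 2"
        | l where "i = 2 * l + 1" "l < n - 1" "l < k" | l where "i = 2 * l + 1" "l < n - 1" "k \<le> l"
      proof (cases "even i")
        case True
        then obtain l where "i = 2 * l" by blast
        then show ?thesis using that(1-3) 2(1) unfolding evens_def by (cases "l = n - 1") auto
      next
        case False
        then obtain l where "i = 2 * l + 1" by (metis oddE)
        then show ?thesis using that(4,5)[of l] 2(1) by (cases "l < k") auto
      qed
      then show ?thesis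
      proof cases
        case 1
        have "cc i (\<rho> z) = 1" for z unfolding 1 cc\<rho>[OF kN] graph_coords_free[OF free_k] by simp
        then have "\<forall>z\<in>polylog Y n. b z \<noteq> 0 \<longrightarrow> 1 * (h z - h (\<rho> z)) = - 1 * (1 - cc (2 * k) z)"
          unfolding 2(2) 1 by simp
        then show ?thesis
          by (intro bexI[OF _ coord_ring_1] bexI[OF _ coord_ring_uminus[OF coord_ring_1]]) simp
      next
        case a: 2
        show ?thesis
          by (rule same) (use a in \<open>simp add: cc\<rho>[OF 2(1)] graph_coords_free[OF evens_free[OF a(1)]] c_def\<close>)
      next
        case 3
        have "1 * (cc i z - cc i (\<rho> z)) = cc i z * (1 - cc (2 * k) z)" if z: "z \<in> polylog Y n" for z
        proof -
          let ?p = "\<lambda>v. fst z * (\<Prod>j<n-1. ((c z)(2 * k := v)) (2 * j))"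
          have nn: "n - 1 = Suc (n - 2)" using n by simp
          have p: "?p v = v * Q (n - 2) z" for v
          proof -
            have "?p v = pp (n - 2) (fst z) ((c z)(2 * k := v))"
              unfolding pp_def nn lessThan_Suc_atMost ..
            also have "\<dots> = v * Q (n - 2) z"
            proof -
              have "k \<le> n - 2" using k by linarith
              then show ?thesis unfolding pp_update Q_def by simp
            qed
            finally show ?thesis .
          qed
          have "cc i (\<rho> z) = 1 / Q (n - 2) z"
            unfolding cc\<rho>[OF 2(1)] graph_coords_def using 3 p[of 1] by simp
          moreover have eq: "cc (2 * k) z * Q (n - 2) z * cc i z = 1"
          proof -
            have "k \<le> n - 2" using k by linarith
            then show ?thesis using polylog_last[OF z n] ppQ[of "n - 2" z] unfolding 3 c_def by simp
          qed
          moreover have "1 / Q (n - 2) z = cc (2 * k) z * cc i z"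
          proof -
            have "Q (n - 2) z \<noteq> 0" using eq by auto
            then show ?thesis using eq by (simp add: divide_eq_eq ac_simps)
          qed
          ultimately show ?thesis by (simp add: algebra_simps)
        qed
        then show ?thesis unfolding 2(2) by (intro bexI[OF _ coord_ring_1] bexI[OF _ Vi]) simp
      next
        case (4 l)
        show ?thesis
        proof (rule same)
          fix z assume z: "z \<in> polylog Y n"
          have "pp l (fst z) ((c z)(2 * k := 1)) = pp l (fst z) (c z)" unfolding pp_update using 4(3) by simp
          then have "cc i (\<rho> z) = 1 / (1 - pp l (fst z) (c z))"
            unfolding cc\<rho>[OF 2(1)] graph_coords_def using 4 odd_last[of l] by simp
          then show "cc i (\<rho> z) = cc i z"
            using polylog_equation[OF z 4(2)] polylog_pp_nonzero(2)[OF z 4(2)] unfolding 4(1) c_def by (simp add: divide_eq_eq)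
        qed
      next
        case (5 l)
        have key: "(1 - Q l z) * (cc i z - cc i (\<rho> z)) = - (Q l z * cc i z) * (1 - cc (2 * k) z)"
          if z: "z \<in> polylog Y n" and bz: "b z \<noteq> 0" for z
        proof -
          have "cc i (\<rho> z) = 1 / (1 - Q l z)"
            unfolding cc\<rho>[OF 2(1)] graph_coords_def using 5 odd_last[of l] by (simp add: pp_update Q_def)
          then have 1: "(1 - Q l z) * cc i (\<rho> z) = 1" using Qne[OF bz 5(3,2)] by simp
          have 2: "cc i z * (1 - cc (2 * k) z * Q l z) = 1"
            using polylog_equation[OF z 5(2)] ppQ[OF 5(3), of z] unfolding 5(1) c_def by simp
          have "(1 - Q l z) * (cc i z - cc i (\<rho> z)) = (1 - Q l z) * cc i z - (1 - Q l z) * cc i (\<rho> z)"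
            by (simp add: algebra_simps)
          also have "\<dots> = (1 - Q l z) * cc i z - cc i z * (1 - cc (2 * k) z * Q l z)" unfolding 1 2 ..
          finally show ?thesis by (simp add: algebra_simps)
        qed
        have d: "(\<lambda>z. 1 - Q l z) \<in> coord_ring ?V" by (intro coord_ring_diff coord_ring_1 QV 5(2))
        have a: "(\<lambda>z. - (Q l z * cc i z)) \<in> coord_ring ?V" by (intro coord_ring_uminus coord_ring.mult QV 5(2) Vi)
        have dW: "1 - Q l w \<noteq> 0" if "w \<in> ?W" for w
          using ppQ[OF 5(3), of w] polylog_pp_nonzero(2)[of w Y n l] that 5(2) by (auto simp: c_def)
        show ?thesis unfolding 2(2)
          by (rule bexI[OF _ d], rule bexI[OF _ a]) (use dW key in blast)
      qed
    qed
  qed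
qed

lemma polylog_simple_faces:
  assumes Y: "base_curve Y" and n: "n \<ge> 2"
  shows "simple_faces Y (2 * n - 1) (polylog Y n) (\<lambda>i. {z \<in> polylog Y n. cc i z = 1}) (\<lambda>_. {})"
  unfolding simple_faces_def
proof (intro conjI allI impI)
  let ?V = "Y \<times>\<^sub>V cube (2 * n - 1)"
  have n1: "n \<ge> 1" using n by simp
  show "irreducible_closed (zariski ?V) (polylog Y n)" by (rule irreducible_polylog[OF Y n1])
  fix i assume i: "i < 2 * n - 1"
  show "simple_cut ?V (cc i) (polylog Y n) {}"
    unfolding simple_cut_def using polylog_coordinates(1)[OF _ n i] by blast
  show "simple_cut ?V (\<lambda>z. 1 - cc i z) (polylog Y n) {z \<in> polylog Y n. cc i z = 1}"
    unfolding simple_cut_def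
  proof (intro conjI)
    show "{z \<in> polylog Y n. cc i z = 1} = {z \<in> polylog Y n. 1 - cc i z = 0}" by auto
    show "{z \<in> polylog Y n. cc i z = 1} = {} \<or> irreducible_closed (zariski ?V) {z \<in> polylog Y n. cc i z = 1} \<and>
      uniformizer ?V (\<lambda>z. 1 - cc i z) (polylog Y n) {z \<in> polylog Y n. cc i z = 1}"
    proof (cases "i \<in> evens n")
      case True
      then obtain k where k: "i = 2 * k" "k < n - 1" unfolding evens_def by blast
      have "irreducible_closed (zariski ?V) (slice Y n (n - 1) UNIV {i} (\<lambda>_. 1))"
        using irreducible_polylog_face[OF Y n1 _ subset_refl slice_points, of "{i}"] True
        unfolding subtopology_zariski_points by simp
      moreover have "slice Y n (n - 1) UNIV {i} (\<lambda>_. 1) = {z \<in> polylog Y n. cc i z = 1}"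
        unfolding slice_polylog by auto
      ultimately show ?thesis using polylog_zero_faces_uniformizer[OF Y n k(2)] unfolding k(1) by simp
    next
      case False
      then have "{z \<in> polylog Y n. cc i z = 1} = {}" using polylog_coordinates(2)[OF _ n i] by blast
      then show ?thesis by (rule disjI1)
    qed
  qed
qed

text \<open>On the face \<open>u\<^bsub>2k\<^esub> = 0\<close> with \<open>k > 0\<close> the neighbouring coordinates \<open>u\<^bsub>2k-1\<^esub>\<close> and \<open>u\<^bsub>2k+1\<^esub>\<close> coincide, so
  that it is invariant under a transposition.\<close>

lemma Alt_inner_face:
  assumes n: "n \<ge> 2" and k: "0 < k" "k < n - 1"
  shows "Alt (2 * n - 2) (set_cycle (omit_coord (2 * k) ` {z \<in> polylog Y n. cc (2 * k) z = 1})) = 0"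
proof (rule Alt_eq_0_if_transposition[of "2 * k - 1" _ "2 * k"])
  let ?D = "{z \<in> polylog Y n. cc (2 * k) z = 1}" and ?\<tau> = "Transposition.transpose (2 * k - 1) (2 * k)"
  show "2 * k - 1 < 2 * n - 2" "2 * k < 2 * n - 2" "2 * k - 1 \<noteq> 2 * k" using k by auto
  have "cube_action (2 * n - 2) {} ?\<tau> (omit_coord (2 * k) z) = omit_coord (2 * k) z" if z: "z \<in> ?D" for z
  proof (rule prod_list_eqI)
    have zZ: "z \<in> polylog Y n" and c1: "cc (2 * k) z = 1" using z by auto
    have zp: "z \<in> points (Y \<times>\<^sub>V cube (2 * n - 1))" by (rule polylog_points[OF zZ])
    then have len: "length (snd z) = 2 * n - 1" by (simp add: mem_Times_iff points_cube)
    have leno: "length (snd (omit_coord (2 * k) z)) = 2 * n - 2"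
      unfolding snd_omit_coord using len k by simp
    obtain l where l: "k = Suc l" using k(1) by (cases k) auto
    have "pp k (fst z) (\<lambda>i. cc i z) = pp l (fst z) (\<lambda>i. cc i z)"
      using c1 unfolding l pp_Suc by simp
    then have "cc (2 * k + 1) z * (1 - pp l (fst z) (\<lambda>i. cc i z)) = 1" "cc (2 * l + 1) z * (1 - pp l (fst z) (\<lambda>i. cc i z)) = 1"
      using polylog_equation[OF zZ k(2)] polylog_equation[OF zZ, of l] k(2) l by auto
    then have "cc (2 * k + 1) z = cc (2 * l + 1) z"
      by (metis mult_cancel_right mult_zero_right zero_neq_one)
    moreover have "snd z ! (2 * k + 1) \<noteq> Fin 1" "snd z ! (2 * l + 1) \<noteq> Fin 1"
      by (rule nth_cube_points[OF zp], use k l in simp)+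
    ultimately have eq: "snd z ! (2 * k + 1) = snd z ! (2 * k - 1)"
      unfolding cc_def using cube_coord_inj l by simp
    have o: "snd (omit_coord (2 * k) z) ! j = snd z ! insert_index (2 * k) j" if "j < 2 * n - 2" for j
      unfolding snd_omit_coord by (rule nth_omit) (use that len k in auto)
    have o1: "snd (omit_coord (2 * k) z) ! (2 * k - 1) = snd z ! (2 * k - 1)"
      and o2: "snd (omit_coord (2 * k) z) ! (2 * k) = snd z ! (2 * k + 1)"
      using o[of "2 * k - 1"] o[of "2 * k"] k by simp_all
    show "length (snd (cube_action (2 * n - 2) {} ?\<tau> (omit_coord (2 * k) z))) = length (snd (omit_coord (2 * k) z))"
      using leno by simp
    fix j assume "j < length (snd (cube_action (2 * n - 2) {} ?\<tau> (omit_coord (2 * k) z)))"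
    then have j: "j < 2 * n - 2" by simp
    show "snd (cube_action (2 * n - 2) {} ?\<tau> (omit_coord (2 * k) z)) ! j = snd (omit_coord (2 * k) z) ! j"
      unfolding nth_cube_action[OF j] using o1 o2 eq by (auto simp: Transposition.transpose_def)
  qed simp
  then have "cube_action (2 * n - 2) {} ?\<tau> ` omit_coord (2 * k) ` ?D = omit_coord (2 * k) ` ?D"
    unfolding image_image by (intro image_cong) simp_all
  then show "image_cycle (cube_action (2 * n - 2) {} ?\<tau>) (set_cycle (omit_coord (2 * k) ` ?D)) =
    set_cycle (omit_coord (2 * k) ` ?D)"
    unfolding image_cycle_set_cycle by simp
qed

text \<open>Of all faces only \<open>u\<^sub>0 = 0\<close> contributes: the others are empty or killed by alternation.\<close>

lemma boundary_Alt_polylog: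
  assumes Y: "base_curve Y" and n: "n \<ge> 2"
  shows "boundary Y (2 * n - 1) (Alt (2 * n - 1) (Poly_Mapping.single (polylog Y n) 1)) =
    Alt (2 * n - 2) (set_cycle (omit_coord 0 ` {z \<in> polylog Y n. cc 0 z = 1}))"
proof -
  let ?D0 = "\<lambda>i. {z \<in> polylog Y n. cc i z = 1}" and ?D1 = "\<lambda>_::nat. {} :: (complex \<times> p1 list) set"
  have N: "2 * n - 1 = Suc (2 * n - 2)" using n by simp
  have fd: "face_diff ?D0 ?D1 j = set_cycle (omit_coord j ` ?D0 j)" for j
    unfolding face_diff_def set_cycle_def by simp
  have zero: "Alt (2 * n - 2) (set_cycle (omit_coord j ` ?D0 j)) = 0" if j: "j < Suc (2 * n - 2)" "j \<noteq> 0" for j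
  proof (cases "j \<in> evens n")
    case True
    then obtain k where "j = 2 * k" "k < n - 1" unfolding evens_def by blast
    then show ?thesis using Alt_inner_face[OF n, of k Y] j(2) by simp
  next
    case False
    then have "?D0 j = {}" using polylog_coordinates(2)[OF _ n, of _ Y j] j(1) N by fastforce
    then show ?thesis by (simp add: set_cycle_def Alt_linear)
  qed
  have "boundary Y (2 * n - 1) (Alt (2 * n - 1) (Poly_Mapping.single (polylog Y n) 1)) =
      (\<Sum>j<Suc (2 * n - 2). scale ((- 1) ^ j) (Alt (2 * n - 2) (set_cycle (omit_coord j ` ?D0 j))))"
    using boundary_Alt[of Y "2 * n - 2" "polylog Y n" ?D0 ?D1] polylog_simple_faces[OF Y n]
    unfolding N fd Alt_sum Alt_linear by blast
  also have "\<dots> = (\<Sum>j\<in>{0}. scale ((- 1) ^ j) (Alt (2 * n - 2) (set_cycle (omit_coord j ` ?D0 j))))"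
    by (rule sum.mono_neutral_right) (use zero in auto)
  finally show ?thesis by simp
qed

section \<open>The product with the logarithm\<close>

definition second :: "('b \<times> 'b) \<times> p1 list \<Rightarrow> 'b \<times> p1 list" where
  "second z = (snd (fst z), tl (snd z))"

definition first :: "('b \<times> 'b) \<times> p1 list \<Rightarrow> 'b \<times> p1 list" where
  "first z = (fst (fst z), [hd (snd z)])"

lemma join_points_first_second: "length (snd z) = Suc m \<Longrightarrow> join_points (first z) (second z) = z"
  unfolding join_points_def first_def second_def by (cases z; cases "snd z") auto

lemma first_join: "length (snd z) = 1 \<Longrightarrow> first (join_points z w) = z"
  unfolding join_points_def first_def by (cases z; cases "snd z") auto

lemma second_join: "length (snd z) = 1 \<Longrightarrow> second (join_points z w) = w"
  unfolding join_points_def second_def by (cases w; cases "snd z") auto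

lemma first_second_points:
  assumes "z \<in> points ((Y \<times>\<^sub>V Y) \<times>\<^sub>V cube (Suc m))"
  shows "first z \<in> points (Y \<times>\<^sub>V cube 1)" "second z \<in> points (Y \<times>\<^sub>V cube m)"
proof -
  obtain u us where us: "snd z = u # us" using assms by (cases "snd z") (auto simp: points_cube mem_Times_iff)
  show "first z \<in> points (Y \<times>\<^sub>V cube 1)" "second z \<in> points (Y \<times>\<^sub>V cube m)"
    using assms us unfolding first_def second_def by (auto simp: points_cube mem_Times_iff)
qed

lemma join_points_points:
  assumes "z \<in> points (Y \<times>\<^sub>V cube 1)" "w \<in> points (Y \<times>\<^sub>V cube m)"
  shows "join_points z w \<in> points ((Y \<times>\<^sub>V Y) \<times>\<^sub>V cube (Suc m))"
  using assms unfolding join_points_def by (auto simp: points_cube mem_Times_iff)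

lemma cc_first: "length (snd z) = Suc m \<Longrightarrow> cc 0 (first z) = cc 0 z"
  unfolding cc_def first_def by (cases "snd z") auto

lemma cc_second: "length (snd z) = Suc m \<Longrightarrow> i < m \<Longrightarrow> cc i (second z) = cc (Suc i) z"
  unfolding cc_def second_def by (cases "snd z") auto

lemma mem_join_set:
  assumes G: "G \<subseteq> points (Y \<times>\<^sub>V cube 1)" and Z: "Z \<subseteq> points (Y \<times>\<^sub>V cube m)"
  shows "z \<in> join_set G Z \<longleftrightarrow> z \<in> points ((Y \<times>\<^sub>V Y) \<times>\<^sub>V cube (Suc m)) \<and> first z \<in> G \<and> second z \<in> Z"
proof
  assume "z \<in> join_set G Z"
  then obtain x w where xw: "x \<in> G" "w \<in> Z" "z = join_points x w" unfolding join_set_def by blast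
  then have "length (snd x) = 1" using G by (auto simp: points_cube mem_Times_iff)
  then show "z \<in> points ((Y \<times>\<^sub>V Y) \<times>\<^sub>V cube (Suc m)) \<and> first z \<in> G \<and> second z \<in> Z"
    using xw join_points_points[of x Y w m] G Z first_join second_join by (metis subsetD)
next
  assume z: "z \<in> points ((Y \<times>\<^sub>V Y) \<times>\<^sub>V cube (Suc m)) \<and> first z \<in> G \<and> second z \<in> Z"
  then have "length (snd z) = Suc m" by (auto simp: points_cube mem_Times_iff)
  then have "z = join_points (first z) (second z)" by (rule join_points_first_second[symmetric])
  then show "z \<in> join_set G Z" unfolding join_set_def using z by blast
qed

lemma gens_prod: "f \<in> gens (V \<times>\<^sub>V W) \<longleftrightarrow> (\<exists>g\<in>gens V. f = (\<lambda>z. g (fst z))) \<or> (\<exists>g\<in>gens W. f = (\<lambda>z. g (snd z)))"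
  unfolding prod_variety_def by (auto simp: comp_def)

lemma coord_ring_fst_fst: "g \<in> coord_ring Y \<Longrightarrow> (\<lambda>z. g (fst (fst z))) \<in> coord_ring ((Y \<times>\<^sub>V Y') \<times>\<^sub>V W)"
  using coord_ring_fst[OF coord_ring_fst] by fast

lemma coord_ring_snd_fst: "g \<in> coord_ring Y' \<Longrightarrow> (\<lambda>z. g (snd (fst z))) \<in> coord_ring ((Y \<times>\<^sub>V Y') \<times>\<^sub>V W)"
  using coord_ring_fst[OF coord_ring_snd] by fast

lemma first_pullback:
  assumes "f \<in> coord_ring (Y \<times>\<^sub>V cube 1)"
  shows "\<exists>f'\<in>coord_ring ((Y \<times>\<^sub>V Y) \<times>\<^sub>V cube (Suc m)). \<forall>p\<in>points ((Y \<times>\<^sub>V Y) \<times>\<^sub>V cube (Suc m)). f' p = f (first p)"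
proof (rule pullback_coord_ring[OF _ assms])
  fix f assume "f \<in> gens (Y \<times>\<^sub>V cube 1)"
  then consider g where "g \<in> gens Y" "f = (\<lambda>z. g (fst z))" | "f = cc 0"
    unfolding gens_prod_cube by fastforce
  then show "\<exists>f'\<in>coord_ring ((Y \<times>\<^sub>V Y) \<times>\<^sub>V cube (Suc m)). \<forall>p\<in>points ((Y \<times>\<^sub>V Y) \<times>\<^sub>V cube (Suc m)). f' p = f (first p)"
  proof cases
    case (1 g)
    then show ?thesis
      by (intro bexI[OF _ coord_ring_fst_fst[OF coord_ring.gen[OF 1(1)]]]) (simp add: first_def)
  next
    case 2
    have "cc 0 p = cc 0 (first p)" if "p \<in> points ((Y \<times>\<^sub>V Y) \<times>\<^sub>V cube (Suc m))" for p
      by (rule cc_first[symmetric, of _ m]) (use that in \<open>simp add: mem_Times_iff points_cube\<close>)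
    then show ?thesis unfolding 2 by (intro bexI[OF _ cc_coord_ring[of 0 "Suc m"]]) simp_all
  qed
qed

lemma second_pullback:
  assumes "f \<in> coord_ring (Y \<times>\<^sub>V cube m)"
  shows "\<exists>f'\<in>coord_ring ((Y \<times>\<^sub>V Y) \<times>\<^sub>V cube (Suc m)). \<forall>p\<in>points ((Y \<times>\<^sub>V Y) \<times>\<^sub>V cube (Suc m)). f' p = f (second p)"
proof (rule pullback_coord_ring[OF _ assms])
  fix f assume "f \<in> gens (Y \<times>\<^sub>V cube m)"
  then consider g where "g \<in> gens Y" "f = (\<lambda>z. g (fst z))" | i where "i < m" "f = cc i"
    unfolding gens_prod_cube by blast
  then show "\<exists>f'\<in>coord_ring ((Y \<times>\<^sub>V Y) \<times>\<^sub>V cube (Suc m)). \<forall>p\<in>points ((Y \<times>\<^sub>V Y) \<times>\<^sub>V cube (Suc m)). f' p = f (second p)"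
  proof cases
    case (1 g)
    then show ?thesis
      by (intro bexI[OF _ coord_ring_snd_fst[OF coord_ring.gen[OF 1(1)]]]) (simp add: second_def)
  next
    case (2 i)
    have "cc (Suc i) p = cc i (second p)" if "p \<in> points ((Y \<times>\<^sub>V Y) \<times>\<^sub>V cube (Suc m))" for p
      by (rule cc_second[symmetric, OF _ 2(1)]) (use that in \<open>simp add: mem_Times_iff points_cube\<close>)
    then show ?thesis unfolding 2(2) using 2(1) by (intro bexI[OF _ cc_coord_ring[of "Suc i" "Suc m"]]) simp_all
  qed
qed

lemma closedin_join_set:
  assumes G: "closedin (zariski (Y \<times>\<^sub>V cube 1)) G" and Z: "closedin (zariski (Y \<times>\<^sub>V cube m)) Z"
  shows "closedin (zariski ((Y \<times>\<^sub>V Y) \<times>\<^sub>V cube (Suc m))) (join_set G Z)"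
  unfolding closedin_zariski
proof (intro conjI ballI)
  let ?V = "(Y \<times>\<^sub>V Y) \<times>\<^sub>V cube (Suc m)"
  have sub: "G \<subseteq> points (Y \<times>\<^sub>V cube 1)" "Z \<subseteq> points (Y \<times>\<^sub>V cube m)"
    using G Z unfolding closedin_zariski by blast+
  note mem = mem_join_set[OF sub]
  show "join_set G Z \<subseteq> points ?V" using mem by blast
  fix p assume p: "p \<in> points ?V - join_set G Z"
  have pt: "first p \<in> points (Y \<times>\<^sub>V cube 1)" "second p \<in> points (Y \<times>\<^sub>V cube m)"
    using first_second_points[of p Y m] p by blast+
  have "first p \<notin> G \<or> second p \<notin> Z" using p mem by blast
  then show "\<exists>f\<in>coord_ring ?V. f p \<noteq> 0 \<and> (\<forall>c\<in>join_set G Z. f c = 0)"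
  proof
    assume "first p \<notin> G"
    then obtain f where f: "f \<in> coord_ring (Y \<times>\<^sub>V cube 1)" "f (first p) \<noteq> 0" "\<forall>c\<in>G. f c = 0"
      using G pt(1) unfolding closedin_zariski by blast
    obtain f' where f': "f' \<in> coord_ring ?V" "\<forall>p\<in>points ?V. f' p = f (first p)"
      using first_pullback[OF f(1), of m] by blast
    have "f' c = 0" if c: "c \<in> join_set G Z" for c
    proof -
      have "c \<in> points ?V" "first c \<in> G" using c mem by blast+
      then show ?thesis using f'(2) f(3) by (simp del: points_prod)
    qed
    moreover have "f' p \<noteq> 0" using f'(2) f(2) p by (simp del: points_prod)
    ultimately show ?thesis using f'(1) by (intro bexI[of _ f'] conjI ballI)
  next
    assume "second p \<notin> Z"
    then obtain f where f: "f \<in> coord_ring (Y \<times>\<^sub>V cube m)" "f (second p) \<noteq> 0" "\<forall>c\<in>Z. f c = 0"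
      using Z pt(2) unfolding closedin_zariski by blast
    obtain f' where f': "f' \<in> coord_ring ?V" "\<forall>p\<in>points ?V. f' p = f (second p)"
      using second_pullback[OF f(1)] by blast
    have "f' c = 0" if c: "c \<in> join_set G Z" for c
    proof -
      have "c \<in> points ?V" "second c \<in> Z" using c mem by blast+
      then show ?thesis using f'(2) f(3) by (simp del: points_prod)
    qed
    moreover have "f' p \<noteq> 0" using f'(2) f(2) p by (simp del: points_prod)
    ultimately show ?thesis using f'(1) by (intro bexI[of _ f'] conjI ballI)
  qed
qed

lemma join_pullback:
  assumes f: "f \<in> gens ((Y \<times>\<^sub>V Y) \<times>\<^sub>V cube (Suc m))"
  shows "(\<exists>g\<in>gens Y. f = (\<lambda>z. g (fst (fst z)))) \<or> (\<exists>g\<in>gens Y. f = (\<lambda>z. g (snd (fst z)))) \<or>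
    f = cc 0 \<or> (\<exists>i<m. f = cc (Suc i))"
proof -
  from f consider g where "g \<in> gens (Y \<times>\<^sub>V Y)" "f = (\<lambda>z. g (fst z))" | i where "i < Suc m" "f = cc i"
    unfolding gens_prod_cube by blast
  then show ?thesis
  proof cases
    case 1
    then show ?thesis unfolding gens_prod by auto
  next
    case (2 i)
    then show ?thesis by (cases i) auto
  qed
qed

lemma rat_conn_join_image:
  assumes rc: "rat_conn V S" and a: "\<And>s. s \<in> S \<Longrightarrow> length (snd (a s)) = 1" and b: "\<And>s. s \<in> S \<Longrightarrow> length (snd (b s)) = m"
    and pa: "\<And>f. f \<in> gens (Y \<times>\<^sub>V cube 1) \<Longrightarrow> \<exists>d\<in>coord_ring V. \<exists>e\<in>coord_ring V. \<forall>s\<in>S. d s \<noteq> 0 \<and> d s * f (a s) = e s"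
    and pb: "\<And>f. f \<in> gens (Y \<times>\<^sub>V cube m) \<Longrightarrow> \<exists>d\<in>coord_ring V. \<exists>e\<in>coord_ring V. \<forall>s\<in>S. d s \<noteq> 0 \<and> d s * f (b s) = e s"
  shows "rat_conn ((Y \<times>\<^sub>V Y) \<times>\<^sub>V cube (Suc m)) ((\<lambda>s. join_points (a s) (b s)) ` S)"
proof (rule rat_conn_image[OF rc])
  fix f assume "f \<in> gens ((Y \<times>\<^sub>V Y) \<times>\<^sub>V cube (Suc m))"
  then consider g where "g \<in> gens Y" "f = (\<lambda>z. g (fst (fst z)))" | g where "g \<in> gens Y" "f = (\<lambda>z. g (snd (fst z)))"
    | "f = cc 0" | i where "i < m" "f = cc (Suc i)" using join_pullback by blast
  then show "\<exists>d\<in>coord_ring V. \<exists>e\<in>coord_ring V. \<forall>s\<in>S. d s \<noteq> 0 \<and> d s * f (join_points (a s) (b s)) = e s"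
  proof cases
    case (1 g)
    have "(\<lambda>z. g (fst z)) \<in> gens (Y \<times>\<^sub>V cube 1)" using 1(1) unfolding gens_prod_cube by blast
    from pa[OF this] show ?thesis unfolding 1(2) join_points_def by simp
  next
    case (2 g)
    have "(\<lambda>z. g (fst z)) \<in> gens (Y \<times>\<^sub>V cube m)" using 2(1) unfolding gens_prod_cube by blast
    from pb[OF this] show ?thesis unfolding 2(2) join_points_def by simp
  next
    case 3
    have "cc 0 \<in> gens (Y \<times>\<^sub>V cube 1)" unfolding gens_prod_cube by auto
    moreover have "cc 0 (join_points (a s) (b s)) = cc 0 (a s)" if "s \<in> S" for s
      using a[OF that] unfolding cc_def join_points_def by (simp add: nth_append)
    ultimately show ?thesis using pa[of "cc 0"] unfolding 3 by simp
  next
    case (4 i)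
    have "cc i \<in> gens (Y \<times>\<^sub>V cube m)" unfolding gens_prod_cube using 4(1) by blast
    moreover have "cc (Suc i) (join_points (a s) (b s)) = cc i (b s)" if "s \<in> S" for s
      using a[OF that] unfolding cc_def join_points_def by (simp add: nth_append)
    ultimately show ?thesis using pb[of "cc i"] unfolding 4(2) by simp
  qed
qed

lemma rat_conn_join_set:
  assumes rc: "rat_conn (Y \<times>\<^sub>V cube 1) G" "rat_conn (Y \<times>\<^sub>V cube m) Z"
    and sub: "G \<subseteq> points (Y \<times>\<^sub>V cube 1)" "Z \<subseteq> points (Y \<times>\<^sub>V cube m)"
  shows "rat_conn ((Y \<times>\<^sub>V Y) \<times>\<^sub>V cube (Suc m)) (join_set G Z)"
proof -
  let ?P = "(Y \<times>\<^sub>V cube 1) \<times>\<^sub>V (Y \<times>\<^sub>V cube m)"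
  have "rat_conn ((Y \<times>\<^sub>V Y) \<times>\<^sub>V cube (Suc m)) ((\<lambda>s. join_points (fst s) (snd s)) ` (G \<times> Z))"
  proof (rule rat_conn_join_image[OF rat_conn_prod[OF rc]])
    show "length (snd (fst s)) = 1" if "s \<in> G \<times> Z" for s
      using that sub(1) by (auto simp: points_cube)
    show "length (snd (snd s)) = m" if "s \<in> G \<times> Z" for s
      using that sub(2) by (auto simp: points_cube)
    show "\<exists>d\<in>coord_ring ?P. \<exists>e\<in>coord_ring ?P. \<forall>s\<in>G \<times> Z. d s \<noteq> 0 \<and> d s * f (fst s) = e s"
      if "f \<in> gens (Y \<times>\<^sub>V cube 1)" for f
      by (intro bexI[OF _ coord_ring_1] bexI[OF _ coord_ring_fst[OF coord_ring.gen[OF that]]]) simp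
    show "\<exists>d\<in>coord_ring ?P. \<exists>e\<in>coord_ring ?P. \<forall>s\<in>G \<times> Z. d s \<noteq> 0 \<and> d s * f (snd s) = e s"
      if "f \<in> gens (Y \<times>\<^sub>V cube m)" for f
      by (intro bexI[OF _ coord_ring_1] bexI[OF _ coord_ring_snd[OF coord_ring.gen[OF that]]]) simp
  qed
  moreover have "(\<lambda>s. join_points (fst s) (snd s)) ` (G \<times> Z) = join_set G Z"
    unfolding join_set_def by force
  ultimately show ?thesis by simp
qed

lemma rat_conn_irreducible_closed:
  assumes "rat_conn V Z" "Z \<noteq> {}" "closedin (zariski V) Z"
  shows "irreducible_closed (zariski V) Z"
  using rat_conn_irreducible[OF assms(1,2) subset_refl] assms(3) unfolding subtopology_zariski_points by blast

lemma rat_conn_polylog: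
  assumes "base_curve Y" "n \<ge> 1" shows "rat_conn (Y \<times>\<^sub>V cube (2 * n - 1)) (polylog Y n)"
  using rat_conn_slice[OF assms order_refl, of "{}" UNIV undefined "\<lambda>_. 1"] unfolding slice_polylog by simp

lemma polylog_infinite:
  assumes "base_curve Y" "n \<ge> 1" shows "infinite (fst ` polylog Y n)"
proof -
  have "slice Y n (n - 1) UNIV {} (\<lambda>_. 1) = polylog Y n" unfolding slice_polylog by simp
  then show ?thesis using slice_ones_infinite[OF assms order_refl, of "{}"] by simp
qed

lemma polynomial_difference:
  assumes "e \<in> alg_ring {\<lambda>t. t}" "f \<in> coord_ring V" "g \<in> coord_ring V"
  shows "\<exists>a\<in>coord_ring V. \<forall>z. e (f z) - e (g z) = a z * (f z - g z)"
  using assms(1)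
proof (induction rule: alg_ring_induct)
  case (const q)
  show ?case by (rule bexI[OF _ coord_ring_0]) simp
next
  case (gen h)
  then show ?case by (intro bexI[OF _ coord_ring_1]) simp
next
  case (add h k)
  then obtain a b where ab: "a \<in> coord_ring V" "\<forall>z. h (f z) - h (g z) = a z * (f z - g z)"
    "b \<in> coord_ring V" "\<forall>z. k (f z) - k (g z) = b z * (f z - g z)" by blast
  have "h (f z) + k (f z) - (h (g z) + k (g z)) = (a z + b z) * (f z - g z)" for z
  proof -
    have "h (f z) + k (f z) - (h (g z) + k (g z)) = (h (f z) - h (g z)) + (k (f z) - k (g z))" by simp
    then show ?thesis using ab(2,4) by (simp add: distrib_right)
  qed
  then show ?case by (intro bexI[OF _ coord_ring.add[OF ab(1,3)]]) simp
next
  case (mult h k)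
  then obtain a b where ab: "a \<in> coord_ring V" "\<forall>z. h (f z) - h (g z) = a z * (f z - g z)"
    "b \<in> coord_ring V" "\<forall>z. k (f z) - k (g z) = b z * (f z - g z)" by blast
  have kh: "(\<lambda>z. k (f z)) \<in> coord_ring V" "(\<lambda>z. h (g z)) \<in> coord_ring V"
    using alg_ring_compose mult assms(2,3) by blast+
  have "h (f z) * k (f z) - h (g z) * k (g z) = (a z * k (f z) + h (g z) * b z) * (f z - g z)" for z
  proof -
    have "h (f z) * k (f z) - h (g z) * k (g z) = (h (f z) - h (g z)) * k (f z) + h (g z) * (k (f z) - k (g z))"
      by (simp add: algebra_simps)
    also have "\<dots> = (a z * (f z - g z)) * k (f z) + h (g z) * (b z * (f z - g z))" using ab(2,4) by simp
    finally show ?thesis by (simp add: algebra_simps)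
  qed
  then show ?case
    by (intro bexI[OF _ coord_ring.add[OF coord_ring.mult[OF ab(1) kh(1)] coord_ring.mult[OF kh(2) ab(3)]]]) simp
qed

text \<open>On the first factor \<open>u = t\<close>, so that a point of the diagonal is determined by its second
  component.\<close>

definition diagonal_lift :: "complex \<times> p1 list \<Rightarrow> (complex \<times> complex) \<times> p1 list" where
  "diagonal_lift w = join_points (point_with 1 (fst w) (\<lambda>_. 1 / (1 - fst w))) w"

definition diagonal_part :: "complex variety \<Rightarrow> nat \<Rightarrow> ((complex \<times> complex) \<times> p1 list) set" where
  "diagonal_part Y k = {z \<in> join_set (curve Y (\<lambda>t. 1 - t)) (polylog Y k). diag_fun z = 0}"

lemma degree_one_minus: "degree_one (\<lambda>t. 1 - t)"
  unfolding degree_one_def by simp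

lemma curve_points: "curve Y l \<subseteq> points (Y \<times>\<^sub>V cube 1)"
  unfolding curve_def by blast

lemma polylog_subset: "polylog Y n \<subseteq> points (Y \<times>\<^sub>V cube (2 * n - 1))"
  using polylog_points by blast

lemma diagonal_lift_in:
  assumes w: "w \<in> polylog Y k" "fst w \<noteq> 1"
  shows "diagonal_lift w \<in> diagonal_part Y k"
proof -
  have "fst w \<in> points Y" using polylog_points[OF w(1)] by (simp add: mem_Times_iff)
  then have "point_with 1 (fst w) (\<lambda>_. 1 / (1 - fst w)) \<in> curve Y (\<lambda>t. 1 - t)" using w(2) by (intro point_with_curve) auto
  then have "diagonal_lift w \<in> join_set (curve Y (\<lambda>t. 1 - t)) (polylog Y k)"
    unfolding diagonal_lift_def join_set_def using w(1) by blast
  moreover have "diag_fun (diagonal_lift w) = 0"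
    unfolding diag_fun_def diagonal_lift_def join_points_def by simp
  ultimately show ?thesis unfolding diagonal_part_def by blast
qed

lemma diagonal_part_eq: "diagonal_part Y k = diagonal_lift ` {w \<in> polylog Y k. fst w \<noteq> 1}"
proof (intro subset_antisym subsetI)
  fix z assume z: "z \<in> diagonal_part Y k"
  then obtain x w where xw: "x \<in> curve Y (\<lambda>t. 1 - t)" "w \<in> polylog Y k" "z = join_points x w"
    unfolding diagonal_part_def join_set_def by blast
  have eq: "fst x = fst w" using z unfolding diagonal_part_def xw(3) diag_fun_def join_points_def by simp
  have c: "x \<in> points (Y \<times>\<^sub>V cube 1)" "cc 0 x * (1 - fst w) = 1" using xw(1) eq unfolding curve_def by auto
  then have ne: "fst w \<noteq> 1" by auto
  have "x = point_with 1 (fst w) (\<lambda>_. 1 / (1 - fst w))"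
  proof (rule cube_points_eqI[OF c(1)])
    show "point_with 1 (fst w) (\<lambda>_. 1 / (1 - fst w)) \<in> points (Y \<times>\<^sub>V cube 1)"
      unfolding point_with_points using c(1) eq by (simp add: mem_Times_iff)
    show "cc i x = cc i (point_with 1 (fst w) (\<lambda>_. 1 / (1 - fst w)))" if "i < 1" for i
      using that c(2) ne by (simp add: eq_divide_eq)
  qed (use eq in simp)
  then have "z = diagonal_lift w" unfolding xw(3) diagonal_lift_def by simp
  then show "z \<in> diagonal_lift ` {w \<in> polylog Y k. fst w \<noteq> 1}" using xw(2) ne by blast
qed (use diagonal_lift_in in blast)

lemma diag_fun_coord_ring:
  assumes "base_curve Y" shows "diag_fun \<in> coord_ring ((Y \<times>\<^sub>V Y) \<times>\<^sub>V W)"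
  unfolding diag_fun_def[abs_def]
  using coord_ring_fst_fst[OF base_curve_coordinate[OF assms]] coord_ring_snd_fst[OF base_curve_coordinate[OF assms]]
  by (intro coord_ring_diff)

lemma curve_nonempty: "base_curve Y \<Longrightarrow> degree_one l \<Longrightarrow> curve Y l \<noteq> {}"
  using curve_infinite[of Y l] by auto

lemma irreducible_join:
  assumes Y: "base_curve Y" and k: "k \<ge> 1"
  shows "irreducible_closed (zariski ((Y \<times>\<^sub>V Y) \<times>\<^sub>V cube (Suc (2 * k - 1)))) (join_set (curve Y (\<lambda>t. 1 - t)) (polylog Y k))"
proof (rule rat_conn_irreducible_closed)
  show "rat_conn ((Y \<times>\<^sub>V Y) \<times>\<^sub>V cube (Suc (2 * k - 1))) (join_set (curve Y (\<lambda>t. 1 - t)) (polylog Y k))"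
    by (rule rat_conn_join_set[OF rat_conn_curve_set[OF Y degree_one_minus] rat_conn_polylog[OF Y k] curve_points polylog_subset])
  show "join_set (curve Y (\<lambda>t. 1 - t)) (polylog Y k) \<noteq> {}"
  proof -
    have "polylog Y k \<noteq> {}" using polylog_infinite[OF Y k] by (metis finite.emptyI image_empty)
    then show ?thesis using curve_nonempty[OF Y degree_one_minus] unfolding join_set_def by blast
  qed
  have "closedin (zariski (Y \<times>\<^sub>V cube (2 * k - 1))) (polylog Y k)"
    using irreducible_polylog[OF Y k] unfolding irreducible_closed_def by blast
  then show "closedin (zariski ((Y \<times>\<^sub>V Y) \<times>\<^sub>V cube (Suc (2 * k - 1)))) (join_set (curve Y (\<lambda>t. 1 - t)) (polylog Y k))"
    by (rule closedin_join_set[OF closedin_curve[OF Y degree_one_minus]])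
qed

lemma irreducible_diagonal_part:
  assumes Y: "base_curve Y" and k: "k \<ge> 1"
  shows "irreducible_closed (zariski ((Y \<times>\<^sub>V Y) \<times>\<^sub>V cube (Suc (2 * k - 1)))) (diagonal_part Y k)"
proof (rule rat_conn_irreducible_closed)
  let ?V = "(Y \<times>\<^sub>V Y) \<times>\<^sub>V cube (Suc (2 * k - 1))" and ?B = "Y \<times>\<^sub>V cube (2 * k - 1)"
  let ?J = "join_set (curve Y (\<lambda>t. 1 - t)) (polylog Y k)" and ?S = "{w \<in> polylog Y k. fst w \<noteq> 1}"
  have t: "(\<lambda>z. fst z) \<in> coord_ring ?B" by (rule base_coord_ring[OF Y])
  have "rat_conn ?V ((\<lambda>w. join_points (point_with 1 (fst w) (\<lambda>_. 1 / (1 - fst w))) w) ` ?S)"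
  proof (rule rat_conn_join_image[OF rat_conn_open[OF rat_conn_polylog[OF Y k] t]])
    show "length (snd (point_with 1 (fst s) (\<lambda>_. 1 / (1 - fst s)))) = 1" if "s \<in> ?S" for s :: "complex \<times> p1 list" by simp
    show "length (snd s) = 2 * k - 1" if "s \<in> ?S" for s
      using that polylog_points[of s Y k] by (simp add: mem_Times_iff points_cube)
    show "\<exists>d\<in>coord_ring ?B. \<exists>e\<in>coord_ring ?B. \<forall>s\<in>?S. d s \<noteq> 0 \<and> d s * f s = e s" if "f \<in> gens ?B" for f
      by (intro bexI[OF _ coord_ring_1] bexI[OF _ coord_ring.gen[OF that]]) simp
    fix f assume "f \<in> gens (Y \<times>\<^sub>V cube 1)"
    then consider g where "g \<in> gens Y" "f = (\<lambda>z. g (fst z))" | "f = cc 0" unfolding gens_prod_cube by fastforce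
    then show "\<exists>d\<in>coord_ring ?B. \<exists>e\<in>coord_ring ?B. \<forall>s\<in>?S. d s \<noteq> 0 \<and> d s * f (point_with 1 (fst s) (\<lambda>_. 1 / (1 - fst s))) = e s"
    proof cases
      case (1 g)
      show ?thesis unfolding 1(2)
        by (intro bexI[OF _ coord_ring_1] bexI[OF _ coord_ring_fst[OF coord_ring.gen[OF 1(1)]]]) simp
    next
      case 2
      show ?thesis unfolding 2
        by (rule bexI[OF _ coord_ring_diff[OF coord_ring_1 t]], rule bexI[OF _ coord_ring_1]) simp
    qed
  qed
  then show "rat_conn ?V (diagonal_part Y k)" unfolding diagonal_part_eq diagonal_lift_def[abs_def] .
  obtain w where "w \<in> polylog Y k" "fst w \<noteq> 1"
  proof -
    have "\<not> fst ` polylog Y k \<subseteq> {1}" using polylog_infinite[OF Y k] finite_subset by blast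
    then show ?thesis using that by blast
  qed
  then show "diagonal_part Y k \<noteq> {}" using diagonal_lift_in by blast
  have J: "closedin (zariski ?V) ?J" using irreducible_join[OF Y k] unfolding irreducible_closed_def by blast
  have "closedin (zariski ?V) {z \<in> points ?V. \<forall>f\<in>{diag_fun}. f z = 0}"
    using closedin_equations[OF subset_refl, of "{diag_fun}" ?V] diag_fun_coord_ring[OF Y]
    unfolding subtopology_zariski_points by blast
  moreover have "diagonal_part Y k = ?J \<inter> {z \<in> points ?V. \<forall>f\<in>{diag_fun}. f z = 0}"
    using irreducible_closed_points[OF irreducible_join[OF Y k]] unfolding diagonal_part_def by blast
  ultimately show "closedin (zariski ?V) (diagonal_part Y k)" using closedin_Int[OF J] by simp
qed

text \<open>The retraction of the exterior product to the diagonal keeps the second component and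
  recomputes the first one, which depends on \<open>t\<close> only.\<close>

lemma diagonal_uniformizer:
  assumes Y: "base_curve Y" and k: "k \<ge> 1"
  shows "uniformizer ((Y \<times>\<^sub>V Y) \<times>\<^sub>V cube (Suc (2 * k - 1))) diag_fun
    (join_set (curve Y (\<lambda>t. 1 - t)) (polylog Y k)) (diagonal_part Y k)"
proof (rule uniformizer_by_retraction[where b = "\<lambda>z. 1 - snd (fst z)" and \<rho> = "\<lambda>z. diagonal_lift (second z)"])
  let ?V = "(Y \<times>\<^sub>V Y) \<times>\<^sub>V cube (Suc (2 * k - 1))" and ?J = "join_set (curve Y (\<lambda>t. 1 - t)) (polylog Y k)"
  have t: "(\<lambda>z. fst (fst z)) \<in> coord_ring ?V" and t': "(\<lambda>z. snd (fst z)) \<in> coord_ring ?V"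
    using coord_ring_fst_fst[OF base_curve_coordinate[OF Y]] coord_ring_snd_fst[OF base_curve_coordinate[OF Y]] by auto
  have J: "z \<in> points ?V" "first z \<in> curve Y (\<lambda>t. 1 - t)" "second z \<in> polylog Y k" if "z \<in> ?J" for z
    using that mem_join_set[OF curve_points polylog_subset, of z Y "\<lambda>t. 1 - t" k] by blast+
  show "diag_fun \<in> coord_ring ?V" by (rule diag_fun_coord_ring[OF Y])
  show "diagonal_part Y k \<noteq> {}" using irreducible_diagonal_part[OF Y k] unfolding irreducible_closed_def by blast
  show "diagonal_part Y k \<subseteq> ?J" unfolding diagonal_part_def by blast
  show b: "(\<lambda>z. 1 - snd (fst z)) \<in> coord_ring ?V" by (rule coord_ring_diff[OF coord_ring_1 t'])
  show bW: "1 - snd (fst z) \<noteq> 0" if "z \<in> diagonal_part Y k" for z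
    using that unfolding diagonal_part_eq diagonal_lift_def join_points_def by auto
  show "diagonal_lift (second z) \<in> diagonal_part Y k" if "z \<in> ?J" "1 - snd (fst z) \<noteq> 0" for z
    by (rule diagonal_lift_in[OF J(3)[OF that(1)]]) (use that(2) in \<open>simp add: second_def\<close>)
  fix h assume "h \<in> gens ?V"
  then consider g where "g \<in> gens Y" "h = (\<lambda>z. g (fst (fst z)))" | g where "g \<in> gens Y" "h = (\<lambda>z. g (snd (fst z)))"
    | "h = cc 0" | i where "i < 2 * k - 1" "h = cc (Suc i)" using join_pullback by blast
  then show "\<exists>d\<in>coord_ring ?V. \<exists>a\<in>coord_ring ?V. (\<forall>w\<in>diagonal_part Y k. d w \<noteq> 0) \<and>
    (\<forall>z\<in>?J. 1 - snd (fst z) \<noteq> 0 \<longrightarrow> d z * (h z - h (diagonal_lift (second z))) = a z * diag_fun z)"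
  proof cases
    case (1 g)
    obtain d e where de: "d \<in> alg_ring {\<lambda>t. t}" "e \<in> alg_ring {\<lambda>t. t}" "\<forall>t\<in>points Y. d t \<noteq> 0 \<and> d t * g t = e t"
      using base_curve_frac[OF Y 1(1)] by (elim bexE)
    obtain a where a: "a \<in> coord_ring ?V" "\<forall>z. e (fst (fst z)) - e (snd (fst z)) = a z * (fst (fst z) - snd (fst z))"
      using polynomial_difference[OF de(2) t t'] by blast
    obtain a' where a': "a' \<in> coord_ring ?V" "\<forall>z. d (fst (fst z)) - d (snd (fst z)) = a' z * (fst (fst z) - snd (fst z))"
      using polynomial_difference[OF de(1) t t'] by blast
    let ?d = "\<lambda>z. d (fst (fst z)) * d (snd (fst z))"
    let ?a = "\<lambda>z. a z * d (snd (fst z)) - e (snd (fst z)) * a' z"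
    have dV: "?d \<in> coord_ring ?V"
      by (rule coord_ring.mult[OF alg_ring_compose[OF de(1) t] alg_ring_compose[OF de(1) t']])
    have aV: "?a \<in> coord_ring ?V"
      by (rule coord_ring_diff[OF coord_ring.mult[OF a(1) alg_ring_compose[OF de(1) t']]
            coord_ring.mult[OF alg_ring_compose[OF de(2) t'] a'(1)]])
    have pts: "fst (fst z) \<in> points Y" "snd (fst z) \<in> points Y" if "z \<in> ?J" for z
      using J(1)[OF that] by (simp_all add: mem_Times_iff)
    have key: "?d z * (g (fst (fst z)) - g (snd (fst z))) = ?a z * diag_fun z" if z: "z \<in> ?J" for z
    proof -
      have gt: "d (fst (fst z)) * g (fst (fst z)) = e (fst (fst z))" "d (snd (fst z)) * g (snd (fst z)) = e (snd (fst z))"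
        using de(3) pts[OF z] by auto
      have "?d z * (g (fst (fst z)) - g (snd (fst z))) =
          (d (fst (fst z)) * g (fst (fst z))) * d (snd (fst z)) - (d (snd (fst z)) * g (snd (fst z))) * d (fst (fst z))"
        by (simp add: algebra_simps)
      also have "\<dots> = (e (fst (fst z)) - e (snd (fst z))) * d (snd (fst z)) - e (snd (fst z)) * (d (fst (fst z)) - d (snd (fst z)))"
        unfolding gt by (simp add: algebra_simps)
      also have "\<dots> = (a z * (fst (fst z) - snd (fst z))) * d (snd (fst z)) - e (snd (fst z)) * (a' z * (fst (fst z) - snd (fst z)))"
        by (simp only: a(2)[rule_format] a'(2)[rule_format])
      also have "\<dots> = ?a z * diag_fun z" unfolding diag_fun_def by (simp add: algebra_simps)
      finally show ?thesis .
    qed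
    have dW: "?d w \<noteq> 0" if "w \<in> diagonal_part Y k" for w
    proof -
      have "w \<in> ?J" using that unfolding diagonal_part_def by blast
      then show ?thesis using de(3) pts[of w] by simp
    qed
    have h: "h z - h (diagonal_lift (second z)) = g (fst (fst z)) - g (snd (fst z))" for z
      unfolding 1(2) diagonal_lift_def join_points_def second_def by simp
    show ?thesis unfolding h by (rule bexI[OF _ dV], rule bexI[OF _ aV]) (intro conjI ballI impI dW key; assumption)
  next
    case (2 g)
    have "h z - h (diagonal_lift (second z)) = 0" for z
      unfolding 2(2) diagonal_lift_def join_points_def second_def by simp
    then show ?thesis by (intro bexI[OF _ coord_ring_1] bexI[OF _ coord_ring_0]) simp
  next
    case 3
    have c: "cc 0 \<in> coord_ring ?V" by (rule cc_coord_ring) simp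
    have key: "(1 - snd (fst z)) * (h z - h (diagonal_lift (second z))) = cc 0 z * diag_fun z"
      if z: "z \<in> ?J" "1 - snd (fst z) \<noteq> 0" for z
    proof -
      have len: "length (snd z) = Suc (2 * k - 1)" using J(1)[OF z(1)] by (simp add: mem_Times_iff points_cube)
      have "cc 0 z * (1 - fst (fst z)) = 1"
        using J(2)[OF z(1)] cc_first[OF len] unfolding curve_def by (simp add: first_def)
      moreover have "cc 0 (diagonal_lift (second z)) = 1 / (1 - snd (fst z))"
        unfolding diagonal_lift_def join_points_def cc_def point_with_def second_def by simp
      ultimately show ?thesis using z(2) unfolding 3 diag_fun_def by (simp add: algebra_simps)
    qed
    show ?thesis by (rule bexI[OF _ b], rule bexI[OF _ c]) (intro conjI ballI impI, rule bW, assumption, rule key)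
  next
    case (4 i)
    have "h z - h (diagonal_lift (second z)) = 0" if z: "z \<in> ?J" for z
    proof -
      have len: "length (snd z) = Suc (2 * k - 1)" using J(1)[OF z] by (simp add: mem_Times_iff points_cube)
      have "cc (Suc i) (diagonal_lift (second z)) = cc i (second z)"
        unfolding diagonal_lift_def join_points_def cc_def point_with_def by simp
      then show ?thesis unfolding 4(2) using cc_second[OF len 4(1)] by simp
    qed
    then show ?thesis by (intro bexI[OF _ coord_ring_1] bexI[OF _ coord_ring_0]) simp
  qed
qed

lemma cyc_prod_polylog:
  assumes Y: "base_curve Y" and k: "k \<ge> 1"
  shows "cyc_prod Y 1 (2 * k - 1) (Alt 1 (Poly_Mapping.single (curve Y (\<lambda>t. 1 - t)) 1))
      (Alt (2 * k - 1) (Poly_Mapping.single (polylog Y k) 1)) =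
    Alt (Suc (2 * k - 1)) (set_cycle (forget_snd ` diagonal_part Y k))"
proof (rule cyc_prod_Alt[OF curve_points polylog_subset irreducible_join[OF Y k] diag_fun_coord_ring[OF Y]])
  show "simple_cut ((Y \<times>\<^sub>V Y) \<times>\<^sub>V cube (Suc (2 * k - 1))) diag_fun (join_set (curve Y (\<lambda>t. 1 - t)) (polylog Y k)) (diagonal_part Y k)"
    unfolding simple_cut_def using irreducible_diagonal_part[OF Y k] diagonal_uniformizer[OF Y k]
    unfolding diagonal_part_def by blast
qed

lemma pp_shift: "pp (Suc j) t c = pp j (t * c 0) (\<lambda>i. c (i + 2))"
  unfolding pp_def by (simp add: prod.atMost_Suc_shift del: prod.atMost_Suc)

text \<open>On the face \<open>u\<^sub>0 = 0\<close>, that is \<open>x\<^bsub>n-1\<^esub> = t\<close>, the coordinate \<open>u\<^sub>1\<close> equals \<open>t\<close> and those after it satisfy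
  the equations of weight \<open>n - 1\<close>.\<close>

lemma outer_face_eq_product:
  assumes k: "k \<ge> 1"
  shows "omit_coord 0 ` {z \<in> polylog Y (Suc k). cc 0 z = 1} = forget_snd ` diagonal_part Y k"
proof -
  let ?Q = "{q \<in> points (Y \<times>\<^sub>V cube (Suc (2 * k - 1))). cc 0 q * (1 - fst q) = 1 \<and> (fst q, tl (snd q)) \<in> polylog Y k}"
  have N: "2 * Suc k - 1 = Suc (Suc (2 * k - 1))" using k by simp
  have tail: "cc i (fst q, tl (snd q)) = cc (Suc i) q" if "length (snd q) = Suc m" "i < m" for q :: "complex \<times> p1 list" and i m
    unfolding cc_def using that by (cases "snd q") auto
  \<comment> \<open>As \<open>c\<^sub>0 = 1\<close>, the partial products of a point of the face are \<open>t\<close> and those of the point without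
    its first two coordinates.\<close>
  have mem: "(t, Fin 0 # us) \<in> polylog Y (Suc k) \<longleftrightarrow> (t, us) \<in> ?Q" for t us
  proof -
    let ?z = "(t, Fin 0 # us)" and ?q = "(t, us)" and ?w = "(t, tl us)"
    have pts: "?z \<in> points (Y \<times>\<^sub>V cube (2 * Suc k - 1)) \<longleftrightarrow> ?q \<in> points (Y \<times>\<^sub>V cube (Suc (2 * k - 1)))"
      unfolding N by (auto simp: points_cube)
    show ?thesis
    proof (cases "?q \<in> points (Y \<times>\<^sub>V cube (Suc (2 * k - 1)))")
      case True
      then have len: "length us = Suc (2 * k - 1)" and wp: "?w \<in> points (Y \<times>\<^sub>V cube (2 * k - 1))"
        by (auto simp: points_cube dest: list.set_sel(2)[rotated])
      have c0: "cc 0 ?z = 1" unfolding cc_def by simp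
      have cS: "cc (Suc i) ?z = cc i ?q" for i unfolding cc_def by simp
      have cw: "cc (i + 2) ?z = cc i ?w" if "i < 2 * k - 1" for i
        using tail[of ?q "2 * k - 1" i] len that cS[of "Suc i"] by simp
      have ppw: "pp (Suc j) t (\<lambda>i. cc i ?z) = pp j t (\<lambda>i. cc i ?w)" if "j \<le> k - 1" for j
        unfolding pp_shift c0 mult_1_right by (rule pp_cong) (rule cw, use that k in linarith)
      have pp0: "pp 0 t (\<lambda>i. cc i ?z) = t" unfolding pp_def using c0 by simp
      have "?z \<in> polylog Y (Suc k) \<longleftrightarrow> pp k t (\<lambda>i. cc i ?z) = 1 \<and>
          (\<forall>j<k. cc (2 * j + 1) ?z * (1 - pp j t (\<lambda>i. cc i ?z)) = 1)"
        unfolding polylog_def partial_polylog_def using pts True by simp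
      also have "pp k t (\<lambda>i. cc i ?z) = pp (k - 1) t (\<lambda>i. cc i ?w)"
        using ppw[of "k - 1"] k by simp
      also have "(\<forall>j<k. cc (2 * j + 1) ?z * (1 - pp j t (\<lambda>i. cc i ?z)) = 1) \<longleftrightarrow>
          cc 0 ?q * (1 - t) = 1 \<and> (\<forall>j<k-1. cc (2 * j + 1) ?w * (1 - pp j t (\<lambda>i. cc i ?w)) = 1)"
      proof -
        obtain l where l: "k = Suc l" using k by (cases k) auto
        have "cc (2 * Suc j + 1) ?z * (1 - pp (Suc j) t (\<lambda>i. cc i ?z)) = cc (2 * j + 1) ?w * (1 - pp j t (\<lambda>i. cc i ?w))"
          if "j < l" for j
        proof -
          have i: "2 * j + 1 < 2 * k - 1" and j: "j \<le> k - 1" using that l by simp_all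
          show ?thesis using cw[OF i] ppw[OF j] by simp
        qed
        moreover have "cc (2 * 0 + 1) ?z * (1 - pp 0 t (\<lambda>i. cc i ?z)) = cc 0 ?q * (1 - t)"
          using cS[of 0] pp0 by simp
        ultimately show ?thesis unfolding l All_less_Suc2 by simp
      qed
      also have "pp (k - 1) t (\<lambda>i. cc i ?w) = 1 \<and> cc 0 ?q * (1 - t) = 1 \<and> (\<forall>j<k-1. cc (2 * j + 1) ?w * (1 - pp j t (\<lambda>i. cc i ?w)) = 1)
          \<longleftrightarrow> cc 0 ?q * (1 - t) = 1 \<and> ?w \<in> polylog Y k"
        unfolding polylog_def partial_polylog_def using wp by auto
      finally show ?thesis using True by simp
    next
      case False
      then show ?thesis using pts polylog_points[of ?z Y "Suc k"] by (simp del: points_prod) blast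
    qed
  qed
  have "omit_coord 0 ` {z \<in> polylog Y (Suc k). cc 0 z = 1} = ?Q"
  proof (intro subset_antisym subsetI)
    fix q assume "q \<in> omit_coord 0 ` {z \<in> polylog Y (Suc k). cc 0 z = 1}"
    then obtain z where z: "z \<in> polylog Y (Suc k)" "cc 0 z = 1" "q = omit_coord 0 z" by blast
    have zp: "z \<in> points (Y \<times>\<^sub>V cube (2 * Suc k - 1))" by (rule polylog_points[OF z(1)])
    then have "length (snd z) = Suc (Suc (2 * k - 1))" unfolding N by (simp add: mem_Times_iff points_cube)
    then obtain u us where us: "snd z = u # us" by (cases "snd z") auto
    have "snd z ! 0 \<noteq> Fin 1" by (rule nth_cube_points[OF zp]) (simp add: N)
    then have "u = Fin 0" using z(2) cube_coord_0[of u] unfolding cc_def us by simp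
    then have "z = (fst z, Fin 0 # us)" using us by (simp add: prod_eq_iff)
    moreover have "q = (fst z, us)" unfolding z(3) omit_coord_def using us by (cases z) simp
    ultimately show "q \<in> ?Q" using mem[of "fst z" us] z(1) by (simp only:)
  next
    fix q assume q: "q \<in> ?Q"
    have "q = (fst q, snd q)" by simp
    then have "(fst q, Fin 0 # snd q) \<in> polylog Y (Suc k)" using mem[of "fst q" "snd q"] q by (simp only: prod.collapse)
    then show "q \<in> omit_coord 0 ` {z \<in> polylog Y (Suc k). cc 0 z = 1}"
      by (intro image_eqI[of _ _ "(fst q, Fin 0 # snd q)"]) (simp_all add: omit_coord_def cc_def)
  qed
  moreover have "forget_snd ` diagonal_part Y k = ?Q"
  proof (intro subset_antisym subsetI)
    fix q assume "q \<in> forget_snd ` diagonal_part Y k"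
    then obtain z where z: "z \<in> diagonal_part Y k" "q = forget_snd z" by blast
    then have zJ: "z \<in> join_set (curve Y (\<lambda>t. 1 - t)) (polylog Y k)" and d: "fst (fst z) = snd (fst z)"
      unfolding diagonal_part_def diag_fun_def by auto
    then have zp: "z \<in> points ((Y \<times>\<^sub>V Y) \<times>\<^sub>V cube (Suc (2 * k - 1)))" and f: "first z \<in> curve Y (\<lambda>t. 1 - t)" and s: "second z \<in> polylog Y k"
      using mem_join_set[OF curve_points polylog_subset] by blast+
    have len: "length (snd z) = Suc (2 * k - 1)" using zp by (simp add: mem_Times_iff points_cube)
    have "q \<in> points (Y \<times>\<^sub>V cube (Suc (2 * k - 1)))" using zp unfolding z(2) forget_snd_def by (simp add: mem_Times_iff)
    moreover have "cc 0 q * (1 - fst q) = 1"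
      using f cc_first[OF len] unfolding z(2) forget_snd_def curve_def cc_def by (simp add: first_def)
    moreover have "(fst q, tl (snd q)) = second z" unfolding z(2) forget_snd_def second_def using d by simp
    ultimately show "q \<in> ?Q" using s by simp
  next
    fix q assume q: "q \<in> ?Q"
    let ?z = "((fst q, fst q), snd q)"
    have qp: "q \<in> points (Y \<times>\<^sub>V cube (Suc (2 * k - 1)))" using q by blast
    then have zp: "?z \<in> points ((Y \<times>\<^sub>V Y) \<times>\<^sub>V cube (Suc (2 * k - 1)))" by (simp add: mem_Times_iff)
    have len: "length (snd ?z) = Suc (2 * k - 1)" using qp by (simp add: mem_Times_iff points_cube)
    have "first ?z \<in> curve Y (\<lambda>t. 1 - t)"
      unfolding curve_def using first_second_points(1)[OF zp] cc_first[OF len] q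
      by (simp add: cc_def first_def del: points_prod)
    moreover have "second ?z \<in> polylog Y k" using q unfolding second_def by simp
    ultimately have "?z \<in> join_set (curve Y (\<lambda>t. 1 - t)) (polylog Y k)"
      using mem_join_set[OF curve_points polylog_subset, of ?z Y] zp by blast
    then have "?z \<in> diagonal_part Y k" unfolding diagonal_part_def diag_fun_def by simp
    then show "q \<in> forget_snd ` diagonal_part Y k"
      by (rule rev_image_eqI) (simp add: forget_snd_def)
  qed
  ultimately show ?thesis by simp
qed

lemma boundary_polylog:
  assumes Y: "base_curve Y" and n: "n \<ge> 2"
  shows "boundary Y (2 * n - 1) (Alt (2 * n - 1) (Poly_Mapping.single (polylog Y n) 1)) =
    cyc_prod Y 1 (2 * (n - 1) - 1) (Alt 1 (Poly_Mapping.single (curve Y (\<lambda>t. 1 - t)) 1))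
      (Alt (2 * (n - 1) - 1) (Poly_Mapping.single (polylog Y (n - 1)) 1))"
proof -
  obtain k where k: "n = Suc k" "k \<ge> 1" using n by (cases n) auto
  have "2 * n - 2 = Suc (2 * k - 1)" using k by simp
  then show ?thesis
    unfolding boundary_Alt_polylog[OF Y n] unfolding k(1) diff_Suc_1 cyc_prod_polylog[OF Y k(2)] outer_face_eq_product[OF k(2)]
    by simp
qed

section \<open>Parametrizations and restriction\<close>

lemma restrict_cycle_Alt:
  assumes Z: "Z \<subseteq> points (B \<times>\<^sub>V cube n)" and ne: "Z \<inter> points (U \<times>\<^sub>V cube n) \<noteq> {}"
  shows "restrict_cycle U n (Alt n (Poly_Mapping.single Z 1)) = Alt n (Poly_Mapping.single (Z \<inter> points (U \<times>\<^sub>V cube n)) 1)"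
proof -
  let ?r = "\<lambda>Z. let Z' = Z \<inter> points (U \<times>\<^sub>V cube n) in if Z' = {} then 0 else Poly_Mapping.single Z' (1 :: rat)"
  let ?Z = "Z \<inter> points (U \<times>\<^sub>V cube n)"
  have "?r (cube_action n e \<sigma> ` Z) = Poly_Mapping.single (cube_action n e \<sigma> ` ?Z) 1" if \<sigma>: "\<sigma> permutes {..<n}" for e \<sigma>
  proof -
    have "cube_action n e \<sigma> z \<in> points (U \<times>\<^sub>V cube n) \<longleftrightarrow> z \<in> points (U \<times>\<^sub>V cube n)" if "z \<in> Z" for z
    proof -
      have zp: "z \<in> points (B \<times>\<^sub>V cube n)" using Z that by blast
      then show ?thesis using cube_action_points[OF \<sigma> zp, of e] by (simp add: mem_Times_iff)
    qed
    then have "cube_action n e \<sigma> ` Z \<inter> points (U \<times>\<^sub>V cube n) = cube_action n e \<sigma> ` ?Z" by blast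
    then show ?thesis using ne by (simp add: Let_def del: points_prod)
  qed
  then have "restrict_cycle U n (alt_sum n (Poly_Mapping.single Z 1)) = alt_sum n (Poly_Mapping.single ?Z 1)"
    unfolding restrict_cycle_def alt_sum_def image_cycle_single lin_ext_sum lin_ext_scale lin_ext_single
    by (intro sum.cong refl) simp
  then show ?thesis unfolding Alt_eq_alt_sum restrict_cycle_def lin_ext_scale by simp
qed

lemma restrict_curve:
  assumes l: "degree_one l"
  shows "restrict_cycle thrice_punctured_line 1 (Alt 1 (Poly_Mapping.single (curve affine_line l) 1)) =
    Alt 1 (Poly_Mapping.single (curve thrice_punctured_line l) 1)"
proof -
  have "curve affine_line l \<inter> points (thrice_punctured_line \<times>\<^sub>V cube 1) = curve thrice_punctured_line l"
    unfolding curve_def affine_line_def by auto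
  then show ?thesis
    using restrict_cycle_Alt[OF curve_points[of affine_line l], of thrice_punctured_line]
      curve_nonempty[OF base_curve_thrice_punctured_line l] by (simp del: points_prod)
qed

lemma restrict_polylog:
  assumes n: "n \<ge> 1"
  shows "restrict_cycle thrice_punctured_line (2 * n - 1) (Alt (2 * n - 1) (Poly_Mapping.single (polylog affine_line n) 1)) =
    Alt (2 * n - 1) (Poly_Mapping.single (polylog thrice_punctured_line n) 1)"
proof -
  have "polylog affine_line n \<inter> points (thrice_punctured_line \<times>\<^sub>V cube (2 * n - 1)) = polylog thrice_punctured_line n"
    unfolding polylog_def partial_polylog_def affine_line_def by auto
  moreover have "polylog thrice_punctured_line n \<noteq> {}"
    using polylog_infinite[OF base_curve_thrice_punctured_line n] by (metis finite.emptyI image_empty)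
  ultimately show ?thesis
    using restrict_cycle_Alt[OF polylog_subset[of affine_line n], of thrice_punctured_line] by (simp del: points_prod)
qed

text \<open>A parametrized set that is already closed needs no closure.\<close>

lemma param_cycle_closed:
  assumes "{(t, us) \<in> points (Y \<times>\<^sub>V cube m). \<exists>x. map Some us = f t x} = Z" "irreducible_closed (zariski (Y \<times>\<^sub>V cube m)) Z"
  shows "param_cycle Y m f = Alt m (Poly_Mapping.single Z 1)"
proof -
  have "zariski (Y \<times>\<^sub>V cube m) closure_of Z = Z"
    using assms(2) unfolding irreducible_closed_def by (simp add: closure_of_eq)
  then show ?thesis unfolding param_cycle_def assms(1) by simp
qed

lemma param_cycle_curve:
  assumes Y: "base_curve Y" and l: "degree_one l"
  shows "param_cycle Y 1 (\<lambda>t x. [Some (Fin (1 - l t))]) = Alt 1 (Poly_Mapping.single (curve Y l) 1)"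
proof (rule param_cycle_closed[OF _ irreducible_curve[OF Y l]])
  have eq: "map Some us = [Some (Fin (1 - l t))] \<longleftrightarrow> cc 0 (t, us) * l t = 1" if "us \<in> points (cube 1)" for t us
  proof -
    obtain u where u: "us = [u]" "u \<noteq> Fin 1" using \<open>us \<in> points (cube 1)\<close> by (cases us) (auto simp: points_cube)
    then show ?thesis by (cases u) (auto simp: cc_def field_simps)
  qed
  show "{(t, us) \<in> points (Y \<times>\<^sub>V cube 1). \<exists>x :: nat \<Rightarrow> p1. map Some us = [Some (Fin (1 - l t))]} = curve Y l"
  proof (rule Set.set_eqI)
    fix z :: "complex \<times> p1 list"
    obtain t us where z: "z = (t, us)" by (cases z)
    show "z \<in> {(t, us) \<in> points (Y \<times>\<^sub>V cube 1). \<exists>x :: nat \<Rightarrow> p1. map Some us = [Some (Fin (1 - l t))]} \<longleftrightarrow> z \<in> curve Y l"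
      unfolding z curve_def points_prod mem_Collect_eq prod.case mem_Times_iff fst_conv snd_conv
      by (rule conj_cong[OF refl]) (use eq[of us t] in simp)
  qed
qed

lemma concat_pairs:
  "length (concat (map (\<lambda>i. [f i, g i]) xs)) = 2 * length xs"
  "j < length xs \<Longrightarrow> concat (map (\<lambda>i. [f i, g i]) xs) ! (2 * j) = f (xs ! j)"
  "j < length xs \<Longrightarrow> concat (map (\<lambda>i. [f i, g i]) xs) ! (2 * j + 1) = g (xs ! j)"
proof -
  show "length (concat (map (\<lambda>i. [f i, g i]) xs)) = 2 * length xs" by (induction xs) auto
  show "concat (map (\<lambda>i. [f i, g i]) xs) ! (2 * j) = f (xs ! j)" if "j < length xs"
    using that by (induction xs arbitrary: j) (auto simp: nth_Cons split: nat.splits)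
  show "concat (map (\<lambda>i. [f i, g i]) xs) ! (2 * j + 1) = g (xs ! j)" if "j < length xs"
    using that by (induction xs arbitrary: j) (auto simp: nth_Cons split: nat.splits)
qed

lemma Li_coords_nth:
  fixes t :: complex and x :: "nat \<Rightarrow> p1"
  assumes n: "n \<ge> 2"
  defines "y \<equiv> \<lambda>k. if k = 0 then Fin t else x (n - k)"
  shows "length (Li_coords n t x) = 2 * n - 1"
    "k < n - 1 \<Longrightarrow> Li_coords n t x ! (2 * k) = map_option one_minus (p1_divide (y k) (y (Suc k)))"
    "k < n - 1 \<Longrightarrow> Li_coords n t x ! (2 * k + 1) = Some (y (Suc k))"
    "Li_coords n t x ! (2 * n - 2) = Some (one_minus (y (n - 1)))"
proof -
  let ?f = "\<lambda>i. map_option one_minus (p1_divide (y (n - 1 - i)) (y (n - i)))" and ?g = "\<lambda>i. Some (y (n - i))"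
  let ?L = "concat (map (\<lambda>i. [?f i, ?g i]) (rev [1..<n]))"
  obtain m where m: "n = Suc (Suc m)" using that[of "n - 2"] n by simp
  have "concat (map (\<lambda>i. [map_option one_minus (p1_divide (x (i + 1)) (x i)), Some (x i)]) (rev [1..<n - 1])) =
      concat (map (\<lambda>i. [?f i, ?g i]) (rev [1..<n - 1]))"
    by (intro arg_cong[of _ _ concat] map_cong refl) (auto simp: y_def)
  then have L: "Li_coords n t x = ?L @ [Some (one_minus (y (n - 1)))]"
    unfolding Li_coords_def using n by (simp add: m y_def)
  have len: "length ?L = 2 * n - 2" by (simp add: concat_pairs(1))
  show "length (Li_coords n t x) = 2 * n - 1" unfolding L using len n by simp
  show "Li_coords n t x ! (2 * n - 2) = Some (one_minus (y (n - 1)))" unfolding L using len by (simp add: nth_append)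
  assume k: "k < n - 1"
  then have kl: "k < length (rev [1..<n])" and r: "rev [1..<n] ! k = n - 1 - k" by (auto simp: rev_nth)
  have r': "n - 1 - (n - 1 - k) = k" "n - (n - 1 - k) = Suc k" using k by auto
  have lt: "2 * k < 2 * n - 2" "2 * k + 1 < 2 * n - 2" using k by simp_all
  show "Li_coords n t x ! (2 * k) = map_option one_minus (p1_divide (y k) (y (Suc k)))"
    unfolding L nth_append len using concat_pairs(2)[OF kl, of ?f ?g, unfolded r r'] lt by simp
  show "Li_coords n t x ! (2 * k + 1) = Some (y (Suc k))"
    unfolding L nth_append len using concat_pairs(3)[OF kl, of ?f ?g, unfolded r r'] lt by simp
qed

lemma all_coordinates:
  fixes n :: nat
  assumes n: "n \<ge> 1"
  shows "(\<forall>i<2 * n - 1. P i) \<longleftrightarrow> (\<forall>k<n - 1. P (2 * k) \<and> P (2 * k + 1)) \<and> P (2 * n - 2)"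
proof
  assume "\<forall>i<2 * n - 1. P i"
  then show "(\<forall>k<n - 1. P (2 * k) \<and> P (2 * k + 1)) \<and> P (2 * n - 2)" using n by simp
next
  assume *: "(\<forall>k<n - 1. P (2 * k) \<and> P (2 * k + 1)) \<and> P (2 * n - 2)"
  show "\<forall>i<2 * n - 1. P i"
  proof (intro allI impI)
    fix i assume i: "i < 2 * n - 1"
    show "P i"
    proof (cases "even i")
      case True
      then obtain k where k: "i = 2 * k" by blast
      show ?thesis
      proof (cases "k = n - 1")
        case True
        have "2 * (n - 1) = 2 * n - 2" by simp
        then show ?thesis using * k True by simp
      next
        case False
        then show ?thesis using * i k by simp
      qed
    next
      case False
      then obtain k where k: "i = 2 * k + 1" by (metis oddE)
      then show ?thesis using * i by simp
    qed
  qed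
qed

text \<open>A coordinate \<open>1 - y\<^sub>k / y\<^bsub>k+1\<^esub>\<close> would be \<open>1\<close>, which is excluded in the cube, if \<open>y\<^sub>k\<close> were finite and
  \<open>y\<^bsub>k+1\<^esub>\<close> infinite, or if \<open>y\<^sub>k\<close> were zero and \<open>y\<^bsub>k+1\<^esub>\<close> not.\<close>

lemma finite_parameters:
  assumes "y 0 = Fin t" and last: "one_minus (y m) \<noteq> Fin 1"
    and step: "\<And>k. k < m \<Longrightarrow> \<exists>u. u \<noteq> Fin 1 \<and> map_option one_minus (p1_divide (y k) (y (Suc k))) = Some u"
  shows "\<exists>a. (\<forall>k\<le>m. y k = Fin (a k) \<and> a k \<noteq> 0) \<and> a 0 = t"
proof -
  have fin: "\<exists>c. y k = Fin c" if "k \<le> m" for k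
    using that
  proof (induction k)
    case (Suc k)
    then obtain c where c: "y k = Fin c" by auto
    show ?case
    proof (cases "y (Suc k)")
      case Infty
      then show ?thesis using step[of k] Suc.prems c by simp
    qed simp
  qed (use assms(1) in simp)
  define a where "a = (\<lambda>k. SOME c. y k = Fin c)"
  have a: "y k = Fin (a k)" if "k \<le> m" for k unfolding a_def by (rule someI_ex[OF fin[OF that]])
  have "a k \<noteq> 0" if "k \<le> m" for k
    using that
  proof (induction rule: inc_induct)
    case base
    then show ?case using last a[of m] by auto
  next
    case (step k)
    then obtain u where u: "u \<noteq> Fin 1" "map_option one_minus (p1_divide (y k) (y (Suc k))) = Some u" using assms(3) by blast
    then show ?case using step a[of k] a[of "Suc k"] by (auto split: if_splits)
  qed
  moreover have "a 0 = t" using a[of 0] assms(1) by simp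
  ultimately show ?thesis using a by blast
qed

lemma param_cycle_polylog:
  assumes Y: "base_curve Y" and n: "n \<ge> 2"
  shows "param_cycle Y (2 * n - 1) (Li_coords n) = Alt (2 * n - 1) (Poly_Mapping.single (polylog Y n) 1)"
proof (rule param_cycle_closed)
  have n1: "n \<ge> 1" using n by simp
  show "irreducible_closed (zariski (Y \<times>\<^sub>V cube (2 * n - 1))) (polylog Y n)" by (rule irreducible_polylog[OF Y n1])
  \<comment> \<open>With \<open>a\<^sub>0 = t\<close> and \<open>a\<^sub>k = x\<^bsub>n-k\<^esub>\<close> the coordinates \<open>c\<^sub>i\<close> are
    \<open>a\<^bsub>k+1\<^esub> / a\<^sub>k\<close>, \<open>1 / (1 - a\<^bsub>k+1\<^esub>)\<close> and \<open>1 / a\<^bsub>n-1\<^esub>\<close>.\<close>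
  have coords: "map Some us = Li_coords n t x \<longleftrightarrow> (\<forall>k<n-1. cc (2 * k) (t, us) = a (Suc k) / a k \<and>
      cc (2 * k + 1) (t, us) * (1 - a (Suc k)) = 1) \<and> cc (2 * n - 2) (t, us) * a (n - 1) = 1"
    if us: "(t, us) \<in> points (Y \<times>\<^sub>V cube (2 * n - 1))" and x: "\<And>k. 0 < k \<Longrightarrow> k \<le> n - 1 \<Longrightarrow> x (n - k) = Fin (a k)"
      and a: "a 0 = t" "\<And>k. k \<le> n - 1 \<Longrightarrow> a k \<noteq> 0" for t us x a
  proof -
    have len: "length us = 2 * n - 1" using us by (simp add: points_cube)
    have u1: "us ! i \<noteq> Fin 1" if "i < 2 * n - 1" for i using nth_cube_points[OF us that] by simp
    have u: "us ! i = Fin (1 - c) \<longleftrightarrow> cc i (t, us) * c = 1" if i: "i < 2 * n - 1" for i c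
    proof (cases "us ! i")
      case (Fin v)
      then have "v \<noteq> 1" using u1[OF i] by auto
      then show ?thesis using Fin by (auto simp: cc_def field_simps)
    qed (simp add: cc_def)
    have y: "(if k = 0 then Fin t else x (n - k)) = Fin (a k)" if "k \<le> n - 1" for k using x[of k] a(1) that by auto
    note L = Li_coords_nth[OF n, where t = t and x = x]
    have L0: "Li_coords n t x ! (2 * k) = Some (Fin (1 - a k / a (Suc k)))" if k: "k < n - 1" for k
    proof -
      have k': "k \<le> n - 1" "Suc k \<le> n - 1" using k by simp_all
      show ?thesis unfolding L(2)[OF k] y[OF k'(1)] y[OF k'(2)] using a(2)[OF k'(2)] by simp
    qed
    have L1: "Li_coords n t x ! (2 * k + 1) = Some (Fin (1 - (1 - a (Suc k))))" if k: "k < n - 1" for k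
    proof -
      have k': "Suc k \<le> n - 1" using k by simp
      show ?thesis unfolding L(3)[OF k] y[OF k'] by simp
    qed
    have L2: "Li_coords n t x ! (2 * n - 2) = Some (Fin (1 - a (n - 1)))"
      unfolding L(4) y[OF order_refl] by simp
    have E: "Some (us ! (2 * k)) = Li_coords n t x ! (2 * k) \<longleftrightarrow> us ! (2 * k) = Fin (1 - a k / a (Suc k))"
        "Some (us ! (2 * k + 1)) = Li_coords n t x ! (2 * k + 1) \<longleftrightarrow> us ! (2 * k + 1) = Fin (1 - (1 - a (Suc k)))"
      if k: "k < n - 1" for k
      unfolding L0[OF k] L1[OF k] option.inject by (rule refl)+
    have "map Some us = Li_coords n t x \<longleftrightarrow> (\<forall>i<2 * n - 1. Some (us ! i) = Li_coords n t x ! i)"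
      unfolding list_eq_iff_nth_eq using len L(1) by simp
    also have "\<dots> \<longleftrightarrow> (\<forall>k<n - 1. us ! (2 * k) = Fin (1 - a k / a (Suc k)) \<and> us ! (2 * k + 1) = Fin (1 - (1 - a (Suc k))))
        \<and> us ! (2 * n - 2) = Fin (1 - a (n - 1))"
      unfolding all_coordinates[OF n1] L2 option.inject
      by (intro arg_cong2[of _ _ _ _ "(\<and>)"] all_cong refl E; assumption)
    also have "\<dots> \<longleftrightarrow> (\<forall>k<n-1. cc (2 * k) (t, us) = a (Suc k) / a k \<and> cc (2 * k + 1) (t, us) * (1 - a (Suc k)) = 1)
        \<and> cc (2 * n - 2) (t, us) * a (n - 1) = 1"
    proof -
      have "us ! (2 * k) = Fin (1 - a k / a (Suc k)) \<longleftrightarrow> cc (2 * k) (t, us) = a (Suc k) / a k" if k: "k < n - 1" for k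
      proof -
        have "2 * k < 2 * n - 1" "a k \<noteq> 0" "a (Suc k) \<noteq> 0" using k a(2)[of k] a(2)[of "Suc k"] by simp_all
        then show ?thesis unfolding u[OF \<open>2 * k < 2 * n - 1\<close>] by (simp add: field_simps)
      qed
      moreover have "us ! (2 * k + 1) = Fin (1 - (1 - a (Suc k))) \<longleftrightarrow> cc (2 * k + 1) (t, us) * (1 - a (Suc k)) = 1" if "k < n - 1" for k
        by (rule u) (use that in simp)
      moreover have "us ! (2 * n - 2) = Fin (1 - a (n - 1)) \<longleftrightarrow> cc (2 * n - 2) (t, us) * a (n - 1) = 1"
        by (rule u) (use n in simp)
      ultimately show ?thesis by (metis (no_types, lifting))
    qed
    finally show ?thesis .
  qed
  have nn: "n - 1 = Suc (n - 2)" using n by simp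
  have "(t, us) \<in> points (Y \<times>\<^sub>V cube (2 * n - 1)) \<and> (\<exists>x. map Some us = Li_coords n t x) \<longleftrightarrow> (t, us) \<in> polylog Y n" for t us
  proof
    assume A: "(t, us) \<in> points (Y \<times>\<^sub>V cube (2 * n - 1)) \<and> (\<exists>x. map Some us = Li_coords n t x)"
    then obtain x where us: "(t, us) \<in> points (Y \<times>\<^sub>V cube (2 * n - 1))" and x: "map Some us = Li_coords n t x" by blast
    have len: "length us = 2 * n - 1" using us by (simp add: points_cube)
    have u1: "us ! i \<noteq> Fin 1" if "i < 2 * n - 1" for i using nth_cube_points[OF us that] by simp
    have xi: "Li_coords n t x ! i = Some (us ! i)" if "i < 2 * n - 1" for i
      unfolding x[symmetric] using that len by simp
    let ?y = "\<lambda>k. if k = 0 then Fin t else x (n - k)"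
    note L = Li_coords_nth[OF n, where t = t and x = x]
    have "\<exists>a. (\<forall>k\<le>n - 1. ?y k = Fin (a k) \<and> a k \<noteq> 0) \<and> a 0 = t"
    proof (rule finite_parameters)
      show "one_minus (?y (n - 1)) \<noteq> Fin 1" using xi[of "2 * n - 2"] u1[of "2 * n - 2"] n unfolding L(4) by simp
      show "\<exists>u. u \<noteq> Fin 1 \<and> map_option one_minus (p1_divide (?y k) (?y (Suc k))) = Some u" if k: "k < n - 1" for k
        using xi[of "2 * k"] u1[of "2 * k"] k unfolding L(2)[OF k] by (intro exI[of _ "us ! (2 * k)"]) simp
    qed simp
    then obtain a where a: "\<And>k. k \<le> n - 1 \<Longrightarrow> ?y k = Fin (a k)" "\<And>k. k \<le> n - 1 \<Longrightarrow> a k \<noteq> 0" "a 0 = t" by blast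
    have xa: "x (n - k) = Fin (a k)" if "0 < k" "k \<le> n - 1" for k using a(1)[OF that(2)] that(1) by simp
    have C: "(\<forall>k<n-1. cc (2 * k) (t, us) = a (Suc k) / a k \<and>
      cc (2 * k + 1) (t, us) * (1 - a (Suc k)) = 1) \<and> cc (2 * n - 2) (t, us) * a (n - 1) = 1"
      using coords[of t us x a, OF us xa a(3,2)] x by blast
    have pp: "pp k t (\<lambda>i. cc i (t, us)) = a (Suc k)" if "k < n - 1" for k
      using that
    proof (induction k)
      case 0
      have "cc (2 * 0) (t, us) = a (Suc 0) / a 0" using C 0 by blast
      then show ?case unfolding pp_def using a(2)[of 0] a(3) by simp
    next
      case (Suc k)
      have "cc (2 * Suc k) (t, us) = a (Suc (Suc k)) / a (Suc k)" using C Suc.prems by blast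
      then show ?case unfolding pp_Suc using Suc a(2)[of "Suc k"] by simp
    qed
    have i2: "2 * Suc (n - 2) = 2 * n - 2" using n by simp
    have "pp (n - 1) t (\<lambda>i. cc i (t, us)) = a (n - 1) * cc (2 * n - 2) (t, us)"
      unfolding nn pp_Suc i2 using pp[of "n - 2"] nn by simp
    then have "pp (n - 1) t (\<lambda>i. cc i (t, us)) = 1" using C by (simp add: mult.commute)
    moreover have "\<forall>k<n - 1. cc (2 * k + 1) (t, us) * (1 - pp k t (\<lambda>i. cc i (t, us))) = 1" using C pp by simp
    ultimately show "(t, us) \<in> polylog Y n" unfolding polylog_def partial_polylog_def using us by simp
  next
    assume z: "(t, us) \<in> polylog Y n"
    have us: "(t, us) \<in> points (Y \<times>\<^sub>V cube (2 * n - 1))" by (rule polylog_points[OF z])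
    define a where "a = (\<lambda>k. if k = 0 then t else pp (k - 1) t (\<lambda>i. cc i (t, us)))"
    have a0: "a k \<noteq> 0" if k: "k \<le> n - 1" for k
    proof (cases k)
      case 0
      then show ?thesis using polylog_fst_nonzero[OF z] unfolding a_def by simp
    next
      case (Suc l)
      then show ?thesis using polylog_pp_nonzero(1)[OF z, of l] k unfolding a_def by simp
    qed
    have even: "cc (2 * k) (t, us) = a (Suc k) / a k" if k: "k < n - 1" for k
    proof -
      have "a (Suc k) = a k * cc (2 * k) (t, us)" by (cases k) (simp_all add: a_def pp_def)
      then show ?thesis using a0[of k] k by simp
    qed
    have odd: "cc (2 * k + 1) (t, us) * (1 - a (Suc k)) = 1" if k: "k < n - 1" for k
      using polylog_equation[OF z k] unfolding a_def by simp
    have last: "cc (2 * n - 2) (t, us) * a (n - 1) = 1"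
      using polylog_last[OF z n] n unfolding a_def by (simp add: mult.commute numeral_2_eq_2)
    have "map Some us = Li_coords n t (\<lambda>i. Fin (a (n - i)))"
      using coords[of t us "\<lambda>i. Fin (a (n - i))" a, OF us] a0 even odd last by (simp add: a_def)
    then show "(t, us) \<in> points (Y \<times>\<^sub>V cube (2 * n - 1)) \<and> (\<exists>x. map Some us = Li_coords n t x)" using us by blast
  qed
  then show "{(t, us) \<in> points (Y \<times>\<^sub>V cube (2 * n - 1)). \<exists>x. map Some us = Li_coords n t x} = polylog Y n"
    by (simp add: set_eq_iff del: points_prod)
qed

lemma polylog_1: "polylog Y 1 = curve Y (\<lambda>t. t)"
  unfolding polylog_def partial_polylog_def curve_def pp_def by (simp add: mult.commute)

lemma Alt_single_cyc_cx:
  assumes "p \<ge> 1" "Z \<in> admissible Y p (2 * p - 1)" shows "Alt (2 * p - 1) (Poly_Mapping.single Z 1) \<in> cyc_cx Y 1 p"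
proof -
  have "nat (2 * int p - 1) = 2 * p - 1" "1 \<le> 2 * int p" using assms(1) by simp_all
  then show ?thesis unfolding cyc_cx_def Let_def using assms(2) by simp
qed

lemma Alt_single_equi_cx:
  assumes "p \<ge> 1" "Z \<in> equi_admissible Y p (2 * p - 1)" shows "Alt (2 * p - 1) (Poly_Mapping.single Z 1) \<in> equi_cx Y 1 p"
proof -
  have "nat (2 * int p - 1) = 2 * p - 1" "1 \<le> 2 * int p" using assms(1) by simp_all
  then show ?thesis unfolding equi_cx_def Let_def using assms(2) by simp
qed

lemma degree_one_id: "degree_one (\<lambda>t. t)"
  unfolding degree_one_def by simp

lemma L_bar_eq:
  "L0_bar = Alt 1 (Poly_Mapping.single (curve affine_line (\<lambda>t. 1 - t)) 1)"
  "L1_bar = Alt 1 (Poly_Mapping.single (curve affine_line (\<lambda>t. t)) 1)"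
  unfolding L0_bar_def L1_bar_def
  using param_cycle_curve[OF base_curve_affine_line degree_one_minus]
    param_cycle_curve[OF base_curve_affine_line degree_one_id] by simp_all

lemma L_eq:
  "L0 = Alt 1 (Poly_Mapping.single (curve thrice_punctured_line (\<lambda>t. 1 - t)) 1)"
  "L1 = Alt 1 (Poly_Mapping.single (curve thrice_punctured_line (\<lambda>t. t)) 1)"
  unfolding L0_def L1_def L_bar_eq by (rule restrict_curve[OF degree_one_minus], rule restrict_curve[OF degree_one_id])

theorem lemma3p16:
  shows "L0_bar \<in> cyc_cx affine_line 1 1 \<and> L1_bar \<in> cyc_cx affine_line 1 1 \<and>
    L0 \<in> cyc_cx thrice_punctured_line 1 1 \<and> L1 \<in> cyc_cx thrice_punctured_line 1 1 \<and>
    (\<exists>Li Li_bar. Li 1 = L1 \<and> Li_bar 1 = L1_bar \<and>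
      (\<forall>n\<ge>2.
        Li n \<in> equi_cx thrice_punctured_line 1 n \<and> Li n \<in> cyc_cx thrice_punctured_line 1 n \<and>
        Li_bar n \<in> equi_cx affine_line 1 n \<and> Li_bar n \<in> cyc_cx affine_line 1 n \<and>
        Li n = restrict_cycle thrice_punctured_line (2 * n - 1) (Li_bar n) \<and>
        fiber_well_defined affine_line n (2 * n - 1) 1 (Li_bar n) \<and>
        empty_fiber 0 (Li_bar n) \<and>
        boundary thrice_punctured_line (2 * n - 1) (Li n) =
          cyc_prod thrice_punctured_line 1 (2 * (n - 1) - 1) L0 (Li (n - 1)) \<and>
        boundary affine_line (2 * n - 1) (Li_bar n) =
          cyc_prod affine_line 1 (2 * (n - 1) - 1) L0_bar (Li_bar (n - 1)) \<and>
        Li n = param_cycle thrice_punctured_line (2 * n - 1) (Li_coords n)))"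
proof -
  note A = base_curve_affine_line and X = base_curve_thrice_punctured_line
  have weight_one: "Alt 1 (Poly_Mapping.single (curve Y l) 1) \<in> cyc_cx Y 1 1" if "base_curve Y" "degree_one l" for Y l
    using Alt_single_cyc_cx[of 1 "curve Y l" Y] curve_admissible[OF that] by simp
  define cyc where "cyc = (\<lambda>Y n. Alt (2 * n - 1) (Poly_Mapping.single (polylog Y n) (1 :: rat)))"
  have one: "cyc Y 1 = Alt 1 (Poly_Mapping.single (curve Y (\<lambda>t. t)) 1)" for Y
    unfolding cyc_def polylog_1 by simp
  have mem: "cyc Y n \<in> equi_cx Y 1 n" "cyc Y n \<in> cyc_cx Y 1 n" if "base_curve Y" "n \<ge> 2" for Y n
    unfolding cyc_def using that(2)
    by (intro Alt_single_equi_cx Alt_single_cyc_cx polylog_equi_admissible polylog_admissible that; simp)+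
  have "(1 :: complex) \<in> points affine_line" by (simp add: affine_line_def)
  then have fib: "fiber_well_defined affine_line n (2 * n - 1) 1 (cyc affine_line n)" if "n \<ge> 2" for n
    unfolding cyc_def by (rule fiber_well_defined_Alt_polylog[OF A that])
  have bd: "boundary Y (2 * n - 1) (cyc Y n) =
      cyc_prod Y 1 (2 * (n - 1) - 1) (Alt 1 (Poly_Mapping.single (curve Y (\<lambda>t. 1 - t)) 1)) (cyc Y (n - 1))"
    if "base_curve Y" "n \<ge> 2" for Y n
    unfolding cyc_def by (rule boundary_polylog[OF that])
  have res: "cyc thrice_punctured_line n = restrict_cycle thrice_punctured_line (2 * n - 1) (cyc affine_line n)" if "n \<ge> 2" for n
    unfolding cyc_def using restrict_polylog[of n] that by simp
  have par: "cyc thrice_punctured_line n = param_cycle thrice_punctured_line (2 * n - 1) (Li_coords n)" if "n \<ge> 2" for n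
    unfolding cyc_def by (rule param_cycle_polylog[OF X that, symmetric])
  have emp: "empty_fiber 0 (cyc affine_line n)" for n
    unfolding cyc_def by (rule empty_fiber_Alt_polylog)
  show ?thesis
    unfolding L_bar_eq L_eq
    by (intro conjI weight_one A X degree_one_id degree_one_minus,
        rule exI[of _ "cyc thrice_punctured_line"], rule exI[of _ "cyc affine_line"])
      (intro conjI allI impI one mem A X fib emp bd res par; assumption)
qed

end
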